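(* Let $\mathfrak g=\mathfrak{sl}(n+1)$ with Chevalley generators $e_i,f_i,h_i$ ($1\le i\le n$), and let $\mathfrak h\subset\mathfrak g$ be the coisotropic subalgebra spanned by $$h_1+h_2+\cdots+h_n,\qquad e_1,\ [e_1,e_2],\ [[e_1,e_2],e_3],\ \dots,\ [[e_1,e_2]\dots,e_n],\qquad e_n,\ [e_n,e_{n-1}],\ [[e_n,e_{n-1}],e_{n-2}],\ \dots,\ [[e_n,e_{n-1}]\dots,e_2]$$ (all brackets nested to the left). Let $B_h$ be the subalgebra of $U_q(\mathfrak{sl}(n+1))$ (identified with $U_h(\mathfrak{sl}(n+1))$) generated by $$K_1K_2\cdots K_n,\qquad E_1,\ [E_1,E_2]_q,\ [[E_1,E_2]_q,E_3]_q,\ \dots,\ [[E_1,E_2]_q\dots,E_n]_q,\qquad E_n,\ [E_n,E_{n-1}]_q,\ [[E_n,E_{n-1}]_q,E_{n-2}]_q,\ \dots,\ [[E_n,E_{n-1}]_q\dots,E_2]_q .$$ Then $B_h$ is a quantization of $\mathfrak h$.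
   Context: Quantum group. For a finite-dimensional complex semisimple Lie algebra $\mathfrak g$ with Cartan matrix $(a_{ij})_{1\le i,j\le n}$ and symmetrizing positive integers $d_i$ (so $(d_ia_{ij})$ is symmetric), $U_q(\mathfrak g)$ is the associative algebra over $\mathbb Q(q)$ with generators $X_i^+,X_i^-,K_i,K_i^{-1}$ ($1\le i\le n$) and relations $K_iK_j=K_jK_i$, $K_iK_i^{-1}=K_i^{-1}K_i=1$, $K_iX_j^{\pm}=q^{\pm d_ia_{ij}}X_j^{\pm}K_i$, $X_i^+X_j^--X_j^-X_i^+=\delta_{ij}\frac{K_i-K_i^{-1}}{q^{d_i}-q^{-d_i}}$, and the quantum Serre relations $\sum_{r=0}^{1-a_{ij}}(-1)^r\binom{1-a_{ij}}{r}_{q^{d_i}}(X_i^{\pm})^{1-a_{ij}-r}X_j^{\pm}(X_i^{\pm})^r=0$ for $i\ne j$ (quantum binomial coefficients in $q^{d_i}$). Its comultiplication is $\Delta(K_i)=K_i\otimes K_i$, $\Delta(X_i^+)=X_i^+\otimes K_i+1\otimes X_i^+$, $\Delta(X_i^-)=X_i^-\otimes1+K_i^{-1}\otimes X_i^-$. Write $E_i=X_i^+$ and $[A,B]_{q^k}=AB-q^kBA$, $[A,B]=AB-BA$. $U_q(\mathfrak g)$ is identified with the Drinfeld–Jimbo algebra $U_h(\mathfrak g)$ over $\mathbb C[[h]]$ by $q=e^{h}$, $K_i=e^{d_ihH_i}$; $U_h(\mathfrak g)/hU_h(\mathfrak g)\cong U(\mathfrak g)$, and $\pi_{U_h}:U_h(\mathfrak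 g)\to U(\mathfrak g)$ is the specialization at $h=0$. For $\mathfrak{sl}(n+1)$ all $d_i=1$, $a_{ii}=2$, $a_{i,i\pm1}=-1$, other $a_{ij}=0$. Coisotropic subalgebra. A coisotropic subalgebra of a Lie bialgebra $(\mathfrak g,[\,,],\delta)$ is a Lie subalgebra $\mathfrak h$ with $\delta(\mathfrak h)\subset\mathfrak h\wedge\mathfrak g$. Here $\mathfrak g$ carries the standard Lie bialgebra structure given by the $r$-matrix $\pi=\sum_{\alpha>0}\lambda_\alpha e_\alpha\wedge f_\alpha$, $\lambda_\alpha=1/K(e_\alpha,f_\alpha)$, with $K$ the Killing form and $e_\alpha,f_\alpha$ root vectors for $\alpha$, $-\alpha$. Quantization. A quantization of a coisotropic subalgebra $\mathfrak h$ of $\mathfrak g$ is a subalgebra $B_h$ of $U_h(\mathfrak g)$ which is a left (or right) coideal ($\Delta(B_h)\subset B_h\otimes U_h(\mathfrak g)$ for left) such that $B_h/hB_h\cong\pi_{U_h}(B_h)=U(\mathfrak h)$; that is, the map $B_h/hB_h\to U(\mathfrak g)$ induced by $\pi_{U_h}$ is injective with image $U(\mathfrak h)$ (equivalently $B_h\cap hU_h(\mathfrak g)=hB_h$ and $\pi_{U_h}(B_h)=U(\mathfrak h)$).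
   Formalization: B_h is taken as the C[[h]]-subalgebra of U_h generated by the listed elements together with (K_1...K_n - 1)/(q-1); without it K_1...K_n specializes to 1 and h_1+...+h_n would not lie in the image (already for n=1). *)

theory Defs
  imports
    "HOL-Computational_Algebra.Formal_Power_Series"
    "HOL-Algebra.QuotRing"
    "HOL-Algebra.Subrings"
    "HOL-Algebra.Generated_Rings"
    "HOL-Algebra.Generated_Groups"
    "Jordan_Normal_Form.Matrix"
begin

section \<open>Algebras of words\<close>

text \<open>
  Elements of an algebra with a multiplicative basis are represented by their coefficient
  functions. The product of such functions is convolution along the product \<open>op\<close> of basis
  elements; the sums are finite for concatenation of words and of pairs of words.
  \<open>C\<close> says which coefficient functions are admitted.
\<close>

definition conv :: "('w \<Rightarrow> 'w \<Rightarrow> 'w) \<Rightarrow> ('w \<Rightarrow> 'r::comm_ring_1) \<Rightarrow> ('w \<Rightarrow> 'r) \<Rightarrow> 'w \<Rightarrow> 'r" where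
  "conv op f g = (\<lambda>w. \<Sum>(u, v)\<in>{(u, v). op u v = w}. f u * g v)"

definition word_ring ::
  "('w \<Rightarrow> 'r) set \<Rightarrow> ('w \<Rightarrow> 'w \<Rightarrow> 'w) \<Rightarrow> 'w \<Rightarrow> ('w \<Rightarrow> 'r::comm_ring_1) ring" where
  "word_ring C op e =
     \<lparr>carrier = C, mult = conv op, one = (\<lambda>w. if w = e then 1 else 0),
      zero = (\<lambda>w. 0), add = (\<lambda>f g w. f w + g w)\<rparr>"

definition mon :: "'w \<Rightarrow> 'w \<Rightarrow> 'r::comm_ring_1" where
  "mon w = (\<lambda>v. if v = w then 1 else 0)"

definition smul :: "'r \<Rightarrow> ('w \<Rightarrow> 'r) \<Rightarrow> 'w \<Rightarrow> 'r::comm_ring_1" where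
  "smul c f = (\<lambda>w. c * f w)"

text \<open>The free associative complex algebra on a set of letters.\<close>

definition free_alg :: "'x set \<Rightarrow> ('x list \<Rightarrow> complex) ring" where
  "free_alg X = word_ring {f. finite {w. f w \<noteq> 0} \<and> {w. f w \<noteq> 0} \<subseteq> lists X} (@) []"

text \<open>
  The ring of formal power series in \<open>h\<close> is \<^typ>\<open>complex fps\<close>. The \<open>h\<close>-adic completion of the
  free module with basis \<open>W\<close> over it consists of the coefficient functions which modulo
  each power of \<open>h\<close> have finite support.
\<close>

definition hcomplete :: "'w set \<Rightarrow> ('w \<Rightarrow> complex fps) set" where
  "hcomplete W = {f. {w. f w \<noteq> 0} \<subseteq> W \<and> (\<forall>m. finite {w. fps_nth (f w) m \<noteq> 0})}"

definition hclosure :: "('a, 'b) ring_scheme \<Rightarrow> 'a \<Rightarrow> 'a set \<Rightarrow> 'a set" where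
  "hclosure R t S =
     {x \<in> carrier R. \<forall>m::nat. \<exists>s\<in>S. \<exists>u\<in>carrier R. x = s \<oplus>\<^bsub>R\<^esub> (t [^]\<^bsub>R\<^esub> m) \<otimes>\<^bsub>R\<^esub> u}"

text \<open>The map induced on cosets of \<open>I\<close> by a map \<open>f\<close> that descends to the quotients by \<open>I\<close> and \<open>J\<close>.\<close>

definition quot_map ::
  "('b, 'c) ring_scheme \<Rightarrow> 'b set \<Rightarrow> ('a \<Rightarrow> 'b) \<Rightarrow> 'a set \<Rightarrow> 'b set" where
  "quot_map S J f X = the_elem ((\<lambda>x. J +>\<^bsub>S\<^esub> f x) ` X)"


section \<open>The Lie algebra \<open>sl(n+1)\<close>\<close>

inductive_set lin_span ::
  "'v \<Rightarrow> ('v \<Rightarrow> 'v \<Rightarrow> 'v) \<Rightarrow> (complex \<Rightarrow> 'v \<Rightarrow> 'v) \<Rightarrow> 'v set \<Rightarrow> 'v set"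
  for z :: 'v and pls :: "'v \<Rightarrow> 'v \<Rightarrow> 'v" and scl :: "complex \<Rightarrow> 'v \<Rightarrow> 'v" and S :: "'v set"
where
  "z \<in> lin_span z pls scl S"
| "x \<in> lin_span z pls scl S \<Longrightarrow> s \<in> S \<Longrightarrow> pls x (scl c s) \<in> lin_span z pls scl S"

definition mat_span :: "nat \<Rightarrow> complex mat set \<Rightarrow> complex mat set" where
  "mat_span n = lin_span (0\<^sub>m (n+1) (n+1)) (+) (\<cdot>\<^sub>m)"

definition sl :: "nat \<Rightarrow> complex mat set" where
  "sl n = {x \<in> carrier_mat (n+1) (n+1). (\<Sum>i<n+1. x $$ (i, i)) = 0}"

definition lie :: "complex mat \<Rightarrow> complex mat \<Rightarrow> complex mat" where
  "lie x y = x * y - y * x"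

text \<open>Rows and columns are numbered from 0, Chevalley generators from 1.\<close>

definition munit :: "nat \<Rightarrow> nat \<Rightarrow> nat \<Rightarrow> complex mat" where
  "munit n i j = mat (n+1) (n+1) (\<lambda>(a, b). if a = i \<and> b = j then 1 else 0)"

definition che :: "nat \<Rightarrow> nat \<Rightarrow> complex mat" where
  "che n i = munit n (i-1) i"

definition chf :: "nat \<Rightarrow> nat \<Rightarrow> complex mat" where
  "chf n i = munit n i (i-1)"

definition chh :: "nat \<Rightarrow> nat \<Rightarrow> complex mat" where
  "chh n i = munit n (i-1) (i-1) - munit n i i"

text \<open>
  The trace of an endomorphism of \<open>sl(n+1)\<close>, computed in the basis of the matrix units
  \<open>E i j\<close> with \<open>i \<noteq> j\<close> and of \<open>h\<^sub>1, \<dots>, h\<^sub>n\<close>: in this basis the coordinate of \<open>x\<close>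
  at \<open>E i j\<close> is the entry of \<open>x\<close> there, and its coordinate at \<open>h\<^sub>k\<close> is the sum of its first
  \<open>k\<close> diagonal entries.
\<close>

definition sl_trace :: "nat \<Rightarrow> (complex mat \<Rightarrow> complex mat) \<Rightarrow> complex" where
  "sl_trace n \<phi> =
     (\<Sum>(i, j)\<in>{(i, j). i < n+1 \<and> j < n+1 \<and> i \<noteq> j}. \<phi> (munit n i j) $$ (i, j))
     + (\<Sum>k\<in>{1..n}. \<Sum>i<k. \<phi> (chh n k) $$ (i, i))"

definition killing :: "nat \<Rightarrow> complex mat \<Rightarrow> complex mat \<Rightarrow> complex" where
  "killing n x y = sl_trace n (\<lambda>z. lie x (lie y z))"

text \<open>Elements of \<open>gl \<otimes> gl\<close> are represented by their coordinates in the basis \<open>E i j \<otimes> E k l\<close>.\<close>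

type_synonym tensor = "(nat \<times> nat) \<times> (nat \<times> nat) \<Rightarrow> complex"

definition tens :: "nat \<Rightarrow> complex mat \<Rightarrow> complex mat \<Rightarrow> tensor" where
  "tens n x y = (\<lambda>((i, j), (k, l)).
     if i < n+1 \<and> j < n+1 \<and> k < n+1 \<and> l < n+1 then x $$ (i, j) * y $$ (k, l) else 0)"

definition wedge :: "nat \<Rightarrow> complex mat \<Rightarrow> complex mat \<Rightarrow> tensor" where
  "wedge n x y = (\<lambda>p. tens n x y p - tens n y x p)"

definition tensor_span :: "tensor set \<Rightarrow> tensor set" where
  "tensor_span = lin_span (\<lambda>p. 0) (\<lambda>s t p. s p + t p) smul"

text \<open>
  The cobracket \<open>\<delta>(x) = [x \<otimes> 1 + 1 \<otimes> x, \<pi>]\<close> for \<open>\<pi> = \<Sum> \<lambda>\<^sub>\<alpha> e\<^sub>\<alpha> \<and> f\<^sub>\<alpha>\<close>. The positive roots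
  correspond to pairs \<open>i < j\<close>, with root vectors \<open>e\<^sub>\<alpha> = E i j\<close> and \<open>f\<^sub>\<alpha> = E j i\<close>.
\<close>

definition cobracket :: "nat \<Rightarrow> complex mat \<Rightarrow> tensor" where
  "cobracket n x = (\<lambda>p. \<Sum>(i, j)\<in>{(i, j). i < j \<and> j < n+1}.
     1 / killing n (munit n i j) (munit n j i) *
       (wedge n (lie x (munit n i j)) (munit n j i) p +
        wedge n (munit n i j) (lie x (munit n j i)) p))"

definition lie_subalgebra :: "nat \<Rightarrow> complex mat set \<Rightarrow> bool" where
  "lie_subalgebra n \<hh> \<longleftrightarrow>
     \<hh> \<subseteq> sl n \<and> 0\<^sub>m (n+1) (n+1) \<in> \<hh> \<and>
     (\<forall>x\<in>\<hh>. \<forall>y\<in>\<hh>. x + y \<in> \<hh> \<and> lie x y \<in> \<hh>) \<and> (\<forall>c. \<forall>x\<in>\<hh>. c \<cdot>\<^sub>m x \<in> \<hh>)"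

definition coisotropic_subalgebra :: "nat \<Rightarrow> complex mat set \<Rightarrow> bool" where
  "coisotropic_subalgebra n \<hh> \<longleftrightarrow>
     lie_subalgebra n \<hh> \<and>
     (\<forall>x\<in>\<hh>. cobracket n x \<in> tensor_span {wedge n a b | a b. a \<in> \<hh> \<and> b \<in> sl n})"


section \<open>The enveloping algebra \<open>U(sl(n+1))\<close>\<close>

abbreviation TA :: "nat \<Rightarrow> (complex mat list \<Rightarrow> complex) ring" where
  "TA n \<equiv> free_alg (sl n)"

text \<open>
  The letters are the elements of the Lie algebra; the first two families of relations make
  the inclusion of letters linear, so that they define the tensor algebra.
\<close>

definition UE_ideal :: "nat \<Rightarrow> (complex mat list \<Rightarrow> complex) set" where
  "UE_ideal n = Idl\<^bsub>TA n\<^esub>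
     ({mon [x + y] \<ominus>\<^bsub>TA n\<^esub> mon [x] \<ominus>\<^bsub>TA n\<^esub> mon [y] | x y. x \<in> sl n \<and> y \<in> sl n} \<union>
      {mon [c \<cdot>\<^sub>m x] \<ominus>\<^bsub>TA n\<^esub> smul c (mon [x]) | c x. x \<in> sl n} \<union>
      {mon [x, y] \<ominus>\<^bsub>TA n\<^esub> mon [y, x] \<ominus>\<^bsub>TA n\<^esub> mon [lie x y] | x y. x \<in> sl n \<and> y \<in> sl n})"

definition UE :: "nat \<Rightarrow> (complex mat list \<Rightarrow> complex) set ring" where
  "UE n = TA n Quot UE_ideal n"

text \<open>
  \<open>U(\<hh>)\<close> inside \<open>U(sl(n+1))\<close>, that is, the unital subalgebra generated by \<open>\<hh>\<close>
  (the canonical map from \<open>U(\<hh>)\<close> is injective by the Poincare-Birkhoff-Witt theorem).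
\<close>

definition UE_sub :: "nat \<Rightarrow> complex mat set \<Rightarrow> (complex mat list \<Rightarrow> complex) set set" where
  "UE_sub n \<hh> = generate_ring (UE n)
     ((\<lambda>f. UE_ideal n +>\<^bsub>TA n\<^esub> f) ` (range (\<lambda>c. smul c (mon [])) \<union> (\<lambda>x. mon [x]) ` \<hh>))"


section \<open>The quantum group \<open>U\<^sub>h(sl(n+1))\<close>\<close>

datatype gen = Xp nat | Xm nat | Hg nat

definition gens :: "nat \<Rightarrow> gen set" where
  "gens n = Xp ` {1..n} \<union> Xm ` {1..n} \<union> Hg ` {1..n}"

definition qh :: "complex fps" where "qh = fps_exp 1"

definition qh_inv :: "complex fps" where "qh_inv = fps_exp (-1)"

definition q_int :: "nat \<Rightarrow> complex fps" where
  "q_int m = (qh ^ m - qh_inv ^ m) / (qh - qh_inv)"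

definition q_fact :: "nat \<Rightarrow> complex fps" where
  "q_fact m = (\<Prod>k\<in>{1..m}. q_int k)"

definition q_binom :: "nat \<Rightarrow> nat \<Rightarrow> complex fps" where
  "q_binom m r = q_fact m / (q_fact r * q_fact (m - r))"

definition cartan :: "nat \<Rightarrow> nat \<Rightarrow> int" where
  "cartan i j = (if i = j then 2 else if i = Suc j \<or> j = Suc i then -1 else 0)"

text \<open>The \<open>h\<close>-adically completed free algebra on the generators, and its completed tensor square.\<close>

definition FA :: "nat \<Rightarrow> (gen list \<Rightarrow> complex fps) ring" where
  "FA n = word_ring (hcomplete (lists (gens n))) (@) []"

definition FA2 :: "nat \<Rightarrow> (gen list \<times> gen list \<Rightarrow> complex fps) ring" where
  "FA2 n = word_ring (hcomplete (lists (gens n) \<times> lists (gens n)))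
     (\<lambda>(a, b) (c, d). (a @ c, b @ d)) ([], [])"

definition ftens ::
  "(gen list \<Rightarrow> complex fps) \<Rightarrow> (gen list \<Rightarrow> complex fps) \<Rightarrow> gen list \<times> gen list \<Rightarrow> complex fps" where
  "ftens f g = (\<lambda>(u, v). f u * g v)"

text \<open>\<open>hexp c i\<close> is \<open>exp(c h H\<^sub>i)\<close>.\<close>

definition hexp :: "complex \<Rightarrow> nat \<Rightarrow> gen list \<Rightarrow> complex fps" where
  "hexp c i = (\<lambda>w. if w = replicate (length w) (Hg i)
                   then fps_const (c ^ length w / fact (length w)) * fps_X ^ length w else 0)"

abbreviation Kp :: "nat \<Rightarrow> gen list \<Rightarrow> complex fps" where "Kp \<equiv> hexp 1"

abbreviation Km :: "nat \<Rightarrow> gen list \<Rightarrow> complex fps" where "Km \<equiv> hexp (-1)"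

text \<open>
  Coefficientwise division by a nonzero power series. It is used only where all the
  coefficients are divisible by \<open>c\<close>, so that the quotient is the exact one.
\<close>

definition sdiv :: "(gen list \<Rightarrow> complex fps) \<Rightarrow> complex fps \<Rightarrow> gen list \<Rightarrow> complex fps" where
  "sdiv f c = (\<lambda>w. f w / c)"

definition serre :: "nat \<Rightarrow> (nat \<Rightarrow> gen) \<Rightarrow> nat \<Rightarrow> nat \<Rightarrow> gen list \<Rightarrow> complex fps" where
  "serre n X i j = (let m = nat (1 - cartan i j) in
     \<Oplus>\<^bsub>FA n\<^esub>r\<in>{0..m}. smul ((-1) ^ r * q_binom m r)
       (mon (replicate (m - r) (X i) @ [X j] @ replicate r (X i))))"

text \<open>
  With \<open>K\<^sub>i = exp(h H\<^sub>i)\<close>, the relations \<open>[H\<^sub>i, X\<^sub>j] = \<plusminus> a\<^sub>i\<^sub>j X\<^sub>j\<close> amount to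
  \<open>K\<^sub>i X\<^sub>j = q\<^sup>\<plusminus>\<^sup>a X\<^sub>j K\<^sub>i\<close> (with \<open>a = a\<^sub>i\<^sub>j\<close>) divided by \<open>h\<close>.
\<close>

definition Uh_rels :: "nat \<Rightarrow> (gen list \<Rightarrow> complex fps) set" where
  "Uh_rels n =
     {mon [Hg i, Hg j] \<ominus>\<^bsub>FA n\<^esub> mon [Hg j, Hg i] | i j. i \<in> {1..n} \<and> j \<in> {1..n}} \<union>
     {mon [Hg i, Xp j] \<ominus>\<^bsub>FA n\<^esub> mon [Xp j, Hg i] \<ominus>\<^bsub>FA n\<^esub> smul (of_int (cartan i j)) (mon [Xp j])
        | i j. i \<in> {1..n} \<and> j \<in> {1..n}} \<union>
     {mon [Hg i, Xm j] \<ominus>\<^bsub>FA n\<^esub> mon [Xm j, Hg i] \<oplus>\<^bsub>FA n\<^esub> smul (of_int (cartan i j)) (mon [Xm j])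
        | i j. i \<in> {1..n} \<and> j \<in> {1..n}} \<union>
     {mon [Xp i, Xm j] \<ominus>\<^bsub>FA n\<^esub> mon [Xm j, Xp i] \<ominus>\<^bsub>FA n\<^esub>
        (if i = j then sdiv (Kp i \<ominus>\<^bsub>FA n\<^esub> Km i) (qh - qh_inv) else \<zero>\<^bsub>FA n\<^esub>)
        | i j. i \<in> {1..n} \<and> j \<in> {1..n}} \<union>
     {serre n X i j | X i j. X \<in> {Xp, Xm} \<and> i \<in> {1..n} \<and> j \<in> {1..n} \<and> i \<noteq> j}"

definition Uh_ideal :: "nat \<Rightarrow> (gen list \<Rightarrow> complex fps) set" where
  "Uh_ideal n = hclosure (FA n) (smul fps_X (mon [])) (Idl\<^bsub>FA n\<^esub> (Uh_rels n))"

definition Uh :: "nat \<Rightarrow> (gen list \<Rightarrow> complex fps) set ring" where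
  "Uh n = FA n Quot Uh_ideal n"

definition Uh_class :: "nat \<Rightarrow> (gen list \<Rightarrow> complex fps) \<Rightarrow> (gen list \<Rightarrow> complex fps) set" where
  "Uh_class n f = Uh_ideal n +>\<^bsub>FA n\<^esub> f"

definition Uh_scalar :: "nat \<Rightarrow> complex fps \<Rightarrow> (gen list \<Rightarrow> complex fps) set" where
  "Uh_scalar n c = Uh_class n (smul c (mon []))"

text \<open>
  The completed tensor square of \<open>Uh n = FA n / J\<close>, as the quotient of the completed tensor
  square of \<open>FA n\<close> by the closure of \<open>J \<otimes> FA n + FA n \<otimes> J\<close>, which is the closed
  two-sided ideal generated by \<open>J \<otimes> 1\<close> and \<open>1 \<otimes> J\<close>.
\<close>

definition Uh2_ideal :: "nat \<Rightarrow> (gen list \<times> gen list \<Rightarrow> complex fps) set" where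
  "Uh2_ideal n = hclosure (FA2 n) (smul fps_X (mon ([], [])))
     (Idl\<^bsub>FA2 n\<^esub> ({ftens r (mon []) | r. r \<in> Uh_ideal n} \<union> {ftens (mon []) r | r. r \<in> Uh_ideal n}))"

definition Uh2 :: "nat \<Rightarrow> (gen list \<times> gen list \<Rightarrow> complex fps) set ring" where
  "Uh2 n = FA2 n Quot Uh2_ideal n"

text \<open>
  The comultiplication: \<open>\<Delta>(H\<^sub>i) = H\<^sub>i \<otimes> 1 + 1 \<otimes> H\<^sub>i\<close> is \<open>\<Delta>(K\<^sub>i) = K\<^sub>i \<otimes> K\<^sub>i\<close> for \<open>K\<^sub>i = exp(h H\<^sub>i)\<close>.
  It is extended multiplicatively to words, and \<open>h\<close>-adically continuously to \<open>FA n\<close>: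
  the coefficient of \<open>h\<^sup>m\<close> in the image of \<open>f\<close> depends only on the finitely many words
  which occur in \<open>f\<close> modulo \<open>h\<^sup>m\<^sup>+\<^sup>1\<close>.
\<close>

fun comult_gen :: "nat \<Rightarrow> gen \<Rightarrow> gen list \<times> gen list \<Rightarrow> complex fps" where
  "comult_gen n (Xp i) = ftens (mon [Xp i]) (Kp i) \<oplus>\<^bsub>FA2 n\<^esub> ftens (mon []) (mon [Xp i])"
| "comult_gen n (Xm i) = ftens (mon [Xm i]) (mon []) \<oplus>\<^bsub>FA2 n\<^esub> ftens (Km i) (mon [Xm i])"
| "comult_gen n (Hg i) = ftens (mon [Hg i]) (mon []) \<oplus>\<^bsub>FA2 n\<^esub> ftens (mon []) (mon [Hg i])"

definition comult_word :: "nat \<Rightarrow> gen list \<Rightarrow> gen list \<times> gen list \<Rightarrow> complex fps" where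
  "comult_word n w = foldr (\<lambda>g t. comult_gen n g \<otimes>\<^bsub>FA2 n\<^esub> t) w \<one>\<^bsub>FA2 n\<^esub>"

definition comult_FA ::
  "nat \<Rightarrow> (gen list \<Rightarrow> complex fps) \<Rightarrow> gen list \<times> gen list \<Rightarrow> complex fps" where
  "comult_FA n f = (\<lambda>p. Abs_fps (\<lambda>m.
     \<Sum>w\<in>{w. \<exists>k\<le>m. fps_nth (f w) k \<noteq> 0}. fps_nth (f w * comult_word n w p) m))"

definition comult ::
  "nat \<Rightarrow> (gen list \<Rightarrow> complex fps) set \<Rightarrow> (gen list \<times> gen list \<Rightarrow> complex fps) set" where
  "comult n = quot_map (FA2 n) (Uh2_ideal n) (comult_FA n)"

text \<open>The specialization at \<open>h = 0\<close>.\<close>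

fun spec_gen :: "nat \<Rightarrow> gen \<Rightarrow> complex mat" where
  "spec_gen n (Xp i) = che n i"
| "spec_gen n (Xm i) = chf n i"
| "spec_gen n (Hg i) = chh n i"

definition spec_FA :: "nat \<Rightarrow> (gen list \<Rightarrow> complex fps) \<Rightarrow> complex mat list \<Rightarrow> complex" where
  "spec_FA n f = (\<lambda>v. \<Sum>w\<in>{w. fps_nth (f w) 0 \<noteq> 0 \<and> map (spec_gen n) w = v}. fps_nth (f w) 0)"

definition spec ::
  "nat \<Rightarrow> (gen list \<Rightarrow> complex fps) set \<Rightarrow> (complex mat list \<Rightarrow> complex) set" where
  "spec n = quot_map (TA n) (UE_ideal n) (spec_FA n)"


section \<open>Quantizations of coisotropic subalgebras\<close>

text \<open>
  The additive subgroup of \<open>Uh2 n\<close> spanned by the pure tensors of elements of \<open>A\<close> and \<open>B\<close>.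
  No completion is applied to it, so the coideal condition below is the strict one.
\<close>

definition tensor_sub ::
  "nat \<Rightarrow> (gen list \<Rightarrow> complex fps) set set \<Rightarrow> (gen list \<Rightarrow> complex fps) set set
     \<Rightarrow> (gen list \<times> gen list \<Rightarrow> complex fps) set set" where
  "tensor_sub n A B = generate (add_monoid (Uh2 n))
     {Uh2_ideal n +>\<^bsub>FA2 n\<^esub> ftens f g | f g.
        f \<in> carrier (FA n) \<and> g \<in> carrier (FA n) \<and> Uh_class n f \<in> A \<and> Uh_class n g \<in> B}"

definition Uh_subalgebra :: "nat \<Rightarrow> (gen list \<Rightarrow> complex fps) set set \<Rightarrow> bool" where
  "Uh_subalgebra n B \<longleftrightarrow> subring B (Uh n) \<and> range (Uh_scalar n) \<subseteq> B"

definition left_coideal :: "nat \<Rightarrow> (gen list \<Rightarrow> complex fps) set set \<Rightarrow> bool" where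
  "left_coideal n B \<longleftrightarrow> comult n ` B \<subseteq> tensor_sub n B (carrier (Uh n))"

definition right_coideal :: "nat \<Rightarrow> (gen list \<Rightarrow> complex fps) set set \<Rightarrow> bool" where
  "right_coideal n B \<longleftrightarrow> comult n ` B \<subseteq> tensor_sub n (carrier (Uh n)) B"

text \<open>
  The last two conditions say that \<open>hB\<close> is the kernel of the specialization on \<open>B\<close>, so that
  the induced map from \<open>B/hB\<close> is well defined and injective, and that its image is \<open>U(\<hh>)\<close>.
\<close>

definition quantization ::
  "nat \<Rightarrow> complex mat set \<Rightarrow> (gen list \<Rightarrow> complex fps) set set \<Rightarrow> bool" where
  "quantization n \<hh> B \<longleftrightarrow>
     coisotropic_subalgebra n \<hh> \<and>
     Uh_subalgebra n B \<and>
     (left_coideal n B \<or> right_coideal n B) \<and>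
     {b \<in> B. spec n b = \<zero>\<^bsub>UE n\<^esub>} = (\<lambda>b. Uh_scalar n fps_X \<otimes>\<^bsub>Uh n\<^esub> b) ` B \<and>
     spec n ` B = UE_sub n \<hh>"


section \<open>The subalgebras \<open>\<hh>\<close> and \<open>B\<^sub>h\<close>\<close>

text \<open>\<open>nested br x [i\<^sub>1, i\<^sub>2, \<dots>] = br (br (x i\<^sub>1) (x i\<^sub>2)) \<dots>\<close>\<close>

definition nested :: "('a \<Rightarrow> 'a \<Rightarrow> 'a) \<Rightarrow> (nat \<Rightarrow> 'a) \<Rightarrow> nat list \<Rightarrow> 'a" where
  "nested br x is = foldl (\<lambda>a i. br a (x i)) (x (hd is)) (tl is)"

definition coiso_h :: "nat \<Rightarrow> complex mat set" where
  "coiso_h n = mat_span n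
     ({foldr (+) (map (chh n) [1..<n+1]) (0\<^sub>m (n+1) (n+1))} \<union>
      {nested lie (che n) [1..<k+1] | k. k \<in> {1..n}} \<union>
      {nested lie (che n) (rev [k..<n+1]) | k. k \<in> {2..n}})"

definition qbr ::
  "nat \<Rightarrow> (gen list \<Rightarrow> complex fps) \<Rightarrow> (gen list \<Rightarrow> complex fps) \<Rightarrow> gen list \<Rightarrow> complex fps" where
  "qbr n a b = a \<otimes>\<^bsub>FA n\<^esub> b \<ominus>\<^bsub>FA n\<^esub> smul qh (b \<otimes>\<^bsub>FA n\<^esub> a)"

text \<open>The product \<open>K\<^sub>1 K\<^sub>2 \<cdots> K\<^sub>n\<close>.\<close>

definition Kprod :: "nat \<Rightarrow> gen list \<Rightarrow> complex fps" where
  "Kprod n = foldr (\<lambda>i t. Kp i \<otimes>\<^bsub>FA n\<^esub> t) [1..<n+1] \<one>\<^bsub>FA n\<^esub>"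

text \<open>
  The ground field of \<open>U\<^sub>q\<close> contains \<open>1/(q-1)\<close>, so that the subalgebra generated there by
  \<open>K = K\<^sub>1\<cdots>K\<^sub>n\<close> and root vectors is also generated by these and \<open>(K-1)/(q-1)\<close>. Over
  power series in \<open>h = log q\<close> this division is not available, and \<open>K\<close> alone specializes to 1
  at \<open>h = 0\<close>; the element \<open>(K-1)/(q-1)\<close>, which lies in \<open>U\<^sub>h\<close> and specializes
  to \<open>h\<^sub>1+\<cdots>+h\<^sub>n\<close>, therefore has to be listed among the generators.
\<close>

definition Bh :: "nat \<Rightarrow> (gen list \<Rightarrow> complex fps) set set" where
  "Bh n = generate_ring (Uh n) (range (Uh_scalar n) \<union> Uh_class n `
     ({Kprod n, sdiv (Kprod n \<ominus>\<^bsub>FA n\<^esub> \<one>\<^bsub>FA n\<^esub>) (qh - 1)} \<union>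
      {nested (qbr n) (\<lambda>i. mon [Xp i]) [1..<k+1] | k. k \<in> {1..n}} \<union>
      {nested (qbr n) (\<lambda>i. mon [Xp i]) (rev [k..<n+1]) | k. k \<in> {2..n}}))"

end

theory Submission imports Defs
begin

text \<open>
  Let \<open>A\<^sub>k\<close> and \<open>B\<^sub>k\<close> be the nested \<open>q\<close>-commutators starting from \<open>E\<^sub>1\<close> and from \<open>E\<^sub>n\<close>, and
  \<open>L = (K - 1)/(q - 1)\<close>. The quantum Serre relations yield commutation relations between these
  elements which straighten every product of them: \<open>B\<^sub>h\<close> is spanned over the power series by the
  ordered monomials \<open>B\<dots> A\<dots> L\<dots>\<close>. At \<open>h = 0\<close> these become the ordered monomials in a basis of
  \<open>\<hh>\<close>, which are linearly independent in the enveloping algebra; hence an element of \<open>B\<^sub>h\<close>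
  that vanishes at \<open>h = 0\<close> has all its coefficients divisible by \<open>h\<close>. Independence is seen in
  tensor powers of the natural representation: functionals on matrices that are dual to the basis
  and vanish at the identity kill all monomials that are too short, and on monomials of the critical
  length they give permanents. The coideal property follows from
  \<open>\<Delta>(A\<^sub>k) \<in> A\<^sub>k \<otimes> U\<^sub>h + \<Sum>\<^bsub>j<k\<^esub> A\<^sub>j \<otimes> U\<^sub>h + 1 \<otimes> U\<^sub>h\<close>, where the second tensor
  factors \<open>q\<close>-commute suitably with \<open>K\<^sub>k\<^sub>+\<^sub>1\<close>.
\<close>

section \<open>Transfer of identities to rings with carrier\<close>

text \<open>The argument never establishes that U_h is torsion-free or topologically free, and this
  shapes it. Flatness of B_h is obtained without uniqueness of normal forms over the power series:
  spanning upstairs together with independence at h = 0 already forces divisible coefficients. The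
  price is that nothing may be cancelled by h or q - 1 inside U_h. Each such division is made in the
  free algebra, whose coefficients lie in a domain. For this the exponentials are moved past letters
  with an error that is h times an element of the ideal, not merely an element of the ideal; only so
  do the relations of L follow from those of K. Since B_h is not completed, straightening has to end
  after finitely many steps. Up to powers of q the elements A_i and B_k commute, except when i + k =
  n; there the exchange produces neighbouring products of the same kind and finally A_n, and placing
  all B before all A makes this recursion terminate.\<close>

typedef 'a ring_family =
  "{f :: 'a ring \<Rightarrow> 'a. \<forall>R. (ring R \<longrightarrow> f R \<in> carrier R) \<and> (\<not> ring R \<longrightarrow> f R = undefined)}"
  by (rule exI[of _ "\<lambda>R. if ring R then \<zero>\<^bsub>R\<^esub> else undefined"]) (simp add: ring.ring_simprules(2))

setup_lifting type_definition_ring_family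

text \<open>The algebras in question are carriers of records, while the normalisation rules for
  noncommutative identities need a type class. The product of all rings on a given type is a ring in
  the class sense; the fixed value \<open>undefined\<close> at records that are not rings makes
  equality extensional. An identity proved for the class is then read off at one component.\<close>

instantiation ring_family :: (type) "{ring, monoid_mult}"
begin

lift_definition zero_ring_family :: "'a ring_family" is
  "\<lambda>R. if ring R then \<zero>\<^bsub>R\<^esub> else undefined" by (simp add: ring.ring_simprules)
lift_definition one_ring_family :: "'a ring_family" is
  "\<lambda>R. if ring R then \<one>\<^bsub>R\<^esub> else undefined" by (simp add: ring.ring_simprules)
lift_definition plus_ring_family :: "'a ring_family \<Rightarrow> 'a ring_family \<Rightarrow> 'a ring_family" is
  "\<lambda>f g R. if ring R then f R \<oplus>\<^bsub>R\<^esub> g R else undefined" by (simp add: ring.ring_simprules)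
lift_definition times_ring_family :: "'a ring_family \<Rightarrow> 'a ring_family \<Rightarrow> 'a ring_family" is
  "\<lambda>f g R. if ring R then f R \<otimes>\<^bsub>R\<^esub> g R else undefined" by (simp add: ring.ring_simprules)
lift_definition uminus_ring_family :: "'a ring_family \<Rightarrow> 'a ring_family" is
  "\<lambda>f R. if ring R then \<ominus>\<^bsub>R\<^esub> f R else undefined" by (simp add: ring.ring_simprules)
lift_definition minus_ring_family :: "'a ring_family \<Rightarrow> 'a ring_family \<Rightarrow> 'a ring_family" is
  "\<lambda>f g R. if ring R then f R \<ominus>\<^bsub>R\<^esub> g R else undefined" by (simp add: ring.ring_simprules)

instance
proof
  fix a b c :: "'a ring_family"
  show "a + b + c = a + (b + c)"
    by transfer (auto simp: fun_eq_iff ring.ring_simprules)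
  show "a + b = b + a"
    by transfer (auto simp: fun_eq_iff intro: abelian_monoid.a_comm[OF abelian_group.axioms(1)[OF ring.axioms(1)]])
  show "0 + a = a"
    by transfer (auto simp: fun_eq_iff ring.ring_simprules)
  show "- a + a = 0"
    by transfer (auto simp: fun_eq_iff ring.ring_simprules)
  show "a - b = a + - b"
    by transfer (auto simp: fun_eq_iff a_minus_def)
  show "a * b * c = a * (b * c)"
    by transfer (auto simp: fun_eq_iff ring.ring_simprules)
  show "(a + b) * c = a * c + b * c"
    by transfer (auto simp: fun_eq_iff ring.ring_simprules)
  show "a * (b + c) = a * b + a * c"
    by transfer (auto simp: fun_eq_iff ring.ring_simprules)
  show "1 * a = a"
    by transfer (auto simp: fun_eq_iff ring.ring_simprules)
  show "a * 1 = a"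
    by transfer (auto simp: fun_eq_iff monoid.r_one[OF ring.is_monoid])
qed

end

text \<open>
  Off the component \<open>R\<close> the family \<open>emb R x\<close> is zero, while \<open>emb1 R x\<close> is one, so that
  central units stay central units.
\<close>

lift_definition emb :: "'a ring \<Rightarrow> 'a \<Rightarrow> 'a ring_family" is
  "\<lambda>R x R'. if ring R' then if R' = R \<and> x \<in> carrier R then x else \<zero>\<^bsub>R'\<^esub> else undefined"
  by (auto intro: ring.ring_simprules(2) monoid.one_closed[OF ring.is_monoid])

lift_definition emb1 :: "'a ring \<Rightarrow> 'a \<Rightarrow> 'a ring_family" is
  "\<lambda>R x R'. if ring R' then if R' = R \<and> x \<in> carrier R then x else \<one>\<^bsub>R'\<^esub> else undefined"
  by (auto intro: ring.ring_simprules(2) monoid.one_closed[OF ring.is_monoid])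

context
  fixes R :: "'a ring"
  assumes R: "ring R"
begin

lemma emb_inject: "x \<in> carrier R \<Longrightarrow> y \<in> carrier R \<Longrightarrow> emb R x = emb R y \<Longrightarrow> x = y"
  by (drule arg_cong[where f = "\<lambda>f. Rep_ring_family f R"]) (simp add: emb.rep_eq R)

lemma emb_mult: "x \<in> carrier R \<Longrightarrow> y \<in> carrier R \<Longrightarrow> emb R (x \<otimes>\<^bsub>R\<^esub> y) = emb R x * emb R y"
  by (transfer, auto simp: fun_eq_iff ring.ring_simprules monoid.one_closed[OF ring.is_monoid] monoid.l_one[OF ring.is_monoid])

lemma emb_add: "x \<in> carrier R \<Longrightarrow> y \<in> carrier R \<Longrightarrow> emb R (x \<oplus>\<^bsub>R\<^esub> y) = emb R x + emb R y"
  by (transfer, auto simp: fun_eq_iff ring.ring_simprules monoid.one_closed[OF ring.is_monoid] monoid.l_one[OF ring.is_monoid])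

lemma emb_minus: "x \<in> carrier R \<Longrightarrow> y \<in> carrier R \<Longrightarrow> emb R (x \<ominus>\<^bsub>R\<^esub> y) = emb R x - emb R y"
  by (transfer, auto simp: fun_eq_iff ring.ring_simprules monoid.one_closed[OF ring.is_monoid] monoid.l_one[OF ring.is_monoid])

lemma emb_uminus: "x \<in> carrier R \<Longrightarrow> emb R (\<ominus>\<^bsub>R\<^esub> x) = - emb R x"
  by (transfer, auto simp: fun_eq_iff ring.ring_simprules monoid.one_closed[OF ring.is_monoid] monoid.l_one[OF ring.is_monoid])

lemma emb_zero: "emb R \<zero>\<^bsub>R\<^esub> = 0"
  by (transfer, auto simp: fun_eq_iff ring.ring_simprules monoid.one_closed[OF ring.is_monoid] monoid.l_one[OF ring.is_monoid])

lemma emb1_mult: "x \<in> carrier R \<Longrightarrow> y \<in> carrier R \<Longrightarrow> emb1 R (x \<otimes>\<^bsub>R\<^esub> y) = emb1 R x * emb1 R y"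
  by (transfer, auto simp: fun_eq_iff ring.ring_simprules monoid.one_closed[OF ring.is_monoid] monoid.l_one[OF ring.is_monoid])

text \<open>The mixed rule for a scalar times an element: away from the component R both sides
  vanish, because the right factor does.\<close>

lemma emb1_emb: "x \<in> carrier R \<Longrightarrow> y \<in> carrier R \<Longrightarrow> emb R (x \<otimes>\<^bsub>R\<^esub> y) = emb1 R x * emb R y"
  by (transfer, auto simp: fun_eq_iff ring.ring_simprules monoid.one_closed[OF ring.is_monoid] monoid.l_one[OF ring.is_monoid])

lemma emb1_one: "emb1 R \<one>\<^bsub>R\<^esub> = 1"
  by (transfer, auto simp: fun_eq_iff)

lemma emb1_central:
  assumes "q \<in> carrier R" "\<And>x. x \<in> carrier R \<Longrightarrow> x \<otimes>\<^bsub>R\<^esub> q = q \<otimes>\<^bsub>R\<^esub> x"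
  shows "x * emb1 R q = emb1 R q * x"
  using assms
  by (transfer, intro ext) (simp add: monoid.r_one[OF ring.is_monoid] monoid.l_one[OF ring.is_monoid])

end

section \<open>Quantum root vectors\<close>

context
  fixes q p :: "'a :: {ring, monoid_mult}"
  assumes qc: "\<And>x. x * q = q * x" and pc: "\<And>x. x * p = p * x" and pq: "p * q = 1"
begin

lemma qlc: "x * (q * y) = q * (x * y)" by (metis qc mult.assoc)
lemma plc: "x * (p * y) = p * (x * y)" by (metis pc mult.assoc)
lemma pql: "p * (q * y) = y" by (metis pq mult.assoc mult_1)
lemma qpl: "q * (p * y) = y" by (metis pc pq mult.assoc mult_1)

lemmas qsimps = distrib_left distrib_right left_diff_distrib right_diff_distrib mult.assoc
  pql qpl

text \<open>The difference (XE - qEX)E - pE(XE - qEX) is XEE - (q + p)EXE + EEX, which is the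
  quantum Serre relation itself; p stands for the inverse of q.\<close>

lemma q_bracket_right:
  assumes "X * (E * E) + E * (E * X) = q * (E * (X * E)) + p * (E * (X * E))"
  shows "(X * E - q * (E * X)) * E = p * (E * (X * E - q * (E * X)))"
proof -
  \<comment> \<open>Scalars are moved past the listed letters only: with a schematic letter the
    rules would also exchange q and p with themselves and not terminate.\<close>
  note qsimps = qsimps qlc[of X] plc[of X] qlc[of E] plc[of E]
  have *: "X * (E * E) = q * (E * (X * E)) + p * (E * (X * E)) - E * (E * X)"
    using assms by (simp add: algebra_simps)
  show ?thesis by (simp add: qsimps *)
qed

text \<open>The mirror image: E(EF - qFE) - p(EF - qFE)E is the Serre expression for F and E, with
  pq = 1 used in the last term.\<close>

lemma q_bracket_left:
  assumes "F * (E * E) + E * (E * F) = q * (E * (F * E)) + p * (E * (F * E))"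
  shows "E * (E * F - q * (F * E)) = p * ((E * F - q * (F * E)) * E)"
proof -
  note qsimps = qsimps qlc[of F] plc[of F] qlc[of E] plc[of E]
  have *: "E * (E * F) = q * (E * (F * E)) + p * (E * (F * E)) - F * (E * E)"
    using assms by (simp add: algebra_simps)
  show ?thesis by (simp add: qsimps *)
qed

text \<open>Multiplying by \<open>q + p\<close> makes the quantum Serre relations applicable to the middle terms \<open>E X E\<close>.\<close>

lemma q_bracket_commute:
  assumes "X * Y = Y * X"
    and "X * (E * E) + E * (E * X) = q * (E * (X * E)) + p * (E * (X * E))"
    and "Y * (E * E) + E * (E * Y) = q * (E * (Y * E)) + p * (E * (Y * E))"
  defines "P \<equiv> X * E - q * (E * X)" and "Q \<equiv> Y * E - q * (E * Y)"
  shows "q * (P * Q) + p * (P * Q) = q * (Q * P) + p * (Q * P)"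
proof -
  note qsimps = qsimps qlc[of X] plc[of X] qlc[of Y] plc[of Y] qlc[of E] plc[of E] qlc[of P] plc[of P] qlc[of Q] plc[of Q]
  have PE: "P * E = p * (E * P)" and QE: "Q * E = p * (E * Q)"
    unfolding P_def Q_def by (rule q_bracket_right, fact)+
  have "P * Q - Q * P = (P * Y) * E - q * ((P * E) * Y) - (Q * X) * E + q * ((Q * E) * X)"
    by (simp add: P_def Q_def qsimps)
  \<comment> \<open>Each leading q is consumed by the p in PE = pEP and QE = pEQ, which leaves a
    genuine commutator with E.\<close>
  also have "\<dots> = (P * Y) * E - E * (P * Y) - (Q * X) * E + E * (Q * X)"
    by (simp add: PE QE qsimps)
  also have "\<dots> = (P * Y - Q * X) * E - E * (P * Y - Q * X)"
    by (simp add: qsimps)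
  also have "P * Y - Q * X = X * E * Y - Y * E * X"
    using assms(1) by (simp add: P_def Q_def qsimps)
  finally have d: "P * Q - Q * P = X * (E * (Y * E)) - Y * (E * (X * E)) - E * (X * (E * Y)) + E * (Y * (E * X))"
    by (simp add: qsimps)
  have s: "q * z + p * z = (q + p) * z" for z by (simp add: distrib_right)
  have l: "(q + p) * (x * y) = x * ((q + p) * y)" for x y
    by (simp add: distrib_left distrib_right qlc[of x y] plc[of x y])
  have EXE: "(q + p) * (E * (X * E)) = X * (E * E) + E * (E * X)"
    and EYE: "(q + p) * (E * (Y * E)) = Y * (E * E) + E * (E * Y)"
    using assms(2,3) by (simp_all add: distrib_right)
  have EXE': "(q + p) * (E * (X * (E * z))) = X * (E * (E * z)) + E * (E * (X * z))" for z
    using arg_cong[OF EXE, of "\<lambda>u. u * z"] by (simp add: mult.assoc distrib_right)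
  have EYE': "(q + p) * (E * (Y * (E * z))) = Y * (E * (E * z)) + E * (E * (Y * z))" for z
    using arg_cong[OF EYE, of "\<lambda>u. u * z"] by (simp add: mult.assoc distrib_right)
  have XY: "X * (Y * z) = Y * (X * z)" for z using assms(1) by (metis mult.assoc)
  have "(q + p) * (P * Q - Q * P) = 0"
    unfolding d right_diff_distrib distrib_left[of "q + p"]
    unfolding l[of X] l[of Y] EXE EYE EXE' EYE'
    by (simp add: distrib_left XY assms(1))
  then show ?thesis by (simp add: s[symmetric] qsimps)
qed

text \<open>The triple bracket T can be bracketed from either side, as [P, F] or as [X, Q] with Q =
  [E, F]. The two forms give ET = q(PQ - QP) + qqTE and TE = q(PQ - QP) + qqET; eliminating PQ - QP
  leaves (1 + qq)ET = (1 + qq)TE.\<close>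

lemma q_bracket_middle:
  assumes XF: "X * F = F * X"
    and "X * (E * E) + E * (E * X) = q * (E * (X * E)) + p * (E * (X * E))"
    and "F * (E * E) + E * (E * F) = q * (E * (F * E)) + p * (E * (F * E))"
  defines "P \<equiv> X * E - q * (E * X)"
  defines "T \<equiv> P * F - q * (F * P)"
  shows "E * T + q * (q * (E * T)) = T * E + q * (q * (T * E))"
proof -
  note qsimps = qsimps qlc[of X] plc[of X] qlc[of E] plc[of E] qlc[of F] plc[of F] qlc[of P] plc[of P] qlc[of Q] plc[of Q] qlc[of T] plc[of T]
  define Q where "Q = E * F - q * (F * E)"
  have PE: "P * E = p * (E * P)" unfolding P_def by (rule q_bracket_right, fact)
  have EQ: "E * Q = p * (Q * E)" unfolding Q_def by (rule q_bracket_left, fact)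
  have XF': "X * (F * z) = F * (X * z)" for z using XF by (metis mult.assoc)
  have EP': "E * P = q * (P * E)" by (simp add: PE qpl)
  have EP'': "E * (P * z) = q * (P * (E * z))" for z using EP' by (metis mult.assoc)
  have QE': "Q * E = q * (E * Q)" by (simp add: EQ qpl)
  have QE'': "Q * (E * z) = q * (E * (Q * z))" for z using QE' by (metis mult.assoc)
  have TXQ: "T = X * Q - q * (Q * X)" by (simp add: T_def P_def Q_def qsimps XF XF')
  have "E * T = q * (P * (E * F)) - q * ((E * F) * P)"
    by (simp add: T_def qsimps EP'')
  also have "E * F = Q + q * (F * E)" by (simp add: Q_def)
  finally have 1: "E * T = q * (P * Q) - q * (Q * P) + q * (q * (P * F * E - F * (E * P)))"
    by (simp add: qsimps)
  have "P * F * E - F * (E * P) = T * E"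
    by (simp add: T_def qsimps EP')
  with 1 have 1: "E * T = q * (P * Q) - q * (Q * P) + q * (q * (T * E))" by simp
  have "T * E = q * ((X * E) * Q) - q * (Q * (X * E))"
    by (simp add: TXQ qsimps QE')
  also have "X * E = P + q * (E * X)" by (simp add: P_def)
  finally have 2: "T * E = q * (P * Q) - q * (Q * P) + q * (q * (E * X * Q - Q * E * X))"
    by (simp add: qsimps qlc[of Q "E * X"])
  have "E * X * Q - Q * E * X = E * T" by (simp add: TXQ qsimps QE'')
  with 2 have 2: "T * E = q * (P * Q) - q * (Q * P) + q * (q * (E * T))" by simp
  have "E * T + q * (q * (E * T)) = E * T + T * E - (q * (P * Q) - q * (Q * P))" using 2 by (simp add: algebra_simps)
  moreover have "T * E + q * (q * (T * E)) = E * T + T * E - (q * (P * Q) - q * (Q * P))" using 1 by (simp add: algebra_simps)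
  ultimately show ?thesis by simp
qed

text \<open>Both sides expand to XYE - qXEY - qYEX + qqEYX, which is symmetric in X and Y because
  these commute.\<close>

lemma q_bracket_exchange:
  assumes "X * Y = Y * X"
  shows "X * (Y * E - q * (E * Y)) - q * ((Y * E - q * (E * Y)) * X) =
    Y * (X * E - q * (E * X)) - q * ((X * E - q * (E * X)) * Y)"
proof -
  note qsimps = qsimps qlc[of X] plc[of X] qlc[of Y] plc[of Y] qlc[of E] plc[of E]
  have "X * (Y * z) = Y * (X * z)" for z using assms by (metis mult.assoc)
  then show ?thesis using assms by (simp add: qsimps)
qed

text \<open>The Serre expression is linear in its first argument, and X passes through every E, so
  the relation for Y can be multiplied by X on either side.\<close>

lemma q_serre_bracket:
  assumes XE: "X * E = E * X"
    and "Y * (E * E) + E * (E * Y) = q * (E * (Y * E)) + p * (E * (Y * E))"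
  defines "Z \<equiv> X * Y - q * (Y * X)"
  shows "Z * (E * E) + E * (E * Z) = q * (E * (Z * E)) + p * (E * (Z * E))"
proof -
  note qsimps = qsimps qlc[of X] plc[of X] qlc[of E] plc[of E] qlc[of Y] plc[of Y]
  have XE': "X * (E * z) = E * (X * z)" for z using XE by (metis mult.assoc)
  have *: "Y * (E * E) = q * (E * (Y * E)) + p * (E * (Y * E)) - E * (E * Y)"
    using assms(2) by (simp add: algebra_simps)
  then have **: "Y * (E * (E * X)) = q * (E * (Y * (E * X))) + p * (E * (Y * (E * X))) - E * (E * (Y * X))"
    by (metis (no_types, lifting) distrib_right left_diff_distrib mult.assoc)
  show ?thesis by (simp add: Z_def qsimps XE XE' * **) (simp add: algebra_simps)?
qed

text \<open>
  In the application \<open>A + B\<close> and \<open>C + D\<close> are the coproducts of two Chevalley generators that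
  are joined in the Dynkin diagram.
\<close>

lemma q_serre_add:
  assumes AB: "A * B = q * (q * (B * A))" and DA: "A * D = p * (D * A)" and CB: "C * B = p * (B * C)"
    and sC: "C * (A * A) + A * (A * C) = q * (A * (C * A)) + p * (A * (C * A))"
    and sD: "D * (B * B) + B * (B * D) = q * (B * (D * B)) + p * (B * (D * B))"
  shows "(C + D) * ((A + B) * (A + B)) + (A + B) * ((A + B) * (C + D)) =
    q * ((A + B) * ((C + D) * (A + B))) + p * ((A + B) * ((C + D) * (A + B)))"
proof -
  note qsimps = qsimps qlc[of A] plc[of A] qlc[of B] plc[of B] qlc[of C] plc[of C] qlc[of D] plc[of D]
  have AB': "A * (B * z) = q * (q * (B * (A * z)))" for z using AB by (metis mult.assoc)
  have DA': "A * (D * z) = p * (D * (A * z))" for z using DA by (metis mult.assoc)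
  have CB': "C * (B * z) = p * (B * (C * z))" for z using CB by (metis mult.assoc)
  have *: "C * (A * A) = q * (A * (C * A)) + p * (A * (C * A)) - A * (A * C)"
    using sC by (simp add: algebra_simps)
  have **: "D * (B * B) = q * (B * (D * B)) + p * (B * (D * B)) - B * (B * D)"
    using sD by (simp add: algebra_simps)
  \<comment> \<open>The parts involving only A, C or only B, D vanish by the two given Serre
    relations. The mixed terms cancel once every B and D has been moved to the left of every A and
    C.\<close>
  show ?thesis
    by (simp add: qsimps AB AB' DA DA' CB CB' * **) (simp add: algebra_simps)?
qed

end

text \<open>The bracket computations determine some commutators only up to a factor q + 1/q. The
  assumption \<open>qq_cancel\<close> allows this factor to be removed; for power series it holds
  because 1 + qq has constant term 2.\<close>

locale qring = ring R for R :: "'a ring" (structure) +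
  fixes q p :: 'a
  assumes q_closed [simp]: "q \<in> carrier R" and p_closed [simp]: "p \<in> carrier R"
    and q_central: "x \<in> carrier R \<Longrightarrow> x \<otimes> q = q \<otimes> x"
    and p_central: "x \<in> carrier R \<Longrightarrow> x \<otimes> p = p \<otimes> x"
    and p_q: "p \<otimes> q = \<one>"
    and qq_cancel: "x \<in> carrier R \<Longrightarrow> x \<oplus> q \<otimes> (q \<otimes> x) = \<zero> \<Longrightarrow> x = \<zero>"
begin

definition qb :: "'a \<Rightarrow> 'a \<Rightarrow> 'a" where "qb x y = x \<otimes> y \<ominus> q \<otimes> (y \<otimes> x)"

definition qserre :: "'a \<Rightarrow> 'a \<Rightarrow> bool" where
  "qserre x e \<longleftrightarrow> x \<otimes> (e \<otimes> e) \<oplus> e \<otimes> (e \<otimes> x) = q \<otimes> (e \<otimes> (x \<otimes> e)) \<oplus> p \<otimes> (e \<otimes> (x \<otimes> e))"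

lemma qb_closed [simp, intro]: "x \<in> carrier R \<Longrightarrow> y \<in> carrier R \<Longrightarrow> qb x y \<in> carrier R"
  by (simp add: qb_def)

lemma emb_q: "x \<in> carrier R \<Longrightarrow> emb R (q \<otimes> x) = emb1 R q * emb R x"
  and emb_p: "x \<in> carrier R \<Longrightarrow> emb R (p \<otimes> x) = emb1 R p * emb R x"
  by (simp_all add: emb1_emb[OF ring_axioms])

text \<open>The \<open>NO_MATCH\<close> conditions leave products with a leading q or p to
  \<open>emb_q\<close> and \<open>emb_p\<close>, which send the scalars to \<open>emb1\<close>.
  There they stay invertible at every component of the family.\<close>

lemma emb_mult_other:
  "NO_MATCH q x \<Longrightarrow> NO_MATCH p x \<Longrightarrow> x \<in> carrier R \<Longrightarrow> y \<in> carrier R \<Longrightarrow>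
    emb R (x \<otimes> y) = emb R x * emb R y"
  by (simp add: emb_mult[OF ring_axioms])

lemmas emb_simps = emb_mult_other emb_add[OF ring_axioms] emb_minus[OF ring_axioms]
  emb_uminus[OF ring_axioms] emb_zero[OF ring_axioms] emb_q emb_p

lemmas emb_eqI = emb_inject[OF ring_axioms]

lemma emb1_qp: "x * emb1 R q = emb1 R q * x" "x * emb1 R p = emb1 R p * x"
  "emb1 R p * emb1 R q = 1"
proof -
  show "x * emb1 R q = emb1 R q * x" "x * emb1 R p = emb1 R p * x"
    by (simp_all add: emb1_central[OF ring_axioms] q_central p_central)
  show "emb1 R p * emb1 R q = 1"
    by (simp add: p_q emb1_one[OF ring_axioms] flip: emb1_mult[OF ring_axioms])
qed

lemma qserre_emb:
  assumes "x \<in> carrier R" "e \<in> carrier R" "qserre x e"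
  shows "emb R x * (emb R e * emb R e) + emb R e * (emb R e * emb R x) =
    emb1 R q * (emb R e * (emb R x * emb R e)) + emb1 R p * (emb R e * (emb R x * emb R e))"
  using arg_cong[OF assms(3)[unfolded qserre_def], of "emb R"] assms(1,2)
  by (simp add: emb_simps)

lemma commute_emb:
  "x \<in> carrier R \<Longrightarrow> y \<in> carrier R \<Longrightarrow> x \<otimes> y = y \<otimes> x \<Longrightarrow> emb R x * emb R y = emb R y * emb R x"
  by (simp flip: emb_mult[OF ring_axioms])

lemma qb_right:
  assumes "x \<in> carrier R" "e \<in> carrier R" "qserre x e"
  shows "qb x e \<otimes> e = p \<otimes> (e \<otimes> qb x e)"
  by (rule emb_eqI)
    (use assms q_bracket_right[OF emb1_qp qserre_emb[OF assms]] in \<open>simp_all add: qb_def emb_simps\<close>)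

lemma qb_left:
  assumes "e \<in> carrier R" "f \<in> carrier R" "qserre f e"
  shows "e \<otimes> qb e f = p \<otimes> (qb e f \<otimes> e)"
  by (rule emb_eqI)
    (use assms q_bracket_left[OF emb1_qp qserre_emb[OF assms(2,1,3)]] in \<open>simp_all add: qb_def emb_simps\<close>)

lemma qq_cancel_diff:
  assumes [simp]: "x \<in> carrier R" "y \<in> carrier R" and "x \<oplus> q \<otimes> (q \<otimes> x) = y \<oplus> q \<otimes> (q \<otimes> y)"
  shows "x = y"
proof -
  have "(x \<ominus> y) \<oplus> q \<otimes> (q \<otimes> (x \<ominus> y)) = (x \<oplus> q \<otimes> (q \<otimes> x)) \<ominus> (y \<oplus> q \<otimes> (q \<otimes> y))"
    by (rule emb_eqI) (simp_all add: emb_simps algebra_simps)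
  also have "\<dots> = \<zero>" unfolding assms(3) by simp
  finally have "x \<ominus> y = \<zero>" by (rule qq_cancel[rotated]) simp
  then show ?thesis by simp
qed

lemma qb_commute:
  assumes [simp]: "x \<in> carrier R" "y \<in> carrier R" "e \<in> carrier R"
    and "x \<otimes> y = y \<otimes> x" "qserre x e" "qserre y e"
  shows "qb x e \<otimes> qb y e = qb y e \<otimes> qb x e"
proof -
  let ?u = "qb x e \<otimes> qb y e" and ?v = "qb y e \<otimes> qb x e"
  have "q \<otimes> ?u \<oplus> p \<otimes> ?u = q \<otimes> ?v \<oplus> p \<otimes> ?v"
    by (rule emb_eqI)
      (use q_bracket_commute[OF emb1_qp commute_emb qserre_emb qserre_emb, of x y e] assms
       in \<open>simp_all add: qb_def emb_simps\<close>)
  \<comment> \<open>Multiplication by q turns the factor q + p of the class identity into 1 + qq,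
    the factor that \<open>qq_cancel\<close> removes.\<close>
  then have "q \<otimes> (q \<otimes> ?u \<oplus> p \<otimes> ?u) = q \<otimes> (q \<otimes> ?v \<oplus> p \<otimes> ?v)" by simp
  moreover have *: "q \<otimes> (q \<otimes> z \<oplus> p \<otimes> z) = z \<oplus> q \<otimes> (q \<otimes> z)" if "z \<in> carrier R" for z
  proof -
    have "q \<otimes> (p \<otimes> z) = z"
      using that p_q q_central[OF p_closed] by (metis l_one m_assoc p_closed q_closed)
    then show ?thesis using that by (simp add: r_distr a_comm)
  qed
  ultimately have "?u \<oplus> q \<otimes> (q \<otimes> ?u) = ?v \<oplus> q \<otimes> (q \<otimes> ?v)"
    using *[of ?u] *[of ?v] assms(1-3) by (metis m_closed qb_closed)
  then show ?thesis by (rule qq_cancel_diff[rotated 2]) simp_all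
qed

lemma qb_middle:
  assumes [simp]: "x \<in> carrier R" "e \<in> carrier R" "f \<in> carrier R"
    and "x \<otimes> f = f \<otimes> x" "qserre x e" "qserre f e"
  shows "e \<otimes> qb (qb x e) f = qb (qb x e) f \<otimes> e"
  by (rule qq_cancel_diff, simp_all, rule emb_eqI)
    (use q_bracket_middle[OF emb1_qp commute_emb qserre_emb qserre_emb, of x f e] assms
      in \<open>simp_all add: qb_def emb_simps\<close>)

lemma qb_exchange:
  assumes [simp]: "x \<in> carrier R" "y \<in> carrier R" "e \<in> carrier R" and "x \<otimes> y = y \<otimes> x"
  shows "x \<otimes> qb y e = q \<otimes> (qb y e \<otimes> x) \<oplus> (y \<otimes> qb x e \<ominus> q \<otimes> (qb x e \<otimes> y))"
  by (rule emb_eqI)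
    (use q_bracket_exchange[OF emb1_qp commute_emb, of x y "emb R e"] assms
      in \<open>simp_all add: qb_def emb_simps algebra_simps\<close>)

lemma qserre_add:
  assumes [simp]: "A \<in> carrier R" "B \<in> carrier R" "C \<in> carrier R" "D \<in> carrier R"
    and "A \<otimes> B = q \<otimes> (q \<otimes> (B \<otimes> A))" "A \<otimes> D = p \<otimes> (D \<otimes> A)" "C \<otimes> B = p \<otimes> (B \<otimes> C)"
    and "qserre C A" "qserre D B"
  shows "qserre (C \<oplus> D) (A \<oplus> B)"
proof -
  have *: "emb R A * emb R B = emb1 R q * (emb1 R q * (emb R B * emb R A))"
    "emb R A * emb R D = emb1 R p * (emb R D * emb R A)"
    "emb R C * emb R B = emb1 R p * (emb R B * emb R C)"
    using assms(5-7)[THEN arg_cong[of _ _ "emb R"]] by (simp_all add: emb_simps)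
  show ?thesis unfolding qserre_def
    by (rule emb_eqI) 
     (use q_serre_add[OF emb1_qp * qserre_emb qserre_emb] assms(8,9)
      in \<open>simp_all add: emb_simps\<close>)
qed

text \<open>The properties that are preserved by \<open>q\<close>-brackets with a fixed second factor.\<close>

lemma qcommute_qb:
  assumes [simp]: "x \<in> carrier R" "y \<in> carrier R" "z \<in> carrier R" "c \<in> carrier R" "d \<in> carrier R"
    and c: "\<And>w. w \<in> carrier R \<Longrightarrow> w \<otimes> c = c \<otimes> w" and d: "\<And>w. w \<in> carrier R \<Longrightarrow> w \<otimes> d = d \<otimes> w"
    and x: "z \<otimes> x = c \<otimes> (x \<otimes> z)" and y: "z \<otimes> y = d \<otimes> (y \<otimes> z)"
  shows "z \<otimes> qb x y = c \<otimes> d \<otimes> (qb x y \<otimes> z)"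
proof -
  have lc: "w \<otimes> (c \<otimes> v) = c \<otimes> (w \<otimes> v)" if "w \<in> carrier R" "v \<in> carrier R" for w v
    using c[OF that(1)] that by (metis assms(4) m_assoc)
  have ld: "w \<otimes> (d \<otimes> v) = d \<otimes> (w \<otimes> v)" if "w \<in> carrier R" "v \<in> carrier R" for w v
    using d[OF that(1)] that by (metis assms(5) m_assoc)
  have lq: "w \<otimes> (q \<otimes> v) = q \<otimes> (w \<otimes> v)" if "w \<in> carrier R" "v \<in> carrier R" for w v
    using q_central[OF that(1)] that by (metis q_closed m_assoc)
  have lx: "z \<otimes> (x \<otimes> v) = c \<otimes> (x \<otimes> (z \<otimes> v))" if "v \<in> carrier R" for v
    using x that by (metis assms(1-5) m_assoc m_closed)
  have ly: "z \<otimes> (y \<otimes> v) = d \<otimes> (y \<otimes> (z \<otimes> v))" if "v \<in> carrier R" for v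
    using y that by (metis assms(1-5) m_assoc m_closed)
  show ?thesis
    by (simp add: qb_def r_distr l_distr minus_eq r_minus l_minus m_assoc x y lx ly
        ld[of x] lc[of y] lq[of z] lq[of c] lq[of d] lc[of d])
qed

lemma commute_qb:
  assumes [simp]: "x \<in> carrier R" "y \<in> carrier R" "z \<in> carrier R"
    and "z \<otimes> x = x \<otimes> z" "z \<otimes> y = y \<otimes> z"
  shows "z \<otimes> qb x y = qb x y \<otimes> z"
  using qcommute_qb[of x y z \<one> \<one>] assms(4,5) by simp

lemma qserre_qb:
  assumes [simp]: "x \<in> carrier R" "y \<in> carrier R" "e \<in> carrier R"
    and "x \<otimes> e = e \<otimes> x" "qserre y e"
  shows "qserre (qb x y) e"
proof -
  have "emb R x * emb R e = emb R e * emb R x" using assms by (intro commute_emb) auto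
  note * = q_serre_bracket[OF emb1_qp this qserre_emb[OF assms(2,3,5)]]
  show ?thesis unfolding qserre_def
    by (intro emb_eqI) (use * in \<open>simp_all add: qb_def emb_simps\<close>)
qed

end

section \<open>Nested brackets along a chain of type A and their commutation relations\<close>

lemma nested_snoc: "is \<noteq> [] \<Longrightarrow> nested br x (is @ [i]) = br (nested br x is) (x i)"
  by (cases "is") (simp_all add: nested_def)

lemma nested_single: "nested br x [i] = x i"
  by (simp add: nested_def)

lemma nested_map: "is \<noteq> [] \<Longrightarrow> nested br x (map f is) = nested br (\<lambda>i. x (f i)) is"
proof (induction "is" rule: rev_induct)
  case (snoc i js)
  then show ?case by (cases "js = []") (simp_all add: nested_snoc nested_single)
qed simp

text \<open>Initial segments suffice: brackets that start from the other end of the diagram are the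
  same function applied to the reversed sequence of generators.\<close>

definition nest :: "('a \<Rightarrow> 'a \<Rightarrow> 'a) \<Rightarrow> (nat \<Rightarrow> 'a) \<Rightarrow> nat \<Rightarrow> 'a" where
  "nest br x k = nested br x [1..<k+1]"

lemma nest_1: "nest br x (Suc 0) = x (Suc 0)"
  by (simp add: nest_def nested_single)

lemma nest_Suc: "k \<ge> 1 \<Longrightarrow> nest br x (Suc k) = br (nest br x k) (x (Suc k))"
  using nested_snoc[of "[1..<k+1]" br x "Suc k"] by (simp add: nest_def)

locale qchain = qring +
  fixes n :: nat and E :: "nat \<Rightarrow> 'a"
  assumes E_closed [simp]: "1 \<le> i \<Longrightarrow> i \<le> n \<Longrightarrow> E i \<in> carrier R"
    and E_far: "1 \<le> i \<Longrightarrow> Suc i < j \<Longrightarrow> j \<le> n \<Longrightarrow> E i \<otimes> E j = E j \<otimes> E i"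
    and E_serre: "1 \<le> i \<Longrightarrow> i < n \<Longrightarrow> qserre (E i) (E (Suc i))"
    and E_serre': "1 \<le> i \<Longrightarrow> i < n \<Longrightarrow> qserre (E (Suc i)) (E i)"
begin

text \<open>\<open>A k\<close> is a root vector for \<alpha>_1 + ... + \<alpha>_k, and
  \<open>B k\<close> below is one for \<alpha>_n + ... + \<alpha>_(n-k+1). Both \<open>A n\<close>
  and \<open>B n\<close> belong to the highest root; only the former is used as a generator.\<close>

abbreviation A :: "nat \<Rightarrow> 'a" where "A \<equiv> nest qb E"

abbreviation B :: "nat \<Rightarrow> 'a" where "B \<equiv> nest qb (\<lambda>i. E (Suc n - i))"

text \<open>Reflection of the Dynkin diagram preserves the assumptions, so every statement about A
  also yields one about B.\<close>

lemma qchain_rev: "qchain R q p n (\<lambda>i. E (Suc n - i))"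
proof
  fix i j :: nat
  show "1 \<le> i \<Longrightarrow> i \<le> n \<Longrightarrow> E (Suc n - i) \<in> carrier R" by simp
  show "E (Suc n - i) \<otimes> E (Suc n - j) = E (Suc n - j) \<otimes> E (Suc n - i)"
    if "1 \<le> i" "Suc i < j" "j \<le> n"
    using that E_far[of "Suc n - j" "Suc n - i"] by simp
  have *: "1 \<le> i \<Longrightarrow> i < n \<Longrightarrow> Suc (Suc n - Suc i) = Suc n - i" by simp
  show "1 \<le> i \<Longrightarrow> i < n \<Longrightarrow> qserre (E (Suc n - i)) (E (Suc n - Suc i))"
    using E_serre'[of "Suc n - Suc i"] * by fastforce
  show "1 \<le> i \<Longrightarrow> i < n \<Longrightarrow> qserre (E (Suc n - Suc i)) (E (Suc n - i))"
    using E_serre[of "Suc n - Suc i"] * by fastforce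
qed

lemma A_closed [simp]: "1 \<le> k \<Longrightarrow> k \<le> n \<Longrightarrow> A k \<in> carrier R"
proof (induction k rule: dec_induct)
  case (step k) then show ?case by (simp add: nest_Suc)
qed (simp add: nest_1)

lemma B_closed [simp]: "1 \<le> k \<Longrightarrow> k \<le> n \<Longrightarrow> B k \<in> carrier R"
  by (rule qchain.A_closed[OF qchain_rev])

lemma A_far: "1 \<le> k \<Longrightarrow> Suc k < j \<Longrightarrow> j \<le> n \<Longrightarrow> E j \<otimes> A k = A k \<otimes> E j"
proof (induction k rule: dec_induct)
  case base then show ?case using E_far[of 1 j] by (simp add: nest_1)
next
  case (step k)
  then show ?case
    using E_far[of "Suc k" j] by (simp add: nest_Suc commute_qb)
qed

text \<open>Only the last letter E_k of A_k interacts with E_(k+1). The preceding part A_(k-1)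
  commutes with it, and bracketing with such an element preserves the Serre relation.\<close>

lemma A_serre:
  assumes "1 \<le> k" "k < n"
  shows "qserre (A k) (E (Suc k))"
proof (cases "k = 1")
  case False
  then obtain l where l: "k = Suc l" "1 \<le> l" using assms by (cases k) auto
  then show ?thesis
    using assms A_far[of l "Suc k"] E_serre[of k] by (simp add: nest_Suc qserre_qb)
qed (use assms E_serre[of 1] in \<open>simp add: nest_1\<close>)

lemma A_E_last: "2 \<le> n \<Longrightarrow> A n \<otimes> E n = p \<otimes> (E n \<otimes> A n)"
  using A_serre[of "n - 1"] by (cases n) (auto simp: nest_Suc intro!: qb_right)

text \<open>The root \<alpha>_j is orthogonal to \<alpha>_1 + ... + \<alpha>_k for 1 < j < k. The
  critical case is k = j + 1, where E_j is the middle letter of a triple bracket; all later letters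
  commute with E_j.\<close>

lemma A_middle:
  assumes "1 < j" "j < k" "k \<le> n"
  shows "E j \<otimes> A k = A k \<otimes> E j"
proof -
  have "Suc j \<le> k" using assms by simp
  then show ?thesis using assms(3)
  proof (induction k rule: dec_induct)
    case base
    obtain l where l: "j = Suc l" "1 \<le> l" using assms(1) by (cases j) auto
    then show ?case
      using base assms A_serre[of l] A_far[of l "Suc j"] E_serre'[of j]
      by (simp add: nest_Suc qb_middle)
  next
    case (step k)
    then show ?case using assms(1) E_far[of j "Suc k"] by (simp add: nest_Suc commute_qb)
  qed
qed

text \<open>The letters E_2, ..., E_i of A_i lie strictly inside A_j and commute with it. The power
  of q comes from E_1 alone, which meets A_j at its first bracket.\<close>

lemma A_A:
  assumes "1 \<le> i" "i < j" "j \<le> n"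
  shows "A j \<otimes> A i = q \<otimes> (A i \<otimes> A j)"
  using assms
proof (induction i rule: dec_induct)
  case base
  have "Suc 1 \<le> j" using base by simp
  then have "E 1 \<otimes> A j = p \<otimes> (A j \<otimes> E 1)" using base(2)
  proof (induction j rule: dec_induct)
    case base
    then show ?case using E_serre'[of 1] qb_left[of "E 1" "E (Suc 1)"]
      by (simp add: nest_Suc nest_1)
  next
    case (step j)
    then show ?case using E_far[of 1 "Suc j"] p_central
      by (simp add: nest_Suc qcommute_qb[of "A j" "E (Suc j)" "E 1" p \<one>, simplified])
  qed
  then have "q \<otimes> (E 1 \<otimes> A j) = (q \<otimes> p) \<otimes> (A j \<otimes> E 1)" using base by (simp add: m_assoc)
  then show ?case using base p_q q_central[of p] by (simp add: nest_1)
next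
  case (step i)
  then show ?case
    using A_middle[of "Suc i" j] q_central
    by (simp add: nest_Suc qcommute_qb[of "A i" "E (Suc i)" "A j" q \<one>, simplified])
qed

text \<open>The letters of A_i are E_1, ..., E_i and those of B_k are E_(n-k+1), ..., E_n. For i + k
  < n no letter of one set is equal or adjacent to a letter of the other.\<close>

lemma A_B_far: "1 \<le> k \<Longrightarrow> 1 \<le> i \<Longrightarrow> i + k < n \<Longrightarrow> A i \<otimes> B k = B k \<otimes> A i"
proof (induction k rule: dec_induct)
  case base then show ?case using A_far[of i n] by (simp add: nest_1)
next
  case (step k)
  then show ?case using A_far[of i "n - k"] by (simp add: nest_Suc commute_qb)
qed

text \<open>For i + k = n + 1 both elements end in the same letter E_i, and their remaining parts
  commute, so \<open>qb_commute\<close> applies. Each further letter of B lies strictly inside A_i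
  and commutes with it.\<close>

lemma A_B_overlap:
  assumes "i < n" "k < n" "n < i + k"
  shows "A i \<otimes> B k = B k \<otimes> A i"
proof -
  have "Suc n - i \<le> k" using assms by simp
  then show ?thesis using assms
  proof (induction k rule: dec_induct)
    case base
    define l where "l = n - i"
    define m where "m = i - 1"
    have lm: "Suc n - i = Suc l" "1 \<le> l" "i = Suc m" "1 \<le> m" "l \<le> n" "m \<le> n" "l < n" "m < n"
      "n - l = Suc m" "m + l < n" "Suc m \<le> n"
      using base by (auto simp: l_def m_def)
    show ?case
      using A_serre[of m] qchain.A_serre[OF qchain_rev, of l] lm A_B_far[of l m]
      by (simp add: nest_Suc qb_commute)
  next
    case (step k)
    then show ?case
      using A_middle[of "n - k" i] by (simp add: nest_Suc commute_qb)
  qed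
qed

text \<open>Only the first letter E_n of B_k contributes a power of q; the others are inner letters
  of A_n.\<close>

lemma A_B_top: "1 \<le> k \<Longrightarrow> k < n \<Longrightarrow> A n \<otimes> B k = p \<otimes> (B k \<otimes> A n)"
proof (induction k rule: dec_induct)
  case base then show ?case using A_E_last by (simp add: nest_1)
next
  case (step k)
  then show ?case
    using A_middle[of "n - k" n] p_central
    by (simp add: nest_Suc qcommute_qb[of "B k" "E (n - k)" "A n" p \<one>, simplified])
qed

end

section \<open>Straightening\<close>

text \<open>The coefficient set is a parameter because two choices occur: all scalars for the normal
  forms in B_h, and only 1 for finite sums of pure tensors, where a scalar can be absorbed into a
  tensor factor.\<close>

inductive_set lspan :: "('a, 'b) ring_scheme \<Rightarrow> 'a set \<Rightarrow> 'a set \<Rightarrow> 'a set" for R (structure) and S G where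
  lspan_zero: "\<zero> \<in> lspan R S G"
| lspan_step: "x \<in> lspan R S G \<Longrightarrow> c \<in> S \<Longrightarrow> g \<in> G \<Longrightarrow> x \<oplus> c \<otimes> g \<in> lspan R S G"

locale scalars = ring R for R (structure) +
  fixes S :: "'a set"
  assumes S_subring: "subring S R"
    and S_central: "c \<in> S \<Longrightarrow> x \<in> carrier R \<Longrightarrow> x \<otimes> c = c \<otimes> x"
begin

lemma S_closed [simp]: "c \<in> S \<Longrightarrow> c \<in> carrier R"
  using subringE(1)[OF S_subring] by auto

lemma S_one [simp]: "\<one> \<in> S" and S_mult [simp]: "c \<in> S \<Longrightarrow> d \<in> S \<Longrightarrow> c \<otimes> d \<in> S"
  and S_neg [simp]: "c \<in> S \<Longrightarrow> \<ominus> c \<in> S"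
  using subringE(3,5,6)[OF S_subring] by auto

lemma lspan_closed: "x \<in> lspan R S G \<Longrightarrow> G \<subseteq> carrier R \<Longrightarrow> x \<in> carrier R"
  by (induction rule: lspan.induct) auto

lemma lspan_incl:
  assumes "g \<in> G" "G \<subseteq> carrier R" shows "g \<in> lspan R S G"
proof -
  have "\<zero> \<oplus> \<one> \<otimes> g \<in> lspan R S G" using assms by (intro lspan.intros) auto
  then show ?thesis using assms by auto
qed

lemma lspan_add:
  assumes "y \<in> lspan R S G" "x \<in> lspan R S G" "G \<subseteq> carrier R"
  shows "x \<oplus> y \<in> lspan R S G"
  using assms(1)
proof (induction rule: lspan.induct)
  case lspan_zero
  then show ?case using lspan_closed[OF assms(2,3)] assms(2) by simp
next
  case (lspan_step y c g)
  have "(x \<oplus> y) \<oplus> c \<otimes> g \<in> lspan R S G" using lspan_step by (intro lspan.lspan_step) auto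
  moreover have "x \<in> carrier R" "y \<in> carrier R" "g \<in> carrier R"
    using lspan_step assms lspan_closed by auto
  ultimately show ?case using lspan_step(2) by (simp add: a_assoc)
qed

lemma lspan_mult_image:
  assumes "x \<in> lspan R S G" "G \<subseteq> carrier R" "H \<subseteq> carrier R" "y \<in> carrier R" "z \<in> carrier R"
    and "\<And>g. g \<in> G \<Longrightarrow> y \<otimes> g \<otimes> z \<in> lspan R S H"
  shows "y \<otimes> x \<otimes> z \<in> lspan R S H"
  using assms(1)
proof (induction rule: lspan.induct)
  case lspan_zero
  then show ?case using assms by (simp add: lspan.lspan_zero)
next
  case (lspan_step x c g)
  have x: "x \<in> carrier R" "g \<in> carrier R" using lspan_step assms(2) lspan_closed by auto
  have *: "c \<otimes> u \<in> lspan R S H" if "u \<in> lspan R S H" for u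
    using that
  proof (induction rule: lspan.induct)
    case lspan_zero
    then show ?case using lspan_step(2) by (simp add: lspan.lspan_zero)
  next
    case (lspan_step u d h)
    then have "c \<otimes> u \<oplus> (c \<otimes> d) \<otimes> h \<in> lspan R S H"
      using \<open>c \<in> S\<close> by (intro lspan.lspan_step) auto
    moreover have "u \<in> carrier R" "h \<in> carrier R" using lspan_step assms(3) lspan_closed by auto
    ultimately show ?case using \<open>c \<in> S\<close> lspan_step(2) by (simp add: r_distr m_assoc)
  qed
  have "y \<otimes> (c \<otimes> g) \<otimes> z = c \<otimes> (y \<otimes> g \<otimes> z)"
    using S_central[OF lspan_step(2) assms(4)] lspan_step(2) x assms(4,5) by (metis S_closed m_assoc m_closed)
  then have "y \<otimes> (x \<oplus> c \<otimes> g) \<otimes> z = y \<otimes> x \<otimes> z \<oplus> c \<otimes> (y \<otimes> g \<otimes> z)"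
    using x lspan_step(2) assms(4,5) by (simp add: r_distr l_distr)
  then show ?case using * assms(6) lspan_step assms(3) by (simp add: lspan_add)
qed

lemma lspan_scale: "c \<in> S \<Longrightarrow> x \<in> lspan R S G \<Longrightarrow> G \<subseteq> carrier R \<Longrightarrow> c \<otimes> x \<in> lspan R S G"
proof -
  assume *: "c \<in> S" "x \<in> lspan R S G" "G \<subseteq> carrier R"
  have "c \<otimes> x \<otimes> \<one> \<in> lspan R S G"
  proof (rule lspan_mult_image[OF *(2,3,3)])
    fix g assume "g \<in> G"
    then have "\<zero> \<oplus> c \<otimes> g \<in> lspan R S G" using * by (intro lspan.intros)
    then show "c \<otimes> g \<otimes> \<one> \<in> lspan R S G" using * \<open>g \<in> G\<close> by auto
  qed (use * in auto)
  then show ?thesis using * lspan_closed by simp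
qed

lemma lspan_minus: "x \<in> lspan R S G \<Longrightarrow> y \<in> lspan R S G \<Longrightarrow> G \<subseteq> carrier R \<Longrightarrow> x \<ominus> y \<in> lspan R S G"
  using lspan_scale[of "\<ominus> \<one>" y G] lspan_closed[of y G] lspan_add[of "\<ominus> y" G x] 
  by (simp add: l_minus minus_eq)

lemma lspan_mono: "G \<subseteq> H \<Longrightarrow> lspan R S G \<subseteq> lspan R S H"
proof
  fix x assume "G \<subseteq> H" "x \<in> lspan R S G"
  from this(2,1) show "x \<in> lspan R S H" by (induction rule: lspan.induct) (auto intro: lspan.intros)
qed

definition gword :: "(nat \<Rightarrow> 'a) \<Rightarrow> nat list \<Rightarrow> 'a" where
  "gword g w = foldr (\<lambda>i t. g i \<otimes> t) w \<one>"

lemma gword_simps [simp]: "gword g [] = \<one>" "gword g (i # w) = g i \<otimes> gword g w"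
  by (simp_all add: gword_def)

definition sorted_words :: "nat \<Rightarrow> nat list set" where
  "sorted_words N = {w. sorted w \<and> set w \<subseteq> {..<N}}"

context
  fixes g :: "nat \<Rightarrow> 'a" and N :: nat
  assumes g_closed: "\<And>i. i < N \<Longrightarrow> g i \<in> carrier R"
    and g_swap: "\<And>i j. j < i \<Longrightarrow> i < N \<Longrightarrow>
      g i \<otimes> g j \<in> lspan R S ({g k \<otimes> g l | k l. k < i \<and> l < N} \<union> g ` {..<N})"
begin

lemma gword_closed: "set w \<subseteq> {..<N} \<Longrightarrow> gword g w \<in> carrier R"
  by (induction w) (auto simp: g_closed)

lemma gword_image_closed: "W \<subseteq> sorted_words N \<Longrightarrow> gword g ` W \<subseteq> carrier R"
  using gword_closed by (auto simp: sorted_words_def)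

text \<open>Termination does not come from counting inversions, since in the products
  \<open>g k \<otimes> g l\<close> allowed by \<open>g_swap\<close> the index l is arbitrary. The
  outer induction is on the length and the inner one on the leading index: the tail with g_l in
  front is one letter shorter and is straightened first, and then k < i permits the inner
  hypothesis. Lengths never grow.\<close>

lemma straighten_word:
  assumes "i < N" "w \<in> sorted_words N" "length w \<le> m"
  shows "g i \<otimes> gword g w \<in> lspan R S (gword g ` {v \<in> sorted_words N. length v \<le> Suc m})"
  using assms
proof (induction m arbitrary: i w)
  case 0
  then have "[i] \<in> {v \<in> sorted_words N. length v \<le> Suc 0}" by (simp add: sorted_words_def)
  from lspan_incl[OF imageI[OF this, of "gword g"] gword_image_closed] 0 show ?case by auto
next
  case (Suc m)
  let ?V = "\<lambda>m. lspan R S (gword g ` {v \<in> sorted_words N. length v \<le> m})"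
  note IH = Suc.IH
  have V: "gword g ` {v \<in> sorted_words N. length v \<le> m} \<subseteq> carrier R" for m
    by (rule gword_image_closed) auto
  have V_mono: "?V m \<subseteq> ?V m'" if "m \<le> m'" for m m' using that by (intro lspan_mono) auto
  show ?case using Suc.prems
  proof (induction i arbitrary: w rule: less_induct)
    case (less i)
    show ?case
    proof (cases "w = [] \<or> i \<le> hd w")
      case True
      then have "i # w \<in> {v \<in> sorted_words N. length v \<le> Suc (Suc m)}"
        using less.prems by (cases w) (auto simp: sorted_words_def)
      from lspan_incl[OF imageI[OF this, of "gword g"] V] show ?thesis by simp
    next
      case False
      then obtain j w' where w: "w = j # w'" "j < i" by (cases w) auto
      have w': "w' \<in> sorted_words N" "length w' \<le> m" "j < N" using less.prems w by (auto simp: sorted_words_def)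
      have gw': "gword g w' \<in> carrier R" using w' gword_closed by (auto simp: sorted_words_def)
      have one: "g l \<otimes> gword g w' \<in> ?V (Suc m)" if "l < N" for l
        using IH[OF that w'(1,2)] .
      \<comment> \<open>The inner hypothesis, extended linearly from sorted words to their
        span.\<close>
      have two: "g k \<otimes> x \<in> ?V (Suc (Suc m))" if "k < i" "x \<in> ?V (Suc m)" for k x
      proof -
        have k: "k < N" using that less.prems by simp
        have "g k \<otimes> x \<otimes> \<one> \<in> ?V (Suc (Suc m))"
        proof (rule lspan_mult_image[OF that(2) V V])
          fix y assume "y \<in> gword g ` {v \<in> sorted_words N. length v \<le> Suc m}"
          then obtain v where "y = gword g v" "v \<in> sorted_words N" "length v \<le> Suc m" by auto
          with less.IH[OF that(1) k] g_closed[OF k] gword_closed[of v]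
          show "g k \<otimes> y \<otimes> \<one> \<in> ?V (Suc (Suc m))" by (simp add: sorted_words_def)
        qed (use k g_closed in auto)
        then show ?thesis using k g_closed lspan_closed[OF that(2) V] by simp
      qed
      have "\<one> \<otimes> (g i \<otimes> g j) \<otimes> gword g w' \<in> ?V (Suc (Suc m))"
      proof (rule lspan_mult_image[OF g_swap[OF w(2) less.prems(1)] _ V])
        show "{g k \<otimes> g l | k l. k < i \<and> l < N} \<union> g ` {..<N} \<subseteq> carrier R"
          using g_closed less.prems by auto
        fix y assume "y \<in> {g k \<otimes> g l | k l. k < i \<and> l < N} \<union> g ` {..<N}"
        then consider k l where "y = g k \<otimes> g l" "k < i" "l < N" | l where "y = g l" "l < N" by auto
        then show "\<one> \<otimes> y \<otimes> gword g w' \<in> ?V (Suc (Suc m))"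
        proof cases
          case 1
          then have "\<one> \<otimes> y \<otimes> gword g w' = g k \<otimes> (g l \<otimes> gword g w')"
            using g_closed less.prems gw' by (simp add: m_assoc)
          then show ?thesis using two[OF 1(2) one[OF 1(3)]] by simp
        next
          case 2
          then show ?thesis using one V_mono[of "Suc m" "Suc (Suc m)"] g_closed by auto
        qed
      qed (use gw' in auto)
      then show ?thesis using w w' less.prems g_closed gw' by (simp add: m_assoc)
    qed
  qed
qed

text \<open>The span is stable under left multiplication by every generator, hence by the generated
  ring, and it contains the empty word.\<close>

lemma straighten:
  "generate_ring R (S \<union> g ` {..<N}) \<subseteq> lspan R S (gword g ` sorted_words N)"
proof
  let ?V = "lspan R S (gword g ` sorted_words N)"
  have V: "gword g ` sorted_words N \<subseteq> carrier R" by (rule gword_image_closed) simp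
  have H: "S \<union> g ` {..<N} \<subseteq> carrier R" using g_closed by auto
  fix x assume x: "x \<in> generate_ring R (S \<union> g ` {..<N})"
  have "\<forall>y\<in>?V. x \<otimes> y \<in> ?V" using x
  proof (induction rule: generate_ring.induct)
    case one
    then show ?case using lspan_closed[OF _ V] by simp
  next
    case (incl h)
    show ?case
    proof (cases "h \<in> S")
      case True then show ?thesis using lspan_scale V by auto
    next
      case False
      then obtain i where i: "h = g i" "i < N" using incl by auto
      show ?thesis
      proof
        fix y assume y: "y \<in> ?V"
        have "g i \<otimes> y \<otimes> \<one> \<in> ?V"
        proof (rule lspan_mult_image[OF y V V])
          fix u assume "u \<in> gword g ` sorted_words N"
          then obtain w where w: "u = gword g w" "w \<in> sorted_words N" by auto
          have "gword g ` {v \<in> sorted_words N. length v \<le> Suc (length w)} \<subseteq> gword g ` sorted_words N"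
            by auto
          with straighten_word[OF i(2) w(2) order_refl] lspan_mono have "g i \<otimes> u \<in> ?V" using w by blast
          then show "g i \<otimes> u \<otimes> \<one> \<in> ?V" using i w g_closed gword_closed by (simp add: sorted_words_def)
        qed (use i g_closed in auto)
        then show "h \<otimes> y \<in> ?V" using i g_closed lspan_closed[OF y V] by simp
      qed
    qed
  next
    case (a_inv h)
    have h: "h \<in> carrier R" by (rule generate_ring_in_carrier[OF H a_inv(1)])
    show ?case
    proof
      fix y assume y: "y \<in> ?V"
      then have "h \<otimes> y \<in> ?V" using a_inv by blast
      then have "\<ominus> \<one> \<otimes> (h \<otimes> y) \<in> ?V" by (rule lspan_scale[rotated]) (simp_all add: V)
      then show "\<ominus> h \<otimes> y \<in> ?V" using h lspan_closed[OF y V] by (simp add: l_minus)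
    qed
  next
    case (eng_add h h')
    then have h: "h \<in> carrier R" "h' \<in> carrier R" using generate_ring_in_carrier[OF H] by auto
    show ?case
    proof
      fix y assume y: "y \<in> ?V"
      then have "h \<otimes> y \<oplus> h' \<otimes> y \<in> ?V" using eng_add by (intro lspan_add) (auto simp: V)
      then show "(h \<oplus> h') \<otimes> y \<in> ?V" using h lspan_closed[OF y V] by (simp add: l_distr)
    qed
  next
    case (eng_mult h h')
    then have h: "h \<in> carrier R" "h' \<in> carrier R" using generate_ring_in_carrier[OF H] by auto
    show ?case
    proof
      fix y assume y: "y \<in> ?V"
      then have "h \<otimes> (h' \<otimes> y) \<in> ?V" using eng_mult by blast
      then show "(h \<otimes> h') \<otimes> y \<in> ?V" using h lspan_closed[OF y V] by (simp add: m_assoc)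
    qed
  qed
  moreover have "\<one> \<in> ?V"
    using lspan_incl[OF imageI[of "[]" "sorted_words N" "gword g"] V] by (simp add: sorted_words_def)
  ultimately have "x \<otimes> \<one> \<in> ?V" by blast
  then show "x \<in> ?V" using generate_ring_in_carrier[OF H x] by simp
qed

end

end

section \<open>The ordered root vectors together with L\<close>

locale qchain_scalars = qchain R q p n E + scalars R S
  for R :: "'a ring" (structure) and q p n E S +
  fixes L :: 'a
  assumes n_pos: "n \<ge> 1" and q_S [simp]: "q \<in> S" and p_S [simp]: "p \<in> S"
    and L_closed [simp]: "L \<in> carrier R"
    and L_E: "1 \<le> i \<Longrightarrow> i \<le> n \<Longrightarrow>
      \<exists>c\<in>S. \<exists>d\<in>S. c = \<one> \<oplus> (q \<ominus> \<one>) \<otimes> d \<and> L \<otimes> E i = c \<otimes> (E i \<otimes> L) \<oplus> d \<otimes> E i"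
begin

text \<open>If Kx = cxK and L = (K - 1)/(q - 1), then Lx = cxL + dx with d = (c - 1)/(q - 1).
  Writing c as 1 + (q - 1)d keeps the link between c and d without a division.\<close>

definition L_eigen :: "'a \<Rightarrow> bool" where
  "L_eigen x \<longleftrightarrow> (\<exists>c\<in>S. \<exists>d\<in>S. c = \<one> \<oplus> (q \<ominus> \<one>) \<otimes> d \<and> L \<otimes> x = c \<otimes> (x \<otimes> L) \<oplus> d \<otimes> x)"

text \<open>The c-values multiply, and the d-value of a product is e = cd' + d = d + d' + (q -
  1)dd'. Being symmetric, it is the same for xy and yx, so the q-bracket is again an eigenvector;
  the link between c and d is what makes e symmetric.\<close>

lemma L_eigen_qb:
  assumes x [simp]: "x \<in> carrier R" and y [simp]: "y \<in> carrier R" and "L_eigen x" "L_eigen y"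
  shows "L_eigen (qb x y)"
proof -
  obtain c d where cd [simp]: "c \<in> S" "d \<in> S" and c: "c = \<one> \<oplus> (q \<ominus> \<one>) \<otimes> d"
    and Lx: "L \<otimes> x = c \<otimes> (x \<otimes> L) \<oplus> d \<otimes> x"
    using assms(3) unfolding L_eigen_def by blast
  obtain c' d' where cd' [simp]: "c' \<in> S" "d' \<in> S" and c': "c' = \<one> \<oplus> (q \<ominus> \<one>) \<otimes> d'"
    and Ly: "L \<otimes> y = c' \<otimes> (y \<otimes> L) \<oplus> d' \<otimes> y"
    using assms(4) unfolding L_eigen_def by blast
  define e where "e = c \<otimes> d' \<oplus> d"
  have S [simp]: "c \<in> carrier R" "d \<in> carrier R" "c' \<in> carrier R" "d' \<in> carrier R" by simp_all
  have e [simp]: "e \<in> S" using subringE(7)[OF S_subring] by (simp add: e_def)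
  have S' [simp]: "e \<in> carrier R" by simp
  have lS: "w \<otimes> (s \<otimes> v) = s \<otimes> (w \<otimes> v)" if "w \<in> carrier R" "v \<in> carrier R" "s \<in> S" for w v s
    using S_central[OF that(3,1)] that by (metis S_closed m_assoc)
  have dd: "d' \<otimes> d = d \<otimes> d'" using S_central[of d d'] by simp
  have e': "e = c' \<otimes> d \<oplus> d'"
    unfolding e_def c c' using dd lS[of d' d q]
    by (simp add: l_distr r_distr minus_eq l_minus r_minus m_assoc) (simp add: a_ac)
  have cc: "c \<otimes> c' = \<one> \<oplus> (q \<ominus> \<one>) \<otimes> e"
  proof -
    have "c \<otimes> c' = c \<oplus> c \<otimes> ((q \<ominus> \<one>) \<otimes> d')"
      by (subst c') (simp add: r_distr)
    also have "c \<otimes> ((q \<ominus> \<one>) \<otimes> d') = (q \<ominus> \<one>) \<otimes> (c \<otimes> d')"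
      using lS[of "q \<ominus> \<one>" d' c] by simp
    also have "c \<oplus> w = \<one> \<oplus> (w \<oplus> (q \<ominus> \<one>) \<otimes> d)" if "w \<in> carrier R" for w
      by (subst c) (use that in \<open>simp add: a_ac\<close>)
    finally show ?thesis by (simp add: e_def r_distr)
  qed
  have LxyL: "L \<otimes> (x \<otimes> y) = (c \<otimes> c') \<otimes> (x \<otimes> y \<otimes> L) \<oplus> e \<otimes> (x \<otimes> y)"
  proof -
    have "L \<otimes> (x \<otimes> y) = c \<otimes> (x \<otimes> (L \<otimes> y)) \<oplus> d \<otimes> (x \<otimes> y)"
      by (simp add: Lx l_distr m_assoc flip: m_assoc[of L])
    also have "x \<otimes> (L \<otimes> y) = c' \<otimes> (x \<otimes> (y \<otimes> L)) \<oplus> d' \<otimes> (x \<otimes> y)"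
      by (simp add: Ly r_distr lS)
    finally show ?thesis by (simp add: e_def r_distr l_distr m_assoc a_assoc)
  qed
  have LyxL: "L \<otimes> (y \<otimes> x) = (c \<otimes> c') \<otimes> (y \<otimes> x \<otimes> L) \<oplus> e \<otimes> (y \<otimes> x)"
  proof -
    have "L \<otimes> (y \<otimes> x) = c' \<otimes> (y \<otimes> (L \<otimes> x)) \<oplus> d' \<otimes> (y \<otimes> x)"
      by (simp add: Ly l_distr m_assoc flip: m_assoc[of L])
    also have "y \<otimes> (L \<otimes> x) = c \<otimes> (y \<otimes> (x \<otimes> L)) \<oplus> d \<otimes> (y \<otimes> x)"
      by (simp add: Lx r_distr lS)
    finally show ?thesis
      by (simp add: e' r_distr l_distr m_assoc a_assoc lS[of c' _ c])
  qed
  have "L \<otimes> qb x y = (c \<otimes> c') \<otimes> (qb x y \<otimes> L) \<oplus> e \<otimes> qb x y"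
  proof -
    have "L \<otimes> qb x y = L \<otimes> (x \<otimes> y) \<ominus> q \<otimes> (L \<otimes> (y \<otimes> x))"
      by (simp add: qb_def minus_eq r_distr r_minus lS[of L _ q])
    then have "L \<otimes> qb x y = (c \<otimes> c') \<otimes> (x \<otimes> y \<otimes> L) \<oplus> e \<otimes> (x \<otimes> y)
        \<ominus> ((c \<otimes> c') \<otimes> (q \<otimes> (y \<otimes> x \<otimes> L)) \<oplus> e \<otimes> (q \<otimes> (y \<otimes> x)))"
      unfolding LxyL LyxL by (simp add: r_distr lS[of q _ "c \<otimes> c'"] lS[of q _ e])
    also have "\<dots> = (c \<otimes> c') \<otimes> (qb x y \<otimes> L) \<oplus> e \<otimes> qb x y"
      by (simp add: qb_def minus_eq r_distr l_distr r_minus l_minus minus_add m_assoc[of q]) (simp add: a_ac)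
    finally show ?thesis .
  qed
  then show ?thesis unfolding L_eigen_def using cc cd cd' e S_mult by blast
qed

lemma L_eigen_A:
  assumes "\<And>i. 1 \<le> i \<Longrightarrow> i \<le> n \<Longrightarrow> F i \<in> carrier R" "\<And>i. 1 \<le> i \<Longrightarrow> i \<le> n \<Longrightarrow> L_eigen (F i)"
  shows "1 \<le> k \<Longrightarrow> k \<le> n \<Longrightarrow> nest qb F k \<in> carrier R \<and> L_eigen (nest qb F k)"
proof (induction k rule: dec_induct)
  case base
  then show ?case using assms by (simp add: nest_1)
next
  case (step k)
  then show ?case using assms by (simp add: nest_Suc L_eigen_qb)
qed

text \<open>The order is B_1, ..., B_(n-1), then A_1, ..., A_n, then L, which gives 2n elements, the
  dimension of \<open>\<hh>\<close>. Having B before A matters for the pairs with i + k = n, and L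
  at the end only ever moves to the right.\<close>

definition root_vector :: "nat \<Rightarrow> 'a" where
  "root_vector i = (if i < n - 1 then B (Suc i) else if i < 2 * n - 1 then A (i + 2 - n) else L)"

lemma root_vector_B: "1 \<le> k \<Longrightarrow> k < n \<Longrightarrow> root_vector (k - 1) = B k"
  by (auto simp: root_vector_def)

lemma root_vector_A:
  assumes "1 \<le> k" "k \<le> n" shows "root_vector (k + n - 2) = A k"
proof -
  have "\<not> k + n - 2 < n - 1" "k + n - 2 < 2 * n - 1" "k + n - 2 + 2 - n = k" using assms by auto
  then show ?thesis unfolding root_vector_def by presburger
qed

lemma root_vector_L: "root_vector (2 * n - 1) = L"
proof -
  have "\<not> 2 * n - 1 < n - 1" using n_pos by linarith
  then show ?thesis by (simp add: root_vector_def)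
qed

lemma root_vector_cases:
  assumes "i < 2 * n"
  obtains k where "1 \<le> k" "k < n" "i = k - 1"
  | k where "1 \<le> k" "k \<le> n" "i = k + n - 2"
  | "i = 2 * n - 1"
proof -
  consider "i < n - 1" | "n - 1 \<le> i" "i < 2 * n - 1" | "i = 2 * n - 1" using assms by linarith
  then show ?thesis
    using that(1)[of "Suc i"] that(2)[of "i + 2 - n"] that(3) n_pos by cases auto
qed

lemma root_vector_closed: "i < 2 * n \<Longrightarrow> root_vector i \<in> carrier R"
  by (erule root_vector_cases) (simp_all add: root_vector_A root_vector_B[simplified] root_vector_L[simplified])

text \<open>The pairs that do not q-commute. With m = n - i - 1, A_(i+1) and B_(n-i) arise from A_i
  and B_m by bracketing with the same letter E_(i+1), and the exchange identity trades A_i B_(n-i)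
  for A_(i+1) B_m up to products in the right order. The recursion climbs to A_(n-1) E_n = q E_n
  A_(n-1) + A_n, the source of the linear term.\<close>

lemma A_B_diagonal:
  assumes "1 \<le> i" "i < n"
  shows "A i \<otimes> B (n - i) \<in> lspan R S ({B k \<otimes> A l | k l. 1 \<le> k \<and> k < n \<and> 1 \<le> l \<and> l \<le> n} \<union> A ` {1..n})"
    (is "_ \<in> lspan R S ?D")
proof -
  have D: "?D \<subseteq> carrier R" by auto
  have BA: "B k \<otimes> A l \<in> lspan R S ?D" if "1 \<le> k" "k < n" "1 \<le> l" "l \<le> n" for k l
    by (rule lspan_incl[OF _ D]) (use that in blast)
  have "i \<le> n - 1" using assms by simp
  then show ?thesis using assms(1)
  proof (induction i rule: inc_induct)
    case base
    have n: "n = Suc (n - 1)" "1 < n" using assms by auto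
    have "A n = A (n - 1) \<otimes> E n \<ominus> q \<otimes> (E n \<otimes> A (n - 1))"
      using nest_Suc[of "n - 1" qb E] n assms by (simp add: qb_def)
    then have "A (n - 1) \<otimes> E n = q \<otimes> (E n \<otimes> A (n - 1)) \<oplus> A n"
      using n assms by (simp add: minus_eq a_ac r_neg r_neg1 r_neg2)
    moreover have "E n \<otimes> A (n - 1) \<in> lspan R S ?D"
      using BA[of 1 "n - 1"] n by (simp add: nest_1)
    moreover have "A n \<in> lspan R S ?D" using D assms by (intro lspan_incl) auto
    ultimately have "A (n - 1) \<otimes> E n \<in> lspan R S ?D"
      using lspan_add[OF _ lspan_scale[OF q_S _ D] D] by simp
    then show ?case using n by (simp add: nest_1)
  next
    case (step i)
    define m where "m = n - Suc i"
    have m: "n - i = Suc m" "1 \<le> m" "m < n" "n - m = Suc i" "i < n" "i + m < n" using step assms by (auto simp: m_def)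
    have "A i \<otimes> B (n - i) = q \<otimes> (B (n - i) \<otimes> A i) \<oplus>
        (B m \<otimes> A (Suc i) \<ominus> q \<otimes> (A (Suc i) \<otimes> B m))"
      using m step.prems qb_exchange[of "A i" "B m" "E (Suc i)"] A_B_far[of m i] by (simp add: nest_Suc)
    also have "\<dots> \<in> lspan R S ?D"
    proof (rule lspan_add[OF _ _ D])
      show "q \<otimes> (B (n - i) \<otimes> A i) \<in> lspan R S ?D"
        by (rule lspan_scale[OF q_S BA D]) (use m step.prems in auto)
      have "q \<otimes> (A (Suc i) \<otimes> B m) \<in> lspan R S ?D"
        by (rule lspan_scale[OF q_S _ D]) (use step.IH in \<open>simp add: m_def\<close>)
      moreover have "B m \<otimes> A (Suc i) \<in> lspan R S ?D" by (rule BA) (use m in auto)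
      ultimately show "B m \<otimes> A (Suc i) \<ominus> q \<otimes> (A (Suc i) \<otimes> B m) \<in> lspan R S ?D"
        by (intro lspan_minus D)
    qed
    finally show ?case .
  qed
qed

text \<open>The hypothesis of the straightening algorithm. Pairs within the A, pairs within the B,
  and most mixed pairs merely acquire a power of q; L produces one extra linear term; the diagonal
  pairs use \<open>A_B_diagonal\<close>.\<close>

lemma root_vector_swap:
  assumes "j < i" "i < 2 * n"
  shows "root_vector i \<otimes> root_vector j \<in>
    lspan R S ({root_vector k \<otimes> root_vector l | k l. k < i \<and> l < 2 * n} \<union> root_vector ` {..<2 * n})"
    (is "_ \<in> lspan R S ?G")
proof -
  have G: "?G \<subseteq> carrier R" using root_vector_closed assms by auto
  have pair: "root_vector k \<otimes> root_vector l \<in> lspan R S ?G" if "k < i" "l < 2 * n" for k l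
    by (rule lspan_incl[OF _ G]) (use that in blast)
  have scaled: "c \<otimes> (root_vector j \<otimes> root_vector i) \<in> lspan R S ?G" if "c \<in> S" for c
    using that pair[OF assms] lspan_scale[OF _ _ G] by blast
  have j: "j < 2 * n" using assms by simp
  have p: "p \<otimes> (q \<otimes> x) = x" if "x \<in> carrier R" for x using that by (simp add: p_q flip: m_assoc)
  from assms(2) show ?thesis
  proof (cases rule: root_vector_cases)
    case (1 k)
    then have "j = Suc j - 1" "Suc j < k" "k < n" using assms by auto
    then have "root_vector i \<otimes> root_vector j = q \<otimes> (root_vector j \<otimes> root_vector i)"
      using qchain.A_A[OF qchain_rev, of "Suc j" k] 1 root_vector_B[of "Suc j"] root_vector_B[of k] by simp
    then show ?thesis using scaled[of q] by simp
  next
    case (2 k)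
    note i = this
    from j show ?thesis
    proof (cases rule: root_vector_cases)
      case (1 l)
      consider "k = n" | "k < n" "k + l \<noteq> n" | "k < n" "l = n - k" using i by force
      then show ?thesis
      proof cases
        assume "k = n"
        then show ?thesis
          using A_B_top[of l] i 1 root_vector_B[of l] root_vector_A[of k] scaled[of p] by simp
      next
        assume "k < n" "k + l \<noteq> n"
        then have "A k \<otimes> B l = B l \<otimes> A k"
          using A_B_far[of l k] A_B_overlap[of k l] i 1 by fastforce
        then show ?thesis
          using i 1 root_vector_B[of l] root_vector_A[of k] pair[OF assms] by simp
      next
        assume kl: "k < n" "l = n - k"
        \<comment> \<open>Every B stands before every A in the order, so each product B A has a
          smaller leading index than the A at position i.\<close>
        have "{B k \<otimes> A l | k l. 1 \<le> k \<and> k < n \<and> 1 \<le> l \<and> l \<le> n} \<union> A ` {1..n} \<subseteq> ?G"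
        proof -
          have "B k' \<otimes> A l' \<in> ?G" if "1 \<le> k'" "k' < n" "1 \<le> l'" "l' \<le> n" for k' l'
          proof -
            have "k' - 1 < i" "l' + n - 2 < 2 * n" using that i by auto
            then show ?thesis using root_vector_B[of k'] root_vector_A[of l'] that by force
          qed
          moreover have "A l' \<in> ?G" if "l' \<in> {1..n}" for l'
          proof -
            have "l' + n - 2 < 2 * n" using that n_pos by auto
            then show ?thesis using root_vector_A[of l'] that by force
          qed
          ultimately show ?thesis by blast
        qed
        from subsetD[OF lspan_mono[OF this] A_B_diagonal[of k]] show ?thesis
          using kl i 1 root_vector_B[of l] root_vector_A[of k] by simp
      qed
    next
      case (2 l)
      then have "l < k" using assms i by simp
      then have "root_vector i \<otimes> root_vector j = q \<otimes> (root_vector j \<otimes> root_vector i)"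
        using A_A[of l k] i 2 root_vector_A[of k] root_vector_A[of l] by simp
      then show ?thesis using scaled[of q] by simp
    next
      case 3
      then show ?thesis using assms i by auto
    qed
  next
    case 3
    have "L_eigen (E i)" if "1 \<le> i" "i \<le> n" for i
      using that L_E unfolding L_eigen_def by simp
    then have A: "L_eigen (A k)" "L_eigen (B k)" if "1 \<le> k" "k \<le> n" for k
      using that L_eigen_A[of E k] L_eigen_A[of "\<lambda>i. E (Suc n - i)" k] by auto
    have "L_eigen (root_vector j)"
      using j
    proof (cases rule: root_vector_cases)
      case (1 k) then show ?thesis using root_vector_B A by simp
    next
      case (2 k) then show ?thesis using root_vector_A A by simp
    qed (use 3 assms in auto)
    then obtain c d where "c \<in> S" "d \<in> S"
      "L \<otimes> root_vector j = c \<otimes> (root_vector j \<otimes> L) \<oplus> d \<otimes> root_vector j"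
      unfolding L_eigen_def by blast
    moreover have "root_vector j \<in> lspan R S ?G"
      by (rule lspan_incl[OF _ G]) (use j in blast)
    ultimately have "c \<otimes> (root_vector j \<otimes> root_vector i) \<oplus> d \<otimes> root_vector j \<in> lspan R S ?G"
      using scaled[of c] by (intro lspan_add[OF lspan_scale[OF _ _ G] _ G])
    then show ?thesis
      using 3 \<open>L \<otimes> root_vector j = _\<close> root_vector_L by simp
  qed
qed

lemmas root_vector_straighten = straighten[of "2 * n" root_vector, OF root_vector_closed root_vector_swap]

end

section \<open>Rings of words\<close>

lemma smul_apply: "smul c f w = c * f w"
  by (simp add: smul_def)

lemma mon_apply: "mon w v = (if v = w then 1 else 0)"
  by (simp add: mon_def)

lemma word_ring_simps [simp]:
  "carrier (word_ring C op e) = C" "mult (word_ring C op e) = conv op"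
  "one (word_ring C op e) = mon e" "zero (word_ring C op e) = (\<lambda>w. 0)"
  "add (word_ring C op e) = (\<lambda>f g w. f w + g w)"
  by (simp_all add: word_ring_def mon_def)

locale words =
  fixes op :: "'w \<Rightarrow> 'w \<Rightarrow> 'w" and e :: 'w
  assumes op_assoc: "op (op u v) w = op u (op v w)"
    and op_left [simp]: "op e w = w" and op_right [simp]: "op w e = w"
    and fin_splits: "finite {(u, v). op u v = w}"
begin

lemma finite_splits: "finite {p. op (fst p) (snd p) = w}"
  using fin_splits[of w] by (simp add: case_prod_unfold)

lemma conv_alt: "conv op f g w = (\<Sum>p | op (fst p) (snd p) = w. f (fst p) * g (snd p))"
  by (simp add: conv_def case_prod_unfold)

lemma conv_assoc: "conv op (conv op f g) h = conv op f (conv op g h)"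
proof
  fix w
  let ?S = "\<lambda>w. {p. op (fst p) (snd p) = w}"
  have "conv op (conv op f g) h w =
    (\<Sum>p\<in>?S w. \<Sum>r\<in>?S (fst p). f (fst r) * g (snd r) * h (snd p))"
    by (simp add: conv_alt sum_distrib_right)
  also have "\<dots> = (\<Sum>(p, r)\<in>(SIGMA p:?S w. ?S (fst p)). f (fst r) * g (snd r) * h (snd p))"
    by (rule sum.Sigma) (simp_all add: finite_splits)
  also have "\<dots> = (\<Sum>(p, r)\<in>(SIGMA p:?S w. ?S (snd p)). f (fst p) * (g (fst r) * h (snd r)))"
    by (rule sum.reindex_bij_witness[of _ "\<lambda>((a, y), (b, v)). ((op a b, v), (a, b))"
          "\<lambda>((x, v), (a, b)). ((a, op b v), (b, v))"]) (auto simp: op_assoc mult.assoc)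
  also have "\<dots> = (\<Sum>p\<in>?S w. \<Sum>r\<in>?S (snd p). f (fst p) * (g (fst r) * h (snd r)))"
    by (rule sum.Sigma[symmetric]) (simp_all add: finite_splits)
  also have "\<dots> = conv op f (conv op g h) w"
    by (simp add: conv_alt sum_distrib_left)
  finally show "conv op (conv op f g) h w = conv op f (conv op g h) w" .
qed

text \<open>The sum is needed because \<open>words\<close> assumes no cancellation: several v may
  complete u to the same w.\<close>

lemma conv_mon_left: "conv op (mon u) f w = (\<Sum>v | op u v = w. f v)"
proof -
  have "conv op (mon u) f w = (\<Sum>p | op (fst p) (snd p) = w. if fst p = u then f (snd p) else 0)"
    unfolding conv_alt by (intro sum.cong) (auto simp: mon_apply)
  also have "\<dots> = (\<Sum>p\<in>{p. op (fst p) (snd p) = w} \<inter> {p. fst p = u}. f (snd p))"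
    by (subst sum.inter_restrict) (simp_all add: finite_splits)
  also have "\<dots> = (\<Sum>v | op u v = w. f v)"
    by (rule sum.reindex_bij_witness[of _ "\<lambda>v. (u, v)" snd]) auto
  finally show ?thesis .
qed

lemma conv_mon_right: "conv op f (mon u) w = (\<Sum>v | op v u = w. f v)"
proof -
  have "conv op f (mon u) w = (\<Sum>p | op (fst p) (snd p) = w. if snd p = u then f (fst p) else 0)"
    unfolding conv_alt by (intro sum.cong) (auto simp: mon_apply)
  also have "\<dots> = (\<Sum>p\<in>{p. op (fst p) (snd p) = w} \<inter> {p. snd p = u}. f (fst p))"
    by (subst sum.inter_restrict) (simp_all add: finite_splits)
  also have "\<dots> = (\<Sum>v | op v u = w. f v)"
    by (rule sum.reindex_bij_witness[of _ "\<lambda>v. (v, u)" fst]) auto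
  finally show ?thesis .
qed

lemma conv_one_left [simp]: "conv op (mon e) f = f" and conv_one_right [simp]: "conv op f (mon e) = f"
  by (auto simp: conv_mon_left conv_mon_right)

lemma conv_mon: "conv op (mon u) (mon v) = mon (op u v)"
proof
  fix w
  have "finite {a. op u a = w}"
    by (rule finite_subset[OF _ finite_imageI[OF fin_splits[of w], of snd]]) force
  then show "conv op (mon u) (mon v) w = mon (op u v) w"
    by (simp add: conv_mon_left mon_apply sum.delta if_distrib cong: if_cong)
qed

lemma conv_add_left: "conv op (\<lambda>w. f w + g w) h = (\<lambda>w. conv op f h w + conv op g h w)"
  by (simp add: conv_def distrib_right sum.distrib case_prod_unfold)

lemma conv_add_right: "conv op h (\<lambda>w. f w + g w) = (\<lambda>w. conv op h f w + conv op h g w)"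
  by (simp add: conv_def distrib_left sum.distrib case_prod_unfold)

lemma conv_smul_left: "conv op (smul c f) g = smul c (conv op f g)"
  by (simp add: conv_def fun_eq_iff smul_apply sum_distrib_left case_prod_unfold mult.assoc)

lemma conv_smul_right: "conv op f (smul c g) = smul c (conv op f g)"
  by (simp add: conv_def fun_eq_iff smul_apply sum_distrib_left case_prod_unfold mult_ac)

lemma conv_nonzero:
  assumes "conv op f g w \<noteq> 0"
  obtains u v where "op u v = w" "f u \<noteq> 0" "g v \<noteq> 0"
proof -
  obtain p where "p \<in> {(u, v). op u v = w}" "(case p of (u, v) \<Rightarrow> f u * g v) \<noteq> 0"
    using assms unfolding conv_def by (rule sum.not_neutral_contains_not_neutral)
  then show ?thesis using that[of "fst p" "snd p"]
    by (cases p; cases "f (fst p) = 0"; cases "g (snd p) = 0") auto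
qed

lemma word_ring_ring:
  assumes "mon e \<in> C" "\<And>f. f \<in> C \<Longrightarrow> smul (- 1) f \<in> C"
    and add: "\<And>f g. f \<in> C \<Longrightarrow> g \<in> C \<Longrightarrow> (\<lambda>w. f w + g w) \<in> C"
    and "\<And>f g. f \<in> C \<Longrightarrow> g \<in> C \<Longrightarrow> conv op f g \<in> C"
  shows "ring (word_ring C op e)"
proof (rule ringI)
  show "abelian_group (word_ring C op e)"
  proof (rule abelian_groupI)
    show "\<zero>\<^bsub>word_ring C op e\<^esub> \<in> carrier (word_ring C op e)"
      using add[OF assms(1) assms(2)[OF assms(1)]] by (simp add: smul_apply)
    fix f assume "f \<in> carrier (word_ring C op e)"
    then show "\<exists>g\<in>carrier (word_ring C op e). g \<oplus>\<^bsub>word_ring C op e\<^esub> f = \<zero>\<^bsub>word_ring C op e\<^esub>"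
      using assms(2) by (intro bexI[of _ "smul (- 1) f"]) (auto simp: smul_apply)
  qed (use add in \<open>auto simp: ac_simps\<close>)
  show "Group.monoid (word_ring C op e)"
    by (rule monoidI) (use assms conv_assoc in auto)
qed (auto simp: conv_add_left conv_add_right)

end

lemma word_ring_uminus:
  assumes "ring (word_ring C op e)" "f \<in> C" "smul (- 1) f \<in> C"
  shows "\<ominus>\<^bsub>word_ring C op e\<^esub> f = smul (- 1) f"
proof -
  interpret ring "word_ring C op e" by fact
  show ?thesis by (rule minus_equality) (use assms in \<open>auto simp: smul_apply\<close>)
qed

lemma words_append: "words (@) []"
proof
  fix w :: "'a list"
  have "{(u, v). u @ v = w} \<subseteq> (\<lambda>k. (take k w, drop k w)) ` {..length w}"
  proof clarify
    fix u v assume "w = u @ v"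
    then show "(u, v) \<in> (\<lambda>k. (take k (u @ v), drop k (u @ v))) ` {..length (u @ v)}"
      by (intro image_eqI[of _ _ "length u"]) auto
  qed
  then show "finite {(u, v). u @ v = w}" by (rule finite_subset) simp
qed auto

abbreviation append2 :: "'a list \<times> 'a list \<Rightarrow> 'a list \<times> 'a list \<Rightarrow> 'a list \<times> 'a list" where
  "append2 \<equiv> \<lambda>(a, b) (c, d). (a @ c, b @ d)"

lemma words_append2: "words append2 ([], [])"
proof
  fix w :: "'a list \<times> 'a list"
  have "{(u, v). append2 u v = w} \<subseteq>
    (\<lambda>((a, c), (b, d)). ((a, b), (c, d))) ` ({(a, c). a @ c = fst w} \<times> {(b, d). b @ d = snd w})"
    by (auto simp: image_iff) 
  then show "finite {(u, v). append2 u v = w}"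
    by (rule finite_subset) (intro finite_imageI finite_cartesian_product words.fin_splits[OF words_append])
qed auto

section \<open>The adic completion\<close>

locale hwords = words op e for op :: "'w \<Rightarrow> 'w \<Rightarrow> 'w" and e +
  fixes W :: "'w set"
  assumes W_e [simp]: "e \<in> W" and W_op: "u \<in> W \<Longrightarrow> v \<in> W \<Longrightarrow> op u v \<in> W"
begin

abbreviation F :: "('w \<Rightarrow> complex fps) ring" where
  "F \<equiv> word_ring (hcomplete W) op e"

lemma hcompleteD: "f \<in> hcomplete W \<Longrightarrow> finite {w. fps_nth (f w) m \<noteq> 0}"
  "f \<in> hcomplete W \<Longrightarrow> w \<notin> W \<Longrightarrow> f w = 0"
  by (auto simp: hcomplete_def)

lemma hcompleteI:
  "(\<And>w. w \<notin> W \<Longrightarrow> f w = 0) \<Longrightarrow> (\<And>m. finite {w. fps_nth (f w) m \<noteq> 0}) \<Longrightarrow> f \<in> hcomplete W"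
  by (auto simp: hcomplete_def)

lemma hcomplete_low_finite: "f \<in> hcomplete W \<Longrightarrow> finite {w. \<exists>k\<le>m. fps_nth (f w) k \<noteq> 0}"
proof -
  assume "f \<in> hcomplete W"
  then have "finite (\<Union>k\<in>{..m}. {w. fps_nth (f w) k \<noteq> 0})" by (auto simp: hcompleteD)
  then show ?thesis by (rule rev_finite_subset) auto
qed

lemma hcomplete_finite: "finite {w. f w \<noteq> 0} \<Longrightarrow> (\<And>w. w \<notin> W \<Longrightarrow> f w = 0) \<Longrightarrow> f \<in> hcomplete W"
  by (rule hcompleteI) (auto elim!: rev_finite_subset)

lemma mon_closed [simp]: "w \<in> W \<Longrightarrow> mon w \<in> hcomplete W"
  by (rule hcomplete_finite) (auto simp: mon_apply)

lemma add_closed [simp]: "f \<in> hcomplete W \<Longrightarrow> g \<in> hcomplete W \<Longrightarrow> (\<lambda>w. f w + g w) \<in> hcomplete W"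
proof (rule hcompleteI)
  fix m assume "f \<in> hcomplete W" "g \<in> hcomplete W"
  then have "finite ({w. fps_nth (f w) m \<noteq> 0} \<union> {w. fps_nth (g w) m \<noteq> 0})" by (auto simp: hcompleteD)
  then show "finite {w. fps_nth (f w + g w) m \<noteq> 0}" by (rule rev_finite_subset) auto
qed (auto simp: smul_apply hcompleteD)

lemma smul_closed [simp]: "f \<in> hcomplete W \<Longrightarrow> smul c f \<in> hcomplete W"
proof (rule hcompleteI)
  fix m assume f: "f \<in> hcomplete W"
  have "{w. fps_nth (smul c f w) m \<noteq> 0} \<subseteq> {w. \<exists>k\<le>m. fps_nth (f w) k \<noteq> 0}"
    by (rule subsetI, rule ccontr) (auto simp: smul_apply fps_mult_nth)
  then show "finite {w. fps_nth (smul c f w) m \<noteq> 0}"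
    by (rule finite_subset) (rule hcomplete_low_finite[OF f])
qed (auto simp: smul_apply hcompleteD)

text \<open>Modulo a power of h only finitely many words of either factor are visible, hence only
  finitely many products.\<close>

lemma conv_closed [simp]:
  assumes f: "f \<in> hcomplete W" and g: "g \<in> hcomplete W" shows "conv op f g \<in> hcomplete W"
proof (rule hcompleteI)
  fix w assume "w \<notin> W"
  then show "conv op f g w = 0"
    using conv_nonzero[of f g w] W_op hcompleteD(2)[OF f] hcompleteD(2)[OF g] by metis
next
  fix m
  let ?L = "\<lambda>f. {w. \<exists>k\<le>m. fps_nth (f w) k \<noteq> 0}"
  have "{w. fps_nth (conv op f g w) m \<noteq> 0} \<subseteq> (\<lambda>(u, v). op u v) ` (?L f \<times> ?L g)"
  proof
    fix w assume "w \<in> {w. fps_nth (conv op f g w) m \<noteq> 0}"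
    then have "(\<Sum>p\<in>{(u, v). op u v = w}. fps_nth (f (fst p) * g (snd p)) m) \<noteq> 0"
      by (simp add: conv_def fps_sum_nth case_prod_unfold)
    then obtain p where p: "p \<in> {(u, v). op u v = w}" "fps_nth (f (fst p) * g (snd p)) m \<noteq> 0"
      by (rule sum.not_neutral_contains_not_neutral)
    from p(2) obtain k where "k \<in> {0..m}" "fps_nth (f (fst p)) k * fps_nth (g (snd p)) (m - k) \<noteq> 0"
      unfolding fps_mult_nth by (rule sum.not_neutral_contains_not_neutral)
    then have "fst p \<in> ?L f" "snd p \<in> ?L g" by (auto intro: exI[of _ "m - k"])
    then show "w \<in> (\<lambda>(u, v). op u v) ` (?L f \<times> ?L g)"
      using p(1) by (intro image_eqI[of _ _ p]) auto
  qed
  then show "finite {w. fps_nth (conv op f g w) m \<noteq> 0}"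
    by (rule finite_subset) (intro finite_imageI finite_cartesian_product hcomplete_low_finite f g)
qed

lemma F_ring: "ring F"
  by (rule word_ring_ring) auto

sublocale F: ring F by (rule F_ring)

lemma F_uminus: "f \<in> hcomplete W \<Longrightarrow> \<ominus>\<^bsub>F\<^esub> f = smul (- 1) f"
  by (rule word_ring_uminus[OF F_ring]) auto

lemma F_minus: "f \<in> hcomplete W \<Longrightarrow> g \<in> hcomplete W \<Longrightarrow> f \<ominus>\<^bsub>F\<^esub> g = (\<lambda>w. f w - g w)"
  by (simp add: a_minus_def F_uminus smul_apply)

abbreviation hvar :: "'w \<Rightarrow> complex fps" where "hvar \<equiv> smul fps_X (mon e)"

lemma smul_smul: "smul c (smul d f) = smul (c * d) f"
  by (simp add: fun_eq_iff smul_apply mult.assoc)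

lemma hvar_pow: "hvar [^]\<^bsub>F\<^esub> m = smul (fps_X ^ m) (mon e)" for m :: nat
proof (induction m)
  case (Suc m)
  then show ?case by (simp add: conv_smul_left conv_smul_right smul_smul mult.commute)
qed (simp add: fun_eq_iff smul_apply)

lemma hclosure_iff:
  "x \<in> hclosure F hvar S \<longleftrightarrow>
    x \<in> hcomplete W \<and> (\<forall>m. \<exists>s\<in>S. \<exists>u\<in>hcomplete W. x = (\<lambda>w. s w + fps_X ^ m * u w))"
  by (simp add: hclosure_def hvar_pow conv_smul_left smul_apply)

lemma ideal_hclosure:
  assumes "ideal S F" shows "ideal (hclosure F hvar S) F"
proof -
  interpret S: ideal S F by fact
  have smul_ideal: "smul c f \<in> S" if "f \<in> S" for c f
    using S.I_l_closed[OF that, of "smul c (mon e)"] by (simp add: conv_smul_left)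
  show ?thesis
  proof (rule idealI[OF F_ring])
    show "subgroup (hclosure F hvar S) (add_monoid F)"
    proof (rule F.add.subgroupI)
      show "hclosure F hvar S \<subseteq> carrier F" by (auto simp: hclosure_iff)
      have "(\<lambda>w. 0) \<in> hclosure F hvar S"
        using S.zero_closed F.zero_closed unfolding hclosure_iff
        by (auto intro!: bexI[of _ "\<lambda>w. 0"])
      then show "hclosure F hvar S \<noteq> {}" by auto
    next
      fix a assume a: "a \<in> hclosure F hvar S"
      then have "smul (- 1) a \<in> hclosure F hvar S"
        unfolding hclosure_iff
      proof (intro conjI allI; elim conjE)
        fix m assume "\<forall>m. \<exists>s\<in>S. \<exists>u\<in>hcomplete W. a = (\<lambda>w. s w + fps_X ^ m * u w)"
        then obtain s u where "s \<in> S" "u \<in> hcomplete W" "a = (\<lambda>w. s w + fps_X ^ m * u w)" by blast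
        then show "\<exists>s\<in>S. \<exists>u\<in>hcomplete W. smul (- 1) a = (\<lambda>w. s w + fps_X ^ m * u w)"
          using smul_ideal[of s "- 1"]
          by (intro bexI[of _ "smul (- 1) s"] bexI[of _ "smul (- 1) u"]) (auto simp: smul_apply algebra_simps)
      qed auto
      then show "\<ominus>\<^bsub>F\<^esub> a \<in> hclosure F hvar S"
        using a by (simp add: F_uminus hclosure_iff)
    next
      fix a b assume ab: "a \<in> hclosure F hvar S" "b \<in> hclosure F hvar S"
      show "a \<oplus>\<^bsub>F\<^esub> b \<in> hclosure F hvar S"
        unfolding hclosure_iff
      proof (intro conjI allI)
        fix m
        obtain s u where "s \<in> S" "u \<in> hcomplete W" "a = (\<lambda>w. s w + fps_X ^ m * u w)"
          using ab(1) hclosure_iff by blast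
        moreover obtain t v where "t \<in> S" "v \<in> hcomplete W" "b = (\<lambda>w. t w + fps_X ^ m * v w)"
          using ab(2) hclosure_iff by blast
        ultimately show "\<exists>s\<in>S. \<exists>u\<in>hcomplete W. a \<oplus>\<^bsub>F\<^esub> b = (\<lambda>w. s w + fps_X ^ m * u w)"
          using S.a_closed[of s t]
          by (intro bexI[of _ "\<lambda>w. s w + t w"] bexI[of _ "\<lambda>w. u w + v w"]) (auto simp: algebra_simps)
      qed (use ab in \<open>simp add: hclosure_iff\<close>)
    qed
  next
    fix a x assume a: "a \<in> hclosure F hvar S" and x: "x \<in> carrier F"
    show "x \<otimes>\<^bsub>F\<^esub> a \<in> hclosure F hvar S"
      unfolding hclosure_iff
    proof (intro conjI allI)
      fix m
      obtain s u where su: "s \<in> S" "u \<in> hcomplete W" "a = (\<lambda>w. s w + fps_X ^ m * u w)"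
        using a hclosure_iff by blast
      have "a = (\<lambda>w. s w + smul (fps_X ^ m) u w)" using su by (simp add: smul_apply)
      then have "x \<otimes>\<^bsub>F\<^esub> a = (\<lambda>w. conv op x s w + fps_X ^ m * conv op x u w)"
        by (simp add: conv_add_right conv_smul_right) (simp add: smul_apply)
      then show "\<exists>s\<in>S. \<exists>u\<in>hcomplete W. x \<otimes>\<^bsub>F\<^esub> a = (\<lambda>w. s w + fps_X ^ m * u w)"
        using S.I_l_closed[OF su(1) x] su x
        by (intro bexI[of _ "conv op x s"] bexI[of _ "conv op x u"]) auto
    qed (use a x in \<open>simp add: hclosure_iff\<close>)
    show "a \<otimes>\<^bsub>F\<^esub> x \<in> hclosure F hvar S"
      unfolding hclosure_iff
    proof (intro conjI allI)
      fix m
      obtain s u where su: "s \<in> S" "u \<in> hcomplete W" "a = (\<lambda>w. s w + fps_X ^ m * u w)"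
        using a hclosure_iff by blast
      have "a = (\<lambda>w. s w + smul (fps_X ^ m) u w)" using su by (simp add: smul_apply)
      then have "a \<otimes>\<^bsub>F\<^esub> x = (\<lambda>w. conv op s x w + fps_X ^ m * conv op u x w)"
        by (simp add: conv_add_left conv_smul_left) (simp add: smul_apply)
      then show "\<exists>s\<in>S. \<exists>u\<in>hcomplete W. a \<otimes>\<^bsub>F\<^esub> x = (\<lambda>w. s w + fps_X ^ m * u w)"
        using S.I_r_closed[OF su(1) x] su x
        by (intro bexI[of _ "conv op s x"] bexI[of _ "conv op u x"]) auto
    qed (use a x in \<open>simp add: hclosure_iff\<close>)
  qed
qed

lemma hclosure_incl:
  assumes "S \<subseteq> hcomplete W" shows "S \<subseteq> hclosure F hvar S"
proof
  fix x assume x: "x \<in> S"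
  have "\<exists>s\<in>S. \<exists>u\<in>hcomplete W. x = (\<lambda>w. s w + fps_X ^ m * u w)" for m
    using x F.zero_closed by (intro bexI[of _ x] bexI[of _ "\<lambda>w. 0"]) auto
  then show "x \<in> hclosure F hvar S" unfolding hclosure_iff using x assms by blast
qed

text \<open>Closing twice adds nothing: an approximant taken from the closure is itself approximated
  to the same order from S, and the two remainders add up.\<close>

lemma hclosure_closed:
  assumes "x \<in> hcomplete W" and S: "ideal S F"
    and x: "\<And>m. \<exists>s\<in>hclosure F hvar S. \<exists>u\<in>hcomplete W. x = (\<lambda>w. s w + fps_X ^ m * u w)"
  shows "x \<in> hclosure F hvar S"
  unfolding hclosure_iff
proof (intro conjI allI)
  fix m
  obtain s u where "s \<in> hclosure F hvar S" "u \<in> hcomplete W" "x = (\<lambda>w. s w + fps_X ^ m * u w)"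
    using x by blast
  moreover from this obtain t v where "t \<in> S" "v \<in> hcomplete W" "s = (\<lambda>w. t w + fps_X ^ m * v w)"
    unfolding hclosure_iff by blast
  ultimately show "\<exists>s\<in>S. \<exists>u\<in>hcomplete W. x = (\<lambda>w. s w + fps_X ^ m * u w)"
    by (intro bexI[of _ t] bexI[of _ "\<lambda>w. u w + v w"]) (auto simp: algebra_simps)
qed fact

text \<open>The sum of the series \<open>\<Sum>m. h\<^sup>m x\<^sub>m\<close>.\<close>

definition hsum :: "(nat \<Rightarrow> 'w \<Rightarrow> complex fps) \<Rightarrow> 'w \<Rightarrow> complex fps" where
  "hsum x = (\<lambda>w. Abs_fps (\<lambda>N. \<Sum>m\<le>N. fps_nth (x m w) (N - m)))"

lemma hsum_0: "hsum x w = x 0 w + fps_X * hsum (\<lambda>m. x (Suc m)) w"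
proof (rule fps_ext)
  fix N show "fps_nth (hsum x w) N = fps_nth (x 0 w + fps_X * hsum (\<lambda>m. x (Suc m)) w) N"
    by (cases N) (simp_all add: hsum_def sum.atMost_Suc_shift del: sum.atMost_Suc)
qed

lemma hsum_split: "hsum x w = (\<Sum>m<M. fps_X ^ m * x m w) + fps_X ^ M * hsum (\<lambda>m. x (m + M)) w"
proof (induction M)
  case (Suc M)
  then show ?case using hsum_0[of "\<lambda>m. x (m + M)" w]
    by (simp add: algebra_simps)
qed simp

lemma hsum_closed: 
  assumes "\<And>m. x m \<in> hcomplete W" shows "hsum x \<in> hcomplete W"
proof (rule hcompleteI)
  fix N
  have "finite (\<Union>m\<in>{..N}. {w. fps_nth (x m w) (N - m) \<noteq> 0})"
    using assms by (auto simp: hcompleteD)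
  then show "finite {w. fps_nth (hsum x w) N \<noteq> 0}"
    by (rule rev_finite_subset) (rule subsetI, rule ccontr, auto simp: hsum_def)
qed (use assms in \<open>auto simp: hsum_def fps_eq_iff hcompleteD\<close>)

text \<open>The partial sums lie in the ideal, and the tail from position M on is h^M times an
  admissible function.\<close>

lemma hsum_hclosure:
  assumes S: "ideal S F" and x: "\<And>m. x m \<in> hclosure F hvar S"
  shows "hsum x \<in> hclosure F hvar S"
proof (rule hclosure_closed[OF _ S])
  interpret J: ideal "hclosure F hvar S" F by (rule ideal_hclosure[OF S])
  have x': "x m \<in> hcomplete W" for m using J.a_subset x by auto
  then show "hsum x \<in> hcomplete W" by (rule hsum_closed)
  fix M
  have "(\<lambda>w. \<Sum>m<M. fps_X ^ m * x m w) \<in> hclosure F hvar S"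
  proof (induction M)
    case 0 then show ?case using J.zero_closed by simp
  next
    case (Suc M)
    have "smul (fps_X ^ M) (x M) \<in> hclosure F hvar S"
      using J.I_l_closed[OF x, of "smul (fps_X ^ M) (mon e)" M] by (simp add: conv_smul_left)
    from J.a_closed[OF Suc this]
    have "(\<lambda>w. (\<Sum>m<M. fps_X ^ m * x m w) + smul (fps_X ^ M) (x M) w) \<in> hclosure F hvar S" by simp
    moreover have "(\<lambda>w. \<Sum>m<Suc M. fps_X ^ m * x m w) =
        (\<lambda>w. (\<Sum>m<M. fps_X ^ m * x m w) + smul (fps_X ^ M) (x M) w)" by (simp add: smul_apply)
    ultimately show ?case by simp
  qed
  moreover have "hsum x = (\<lambda>w. (\<Sum>m<M. fps_X ^ m * x m w) + fps_X ^ M * hsum (\<lambda>m. x (m + M)) w)"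
    by (rule ext, rule hsum_split)
  moreover have "hsum (\<lambda>m. x (m + M)) \<in> hcomplete W" using x' by (rule hsum_closed)
  ultimately show "\<exists>s\<in>hclosure F hvar S. \<exists>u\<in>hcomplete W. hsum x = (\<lambda>w. s w + fps_X ^ M * u w)"
    by (intro bexI[of _ "\<lambda>w. \<Sum>m<M. fps_X ^ m * x m w"] bexI[of _ "hsum (\<lambda>m. x (m + M))"])
qed

text \<open>The h-adic topology is separated; this turns agreement of all truncations into
  equality.\<close>

lemma fps_eq_mod: "(\<And>M. \<exists>c. a - b = fps_X ^ M * (c :: complex fps)) \<Longrightarrow> a = b"
proof (rule fps_ext)
  fix N assume "\<And>M. \<exists>c. a - b = fps_X ^ M * (c :: complex fps)"
  then obtain c where "a - b = fps_X ^ Suc N * c" by blast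
  then have "fps_nth (a - b) N = fps_nth (fps_X ^ Suc N * c) N" by simp
  then show "fps_nth a N = fps_nth b N" by (simp add: fps_X_power_mult_nth del: power_Suc)
qed

lemma conv_sum_left: "conv op (\<lambda>w. \<Sum>m\<in>I. f m w) g = (\<lambda>w. \<Sum>m\<in>I. conv op (f m) g w)"
  unfolding conv_def by (simp add: sum_distrib_right case_prod_unfold sum.swap[of _ I])

lemma conv_sum_right: "conv op g (\<lambda>w. \<Sum>m\<in>I. f m w) = (\<lambda>w. \<Sum>m\<in>I. conv op g (f m) w)"
  unfolding conv_def by (simp add: sum_distrib_left case_prod_unfold sum.swap[of _ I])

text \<open>Multiplication is h-adically continuous: both sides are compared after splitting off the
  first M terms.\<close>

lemma conv_hsum_left: "conv op (hsum x) g = hsum (\<lambda>m. conv op (x m) g)"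
proof (rule ext, rule fps_eq_mod)
  fix w M
  have "hsum x = (\<lambda>w. (\<Sum>m<M. smul (fps_X ^ m) (x m) w) + smul (fps_X ^ M) (hsum (\<lambda>m. x (m + M))) w)"
    using hsum_split[of x _ M] by (auto simp: smul_apply)
  then have "conv op (hsum x) g w = (\<Sum>m<M. fps_X ^ m * conv op (x m) g w) + fps_X ^ M * conv op (hsum (\<lambda>m. x (m + M))) g w"
    by (simp add: conv_add_left conv_sum_left conv_smul_left) (simp add: smul_apply)
  then show "\<exists>c. conv op (hsum x) g w - hsum (\<lambda>m. conv op (x m) g) w = fps_X ^ M * c"
    using hsum_split[of "\<lambda>m. conv op (x m) g" w M]
    by (auto simp flip: right_diff_distrib)
qed

lemma conv_hsum_right: "conv op g (hsum x) = hsum (\<lambda>m. conv op g (x m))"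
proof (rule ext, rule fps_eq_mod)
  fix w M
  have "hsum x = (\<lambda>w. (\<Sum>m<M. smul (fps_X ^ m) (x m) w) + smul (fps_X ^ M) (hsum (\<lambda>m. x (m + M))) w)"
    using hsum_split[of x _ M] by (auto simp: smul_apply)
  then have "conv op g (hsum x) w = (\<Sum>m<M. fps_X ^ m * conv op g (x m) w) + fps_X ^ M * conv op g (hsum (\<lambda>m. x (m + M))) w"
    by (simp add: conv_add_right conv_sum_right conv_smul_right) (simp add: smul_apply)
  then show "\<exists>c. conv op g (hsum x) w - hsum (\<lambda>m. conv op g (x m)) w = fps_X ^ M * c"
    using hsum_split[of "\<lambda>m. conv op g (x m)" w M]
    by (auto simp flip: right_diff_distrib)
qed

lemma hsum_diff: "(\<lambda>w. hsum x w - hsum y w) = hsum (\<lambda>m w. x m w - y m w)"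
  by (auto simp: hsum_def fps_eq_iff sum_subtractf)

end

section \<open>Maps of quotient rings\<close>

text \<open>On a coset of I the map is constant modulo J, so the image set in
  \<open>quot_map\<close> is a singleton and \<open>the_elem\<close> returns its member.\<close>

lemma quot_map_coset:
  assumes I: "ideal I R" and J: "ideal J S"
    and closed: "\<And>x. x \<in> carrier R \<Longrightarrow> f x \<in> carrier S"
    and add: "\<And>x y. x \<in> carrier R \<Longrightarrow> y \<in> carrier R \<Longrightarrow> f (x \<oplus>\<^bsub>R\<^esub> y) = f x \<oplus>\<^bsub>S\<^esub> f y"
    and IJ: "\<And>x. x \<in> I \<Longrightarrow> f x \<in> J" and x: "x \<in> carrier R"
  shows "quot_map S J f (I +>\<^bsub>R\<^esub> x) = J +>\<^bsub>S\<^esub> f x"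
proof -
  interpret I: ideal I R by fact
  interpret J: ideal J S by fact
  have "J +>\<^bsub>S\<^esub> f y = J +>\<^bsub>S\<^esub> f x" if y: "y \<in> I +>\<^bsub>R\<^esub> x" for y
  proof -
    obtain i where i: "i \<in> I" "y = i \<oplus>\<^bsub>R\<^esub> x" using y by (auto simp: a_r_coset_def r_coset_def)
    then have "f y \<ominus>\<^bsub>S\<^esub> f x = f i"
      using add[of i x] closed[of i] closed[of x] x by (simp add: J.minus_eq J.a_assoc J.r_neg)
    then have "f y \<ominus>\<^bsub>S\<^esub> f x \<in> J" using IJ i by simp
    then show ?thesis
      using J.quotient_eq_iff_same_a_r_cos[OF J, of "f y" "f x"] closed x i by simp
  qed
  moreover have "x \<in> I +>\<^bsub>R\<^esub> x" by (rule I.a_rcos_self[OF x])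
  ultimately have "(\<lambda>x. J +>\<^bsub>S\<^esub> f x) ` (I +>\<^bsub>R\<^esub> x) = {J +>\<^bsub>S\<^esub> f x}" by blast
  then show ?thesis by (simp add: quot_map_def)
qed

lemma coset_ring_hom:
  assumes "ideal I R" shows "(\<lambda>x. I +>\<^bsub>R\<^esub> x) \<in> Ring.ring_hom R (R Quot I)"
  by (rule ideal.rcos_ring_hom[OF assms])

lemma coset_eq_iff:
  assumes "ideal I R" "x \<in> carrier R" "y \<in> carrier R"
  shows "I +>\<^bsub>R\<^esub> x = I +>\<^bsub>R\<^esub> y \<longleftrightarrow> x \<ominus>\<^bsub>R\<^esub> y \<in> I"
proof -
  interpret ideal I R by fact
  show ?thesis using quotient_eq_iff_same_a_r_cos[OF assms] by simp
qed

lemma quotient_carrierE: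
  assumes "X \<in> carrier (R Quot I)"
  obtains x where "x \<in> carrier R" "X = I +>\<^bsub>R\<^esub> x"
  using assms by (auto simp: FactRing_def A_RCOSETS_def RCOSETS_def a_r_coset_def)

lemma quot_map_ring_hom:
  assumes I: "ideal I R" and J: "ideal J S" and f: "f \<in> Ring.ring_hom R S"
    and IJ: "\<And>x. x \<in> I \<Longrightarrow> f x \<in> J"
  shows "quot_map S J f \<in> Ring.ring_hom (R Quot I) (S Quot J)"
proof -
  note coset = quot_map_coset[OF I J ring_hom_closed[OF f] ring_hom_add[OF f] IJ]
  note RI = coset_ring_hom[OF I]
  note SJ = coset_ring_hom[OF J]
  interpret I: ideal I R by fact
  show ?thesis
  proof (rule ring_hom_memI)
    fix X assume "X \<in> carrier (R Quot I)"
    then obtain x where "x \<in> carrier R" "X = I +>\<^bsub>R\<^esub> x" by (rule quotient_carrierE)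
    then show "quot_map S J f X \<in> carrier (S Quot J)"
      using coset ring_hom_closed[OF SJ ring_hom_closed[OF f]] by simp
    fix Y assume "Y \<in> carrier (R Quot I)"
    then obtain y where y: "y \<in> carrier R" "Y = I +>\<^bsub>R\<^esub> y" by (rule quotient_carrierE)
    note x = \<open>x \<in> carrier R\<close> \<open>X = I +>\<^bsub>R\<^esub> x\<close>
    show "quot_map S J f (X \<otimes>\<^bsub>R Quot I\<^esub> Y) = quot_map S J f X \<otimes>\<^bsub>S Quot J\<^esub> quot_map S J f Y"
      using x y coset ring_hom_mult[OF RI, symmetric] ring_hom_mult[OF SJ, symmetric] ring_hom_mult[OF f]
        ring_hom_closed[OF f] by simp
    show "quot_map S J f (X \<oplus>\<^bsub>R Quot I\<^esub> Y) = quot_map S J f X \<oplus>\<^bsub>S Quot J\<^esub> quot_map S J f Y"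
      using x y coset ring_hom_add[OF RI, symmetric] ring_hom_add[OF SJ, symmetric] ring_hom_add[OF f]
        ring_hom_closed[OF f] by simp
  next
    show "quot_map S J f \<one>\<^bsub>R Quot I\<^esub> = \<one>\<^bsub>S Quot J\<^esub>"
      using coset[of "\<one>\<^bsub>R\<^esub>"] ring_hom_one[OF RI] ring_hom_one[OF SJ] ring_hom_one[OF f] by simp
  qed
qed

section \<open>The algebra \<open>U\<^sub>h\<close>\<close>

text \<open>A series of order exactly one is h times a unit, so dividing by it is multiplication by
  the inverse unit followed by a shift. The divisors that occur are q - 1/q and q - 1.\<close>

lemma fps_divide_simple:
  fixes a c :: "complex fps"
  assumes "fps_nth c 0 = 0" "fps_nth c 1 \<noteq> 0"
  shows "a / c = fps_shift 1 (a * inverse (fps_shift 1 c))"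
proof -
  have "subdegree c = 1" using assms by (intro subdegreeI) auto
  moreover from this have "c \<noteq> 0" by auto
  ultimately show ?thesis by (simp add: fps_divide_def Let_def)
qed

lemma fps_mult_divide_simple:
  fixes a c :: "complex fps"
  assumes "fps_nth c 0 = 0" "fps_nth c 1 \<noteq> 0" "fps_nth a 0 = 0"
  shows "c * (a / c) = a"
proof -
  have c: "c = fps_X * fps_shift 1 c" using assms by (simp add: fps_eq_iff)
  have "fps_X * (a / c) = a * inverse (fps_shift 1 c)"
    unfolding fps_divide_simple[OF assms(1,2)] using assms(3)
    by (intro fps_ext) simp
  then have "fps_X * (a / c) * fps_shift 1 c = a * (inverse (fps_shift 1 c) * fps_shift 1 c)" by simp
  also have "\<dots> = a" using assms(2) by (simp add: inverse_mult_eq_1)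
  finally show ?thesis using c by (metis mult.assoc mult.commute)
qed

lemma FA_words: "hwords (@) [] (lists (gens n))"
  by (intro hwords.intro words_append hwords_axioms.intro) auto

lemma FA2_words: "hwords append2 ([], []) (lists (gens n) \<times> lists (gens n))"
  by (intro hwords.intro words_append2 hwords_axioms.intro) auto

interpretation FA: hwords "(@)" "[]" "lists (gens n)"
  rewrites "word_ring (hcomplete (lists (gens n))) (@) [] = FA n" for n
  by (rule FA_words) (simp add: FA_def)

interpretation FA2: hwords append2 "([], [])" "lists (gens n) \<times> lists (gens n)"
  rewrites "word_ring (hcomplete (lists (gens n) \<times> lists (gens n))) append2 ([], []) = FA2 n" for n
  by (rule FA2_words) (simp add: FA2_def)

lemma FA_simps [simp]:
  "carrier (FA n) = hcomplete (lists (gens n))" "mult (FA n) = conv (@)" "one (FA n) = mon []"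
  "zero (FA n) = (\<lambda>w. 0)" "add (FA n) = (\<lambda>f g w. f w + g w)"
  by (simp_all add: FA_def)

lemma FA2_simps [simp]:
  "carrier (FA2 n) = hcomplete (lists (gens n) \<times> lists (gens n))" "mult (FA2 n) = conv append2"
  "one (FA2 n) = mon ([], [])" "zero (FA2 n) = (\<lambda>w. 0)" "add (FA2 n) = (\<lambda>f g w. f w + g w)"
  by (simp_all add: FA2_def)

lemma gens_simps [simp]:
  "Xp i \<in> gens n \<longleftrightarrow> i \<in> {1..n}" "Xm i \<in> gens n \<longleftrightarrow> i \<in> {1..n}" "Hg i \<in> gens n \<longleftrightarrow> i \<in> {1..n}"
  by (auto simp: gens_def)

lemma hexp_closed [simp]:
  assumes "i \<in> {1..n}" shows "hexp c i \<in> hcomplete (lists (gens n))"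
proof (rule FA.hcompleteI)
  fix w assume w: "w \<notin> lists (gens n)"
  have "replicate k (Hg i) \<in> lists (gens n)" for k using assms by (induction k) auto
  then have "w \<noteq> replicate (length w) (Hg i)" using w by metis
  then show "hexp c i w = 0" by (simp add: hexp_def)
next
  fix m
  have "{w. fps_nth (hexp c i w) m \<noteq> 0} \<subseteq> {replicate m (Hg i)}"
    by (auto simp: hexp_def split: if_splits)
  then show "finite {w. fps_nth (hexp c i w) m \<noteq> 0}" by (rule finite_subset) simp
qed

lemma sdiv_closed:
  assumes "f \<in> hcomplete (lists (gens n))" "fps_nth c 0 = 0" "fps_nth c 1 \<noteq> 0"
  shows "sdiv f c \<in> hcomplete (lists (gens n))"
proof (rule FA.hcompleteI)
  \<comment> \<open>Coefficient m of the quotient is coefficient m + 1 of a scalar multiple of f, so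
    finiteness of the supports is inherited.\<close>
  have eq: "sdiv f c w = fps_shift 1 (smul (inverse (fps_shift 1 c)) f w)" for w
    using assms by (simp add: sdiv_def smul_apply fps_divide_simple mult.commute)
  show "sdiv f c w = 0" if "w \<notin> lists (gens n)" for w
    using FA.hcompleteD(2)[OF assms(1) that] by (simp add: sdiv_def)
  show "finite {w. fps_nth (sdiv f c w) m \<noteq> 0}" for m
    unfolding eq fps_shift_nth by (rule FA.hcompleteD(1)[OF FA.smul_closed[OF assms(1)]])
qed

lemma smul_sdiv:
  assumes "\<And>w. fps_nth (f w) 0 = 0" "fps_nth c 0 = 0" "fps_nth c 1 \<noteq> 0"
  shows "smul c (sdiv f c) = f"
  using assms by (auto simp: smul_apply sdiv_def fps_mult_divide_simple)

lemma qh_nth: "fps_nth qh m = 1 / fact m" "fps_nth qh_inv m = (- 1) ^ m / fact m"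
  by (simp_all add: qh_def qh_inv_def)

lemma qh_diff: "fps_nth (qh - qh_inv) 0 = 0" "fps_nth (qh - qh_inv) 1 \<noteq> 0"
  "fps_nth (qh - 1) 0 = 0" "fps_nth (qh - 1) 1 \<noteq> 0"
  by (simp_all add: qh_nth)

lemma qh_mult: "qh * qh_inv = 1" "qh_inv * qh = 1"
  by (simp_all add: qh_def qh_inv_def flip: fps_exp_add_mult)

lemma hexp_nth_0: "fps_nth (hexp c i w) 0 = (if w = [] then 1 else 0)"
  by (auto simp: hexp_def)

lemma Kp_Km_nth_0: "fps_nth (Kp i w - Km i w) 0 = 0"
  by (simp add: hexp_nth_0)

abbreviation H_rel :: "nat \<Rightarrow> gen list \<Rightarrow> complex fps" where
  "H_rel i \<equiv> sdiv (\<lambda>w. Kp i w - Km i w) (qh - qh_inv)"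

lemma serre_adjacent:
  assumes "X \<in> {Xp, Xm}" "i \<in> {1..n}" "j \<in> {1..n}" "i = Suc j \<or> j = Suc i"
  shows "serre n X i j = (\<lambda>w. mon [X i, X i, X j] w - (qh + qh_inv) * mon [X i, X j, X i] w
    + mon [X j, X i, X i] w)"
proof -
  have m: "nat (1 - cartan i j) = 2" using assms(4) by (auto simp: cartan_def)
  have q: "(qh - qh_inv) \<noteq> 0" using qh_diff(2) by auto
  have i1: "q_int 1 = 1" using q by (simp add: q_int_def)
  have "qh ^ 2 - qh_inv ^ 2 = (qh + qh_inv) * (qh - qh_inv)" by (simp add: power2_eq_square algebra_simps)
  then have i2: "q_int 2 = qh + qh_inv" using q by (simp add: q_int_def)
  have i2': "qh + qh_inv \<noteq> 0"
  proof
    assume "qh + qh_inv = 0" then have "fps_nth (qh + qh_inv) 0 = 0" by simp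
    then show False by (simp add: qh_nth)
  qed
  have f: "q_fact 0 = 1" "q_fact 1 = 1" "q_fact 2 = qh + qh_inv"
    using i1 i2 by (simp_all add: q_fact_def numeral_2_eq_2)
  have b: "q_binom 2 0 = 1" "q_binom 2 1 = qh + qh_inv" "q_binom 2 2 = 1"
    using f i2' by (simp_all add: q_binom_def)
  have l: "w \<in> lists (gens n)" if "set w \<subseteq> {X i, X j}" for w
    using that assms by auto
  define t where "t r = smul ((- 1) ^ r * q_binom 2 r) (mon (replicate (2 - r) (X i) @ [X j] @ replicate r (X i)))" for r
  have t: "t r \<in> carrier (FA n)" for r
    unfolding t_def by (simp, rule FA.smul_closed, rule FA.mon_closed, rule l) auto
  have "{0..2} = ({0, 1, 2} :: nat set)" by auto
  then have "serre n X i j = (\<Oplus>\<^bsub>FA n\<^esub>r\<in>{0, 1, 2}. t r)"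
    unfolding serre_def Let_def m t_def by simp
  also have "\<dots> = (\<lambda>w. t 0 w + (t 1 w + t 2 w))"
    using t by (simp add: FA.F.finsum_insert)
  also have "\<dots> = (\<lambda>w. mon [X i, X i, X j] w - (qh + qh_inv) * mon [X i, X j, X i] w + mon [X j, X i, X i] w)"
    using b by (simp add: t_def smul_apply fun_eq_iff numeral_2_eq_2 algebra_simps)
  finally show ?thesis .
qed

lemma serre_far:
  assumes "X \<in> {Xp, Xm}" "i \<in> {1..n}" "j \<in> {1..n}" "i \<noteq> j" "\<not> (i = Suc j \<or> j = Suc i)"
  shows "serre n X i j = (\<lambda>w. mon [X i, X j] w - mon [X j, X i] w)"
proof -
  have m: "nat (1 - cartan i j) = 1" using assms(4,5) by (auto simp: cartan_def)
  have q: "(qh - qh_inv) \<noteq> 0" using qh_diff(2) by auto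
  have i1: "q_int 1 = 1" using q by (simp add: q_int_def)
  have b: "q_binom 1 0 = 1" "q_binom 1 1 = 1"
    using i1 by (simp_all add: q_binom_def q_fact_def)
  have l: "w \<in> lists (gens n)" if "set w \<subseteq> {X i, X j}" for w
    using that assms by auto
  define t where "t r = smul ((- 1) ^ r * q_binom 1 r) (mon (replicate (1 - r) (X i) @ [X j] @ replicate r (X i)))" for r
  have t: "t r \<in> carrier (FA n)" for r
    unfolding t_def by (simp, rule FA.smul_closed, rule FA.mon_closed, rule l) auto
  have "{0..1} = ({0, 1} :: nat set)" by auto
  then have "serre n X i j = (\<Oplus>\<^bsub>FA n\<^esub>r\<in>{0, 1}. t r)"
    unfolding serre_def Let_def m t_def by simp
  also have "\<dots> = (\<lambda>w. t 0 w + t 1 w)"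
    using t by (simp add: FA.F.finsum_insert)
  also have "\<dots> = (\<lambda>w. mon [X i, X j] w - mon [X j, X i] w)"
    using b by (simp add: t_def smul_apply fun_eq_iff numeral_2_eq_2 algebra_simps)
  finally show ?thesis .
qed

section \<open>The relations, the closed ideal and the quotient\<close>

lemma Hg_word_closed: "i \<in> {1..n} \<Longrightarrow> replicate k (Hg i) \<in> lists (gens n)"
  by (induction k) auto

lemma H_rel_closed: "i \<in> {1..n} \<Longrightarrow> H_rel i \<in> hcomplete (lists (gens n))"
  using FA.F.minus_closed[of "Kp i" n "Km i"] by (intro sdiv_closed qh_diff) (simp add: FA.F_minus)

text \<open>The relators as explicit coefficient functions, with the Serre relators already divided
  into adjacent and distant nodes; the checks for the comultiplication and for the specialization
  both run through these cases.\<close>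

lemma Uh_rels_cases:
  assumes "r \<in> Uh_rels n"
  obtains (HH) i j where "i \<in> {1..n}" "j \<in> {1..n}" "r = (\<lambda>w. mon [Hg i, Hg j] w - mon [Hg j, Hg i] w)"
  | (HXp) i j where "i \<in> {1..n}" "j \<in> {1..n}"
      "r = (\<lambda>w. mon [Hg i, Xp j] w - mon [Xp j, Hg i] w - of_int (cartan i j) * mon [Xp j] w)"
  | (HXm) i j where "i \<in> {1..n}" "j \<in> {1..n}"
      "r = (\<lambda>w. mon [Hg i, Xm j] w - mon [Xm j, Hg i] w + of_int (cartan i j) * mon [Xm j] w)"
  | (XX) i j where "i \<in> {1..n}" "j \<in> {1..n}"
      "r = (\<lambda>w. mon [Xp i, Xm j] w - mon [Xm j, Xp i] w - (if i = j then H_rel i w else 0))"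
  | (near) X i j where "X \<in> {Xp, Xm}" "i \<in> {1..n}" "j \<in> {1..n}" "i = Suc j \<or> j = Suc i"
      "r = (\<lambda>w. mon [X i, X i, X j] w - (qh + qh_inv) * mon [X i, X j, X i] w + mon [X j, X i, X i] w)"
  | (far) X i j where "X \<in> {Xp, Xm}" "i \<in> {1..n}" "j \<in> {1..n}" "i \<noteq> j" "\<not> (i = Suc j \<or> j = Suc i)"
      "r = (\<lambda>w. mon [X i, X j] w - mon [X j, X i] w)"
proof -
  have m [simp]: "mon w \<in> hcomplete (lists (gens n))" if "set w \<subseteq> gens n" for w
    using that by (intro FA.mon_closed) auto
  have H: "H_rel i \<in> hcomplete (lists (gens n))" if "i \<in> {1..n}" for i
    using that by (rule H_rel_closed)
  have z: "(\<lambda>w. 0) \<in> hcomplete (lists (gens n))" using FA.F.zero_closed[of n] by simp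
  have c: "(\<lambda>w. f w - g w) \<in> hcomplete (lists (gens n))"
    if "f \<in> hcomplete (lists (gens n))" "g \<in> hcomplete (lists (gens n))" for f g
    using FA.F.minus_closed[of f n g] that by (simp add: FA.F_minus)
  from assms consider
     (1) i j where "i \<in> {1..n}" "j \<in> {1..n}" "r = mon [Hg i, Hg j] \<ominus>\<^bsub>FA n\<^esub> mon [Hg j, Hg i]"
   | (2) i j where "i \<in> {1..n}" "j \<in> {1..n}"
       "r = mon [Hg i, Xp j] \<ominus>\<^bsub>FA n\<^esub> mon [Xp j, Hg i] \<ominus>\<^bsub>FA n\<^esub> smul (of_int (cartan i j)) (mon [Xp j])"
   | (3) i j where "i \<in> {1..n}" "j \<in> {1..n}"
       "r = mon [Hg i, Xm j] \<ominus>\<^bsub>FA n\<^esub> mon [Xm j, Hg i] \<oplus>\<^bsub>FA n\<^esub> smul (of_int (cartan i j)) (mon [Xm j])"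
   | (4) i j where "i \<in> {1..n}" "j \<in> {1..n}"
       "r = mon [Xp i, Xm j] \<ominus>\<^bsub>FA n\<^esub> mon [Xm j, Xp i] \<ominus>\<^bsub>FA n\<^esub>
        (if i = j then sdiv (Kp i \<ominus>\<^bsub>FA n\<^esub> Km i) (qh - qh_inv) else \<zero>\<^bsub>FA n\<^esub>)"
   | (5) X i j where "X \<in> {Xp, Xm}" "i \<in> {1..n}" "j \<in> {1..n}" "i \<noteq> j" "r = serre n X i j"
    unfolding Uh_rels_def by blast
  then show ?thesis
  proof cases
    case 1 then show ?thesis by (intro that(1)[of i j]) (simp_all add: FA.F_minus)
  next
    case 2 then show ?thesis by (intro that(2)[of i j]) (simp_all add: FA.F_minus smul_apply c)
  next
    case 3 then show ?thesis by (intro that(3)[of i j]) (simp_all add: FA.F_minus smul_apply c)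
  next
    case 4
    then have e: "(if i = j then sdiv (Kp i \<ominus>\<^bsub>FA n\<^esub> Km i) (qh - qh_inv) else \<zero>\<^bsub>FA n\<^esub>)
      = (if i = j then H_rel i else (\<lambda>w. 0))" by (auto simp: FA.F_minus)
    define h where "h = (if i = j then H_rel i else (\<lambda>w. 0))"
    have "h \<in> hcomplete (lists (gens n))" using 4 H z by (simp add: h_def)
    then have "r = (\<lambda>w. mon [Xp i, Xm j] w - mon [Xm j, Xp i] w - h w)"
      unfolding 4(3) e h_def[symmetric] using 4(1,2) by (simp add: FA.F_minus c)
    then show ?thesis using 4(1,2) by (intro that(4)[of i j]) (auto simp: h_def)
  next
    case 5
    then show ?thesis
    proof (cases "i = Suc j \<or> j = Suc i")
      case True
      then show ?thesis using 5 serre_adjacent[OF 5(1-3) True] by (intro that(5)[of X i j]) simp_all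
    next
      case False
      then show ?thesis using 5 serre_far[OF 5(1-4) False] by (intro that(6)[of X i j]) simp_all
    qed
  qed
qed

lemma Uh_rels_closed: "Uh_rels n \<subseteq> carrier (FA n)"
proof
  have m [simp]: "mon w \<in> hcomplete (lists (gens n))" if "set w \<subseteq> gens n" for w
    using that by (intro FA.mon_closed) auto
  have m': "(\<lambda>v. c * mon w v) \<in> hcomplete (lists (gens n))" if "set w \<subseteq> gens n" for w c
    using FA.smul_closed[OF m[OF that], of c] by (simp add: smul_def)
  have z: "(\<lambda>w. 0) \<in> hcomplete (lists (gens n))" using FA.F.zero_closed[of n] by simp
  have c: "(\<lambda>w. f w - g w) \<in> hcomplete (lists (gens n))"
    if "f \<in> hcomplete (lists (gens n))" "g \<in> hcomplete (lists (gens n))" for f g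
    using FA.F.minus_closed[of f n g] that by (simp add: FA.F_minus)
  fix r assume "r \<in> Uh_rels n"
  then show "r \<in> carrier (FA n)"
  proof (cases rule: Uh_rels_cases)
    case (XX i j)
    have "(\<lambda>w. if i = j then H_rel i w else 0) \<in> hcomplete (lists (gens n))"
      using XX z H_rel_closed by (cases "i = j") auto
    then show ?thesis unfolding XX(3) FA_simps by (intro c) (use XX in auto)
  qed (auto intro!: c m' FA.add_closed)
qed

lemma Uh_ideal_ideal: "ideal (Uh_ideal n) (FA n)"
  unfolding Uh_ideal_def by (intro FA.ideal_hclosure FA.F.genideal_ideal Uh_rels_closed)

lemma Uh_rels_ideal: "Uh_rels n \<subseteq> Uh_ideal n"
  unfolding Uh_ideal_def
  using FA.F.genideal_self[OF Uh_rels_closed]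
    FA.hclosure_incl[of "Idl\<^bsub>FA n\<^esub> Uh_rels n" n]
    ideal.axioms(1)[OF FA.F.genideal_ideal[OF Uh_rels_closed]]
    additive_subgroup.a_subset by fastforce

text \<open>This is where closedness of the ideal enters: relations for all powers of H may be
  summed to a relation for an exponential.\<close>

lemma Uh_ideal_hsum: "(\<And>m. x m \<in> Uh_ideal n) \<Longrightarrow> FA.hsum x \<in> Uh_ideal n"
  unfolding Uh_ideal_def by (rule FA.hsum_hclosure[OF FA.F.genideal_ideal[OF Uh_rels_closed]])

lemmas J_simps = ideal.Icarr[OF Uh_ideal_ideal] ideal.I_l_closed[OF Uh_ideal_ideal]
  ideal.I_r_closed[OF Uh_ideal_ideal] additive_subgroup.a_closed[OF ideal.axioms(1)[OF Uh_ideal_ideal]]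

lemma J_zero: "(\<lambda>w. 0) \<in> Uh_ideal n"
  using additive_subgroup.zero_closed[OF ideal.axioms(1)[OF Uh_ideal_ideal]] by simp

lemma J_carrier: "f \<in> Uh_ideal n \<Longrightarrow> f \<in> hcomplete (lists (gens n))"
  using J_simps(1)[of f n] by simp

lemma J_smul: "f \<in> Uh_ideal n \<Longrightarrow> smul c f \<in> Uh_ideal n"
  using J_simps(2)[of f n "smul c (mon [])"] by (simp add: FA.conv_smul_left)

lemma J_add: "f \<in> Uh_ideal n \<Longrightarrow> g \<in> Uh_ideal n \<Longrightarrow> (\<lambda>w. f w + g w) \<in> Uh_ideal n"
  using J_simps(4)[of f n g] by simp

lemma J_conv_left: "f \<in> Uh_ideal n \<Longrightarrow> g \<in> hcomplete (lists (gens n)) \<Longrightarrow> conv (@) g f \<in> Uh_ideal n"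
  using J_simps(2)[of f n g] by simp

lemma J_conv_right: "f \<in> Uh_ideal n \<Longrightarrow> g \<in> hcomplete (lists (gens n)) \<Longrightarrow> conv (@) f g \<in> Uh_ideal n"
  using J_simps(3)[of f n g] by simp

lemma Uh_ring: "ring (Uh n)"
  unfolding Uh_def by (rule ideal.quotient_is_ring[OF Uh_ideal_ideal])

interpretation Uh: ring "Uh n" for n by (rule Uh_ring)

lemma Uh_class_hom: "Uh_class n \<in> Ring.ring_hom (FA n) (Uh n)"
  unfolding Uh_class_def Uh_def by (rule ideal.rcos_ring_hom[OF Uh_ideal_ideal])

lemma Uh_class_closed [simp]: "f \<in> hcomplete (lists (gens n)) \<Longrightarrow> Uh_class n f \<in> carrier (Uh n)"
  using ring_hom_closed[OF Uh_class_hom] by simp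

lemma Uh_class_mult:
  "f \<in> hcomplete (lists (gens n)) \<Longrightarrow> g \<in> hcomplete (lists (gens n)) \<Longrightarrow>
    Uh_class n (conv (@) f g) = Uh_class n f \<otimes>\<^bsub>Uh n\<^esub> Uh_class n g"
  using ring_hom_mult[OF Uh_class_hom, of f n g] by simp

lemma Uh_class_add:
  "f \<in> hcomplete (lists (gens n)) \<Longrightarrow> g \<in> hcomplete (lists (gens n)) \<Longrightarrow>
    Uh_class n (\<lambda>w. f w + g w) = Uh_class n f \<oplus>\<^bsub>Uh n\<^esub> Uh_class n g"
  using ring_hom_add[OF Uh_class_hom, of f n g] by simp

lemma Uh_class_one: "Uh_class n (mon []) = \<one>\<^bsub>Uh n\<^esub>"
  using ring_hom_one[OF Uh_class_hom] by simp

lemma Uh_class_zero: "Uh_class n (\<lambda>w. 0) = \<zero>\<^bsub>Uh n\<^esub>"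
  using Ring.ring_hom_zero[OF Uh_class_hom FA.F_ring Uh_ring, of n] by simp

lemma Uh_class_eq_iff:
  "f \<in> hcomplete (lists (gens n)) \<Longrightarrow> g \<in> hcomplete (lists (gens n)) \<Longrightarrow>
    Uh_class n f = Uh_class n g \<longleftrightarrow> (\<lambda>w. f w - g w) \<in> Uh_ideal n"
  using coset_eq_iff[OF Uh_ideal_ideal, of f n g] by (simp add: Uh_class_def FA.F_minus)

lemma Uh_carrierE:
  assumes "x \<in> carrier (Uh n)"
  obtains f where "f \<in> hcomplete (lists (gens n))" "x = Uh_class n f"
  using quotient_carrierE[OF assms[unfolded Uh_def]] by (auto simp: Uh_class_def)

lemma Uh_class_smul:
  "f \<in> hcomplete (lists (gens n)) \<Longrightarrow> Uh_class n (smul c f) = Uh_scalar n c \<otimes>\<^bsub>Uh n\<^esub> Uh_class n f"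
  using Uh_class_mult[of "smul c (mon [])" n f] by (simp add: Uh_scalar_def FA.conv_smul_left)

lemma Uh_class_diff:
  assumes "f \<in> hcomplete (lists (gens n))" "g \<in> hcomplete (lists (gens n))"
  shows "Uh_class n (\<lambda>w. f w - g w) = Uh_class n f \<ominus>\<^bsub>Uh n\<^esub> Uh_class n g"
proof -
  have "(\<lambda>w. f w - g w) \<in> hcomplete (lists (gens n))"
    using FA.F.minus_closed[of f n g] assms by (simp add: FA.F_minus)
  moreover have "f = (\<lambda>w. (f w - g w) + g w)" by simp
  ultimately have "Uh_class n f = Uh_class n (\<lambda>w. f w - g w) \<oplus>\<^bsub>Uh n\<^esub> Uh_class n g"
    using Uh_class_add[of "\<lambda>w. f w - g w" n g] assms by simp
  then show ?thesis
    using assms \<open>(\<lambda>w. f w - g w) \<in> _\<close> by (simp add: Uh.minus_eq Uh.a_assoc Uh.r_neg)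
qed

lemma Uh_scalar_closed [simp]: "Uh_scalar n c \<in> carrier (Uh n)"
  by (simp add: Uh_scalar_def)

lemma Uh_scalar_central:
  assumes "x \<in> carrier (Uh n)" shows "x \<otimes>\<^bsub>Uh n\<^esub> Uh_scalar n c = Uh_scalar n c \<otimes>\<^bsub>Uh n\<^esub> x"
proof -
  obtain f where f: "f \<in> hcomplete (lists (gens n))" "x = Uh_class n f" using assms by (rule Uh_carrierE)
  then have "x \<otimes>\<^bsub>Uh n\<^esub> Uh_scalar n c = Uh_class n (conv (@) f (smul c (mon [])))"
    by (simp add: Uh_scalar_def Uh_class_mult)
  then show ?thesis using f by (simp add: FA.conv_smul_right Uh_class_smul)
qed

lemma Uh_scalar_mult: "Uh_scalar n (a * b) = Uh_scalar n a \<otimes>\<^bsub>Uh n\<^esub> Uh_scalar n b"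
  using Uh_class_smul[of "smul b (mon [])" n a] by (simp add: Uh_scalar_def FA.smul_smul)

lemma Uh_scalar_add: "Uh_scalar n (a + b) = Uh_scalar n a \<oplus>\<^bsub>Uh n\<^esub> Uh_scalar n b"
  using Uh_class_add[of "smul a (mon [])" n "smul b (mon [])"]
  by (simp add: Uh_scalar_def) (simp add: smul_def distrib_right)

lemma Uh_scalar_one: "Uh_scalar n 1 = \<one>\<^bsub>Uh n\<^esub>"
  using Uh_class_one by (simp add: Uh_scalar_def smul_def)

lemma Uh_scalar_zero: "Uh_scalar n 0 = \<zero>\<^bsub>Uh n\<^esub>"
  using Uh_class_zero by (simp add: Uh_scalar_def smul_def)

lemma Uh_scalar_minus: "Uh_scalar n (a - b) = Uh_scalar n a \<ominus>\<^bsub>Uh n\<^esub> Uh_scalar n b"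
proof -
  have "Uh_scalar n a = Uh_scalar n (a - b) \<oplus>\<^bsub>Uh n\<^esub> Uh_scalar n b"
    by (simp flip: Uh_scalar_add)
  then show ?thesis by (simp add: Uh.minus_eq Uh.a_assoc Uh.r_neg)
qed

lemma Uh_scalars: "scalars (Uh n) (range (Uh_scalar n))"
proof (intro scalars.intro scalars_axioms.intro Uh_ring Uh.subringI)
  show "\<ominus>\<^bsub>Uh n\<^esub> h \<in> range (Uh_scalar n)" if h: "h \<in> range (Uh_scalar n)" for h
  proof -
    obtain c where "h = Uh_scalar n c" using h by auto
    then have "\<ominus>\<^bsub>Uh n\<^esub> h = Uh_scalar n (0 - c)"
      unfolding Uh_scalar_minus by (simp add: Uh_scalar_zero Uh.minus_eq)
    then show ?thesis by blast
  qed
qed (auto simp: Uh_scalar_central simp flip: Uh_scalar_mult Uh_scalar_add Uh_scalar_one)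

lemma Uh_qring: "qring (Uh n) (Uh_scalar n qh) (Uh_scalar n qh_inv)"
proof (intro qring.intro qring_axioms.intro Uh_ring Uh_scalar_closed Uh_scalar_central)
  show "Uh_scalar n qh_inv \<otimes>\<^bsub>Uh n\<^esub> Uh_scalar n qh = \<one>\<^bsub>Uh n\<^esub>"
    by (simp add: Uh_scalar_one qh_mult flip: Uh_scalar_mult)
  fix x assume x: "x \<in> carrier (Uh n)"
    and z: "x \<oplus>\<^bsub>Uh n\<^esub> Uh_scalar n qh \<otimes>\<^bsub>Uh n\<^esub> (Uh_scalar n qh \<otimes>\<^bsub>Uh n\<^esub> x) = \<zero>\<^bsub>Uh n\<^esub>"
  let ?u = "1 + qh * qh"
  have "Uh_scalar n ?u \<otimes>\<^bsub>Uh n\<^esub> x = \<zero>\<^bsub>Uh n\<^esub>"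
    using x z by (simp add: Uh_scalar_add Uh_scalar_mult Uh_scalar_one Uh.l_distr Uh.m_assoc)
  then have "Uh_scalar n (inverse ?u * ?u) \<otimes>\<^bsub>Uh n\<^esub> x = \<zero>\<^bsub>Uh n\<^esub>"
    using x by (simp add: Uh_scalar_mult Uh.m_assoc)
  \<comment> \<open>The constant term of 1 + qq is 2, so this series is a unit.\<close>
  moreover have "fps_nth ?u 0 \<noteq> 0" by (simp add: qh_nth)
  ultimately show "x = \<zero>\<^bsub>Uh n\<^esub>"
    using x by (simp add: inverse_mult_eq_1 Uh_scalar_one)
qed

section \<open>Commuting exponentials past weight vectors\<close>

lemma hsum_const: "FA.hsum (\<lambda>m w. fps_const (k m w)) = (\<lambda>w. Abs_fps (\<lambda>N. k N w))"
proof -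
  have "(\<Sum>m\<le>N. fps_nth (fps_const (k m w)) (N - m)) = k N w" for N w
    by (subst sum.remove[of _ N]) (auto intro!: sum.neutral)
  then show ?thesis by (simp add: FA.hsum_def)
qed

text \<open>The coefficients of \<open>(H + a)\<^sup>m\<close>.\<close>

definition Hshift :: "nat \<Rightarrow> complex \<Rightarrow> nat \<Rightarrow> gen list \<Rightarrow> complex" where
  "Hshift i a m w = (if w = replicate (length w) (Hg i) \<and> length w \<le> m
     then of_nat (m choose length w) * a ^ (m - length w) else 0)"

lemma hexp_hsum:
  "hexp c i = FA.hsum (\<lambda>m. smul (fps_const (c ^ m / fact m)) (mon (replicate m (Hg i))))"
proof -
  have *: "(\<lambda>m. smul (fps_const (c ^ m / fact m)) (mon (replicate m (Hg i)))) =
    (\<lambda>m w. fps_const (if w = replicate m (Hg i) then c ^ m / fact m else 0))"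
    by (auto simp: smul_apply mon_apply fun_eq_iff)
  have "hexp c i w = Abs_fps (\<lambda>N. if w = replicate N (Hg i) then c ^ N / fact N else 0)" for w
  proof (cases "\<exists>l. w = replicate l (Hg i)")
    case True
    then obtain l where w: "w = replicate l (Hg i)" by blast
    show ?thesis unfolding w by (rule fps_ext) (simp add: hexp_def)
  next
    case False
    then have "w \<noteq> replicate (length w) (Hg i)" by blast
    then have "hexp c i w = 0" by (simp add: hexp_def)
    then show ?thesis using False by (intro fps_ext) auto
  qed
  then show ?thesis unfolding * hsum_const by (rule ext)
qed

text \<open>The identity exp(cah) exp(chH) = exp(ch(H + a)), compared coefficientwise with the help
  of the binomial expansion of (H + a)^m.\<close>

lemma hexp_shift_hsum:
  "smul (fps_exp (c * a)) (hexp c i) =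
    FA.hsum (\<lambda>m. smul (fps_const (c ^ m / fact m)) (\<lambda>w. fps_const (Hshift i a m w)))"
proof -
  have *: "(\<lambda>m. smul (fps_const (c ^ m / fact m)) (\<lambda>w. fps_const (Hshift i a m w))) =
    (\<lambda>m w. fps_const (c ^ m / fact m * Hshift i a m w))"
    by (auto simp: smul_apply fun_eq_iff)
  have "smul (fps_exp (c * a)) (hexp c i) w = Abs_fps (\<lambda>N. c ^ N / fact N * Hshift i a N w)" for w
  proof (rule fps_ext)
    fix N
    show "fps_nth (smul (fps_exp (c * a)) (hexp c i) w) N = fps_nth (Abs_fps (\<lambda>N. c ^ N / fact N * Hshift i a N w)) N"
    proof (cases "w = replicate (length w) (Hg i) \<and> length w \<le> N")
      case True
      define l where "l = length w"
      have l: "l \<le> N" and w: "w = replicate l (Hg i)" using True by (auto simp: l_def)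
      have "smul (fps_exp (c * a)) (hexp c i) w = fps_const (c ^ l / fact l) * (fps_exp (c * a) * fps_X ^ l)"
        using w by (simp add: smul_apply hexp_def mult_ac)
      then have "fps_nth (smul (fps_exp (c * a)) (hexp c i) w) N =
          c ^ l / fact l * ((c * a) ^ (N - l) / fact (N - l))"
        using l by (simp add: fps_X_power_mult_right_nth)
      also have "\<dots> = c ^ N / fact N * (of_nat (N choose l) * a ^ (N - l))"
        using l by (simp add: binomial_fact power_mult_distrib field_simps flip: power_add)
      finally show ?thesis using l w by (simp add: Hshift_def)
    next
      case False
      then show ?thesis
        by (auto simp: smul_apply hexp_def Hshift_def fps_X_power_mult_right_nth mult.assoc[symmetric])
    qed
  qed
  then show ?thesis unfolding * hsum_const by (rule ext)
qed

text \<open>The recursion (H + a)^(m+1) = H(H + a)^m + a(H + a)^m, which on coefficients is the rule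
  of Pascal.\<close>

lemma Hshift_Suc:
  "(\<lambda>w. fps_const (Hshift i a (Suc m) w)) =
    (\<lambda>w. conv (@) (mon [Hg i]) (\<lambda>w. fps_const (Hshift i a m w)) w + fps_const a * fps_const (Hshift i a m w))"
proof
  fix w
  define P where "P w \<longleftrightarrow> w = replicate (length w) (Hg i)" for w
  have P: "P []" "P (g # v) \<longleftrightarrow> g = Hg i \<and> P v" for g v by (auto simp: P_def)
  have shift: "Hshift i a m w = (if P w \<and> length w \<le> m
     then of_nat (m choose length w) * a ^ (m - length w) else 0)" for m w
    by (simp add: Hshift_def P_def)
  show "fps_const (Hshift i a (Suc m) w) =
    conv (@) (mon [Hg i]) (\<lambda>w. fps_const (Hshift i a m w)) w + fps_const a * fps_const (Hshift i a m w)"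
  proof (cases w)
    case Nil
    then show ?thesis by (simp add: FA.conv_mon_left shift P)
  next
    case (Cons g v)
    define l where "l = length v"
    have split: "{u. [Hg i] @ u = w} = (if g = Hg i then {v} else {})" using Cons by auto
    show ?thesis
    proof (cases "g = Hg i \<and> P v")
      case True
      then have w: "P w" "length w = Suc l" and v: "P v" "length v = l" using Cons P by (auto simp: l_def)
      have "Hshift i a (Suc m) w = Hshift i a m v + a * Hshift i a m w"
      proof (cases "l < m")
        case True
        then have "a ^ (m - l) = a * a ^ (m - Suc l)" by (metis Suc_diff_Suc power_Suc)
        then show ?thesis using True by (simp add: shift w v algebra_simps)
      next
        case False
        then show ?thesis by (cases "l = m") (simp_all add: shift w v)
      qed
      then show ?thesis using True split by (simp add: FA.conv_mon_left)
    next
      case False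
      then have "\<not> P w" using Cons P by auto
      then show ?thesis using False split by (auto simp: FA.conv_mon_left shift)
    qed
  qed
qed

lemma Hshift_closed: "i \<in> {1..n} \<Longrightarrow> (\<lambda>w. fps_const (Hshift i a m w)) \<in> hcomplete (lists (gens n))"
proof (rule FA.hcomplete_finite)
  have "{w. fps_const (Hshift i a m w) \<noteq> 0} \<subseteq> (\<lambda>k. replicate k (Hg i)) ` {..m}"
  proof
    fix w assume "w \<in> {w. fps_const (Hshift i a m w) \<noteq> 0}"
    then have nz: "Hshift i a m w \<noteq> 0" by auto
    have "w = replicate (length w) (Hg i) \<and> length w \<le> m"
    proof (rule ccontr)
      assume "\<not> ?thesis"
      then have "Hshift i a m w = 0" unfolding Hshift_def by (rule if_not_P)
      with nz show False by contradiction
    qed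
    then show "w \<in> (\<lambda>k. replicate k (Hg i)) ` {..m}" by (intro image_eqI[of _ _ "length w"]) auto
  qed
  then show "finite {w. fps_const (Hshift i a m w) \<noteq> 0}" by (rule finite_subset) simp
  fix w assume "i \<in> {1..n}" "w \<notin> lists (gens n)"
  then have "w \<noteq> replicate (length w) (Hg i)" using Hg_word_closed by metis
  then show "fps_const (Hshift i a m w) = 0" by (simp add: Hshift_def)
qed

text \<open>From Hy = y(H + a) modulo the ideal follows H^m y = y(H + a)^m. The error at m + 1 is H
  times the error at m plus the basic relation times (H + a)^m.\<close>

lemma Hg_power_shift:
  assumes i: "i \<in> {1..n}" and y: "y \<in> hcomplete (lists (gens n))"
    and rel: "(\<lambda>w. conv (@) (mon [Hg i]) y w - conv (@) y (mon [Hg i]) w - fps_const a * y w) \<in> Uh_ideal n"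
  shows "(\<lambda>w. conv (@) (mon (replicate m (Hg i))) y w - conv (@) y (\<lambda>w. fps_const (Hshift i a m w)) w) \<in> Uh_ideal n"
    (is "?r m \<in> _")
proof (induction m)
  case 0
  have "(\<lambda>w. fps_const (Hshift i a 0 w)) = mon []"
    by (auto simp: Hshift_def mon_apply)
  then show ?case using J_zero[of n] by simp
next
  case (Suc m)
  let ?H = "mon [Hg i] :: gen list \<Rightarrow> complex fps" and ?S = "\<lambda>m w. fps_const (Hshift i a m w)"
  let ?d = "\<lambda>w. conv (@) ?H y w - conv (@) y ?H w - fps_const a * y w"
  have H: "?H \<in> hcomplete (lists (gens n))" using i by (intro FA.mon_closed) auto
  have S: "?S m \<in> hcomplete (lists (gens n))" by (rule Hshift_closed[OF i])
  have neg: "(\<lambda>w. f w - g w) = (\<lambda>w. f w + smul (- 1) g w)" for f g :: "gen list \<Rightarrow> complex fps"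
    by (simp add: smul_apply)
  have d: "conv (@) ?d (?S m) = (\<lambda>w. conv (@) ?H (conv (@) y (?S m)) w - conv (@) y (conv (@) ?H (?S m)) w
      - fps_const a * conv (@) y (?S m) w)"
  proof -
    have "?d = (\<lambda>w. conv (@) ?H y w + (smul (- 1) (conv (@) y ?H) w + smul (- fps_const a) y w))"
      by (rule ext) (simp add: smul_apply del: fps_const_neg)
    then have "conv (@) ?d (?S m) = (\<lambda>w. conv (@) ?H (conv (@) y (?S m)) w +
        (smul (- 1) (conv (@) y (conv (@) ?H (?S m))) w + smul (- fps_const a) (conv (@) y (?S m)) w))"
      by (simp only: FA.conv_add_left FA.conv_smul_left FA.conv_assoc)
    then show ?thesis by (rule trans) (rule ext, simp add: smul_apply del: fps_const_neg)
  qed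
  have "mon (replicate (Suc m) (Hg i)) = conv (@) ?H (mon (replicate m (Hg i)))"
    by (simp add: FA.conv_mon)
  then have 1: "conv (@) (mon (replicate (Suc m) (Hg i))) y = conv (@) ?H (conv (@) (mon (replicate m (Hg i))) y)"
    by (simp add: FA.conv_assoc)
  have 2: "conv (@) y (?S (Suc m)) =
      (\<lambda>w. conv (@) y (conv (@) ?H (?S m)) w + fps_const a * conv (@) y (?S m) w)"
  proof -
    have "?S (Suc m) = (\<lambda>w. conv (@) ?H (?S m) w + smul (fps_const a) (?S m) w)"
      unfolding Hshift_Suc by (simp add: smul_apply)
    then show ?thesis by (simp only: FA.conv_add_right FA.conv_smul_right) (simp add: smul_apply)
  qed
  have 3: "conv (@) ?H (?r m) = (\<lambda>w. conv (@) ?H (conv (@) (mon (replicate m (Hg i))) y) w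
      - conv (@) ?H (conv (@) y (?S m)) w)"
    unfolding neg FA.conv_add_right FA.conv_smul_right ..
  have "?r (Suc m) = (\<lambda>w. conv (@) ?H (?r m) w + conv (@) ?d (?S m) w)"
    unfolding 1 2 3 d by (simp add: fun_eq_iff)
  also have "\<dots> \<in> Uh_ideal n"
    by (intro J_add J_conv_left J_conv_right Suc rel H S)
  finally show ?case .
qed

text \<open>The error is h times an element of the ideal, which is stronger than membership. The
  extra factor is needed to pass from K to (K - 1)/(q - 1), because h may not be cancelled modulo
  the ideal.\<close>

lemma hexp_commute:
  assumes i: "i \<in> {1..n}" and y: "y \<in> hcomplete (lists (gens n))"
    and rel: "(\<lambda>w. conv (@) (mon [Hg i]) y w - conv (@) y (mon [Hg i]) w - fps_const a * y w) \<in> Uh_ideal n"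
  shows "\<exists>j\<in>Uh_ideal n. (\<lambda>w. conv (@) (hexp c i) y w - fps_exp (c * a) * conv (@) y (hexp c i) w) = smul fps_X j"
proof -
  define r where "r m = (\<lambda>w. conv (@) (mon (replicate m (Hg i))) y w - conv (@) y (\<lambda>w. fps_const (Hshift i a m w)) w)" for m
  have r: "r m \<in> Uh_ideal n" for m unfolding r_def by (rule Hg_power_shift[OF assms])
  define x where "x m = smul (fps_const (c ^ m / fact m)) (r m)" for m
  have x: "x m \<in> Uh_ideal n" for m unfolding x_def by (intro J_smul r)
  have 1: "(\<lambda>w. fps_exp (c * a) * conv (@) y (hexp c i) w) = conv (@) y (smul (fps_exp (c * a)) (hexp c i))"
    by (simp only: FA.conv_smul_right) (simp add: smul_def)
  have "(\<lambda>w. conv (@) (hexp c i) y w - fps_exp (c * a) * conv (@) y (hexp c i) w) =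
      (\<lambda>w. conv (@) (hexp c i) y w - conv (@) y (smul (fps_exp (c * a)) (hexp c i)) w)"
    using 1 by (simp add: fun_eq_iff)
  also have "\<dots> = FA.hsum x"
    unfolding hexp_shift_hsum
    unfolding hexp_hsum FA.conv_hsum_left FA.conv_hsum_right FA.hsum_diff FA.conv_smul_left FA.conv_smul_right
    by (rule arg_cong[of _ _ FA.hsum]) (simp add: fun_eq_iff x_def r_def smul_apply right_diff_distrib)
  \<comment> \<open>The term of index 0 in the series is 1y - y1 = 0, so the whole error carries a
    factor h.\<close>
  also have "\<dots> = smul fps_X (FA.hsum (\<lambda>m. x (Suc m)))"
  proof -
    have "(\<lambda>w. fps_const (Hshift i a 0 w)) = mon []"
      by (auto simp: Hshift_def mon_apply)
    then have "x 0 w = 0" for w by (simp add: x_def r_def smul_apply)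
    then show ?thesis using FA.hsum_0[of x] by (auto simp: smul_apply)
  qed
  finally show ?thesis using Uh_ideal_hsum[of "\<lambda>m. x (Suc m)" n] x by blast
qed

abbreviation (input) Xc :: "nat \<Rightarrow> gen \<Rightarrow> (gen list \<Rightarrow> complex fps) set" where
  "Xc n g \<equiv> Uh_class n (mon [g])"

lemma letter_closed [simp]: "g \<in> gens n \<Longrightarrow> mon [g] \<in> hcomplete (lists (gens n))"
  by (intro FA.mon_closed) auto

text \<open>The eigenvalue of ad H_i on the letter, hence the exponent of q when K_i moves past
  it.\<close>

definition weight :: "nat \<Rightarrow> gen \<Rightarrow> int" where
  "weight i g = (case g of Xp j \<Rightarrow> cartan i j | Xm j \<Rightarrow> - cartan i j | Hg j \<Rightarrow> 0)"

lemma Hg_letter: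
  assumes "i \<in> {1..n}" "g \<in> gens n"
  shows "(\<lambda>w. conv (@) (mon [Hg i]) (mon [g]) w - conv (@) (mon [g]) (mon [Hg i]) w
    - fps_const (of_int (weight i g)) * mon [g] w) \<in> Uh_ideal n"
proof -
  have m [simp]: "mon w \<in> hcomplete (lists (gens n))" if "set w \<subseteq> gens n" for w
    using that by (intro FA.mon_closed) auto
  have c: "(\<lambda>w. f w - g w) \<in> hcomplete (lists (gens n))"
    if "f \<in> hcomplete (lists (gens n))" "g \<in> hcomplete (lists (gens n))" for f g
    using FA.F.minus_closed[of f n g] that by (simp add: FA.F_minus)
  have k: "fps_const (of_int z) = (of_int z :: complex fps)" for z by (simp add: fps_of_int)
  have "(\<lambda>w. mon [Hg i, g] w - mon [g, Hg i] w - of_int (weight i g) * mon [g] w) \<in> Uh_ideal n"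
  proof (cases g)
    case (Xp j)
    then have j: "j \<in> {1..n}" using assms by simp
    have "mon [Hg i, Xp j] \<ominus>\<^bsub>FA n\<^esub> mon [Xp j, Hg i] \<ominus>\<^bsub>FA n\<^esub> smul (of_int (cartan i j)) (mon [Xp j]) \<in> Uh_rels n"
      unfolding Uh_rels_def
      by (rule UnI1, rule UnI1, rule UnI1, rule UnI2) (use assms(1) j in blast)
    from subsetD[OF Uh_rels_ideal this] show ?thesis
      using assms Xp by (simp add: FA.F_minus smul_apply c weight_def)
  next
    case (Xm j)
    then have j: "j \<in> {1..n}" using assms by simp
    have "mon [Hg i, Xm j] \<ominus>\<^bsub>FA n\<^esub> mon [Xm j, Hg i] \<oplus>\<^bsub>FA n\<^esub> smul (of_int (cartan i j)) (mon [Xm j]) \<in> Uh_rels n"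
      unfolding Uh_rels_def
      by (rule UnI1, rule UnI1, rule UnI2) (use assms(1) j in blast)
    from subsetD[OF Uh_rels_ideal this] show ?thesis
      using assms Xm by (simp add: FA.F_minus smul_apply c weight_def)
  next
    case (Hg j)
    then have j: "j \<in> {1..n}" using assms by simp
    have "mon [Hg i, Hg j] \<ominus>\<^bsub>FA n\<^esub> mon [Hg j, Hg i] \<in> Uh_rels n"
      unfolding Uh_rels_def
      by (rule UnI1, rule UnI1, rule UnI1, rule UnI1) (use assms(1) j in blast)
    from subsetD[OF Uh_rels_ideal this] show ?thesis
      using assms Hg by (simp add: FA.F_minus weight_def)
  qed
  then show ?thesis by (simp add: FA.conv_mon k)
qed

lemma hexp_letter_h:
  assumes "i \<in> {1..n}" "g \<in> gens n"
  shows "\<exists>j\<in>Uh_ideal n. (\<lambda>w. conv (@) (hexp c i) (mon [g]) w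
    - fps_exp (c * of_int (weight i g)) * conv (@) (mon [g]) (hexp c i) w) = smul fps_X j"
  using hexp_commute[OF assms(1) letter_closed[OF assms(2)] Hg_letter[OF assms]] .

lemma h_ideal_ideal:
  "(\<lambda>w. f w - g w) = smul fps_X j \<Longrightarrow> j \<in> Uh_ideal n \<Longrightarrow> (\<lambda>w. f w - g w) \<in> Uh_ideal n"
  using J_smul by simp

lemma hexp_letter:
  assumes "i \<in> {1..n}" "g \<in> gens n"
  shows "Uh_class n (hexp c i) \<otimes>\<^bsub>Uh n\<^esub> Xc n g =
    Uh_scalar n (fps_exp (c * of_int (weight i g))) \<otimes>\<^bsub>Uh n\<^esub> (Xc n g \<otimes>\<^bsub>Uh n\<^esub> Uh_class n (hexp c i))"
proof -
  let ?e = "fps_exp (c * of_int (weight i g))"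
  have "(\<lambda>w. conv (@) (hexp c i) (mon [g]) w - smul ?e (conv (@) (mon [g]) (hexp c i)) w) \<in> Uh_ideal n"
    using hexp_letter_h[OF assms, of c] h_ideal_ideal by (auto simp: smul_apply)
  then show ?thesis using assms
    by (simp add: Uh_class_eq_iff[symmetric] Uh_class_mult Uh_class_smul)
qed

text \<open>The exponential rule is used twice with eigenvalue 0: once to move exp(H_j) past the
  letter H_i, and once, with this whole exponential in the role of y, to move exp(H_i) past
  it.\<close>

lemma hexp_hexp:
  assumes "i \<in> {1..n}" "j \<in> {1..n}"
  shows "Uh_class n (hexp c i) \<otimes>\<^bsub>Uh n\<^esub> Uh_class n (hexp d j) = Uh_class n (hexp d j) \<otimes>\<^bsub>Uh n\<^esub> Uh_class n (hexp c i)"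
proof -
  have H: "Hg i \<in> gens n" "Hg j \<in> gens n" using assms by auto
  have "Uh_class n (hexp d j) \<otimes>\<^bsub>Uh n\<^esub> Xc n (Hg i) = Xc n (Hg i) \<otimes>\<^bsub>Uh n\<^esub> Uh_class n (hexp d j)"
    using hexp_letter[OF assms(2) H(1), of d] assms
    by (simp add: weight_def Uh_scalar_one)
  then have "(\<lambda>w. conv (@) (mon [Hg i]) (hexp d j) w - conv (@) (hexp d j) (mon [Hg i]) w
    - fps_const 0 * hexp d j w) \<in> Uh_ideal n"
    using assms by (simp add: Uh_class_eq_iff[symmetric] Uh_class_mult)
  from hexp_commute[OF assms(1) hexp_closed[OF assms(2)] this, of c]
  have "(\<lambda>w. conv (@) (hexp c i) (hexp d j) w - conv (@) (hexp d j) (hexp c i) w) \<in> Uh_ideal n"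
    using h_ideal_ideal by auto
  then show ?thesis using assms by (simp add: Uh_class_eq_iff[symmetric] Uh_class_mult)
qed

section \<open>The element \<open>(K - 1) / (q - 1)\<close>\<close>

definition Kpart :: "nat list \<Rightarrow> gen list \<Rightarrow> complex fps" where
  "Kpart is = foldr (\<lambda>i t. conv (@) (Kp i) t) is (mon [])"

lemma Kprod_Kpart: "Kprod n = Kpart [1..<n+1]"
  by (simp add: Kprod_def Kpart_def)

lemma Kpart_closed: "set is \<subseteq> {1..n} \<Longrightarrow> Kpart is \<in> hcomplete (lists (gens n))"
  by (induction "is") (auto simp: Kpart_def)

text \<open>The exponents add over the factors, and the factor h in the error survives each
  multiplication. Arbitrary lists make the induction possible; only [1..<n+1] is used in the
  end.\<close>

lemma Kpart_letter_h:
  assumes "g \<in> gens n" "set is \<subseteq> {1..n}"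
  shows "\<exists>j\<in>Uh_ideal n. (\<lambda>w. conv (@) (Kpart is) (mon [g]) w
    - fps_exp (of_int (\<Sum>i\<leftarrow>is. weight i g)) * conv (@) (mon [g]) (Kpart is) w) = smul fps_X j"
  using assms(2)
proof (induction "is")
  case Nil
  then show ?case using J_zero[of n] by (intro bexI[of _ "\<lambda>w. 0"]) (auto simp: Kpart_def smul_apply)
next
  case (Cons i "is")
  let ?g = "mon [g] :: gen list \<Rightarrow> complex fps"
  let ?e = "fps_exp (of_int (\<Sum>i\<leftarrow>is. weight i g)) :: complex fps" and ?f = "fps_exp (of_int (weight i g)) :: complex fps"
  obtain j where j: "j \<in> Uh_ideal n"
    "(\<lambda>w. conv (@) (Kpart is) ?g w - ?e * conv (@) ?g (Kpart is) w) = smul fps_X j"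
    using Cons by auto
  obtain k where k: "k \<in> Uh_ideal n"
    "(\<lambda>w. conv (@) (Kp i) ?g w - ?f * conv (@) ?g (Kp i) w) = smul fps_X k"
    using hexp_letter_h[of i n g 1] Cons assms by auto
  have 1: "conv (@) (Kpart is) ?g = (\<lambda>w. smul ?e (conv (@) ?g (Kpart is)) w + smul fps_X j w)"
    using fun_cong[OF j(2)] by (auto simp: smul_apply algebra_simps)
  have 2: "conv (@) (Kp i) ?g = (\<lambda>w. smul ?f (conv (@) ?g (Kp i)) w + smul fps_X k w)"
    using fun_cong[OF k(2)] by (auto simp: smul_apply algebra_simps)
  have "conv (@) (Kpart (i # is)) ?g = conv (@) (Kp i) (conv (@) (Kpart is) ?g)"
    by (simp add: Kpart_def FA.conv_assoc)
  also have "\<dots> = (\<lambda>w. smul ?e (conv (@) (conv (@) (Kp i) ?g) (Kpart is)) w + smul fps_X (conv (@) (Kp i) j) w)"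
    unfolding 1 FA.conv_add_right FA.conv_smul_right FA.conv_assoc ..
  also have "conv (@) (conv (@) (Kp i) ?g) (Kpart is) =
      (\<lambda>w. smul ?f (conv (@) ?g (Kpart (i # is))) w + smul fps_X (conv (@) k (Kpart is)) w)"
    unfolding 2 FA.conv_add_left FA.conv_smul_left FA.conv_assoc by (simp add: Kpart_def)
  finally have 3: "conv (@) (Kpart (i # is)) ?g w = ?e * (?f * conv (@) ?g (Kpart (i # is)) w + fps_X * conv (@) k (Kpart is) w)
      + fps_X * conv (@) (Kp i) j w" for w
    by (auto simp: smul_apply dest: fun_cong[of _ _ w])
  have ef: "?e * ?f = fps_exp (of_int (\<Sum>i\<leftarrow>i # is. weight i g))"
    by (simp add: add.commute flip: fps_exp_add_mult)
  then have "(\<lambda>w. conv (@) (Kpart (i # is)) ?g w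
      - fps_exp (of_int (\<Sum>i\<leftarrow>i # is. weight i g)) * conv (@) ?g (Kpart (i # is)) w)
    = smul fps_X (\<lambda>w. smul ?e (conv (@) k (Kpart is)) w + conv (@) (Kp i) j w)"
    unfolding 3 ef[symmetric] by (simp add: fun_eq_iff smul_apply algebra_simps)
  moreover have "(\<lambda>w. smul ?e (conv (@) k (Kpart is)) w + conv (@) (Kp i) j w) \<in> Uh_ideal n"
    using Cons.prems by (intro J_add J_smul J_conv_left J_conv_right j k Kpart_closed) auto
  ultimately show ?case by blast
qed

definition Lgen :: "nat \<Rightarrow> gen list \<Rightarrow> complex fps" where
  "Lgen n = sdiv (\<lambda>w. Kprod n w - mon [] w) (qh - 1)"

lemma Kprod_closed [simp]: "Kprod n \<in> hcomplete (lists (gens n))"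
  unfolding Kprod_Kpart by (rule Kpart_closed) auto

lemma Lgen_eq: "sdiv (Kprod n \<ominus>\<^bsub>FA n\<^esub> \<one>\<^bsub>FA n\<^esub>) (qh - 1) = Lgen n"
  by (simp add: Lgen_def FA.F_minus)

text \<open>The expansion K = 1 + h(H_1 + ... + H_n) + O(h^2). Its constant term makes (K - 1)/(q -
  1) an exact quotient, and its linear term gives the specialization of that quotient.\<close>

lemma Kpart_low:
  assumes "set is \<subseteq> {1..n}"
  shows "\<exists>u\<in>hcomplete (lists (gens n)). Kpart is =
    (\<lambda>w. mon [] w + fps_X * (\<Sum>i\<leftarrow>is. mon [Hg i] w) + fps_X * fps_X * u w)"
  using assms
proof (induction "is")
  case Nil
  then show ?case using FA.F.zero_closed[of n] by (intro bexI[of _ "\<lambda>w. 0"]) (auto simp: Kpart_def)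
next
  case (Cons i "is")
  let ?s = "\<lambda>w. \<Sum>i\<leftarrow>is. mon [Hg i] w :: complex fps" and ?H = "mon [Hg i] :: gen list \<Rightarrow> complex fps"
  obtain u where u: "u \<in> hcomplete (lists (gens n))"
    "Kpart is = (\<lambda>w. mon [] w + fps_X * ?s w + fps_X * fps_X * u w)"
    using Cons by auto
  have s: "?s \<in> hcomplete (lists (gens n))"
    using Cons.prems
  proof (induction "is")
    case Nil
    then show ?case using FA.F.zero_closed[of n] by simp
  qed auto
  define x where "x = (\<lambda>m. smul (fps_const (1 ^ m / fact m)) (mon (replicate m (Hg i)) :: gen list \<Rightarrow> complex fps))"
  define v where "v = FA.hsum (\<lambda>m. x (Suc (Suc m)))"
  have v: "v \<in> hcomplete (lists (gens n))"
    unfolding v_def x_def using Cons.prems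
    by (intro FA.hsum_closed FA.smul_closed FA.mon_closed Hg_word_closed) auto
  have K: "Kp i = (\<lambda>w. mon [] w + smul fps_X ?H w + smul (fps_X * fps_X) v w)"
  proof
    fix w
    have "Kp i w = FA.hsum x w" unfolding hexp_hsum x_def ..
    also have "\<dots> = x 0 w + fps_X * (x 1 w + fps_X * v w)"
      using FA.hsum_0[of x w] FA.hsum_0[of "\<lambda>m. x (Suc m)" w] by (simp add: v_def)
    finally show "Kp i w = mon [] w + smul fps_X ?H w + smul (fps_X * fps_X) v w"
      by (simp add: x_def smul_apply algebra_simps)
  qed
  have P: "Kpart is = (\<lambda>w. mon [] w + smul fps_X ?s w + smul (fps_X * fps_X) u w)"
    unfolding u(2) by (simp add: smul_apply)
  define t where "t = (\<lambda>w. u w + conv (@) ?H (\<lambda>w. ?s w + smul fps_X u w) w + conv (@) v (Kpart is) w)"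
  have "Kpart (i # is) = conv (@) (Kp i) (Kpart is)" by (simp add: Kpart_def)
  also have "\<dots> = (\<lambda>w. Kpart is w + smul fps_X (conv (@) ?H (Kpart is)) w + smul (fps_X * fps_X) (conv (@) v (Kpart is)) w)"
    unfolding K FA.conv_add_left FA.conv_smul_left by simp
  also have "conv (@) ?H (Kpart is) = (\<lambda>w. ?H w + fps_X * conv (@) ?H (\<lambda>w. ?s w + smul fps_X u w) w)"
  proof -
    have "Kpart is = (\<lambda>w. mon [] w + smul fps_X (\<lambda>w. ?s w + smul fps_X u w) w)"
      unfolding P by (simp add: smul_apply algebra_simps)
    then show ?thesis by (simp only: FA.conv_add_right FA.conv_smul_right FA.conv_one_right) (simp add: smul_apply)
  qed
  finally have "Kpart (i # is) = (\<lambda>w. mon [] w + fps_X * (\<Sum>i\<leftarrow>i # is. mon [Hg i] w) + fps_X * fps_X * t w)"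
    unfolding u(2) by (simp add: fun_eq_iff t_def smul_apply algebra_simps u(2))
  moreover have "t \<in> hcomplete (lists (gens n))"
    unfolding t_def using Cons.prems s u v Kpart_closed[of "is" n]
    by (intro FA.add_closed FA.conv_closed FA.smul_closed) auto
  ultimately show ?case by blast
qed

lemma Kprod_nth_0: "fps_nth (Kprod n w - mon [] w) 0 = 0"
proof -
  have "set [1..<n+1] \<subseteq> {1..n}" by auto
  then obtain u where "Kprod n = (\<lambda>w. mon [] w + fps_X * (\<Sum>i\<leftarrow>[1..<n+1]. mon [Hg i] w) + fps_X * fps_X * u w)"
    using Kpart_low[of "[1..<n+1]" n] unfolding Kprod_Kpart by blast
  then show ?thesis by (simp add: mult.assoc)
qed

lemma Lgen_mult: "smul (qh - 1) (Lgen n) = (\<lambda>w. Kprod n w - mon [] w)"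
  unfolding Lgen_def by (intro smul_sdiv Kprod_nth_0 qh_diff)

lemma Lgen_closed [simp]: "Lgen n \<in> hcomplete (lists (gens n))"
proof -
  have "(\<lambda>w. Kprod n w - mon [] w) \<in> hcomplete (lists (gens n))"
    using FA.F.minus_closed[of "Kprod n" n "mon []"] by (simp add: FA.F_minus)
  then show ?thesis unfolding Lgen_def by (intro sdiv_closed qh_diff)
qed

lemma fps_cancel_X: "fps_X * (a :: complex fps) = fps_X * b \<Longrightarrow> a = b"
  by (metis fps_X_neq_zero mult_cancel_left)

text \<open>The relation Kg = cgK + hj with j in the ideal is divided by q - 1 = hv in the free
  algebra, v being a unit. The error of the resulting relation for L is the inverse of v times j, so
  it lies in the ideal again.\<close>

lemma Lgen_letter:
  assumes g: "g \<in> gens n"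
  shows "\<exists>c d. c = 1 + (qh - 1) * d \<and>
    Uh_class n (Lgen n) \<otimes>\<^bsub>Uh n\<^esub> Xc n g =
      Uh_scalar n c \<otimes>\<^bsub>Uh n\<^esub> (Xc n g \<otimes>\<^bsub>Uh n\<^esub> Uh_class n (Lgen n)) \<oplus>\<^bsub>Uh n\<^esub> Uh_scalar n d \<otimes>\<^bsub>Uh n\<^esub> Xc n g"
proof -
  let ?g = "mon [g] :: gen list \<Rightarrow> complex fps"
  define z where "z = (\<Sum>i\<leftarrow>[1..<n+1]. weight i g)"
  define c where "c = (fps_exp (of_int z) :: complex fps)"
  \<comment> \<open>c is q to the total weight of g under H_1 + ... + H_n, so c - 1 has no constant
    term and the quotient is exact.\<close>
  define d where "d = (c - 1) / (qh - 1)"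
  have cd: "(qh - 1) * d = c - 1"
    unfolding d_def by (intro fps_mult_divide_simple qh_diff) (simp add: c_def)
  have "set [1..<n+1] \<subseteq> {1..n}" by auto
  then obtain j where j: "j \<in> Uh_ideal n"
    "(\<lambda>w. conv (@) (Kprod n) ?g w - c * conv (@) ?g (Kprod n) w) = smul fps_X j"
    using Kpart_letter_h[OF g, of "[1..<n+1]"] unfolding Kprod_Kpart c_def z_def by blast
  have K: "Kprod n = (\<lambda>w. mon [] w + smul (qh - 1) (Lgen n) w)" by (simp add: Lgen_mult)
  have Kg: "conv (@) (Kprod n) ?g = (\<lambda>w. ?g w + smul (qh - 1) (conv (@) (Lgen n) ?g) w)"
    unfolding K FA.conv_add_left FA.conv_smul_left FA.conv_one_left ..
  have gK: "conv (@) ?g (Kprod n) = (\<lambda>w. ?g w + smul (qh - 1) (conv (@) ?g (Lgen n)) w)"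
    unfolding K FA.conv_add_right FA.conv_smul_right FA.conv_one_right ..
  define Z where "Z = (\<lambda>w. conv (@) (Lgen n) ?g w - (smul c (conv (@) ?g (Lgen n)) w + smul d ?g w))"
  define v where "v = fps_shift 1 (qh - 1)"
  have v: "qh - 1 = fps_X * v" using qh_diff(3) by (simp add: v_def fps_eq_iff)
  \<comment> \<open>Both sides are coefficients in the free algebra, where cancelling h is
    legitimate.\<close>
  have "fps_X * (v * Z w) = fps_X * j w" for w
  proof -
    have "fps_X * (v * Z w) = (qh - 1) * Z w" by (simp add: v mult.assoc)
    also have "\<dots> = (qh - 1) * conv (@) (Lgen n) ?g w - c * ((qh - 1) * conv (@) ?g (Lgen n) w) - ((qh - 1) * d) * ?g w"
      by (simp add: Z_def smul_apply algebra_simps)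
    also have "\<dots> = conv (@) (Kprod n) ?g w - c * conv (@) ?g (Kprod n) w"
      unfolding cd Kg gK by (simp add: smul_apply algebra_simps)
    also have "\<dots> = fps_X * j w" using fun_cong[OF j(2), of w] by (simp add: smul_apply)
    finally show ?thesis .
  qed
  then have "v * Z w = j w" for w by (rule fps_cancel_X)
  then have "inverse v * (v * Z w) = inverse v * j w" for w by simp
  moreover have "fps_nth v 0 \<noteq> 0" using qh_diff(4) by (simp add: v_def)
  ultimately have "Z = smul (inverse v) j"
    by (simp add: fun_eq_iff smul_apply inverse_mult_eq_1 flip: mult.assoc)
  then have "Z \<in> Uh_ideal n" using J_smul j by simp
  then have "Uh_class n (conv (@) (Lgen n) ?g) = Uh_class n (\<lambda>w. smul c (conv (@) ?g (Lgen n)) w + smul d ?g w)"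
    unfolding Z_def using g by (subst Uh_class_eq_iff) auto
  then have "Uh_class n (Lgen n) \<otimes>\<^bsub>Uh n\<^esub> Xc n g =
      Uh_scalar n c \<otimes>\<^bsub>Uh n\<^esub> (Xc n g \<otimes>\<^bsub>Uh n\<^esub> Uh_class n (Lgen n)) \<oplus>\<^bsub>Uh n\<^esub> Uh_scalar n d \<otimes>\<^bsub>Uh n\<^esub> Xc n g"
    using g by (simp add: Uh_class_mult Uh_class_add Uh_class_smul)
  moreover have "c = 1 + (qh - 1) * d" by (simp add: cd)
  ultimately show ?thesis by blast
qed

section \<open>The comultiplication\<close>

abbreviation FAset :: "nat \<Rightarrow> (gen list \<Rightarrow> complex fps) set" where
  "FAset n \<equiv> hcomplete (lists (gens n))"

abbreviation FA2set :: "nat \<Rightarrow> (gen list \<times> gen list \<Rightarrow> complex fps) set" where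
  "FA2set n \<equiv> hcomplete (lists (gens n) \<times> lists (gens n))"

text \<open>The words that can influence coefficients up to h^m; by completeness there are finitely
  many.\<close>

definition low :: "('w \<Rightarrow> complex fps) \<Rightarrow> nat \<Rightarrow> 'w set" where
  "low f m = {w. \<exists>k\<le>m. fps_nth (f w) k \<noteq> 0}"

lemma low_finite: "f \<in> FAset n \<Longrightarrow> finite (low f m)" "F \<in> FA2set n \<Longrightarrow> finite (low F m)"
  unfolding low_def by (rule FA.hcomplete_low_finite FA2.hcomplete_low_finite, assumption)+

lemma low_subset:
  assumes "f \<in> FAset n" shows "low f m \<subseteq> lists (gens n)"
proof
  fix w assume w: "w \<in> low f m"
  show "w \<in> lists (gens n)"
  proof (rule ccontr)
    assume "w \<notin> lists (gens n)"
    then have "f w = 0" by (rule FA.hcompleteD(2)[OF assms])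
    then show False using w by (simp add: low_def)
  qed
qed

lemma not_low:
  assumes "w \<notin> low f m" "k \<le> m" shows "fps_nth (f w * a) k = 0"
  using assms by (auto simp: low_def fps_mult_nth intro!: sum.neutral)

lemma low_multD:
  assumes "k \<le> m"
  shows "fps_nth (f w * a) k \<noteq> 0 \<Longrightarrow> w \<in> low f m"
    and "fps_nth (a * f w) k \<noteq> 0 \<Longrightarrow> w \<in> low f m"
proof -
  have *: "fps_nth (f w * a) k = 0" if "w \<notin> low f m" using that assms by (rule not_low)
  show "fps_nth (f w * a) k \<noteq> 0 \<Longrightarrow> w \<in> low f m" by (erule contrapos_np) (rule *)
  show "fps_nth (a * f w) k \<noteq> 0 \<Longrightarrow> w \<in> low f m"
    unfolding mult.commute[of a] by (erule contrapos_np) (rule *)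
qed

lemma fps_mult_cong_low:
  assumes "\<And>k. k \<le> m \<Longrightarrow> fps_nth a k = fps_nth a' k" "\<And>k. k \<le> m \<Longrightarrow> fps_nth b k = fps_nth b' k"
  shows "fps_nth (a * b) m = fps_nth (a' * b' :: complex fps) m"
  unfolding fps_mult_nth by (intro sum.cong refl arg_cong2[of _ _ _ _ "(*)"]) (use assms in auto)

lemma ftens_closed [simp]:
  assumes f: "f \<in> FAset n" and g: "g \<in> FAset n" shows "ftens f g \<in> FA2set n"
proof (rule FA2.hcompleteI)
  fix p assume "p \<notin> lists (gens n) \<times> lists (gens n)"
  then have "fst p \<notin> lists (gens n) \<or> snd p \<notin> lists (gens n)" by (cases p) auto
  then show "ftens f g p = 0"
    using FA.hcompleteD(2)[OF f, of "fst p"] FA.hcompleteD(2)[OF g, of "snd p"]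
    by (cases p) (auto simp: ftens_def)
next
  fix m
  have "{p. fps_nth (ftens f g p) m \<noteq> 0} \<subseteq> low f m \<times> low g m"
  proof
    fix p assume "p \<in> {p. fps_nth (ftens f g p) m \<noteq> 0}"
    then have *: "fps_nth (f (fst p) * g (snd p)) m \<noteq> 0" by (cases p) (simp add: ftens_def)
    then have "fst p \<in> low f m" "snd p \<in> low g m" by (rule low_multD[OF order_refl])+
    then show "p \<in> low f m \<times> low g m" by (cases p) auto
  qed
  then show "finite {p. fps_nth (ftens f g p) m \<noteq> 0}"
    by (rule finite_subset) (intro finite_cartesian_product low_finite(1)[OF f] low_finite(1)[OF g])
qed

lemma ftens_mon: "ftens (mon u) (mon v) = mon (u, v)"
  by (auto simp: ftens_def mon_apply)

lemma ftens_add: "ftens (\<lambda>w. f w + g w) h = (\<lambda>p. ftens f h p + ftens g h p)"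
  "ftens h (\<lambda>w. f w + g w) = (\<lambda>p. ftens h f p + ftens h g p)"
  by (auto simp: ftens_def algebra_simps)

lemma ftens_diff: "ftens (\<lambda>w. f w - g w) h = (\<lambda>p. ftens f h p - ftens g h p)"
  "ftens h (\<lambda>w. f w - g w) = (\<lambda>p. ftens h f p - ftens h g p)"
  by (auto simp: ftens_def algebra_simps)

lemma ftens_smul: "ftens (smul c f) h = smul c (ftens f h)" "ftens h (smul c f) = smul c (ftens h f)"
  by (auto simp: ftens_def smul_apply)

lemma ftens_conv:
  "conv append2 (ftens f g) (ftens f' g') = ftens (conv (@) f f') (conv (@) g g')"
proof
  fix p :: "gen list \<times> gen list"
  obtain w z where p: "p = (w, z)" by (cases p)
  have "conv append2 (ftens f g) (ftens f' g') (w, z) =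
    (\<Sum>r | append2 (fst r) (snd r) = (w, z). ftens f g (fst r) * ftens f' g' (snd r))"
    by (rule FA2.conv_alt)
  also have "\<dots> = (\<Sum>(s, t)\<in>{s. fst s @ snd s = w} \<times> {t. fst t @ snd t = z}.
      (f (fst s) * f' (snd s)) * (g (fst t) * g' (snd t)))"
    by (rule sum.reindex_bij_witness[of _ "\<lambda>((a, c), (b, d)). ((a, b), (c, d))"
          "\<lambda>((a, b), (c, d)). ((a, c), (b, d))"]) (auto simp: ftens_def mult_ac)
  also have "\<dots> = ftens (conv (@) f f') (conv (@) g g') (w, z)"
    by (simp add: sum.cartesian_product[symmetric] ftens_def FA.conv_alt sum_product)
  finally show "conv append2 (ftens f g) (ftens f' g') p = ftens (conv (@) f f') (conv (@) g g') p"
    using p by simp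
qed

lemma comult_gen_closed: "g \<in> gens n \<Longrightarrow> comult_gen n g \<in> FA2set n"
  by (cases g) (auto intro!: FA2.add_closed ftens_closed)

lemma comult_word_Nil [simp]: "comult_word n [] = mon ([], [])"
  by (simp add: comult_word_def)

lemma comult_word_Cons [simp]: "comult_word n (g # w) = conv append2 (comult_gen n g) (comult_word n w)"
  by (simp add: comult_word_def)

lemma comult_word_closed: "w \<in> lists (gens n) \<Longrightarrow> comult_word n w \<in> FA2set n"
  by (induction w) (auto intro!: FA2.conv_closed comult_gen_closed FA2.mon_closed)

lemma comult_word_append: "comult_word n (u @ v) = conv append2 (comult_word n u) (comult_word n v)"
  by (induction u) (simp_all add: FA2.conv_assoc)

lemma low_mono: "k \<le> m \<Longrightarrow> low f k \<subseteq> low f m"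
  unfolding low_def by auto (meson le_trans)

text \<open>Any finite set containing \<open>low f m\<close> may index the sum, so that several
  functions can be treated over a common index set.\<close>

lemma comult_FA_nth:
  assumes "finite A" "low f m \<subseteq> A"
  shows "fps_nth (comult_FA n f p) m = fps_nth (\<Sum>w\<in>A. f w * comult_word n w p) m"
proof -
  have "(\<Sum>w\<in>low f m. fps_nth (f w * comult_word n w p) m) = (\<Sum>w\<in>A. fps_nth (f w * comult_word n w p) m)"
  proof (rule sum.mono_neutral_left)
    show "\<forall>w\<in>A - low f m. fps_nth (f w * comult_word n w p) m = 0"
      by (intro ballI not_low[OF _ order_refl]) simp
  qed (use assms in auto)
  then show ?thesis by (simp add: comult_FA_def fps_sum_nth flip: low_def)
qed

lemma comult_FA_add:
  assumes "f \<in> FAset n" "g \<in> FAset n"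
  shows "comult_FA n (\<lambda>w. f w + g w) = (\<lambda>p. comult_FA n f p + comult_FA n g p)"
proof (rule ext, rule fps_ext)
  fix p m
  let ?A = "low f m \<union> low g m"
  have A: "finite ?A" using assms low_finite(1) by blast
  moreover have "low (\<lambda>w. f w + g w) m \<subseteq> ?A" by (auto simp: low_def)
  ultimately show "fps_nth (comult_FA n (\<lambda>w. f w + g w) p) m = fps_nth (comult_FA n f p + comult_FA n g p) m"
    by (simp add: comult_FA_nth[of ?A] distrib_right sum.distrib)
qed

lemma comult_FA_smul:
  assumes "f \<in> FAset n"
  shows "comult_FA n (smul c f) = smul c (comult_FA n f)"
proof (rule ext, rule fps_ext)
  fix p m
  let ?A = "low f m"
  have A: "finite ?A" using assms low_finite(1) by blast
  have "low (smul c f) m \<subseteq> ?A"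
    proof
    fix w assume "w \<in> low (smul c f) m"
    then obtain k where "k \<le> m" "fps_nth (c * f w) k \<noteq> 0" by (auto simp: low_def smul_apply)
    then show "w \<in> low f m" by (rule low_multD(2))
  qed
  then have "fps_nth (comult_FA n (smul c f) p) m = fps_nth (c * (\<Sum>w\<in>?A. f w * comult_word n w p)) m"
    using A by (simp add: comult_FA_nth[of ?A] smul_apply sum_distrib_left mult.assoc)
  also have "\<dots> = fps_nth (c * comult_FA n f p) m"
    by (rule fps_mult_cong_low) (use comult_FA_nth[OF A low_mono] in simp_all)
  finally show "fps_nth (comult_FA n (smul c f) p) m = fps_nth (smul c (comult_FA n f) p) m"
    by (simp add: smul_apply)
qed

lemma comult_FA_closed:
  assumes f: "f \<in> FAset n" shows "comult_FA n f \<in> FA2set n"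
proof (rule FA2.hcompleteI)
  have sub: "w \<in> lists (gens n)" if "w \<in> low f m" for w m
    using low_subset[OF f] that by blast
  fix p :: "gen list \<times> gen list" assume p: "p \<notin> lists (gens n) \<times> lists (gens n)"
  have "fps_nth (comult_FA n f p) m = 0" for m
    unfolding comult_FA_nth[OF low_finite(1)[OF f] order_refl]
    using FA2.hcompleteD(2)[OF comult_word_closed[OF sub] p] by (simp add: sum.neutral)
  then show "comult_FA n f p = 0" by (simp add: fps_eq_iff)
next
  have sub: "w \<in> lists (gens n)" if "w \<in> low f m" for w m
    using low_subset[OF f] that by blast
  fix m
  have "{p. fps_nth (comult_FA n f p) m \<noteq> 0} \<subseteq> (\<Union>w\<in>low f m. low (comult_word n w) m)"
  proof
    fix p assume "p \<in> {p. fps_nth (comult_FA n f p) m \<noteq> 0}"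
    then have "(\<Sum>w\<in>low f m. fps_nth (f w * comult_word n w p) m) \<noteq> 0"
      by (simp add: comult_FA_def flip: low_def)
    then obtain w where w: "w \<in> low f m" "fps_nth (f w * comult_word n w p) m \<noteq> 0"
      by (rule sum.not_neutral_contains_not_neutral)
    then have "p \<in> low (comult_word n w) m" by (intro low_multD(2)[OF order_refl])
    then show "p \<in> (\<Union>w\<in>low f m. low (comult_word n w) m)" using w by blast
  qed
  moreover have "finite (\<Union>w\<in>low f m. low (comult_word n w) m)"
    using low_finite(1)[OF f] low_finite(2)[OF comult_word_closed[OF sub]] by blast
  ultimately show "finite {p. fps_nth (comult_FA n f p) m \<noteq> 0}" by (rule finite_subset)
qed

lemma comult_FA_mon: "w \<in> lists (gens n) \<Longrightarrow> comult_FA n (mon w) = comult_word n w"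
proof (rule ext, rule fps_ext)
  fix p m
  have "low (mon w) m \<subseteq> {w}" by (auto simp: low_def mon_apply)
  then show "fps_nth (comult_FA n (mon w) p) m = fps_nth (comult_word n w p) m"
    using comult_FA_nth[of "{w}" "mon w" m n p] by (simp add: mon_apply)
qed

lemma low_conv:
  fixes f g :: "gen list \<Rightarrow> complex fps"
  shows "low (conv (@) f g) m \<subseteq> (\<lambda>(u, v). u @ v) ` (low f m \<times> low g m)"
proof
  fix w assume "w \<in> low (conv (@) f g) m"
  then obtain k where k: "k \<le> m" "fps_nth (conv (@) f g w) k \<noteq> 0" by (auto simp: low_def)
  then have "(\<Sum>p | fst p @ snd p = w. fps_nth (f (fst p) * g (snd p)) k) \<noteq> 0"
    unfolding FA.conv_alt fps_sum_nth by simp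
  then obtain p where p: "p \<in> {p. fst p @ snd p = w}" "fps_nth (f (fst p) * g (snd p)) k \<noteq> 0"
    by (rule sum.not_neutral_contains_not_neutral)
  from p(2) have "fst p \<in> low f m" "snd p \<in> low g m" by (rule low_multD[OF k(1)])+
  then show "w \<in> (\<lambda>(u, v). u @ v) ` (low f m \<times> low g m)"
    using p(1) by (cases p) (auto intro!: image_eqI[of _ _ p])
qed

text \<open>In degree m only words u in \<open>low f m\<close> and v in \<open>low g m\<close>
  contribute. Over these finite sets the identity reduces to multiplicativity on words and a
  rearrangement of sums.\<close>

lemma comult_FA_mult:
  assumes f: "f \<in> FAset n" and g: "g \<in> FAset n"
  shows "comult_FA n (conv (@) f g) = conv append2 (comult_FA n f) (comult_FA n g)"
proof (rule ext, rule fps_ext)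
  fix p m
  define A where "A = low f m"
  define B where "B = low g m"
  define C where "C = (\<lambda>r. fst r @ snd r) ` (A \<times> B)"
  let ?t = "\<lambda>r. f (fst r) * g (snd r) * comult_word n (fst r @ snd r) p"
  have fin: "finite A" "finite B" "finite C" using low_finite(1)[OF f] low_finite(1)[OF g] by (simp_all add: A_def B_def C_def)
  have low: "low (conv (@) f g) m \<subseteq> C" using low_conv[of f g m] by (simp add: C_def A_def B_def case_prod_unfold)
  have out: "fps_nth (?t r) m = 0" if r: "r \<notin> A \<times> B" for r
  proof -
    from r consider "fst r \<notin> low f m" | "snd r \<notin> low g m" by (cases r) (auto simp: A_def B_def)
    then show ?thesis
    proof cases
      assume "fst r \<notin> low f m" then show ?thesis unfolding mult.assoc by (rule not_low) simp
    next
      assume "snd r \<notin> low g m"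
      then have "fps_nth (g (snd r) * (f (fst r) * comult_word n (fst r @ snd r) p)) m = 0" by (rule not_low) simp
      then show ?thesis by (simp add: mult_ac)
    qed
  qed
  have "fps_nth (comult_FA n (conv (@) f g) p) m =
      (\<Sum>w\<in>C. \<Sum>r | fst r @ snd r = w. fps_nth (?t r) m)"
    unfolding comult_FA_nth[OF fin(3) low]
    unfolding FA.conv_alt fps_sum_nth sum_distrib_right by (intro sum.cong refl) auto
  also have "\<dots> = (\<Sum>w\<in>C. \<Sum>r\<in>{r \<in> A \<times> B. fst r @ snd r = w}. fps_nth (?t r) m)"
    using out by (intro sum.cong refl sum.mono_neutral_right FA.finite_splits) auto
  also have "\<dots> = (\<Sum>r\<in>A \<times> B. fps_nth (?t r) m)"
    unfolding C_def by (rule sum.image_gen[symmetric]) (use fin in auto)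
  also have "\<dots> = (\<Sum>r\<in>A \<times> B. \<Sum>s | append2 (fst s) (snd s) = p.
      fps_nth (f (fst r) * comult_word n (fst r) (fst s) * (g (snd r) * comult_word n (snd r) (snd s))) m)"
    by (simp add: comult_word_append FA2.conv_alt sum_distrib_left fps_sum_nth mult_ac)
  also have "\<dots> = (\<Sum>s | append2 (fst s) (snd s) = p. \<Sum>r\<in>A \<times> B.
      fps_nth (f (fst r) * comult_word n (fst r) (fst s) * (g (snd r) * comult_word n (snd r) (snd s))) m)"
    by (rule sum.swap)
  also have "\<dots> = (\<Sum>s | append2 (fst s) (snd s) = p.
      fps_nth ((\<Sum>u\<in>A. f u * comult_word n u (fst s)) * (\<Sum>v\<in>B. g v * comult_word n v (snd s))) m)"
    by (simp add: sum_product sum.cartesian_product fps_sum_nth case_prod_unfold)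
  also have "\<dots> = (\<Sum>s | append2 (fst s) (snd s) = p. fps_nth (comult_FA n f (fst s) * comult_FA n g (snd s)) m)"
    by (intro sum.cong refl fps_mult_cong_low comult_FA_nth[symmetric] fin)
      (simp_all add: A_def B_def low_mono)
  finally show "fps_nth (comult_FA n (conv (@) f g) p) m =
      fps_nth (conv append2 (comult_FA n f) (comult_FA n g) p) m"
    by (simp add: FA2.conv_alt fps_sum_nth)
qed

lemma comult_FA_hom: "comult_FA n \<in> Ring.ring_hom (FA n) (FA2 n)"
proof (rule ring_hom_memI)
  show "comult_FA n \<one>\<^bsub>FA n\<^esub> = \<one>\<^bsub>FA2 n\<^esub>" using comult_FA_mon[of "[]" n] by simp
qed (simp_all add: comult_FA_closed comult_FA_add comult_FA_mult)

lemma comult_FA_hsum: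
  assumes x: "\<And>m. x m \<in> FAset n"
  shows "comult_FA n (FA.hsum x) = FA2.hsum (\<lambda>m. comult_FA n (x m))"
proof (rule ext, rule FA2.fps_eq_mod)
  fix p M
  have c: "(\<lambda>w. \<Sum>m<M. smul (fps_X ^ m) (x m) w) \<in> FAset n \<and>
      comult_FA n (\<lambda>w. \<Sum>m<M. smul (fps_X ^ m) (x m) w) = (\<lambda>p. \<Sum>m<M. fps_X ^ m * comult_FA n (x m) p)" for M
  proof (induction M)
    case 0
    have "(\<lambda>w. 0) \<in> FAset n" using FA.F.zero_closed[of n] by simp
    moreover from comult_FA_smul[OF this, of 0] have "comult_FA n (\<lambda>w. 0) = (\<lambda>p. 0)"
      by (simp add: smul_def)
    ultimately show ?case by simp
  next
    case (Suc M)
    then show ?case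
      using FA.add_closed[of "\<lambda>w. \<Sum>m<M. smul (fps_X ^ m) (x m) w" n "smul (fps_X ^ M) (x M)"]
        comult_FA_add[of "\<lambda>w. \<Sum>m<M. smul (fps_X ^ m) (x m) w" n "smul (fps_X ^ M) (x M)"] x
      by (simp add: comult_FA_smul) (simp add: smul_apply)
  qed
  let ?y = "FA.hsum (\<lambda>m. x (m + M))"
  have y: "?y \<in> FAset n" using x by (rule FA.hsum_closed)
  define t where "t = (\<lambda>w. \<Sum>m<M. smul (fps_X ^ m) (x m) w)"
  have t: "t \<in> FAset n" "comult_FA n t = (\<lambda>p. \<Sum>m<M. fps_X ^ m * comult_FA n (x m) p)"
    using c[of M] by (simp_all add: t_def)
  have "FA.hsum x = (\<lambda>w. t w + smul (fps_X ^ M) ?y w)"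
    using FA.hsum_split[of x _ M] by (simp add: fun_eq_iff t_def smul_apply)
  then have "comult_FA n (FA.hsum x) = (\<lambda>p. comult_FA n t p + smul (fps_X ^ M) (comult_FA n ?y) p)"
    by (simp only: comult_FA_add[OF t(1) FA.smul_closed[OF y]] comult_FA_smul[OF y])
  then have "comult_FA n (FA.hsum x) p = (\<Sum>m<M. fps_X ^ m * comult_FA n (x m) p) + fps_X ^ M * comult_FA n ?y p"
    unfolding t(2) by (simp add: smul_apply)
  then show "\<exists>c. comult_FA n (FA.hsum x) p - FA2.hsum (\<lambda>m. comult_FA n (x m)) p = fps_X ^ M * c"
    using FA2.hsum_split[of "\<lambda>m. comult_FA n (x m)" p M] by (auto simp flip: right_diff_distrib)
qed

text \<open>The coefficients of (H \<otimes> 1 + 1 \<otimes> H)^m: the first letter goes to one of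
  the two sides, which is the recursion of Pascal.\<close>

lemma comult_Hg_power:
  "comult_word n (replicate m (Hg i)) (u, v) =
    (if u = replicate (length u) (Hg i) \<and> v = replicate (length v) (Hg i) \<and> length u + length v = m
     then of_nat (m choose length u) else 0)"
proof -
  define P where "P w \<longleftrightarrow> w = replicate (length w) (Hg i)" for w
  have P: "P []" "P (g # v) \<longleftrightarrow> g = Hg i \<and> P v" for g v by (auto simp: P_def)
  have "comult_word n (replicate m (Hg i)) (u, v) =
    (if P u \<and> P v \<and> length u + length v = m then of_nat (m choose length u) else 0)"
  proof (induction m arbitrary: u v)
    case 0
    then show ?case by (auto simp: mon_apply P)
  next
    case (Suc m)
    let ?C = "comult_word n (replicate m (Hg i))"
    have left: "(\<Sum>q | append2 ([Hg i], []) q = (u, v). ?C q) =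
      (case u of [] \<Rightarrow> 0 | g # u' \<Rightarrow> if g = Hg i then ?C (u', v) else 0)"
    proof (cases u)
      case (Cons g u')
      then have "{q. append2 ([Hg i], []) q = (u, v)} = (if g = Hg i then {(u', v)} else {})" by auto
      then show ?thesis using Cons by auto
    qed (auto intro!: sum.neutral)
    have right: "(\<Sum>q | append2 ([], [Hg i]) q = (u, v). ?C q) =
      (case v of [] \<Rightarrow> 0 | g # v' \<Rightarrow> if g = Hg i then ?C (u, v') else 0)"
    proof (cases v)
      case (Cons g v')
      then have "{q. append2 ([], [Hg i]) q = (u, v)} = (if g = Hg i then {(u, v')} else {})" by auto
      then show ?thesis using Cons by auto
    qed (auto intro!: sum.neutral)
    have "comult_word n (replicate (Suc m) (Hg i)) (u, v) =
      (\<Sum>q | append2 ([Hg i], []) q = (u, v). ?C q) + (\<Sum>q | append2 ([], [Hg i]) q = (u, v). ?C q)"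
      by (simp only: replicate_Suc comult_word_Cons comult_gen.simps FA2_simps ftens_mon
          FA2.conv_add_left FA2.conv_mon_left)
    then show ?case
      unfolding left right
      by (cases u; cases v) (auto simp: Suc.IH P simp del: comult_word_Cons replicate_Suc)
  qed
  then show ?thesis by (simp add: P_def)
qed

lemma hexp_replicate: "hexp c i (replicate k (Hg i)) = fps_const (c ^ k / fact k) * fps_X ^ k"
  by (simp add: hexp_def)

lemma hexp_other: "\<not> (\<exists>k. w = replicate k (Hg i)) \<Longrightarrow> hexp c i w = 0"
  by (auto simp: hexp_def)

text \<open>Exponentials of primitive elements are group-like. On coefficients this says that
  binomial(k + l, k) / (k + l)! equals 1 / (k! l!).\<close>

lemma comult_hexp:
  assumes i: "i \<in> {1..n}" shows "comult_FA n (hexp c i) = ftens (hexp c i) (hexp c i)"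
proof -
  have D: "comult_FA n (smul (fps_const (c ^ m / fact m)) (mon (replicate m (Hg i)))) =
      (\<lambda>p. fps_const (c ^ m / fact m * (if fst p = replicate (length (fst p)) (Hg i) \<and>
         snd p = replicate (length (snd p)) (Hg i) \<and> length (fst p) + length (snd p) = m
         then of_nat (m choose length (fst p)) else 0)))" for m
  proof
    fix p
    show "comult_FA n (smul (fps_const (c ^ m / fact m)) (mon (replicate m (Hg i)))) p =
      fps_const (c ^ m / fact m * (if fst p = replicate (length (fst p)) (Hg i) \<and>
         snd p = replicate (length (snd p)) (Hg i) \<and> length (fst p) + length (snd p) = m
         then of_nat (m choose length (fst p)) else 0))"
      using comult_Hg_power[of n m i "fst p" "snd p"] Hg_word_closed[OF i]
      by (simp add: comult_FA_smul comult_FA_mon smul_apply fps_of_nat[symmetric])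
  qed
  have "comult_FA n (hexp c i) p = ftens (hexp c i) (hexp c i) p" for p
  proof -
    obtain u v where p: "p = (u, v)" by (cases p)
    have "comult_FA n (hexp c i) p = Abs_fps (\<lambda>N. c ^ N / fact N * (if u = replicate (length u) (Hg i) \<and>
         v = replicate (length v) (Hg i) \<and> length u + length v = N
         then of_nat (N choose length u) else 0))"
    proof -
      have "comult_FA n (hexp c i) = FA2.hsum (\<lambda>m. comult_FA n (smul (fps_const (c ^ m / fact m)) (mon (replicate m (Hg i)))))"
        unfolding hexp_hsum[of c i]
        by (rule comult_FA_hsum) (intro FA.smul_closed FA.mon_closed Hg_word_closed i)
      then show ?thesis unfolding D p
        by (simp add: FA2.hsum_def fps_eq_iff)
    qed
    also have "\<dots> = ftens (hexp c i) (hexp c i) p"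
    proof (cases "(\<exists>k. u = replicate k (Hg i)) \<and> (\<exists>l. v = replicate l (Hg i))")
      case True
      then obtain k l where uv: "u = replicate k (Hg i)" "v = replicate l (Hg i)" by blast
      have "ftens (hexp c i) (hexp c i) p = fps_const (c ^ (k + l) / (fact k * fact l)) * fps_X ^ (k + l)"
      proof -
        have "ftens (hexp c i) (hexp c i) p =
            (fps_const (c ^ k / fact k) * fps_const (c ^ l / fact l)) * (fps_X ^ k * fps_X ^ l)"
          unfolding p uv ftens_def by (simp only: hexp_replicate prod.case mult_ac)
        then show ?thesis by (simp add: power_add)
      qed
      moreover have "of_nat ((k + l) choose k) / fact (k + l) = (1 / (fact k * fact l) :: complex)"
        by (simp add: binomial_fact[of k "k + l"])
      then have "c ^ (k + l) / fact (k + l) * of_nat ((k + l) choose k) = c ^ (k + l) / (fact k * fact l)"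
        by (metis (no_types, opaque_lifting) mult.right_neutral times_divide_eq_left times_divide_eq_right)
      ultimately show ?thesis unfolding uv
        by (intro fps_ext) simp
    next
      case False
      then have "\<not> (u = replicate (length u) (Hg i) \<and> v = replicate (length v) (Hg i))" by blast
      moreover from False hexp_other have "hexp c i u = 0 \<or> hexp c i v = 0" by blast
      then have "ftens (hexp c i) (hexp c i) p = 0" by (auto simp: p ftens_def)
      ultimately show ?thesis by (intro fps_ext) auto
    qed
    finally show ?thesis .
  qed
  then show ?thesis by (rule ext)
qed

section \<open>The completed tensor square as a quotient, and its pure tensors\<close>

abbreviation J2gen :: "nat \<Rightarrow> (gen list \<times> gen list \<Rightarrow> complex fps) set" where
  "J2gen n \<equiv> {ftens r (mon []) | r. r \<in> Uh_ideal n} \<union> {ftens (mon []) r | r. r \<in> Uh_ideal n}"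

lemma J2gen_closed: "J2gen n \<subseteq> carrier (FA2 n)"
proof -
  have "mon [] \<in> FAset n" by simp
  then show ?thesis using J_carrier by auto
qed

lemma Uh2_ideal_ideal: "ideal (Uh2_ideal n) (FA2 n)"
  unfolding Uh2_ideal_def by (intro FA2.ideal_hclosure FA2.F.genideal_ideal J2gen_closed)

lemma J2gen_ideal: "J2gen n \<subseteq> Uh2_ideal n"
proof -
  have I: "ideal (Idl\<^bsub>FA2 n\<^esub> (J2gen n)) (FA2 n)" by (rule FA2.F.genideal_ideal[OF J2gen_closed])
  have "Idl\<^bsub>FA2 n\<^esub> (J2gen n) \<subseteq> FA2set n"
    using additive_subgroup.a_subset[OF ideal.axioms(1)[OF I]] by simp
  then have "Idl\<^bsub>FA2 n\<^esub> (J2gen n) \<subseteq> Uh2_ideal n"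
    unfolding Uh2_ideal_def by (rule FA2.hclosure_incl)
  then show ?thesis using FA2.F.genideal_self[OF J2gen_closed] by blast
qed

lemma Uh2_ideal_closed:
  assumes "x \<in> FA2set n"
    and "\<And>m. \<exists>s\<in>Uh2_ideal n. \<exists>u\<in>FA2set n. x = (\<lambda>w. s w + fps_X ^ m * u w)"
  shows "x \<in> Uh2_ideal n"
  using assms unfolding Uh2_ideal_def
  by (intro FA2.hclosure_closed FA2.F.genideal_ideal J2gen_closed)

lemma Uh2_ring: "ring (Uh2 n)"
  unfolding Uh2_def by (rule ideal.quotient_is_ring[OF Uh2_ideal_ideal])

interpretation Uh2: ring "Uh2 n" for n by (rule Uh2_ring)

definition cl2 :: "nat \<Rightarrow> (gen list \<times> gen list \<Rightarrow> complex fps) \<Rightarrow> (gen list \<times> gen list \<Rightarrow> complex fps) set" where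
  "cl2 n F = Uh2_ideal n +>\<^bsub>FA2 n\<^esub> F"

lemma cl2_hom: "cl2 n \<in> Ring.ring_hom (FA2 n) (Uh2 n)"
  unfolding cl2_def[abs_def] Uh2_def by (rule coset_ring_hom[OF Uh2_ideal_ideal])

lemma cl2_closed [simp]: "F \<in> FA2set n \<Longrightarrow> cl2 n F \<in> carrier (Uh2 n)"
  using ring_hom_closed[OF cl2_hom] by simp

lemma cl2_mult: "F \<in> FA2set n \<Longrightarrow> G \<in> FA2set n \<Longrightarrow> cl2 n (conv append2 F G) = cl2 n F \<otimes>\<^bsub>Uh2 n\<^esub> cl2 n G"
  using ring_hom_mult[OF cl2_hom, of F n G] by simp

lemma cl2_add: "F \<in> FA2set n \<Longrightarrow> G \<in> FA2set n \<Longrightarrow> cl2 n (\<lambda>w. F w + G w) = cl2 n F \<oplus>\<^bsub>Uh2 n\<^esub> cl2 n G"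
  using ring_hom_add[OF cl2_hom, of F n G] by simp

lemma cl2_eq_iff:
  "F \<in> FA2set n \<Longrightarrow> G \<in> FA2set n \<Longrightarrow> cl2 n F = cl2 n G \<longleftrightarrow> (\<lambda>w. F w - G w) \<in> Uh2_ideal n"
  using coset_eq_iff[OF Uh2_ideal_ideal, of F n G] by (simp add: cl2_def FA2.F_minus)

lemma cl2_zero: "cl2 n (\<lambda>w. 0) = \<zero>\<^bsub>Uh2 n\<^esub>"
  using Ring.ring_hom_zero[OF cl2_hom FA2.F_ring Uh2_ring, of n] by simp

lemma cl2_zero_iff: "F \<in> FA2set n \<Longrightarrow> cl2 n F = \<zero>\<^bsub>Uh2 n\<^esub> \<longleftrightarrow> F \<in> Uh2_ideal n"
  using cl2_eq_iff[of F n "\<lambda>w. 0"] FA2.F.zero_closed[of n] by (simp add: cl2_zero)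

lemma cl2_one: "cl2 n (mon ([], [])) = \<one>\<^bsub>Uh2 n\<^esub>"
  using ring_hom_one[OF cl2_hom] by simp

definition s2 :: "nat \<Rightarrow> complex fps \<Rightarrow> (gen list \<times> gen list \<Rightarrow> complex fps) set" where
  "s2 n c = cl2 n (smul c (mon ([], [])))"

lemma s2_closed [simp]: "s2 n c \<in> carrier (Uh2 n)" by (simp add: s2_def)

lemma cl2_smul: "F \<in> FA2set n \<Longrightarrow> cl2 n (smul c F) = s2 n c \<otimes>\<^bsub>Uh2 n\<^esub> cl2 n F"
  using cl2_mult[of "smul c (mon ([], []))" n F] by (simp add: s2_def FA2.conv_smul_left)

lemma Uh2_carrierE:
  assumes "x \<in> carrier (Uh2 n)"
  obtains F where "F \<in> FA2set n" "x = cl2 n F"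
  using quotient_carrierE[OF assms[unfolded Uh2_def]] by (auto simp: cl2_def)

lemma s2_central:
  assumes "x \<in> carrier (Uh2 n)" shows "x \<otimes>\<^bsub>Uh2 n\<^esub> s2 n c = s2 n c \<otimes>\<^bsub>Uh2 n\<^esub> x"
proof -
  obtain F where F: "F \<in> FA2set n" "x = cl2 n F" using assms by (rule Uh2_carrierE)
  then have "x \<otimes>\<^bsub>Uh2 n\<^esub> s2 n c = cl2 n (conv append2 F (smul c (mon ([], []))))"
    by (simp add: s2_def cl2_mult)
  then show ?thesis using F by (simp add: FA2.conv_smul_right cl2_smul)
qed

lemma s2_mult: "s2 n (a * b) = s2 n a \<otimes>\<^bsub>Uh2 n\<^esub> s2 n b"
  using cl2_smul[of "smul b (mon ([], []))" n a] by (simp add: s2_def FA2.smul_smul)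

lemma s2_add: "s2 n (a + b) = s2 n a \<oplus>\<^bsub>Uh2 n\<^esub> s2 n b"
  using cl2_add[of "smul a (mon ([], []))" n "smul b (mon ([], []))"]
  by (simp add: s2_def) (simp add: smul_def distrib_right)

lemma s2_one: "s2 n 1 = \<one>\<^bsub>Uh2 n\<^esub>"
  using cl2_one by (simp add: s2_def smul_def)

lemma Uh2_qring: "qring (Uh2 n) (s2 n qh) (s2 n qh_inv)"
proof (intro qring.intro qring_axioms.intro Uh2_ring s2_closed s2_central)
  show "s2 n qh_inv \<otimes>\<^bsub>Uh2 n\<^esub> s2 n qh = \<one>\<^bsub>Uh2 n\<^esub>"
    by (simp add: s2_one qh_mult flip: s2_mult)
  fix x assume x: "x \<in> carrier (Uh2 n)"
    and z: "x \<oplus>\<^bsub>Uh2 n\<^esub> s2 n qh \<otimes>\<^bsub>Uh2 n\<^esub> (s2 n qh \<otimes>\<^bsub>Uh2 n\<^esub> x) = \<zero>\<^bsub>Uh2 n\<^esub>"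
  let ?u = "1 + qh * qh"
  have "s2 n ?u \<otimes>\<^bsub>Uh2 n\<^esub> x = \<zero>\<^bsub>Uh2 n\<^esub>"
    using x z by (simp add: s2_add s2_mult s2_one Uh2.l_distr Uh2.m_assoc)
  then have "s2 n (inverse ?u * ?u) \<otimes>\<^bsub>Uh2 n\<^esub> x = \<zero>\<^bsub>Uh2 n\<^esub>"
    using x by (simp add: s2_mult Uh2.m_assoc)
  moreover have "fps_nth ?u 0 \<noteq> 0" by (simp add: qh_nth)
  ultimately show "x = \<zero>\<^bsub>Uh2 n\<^esub>"
    using x by (simp add: inverse_mult_eq_1 s2_one)
qed

text \<open>The tensor r \<otimes> f factors as (r \<otimes> 1)(1 \<otimes> f), whose first factor
  generates the ideal; the other side is analogous.\<close>

lemma ftens_ideal: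
  assumes "r \<in> Uh_ideal n" "f \<in> FAset n"
  shows "ftens r f \<in> Uh2_ideal n" "ftens f r \<in> Uh2_ideal n"
proof -
  have one: "mon [] \<in> FAset n" by simp
  have "ftens r (mon []) \<in> Uh2_ideal n" "ftens (mon []) r \<in> Uh2_ideal n" using J2gen_ideal assms(1) by blast+
  then have "conv append2 (ftens r (mon [])) (ftens (mon []) f) \<in> Uh2_ideal n"
    "conv append2 (ftens (mon []) r) (ftens f (mon [])) \<in> Uh2_ideal n"
    using ideal.I_r_closed[OF Uh2_ideal_ideal] ftens_closed[OF one assms(2)] ftens_closed[OF assms(2) one] by fastforce+
  then show "ftens r f \<in> Uh2_ideal n" "ftens f r \<in> Uh2_ideal n" by (simp_all add: ftens_conv)
qed

text \<open>\<open>utens n x y\<close> is the pure tensor \<open>x \<otimes> y\<close> of two elements of \<open>U\<^sub>h\<close>.\<close>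

definition utens where
  "utens n x y = cl2 n (ftens (SOME f. f \<in> FAset n \<and> Uh_class n f = x) (SOME f. f \<in> FAset n \<and> Uh_class n f = y))"

lemma utens_class:
  assumes f: "f \<in> FAset n" and g: "g \<in> FAset n"
  shows "utens n (Uh_class n f) (Uh_class n g) = cl2 n (ftens f g)"
proof -
  define f' where "f' = (SOME f'. f' \<in> FAset n \<and> Uh_class n f' = Uh_class n f)"
  define g' where "g' = (SOME g'. g' \<in> FAset n \<and> Uh_class n g' = Uh_class n g)"
  have f': "f' \<in> FAset n" "Uh_class n f' = Uh_class n f"
    using someI_ex[of "\<lambda>f'. f' \<in> FAset n \<and> Uh_class n f' = Uh_class n f"] f by (auto simp: f'_def)
  have g': "g' \<in> FAset n" "Uh_class n g' = Uh_class n g"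
    using someI_ex[of "\<lambda>g'. g' \<in> FAset n \<and> Uh_class n g' = Uh_class n g"] g by (auto simp: g'_def)
  have d: "(\<lambda>w. f' w - f w) \<in> Uh_ideal n" "(\<lambda>w. g' w - g w) \<in> Uh_ideal n"
    using f f' g g' by (simp_all add: Uh_class_eq_iff)
  \<comment> \<open>The representatives are exchanged one factor at a time, so that each difference
    is a pure tensor with one entry in the ideal.\<close>
  have "(\<lambda>p. ftens f' g' p - ftens f g' p) \<in> Uh2_ideal n" "(\<lambda>p. ftens f g' p - ftens f g p) \<in> Uh2_ideal n"
    using ftens_ideal(1)[OF d(1) g'(1)] ftens_ideal(2)[OF d(2) f] by (simp_all add: ftens_diff)
  then have "cl2 n (ftens f' g') = cl2 n (ftens f g')" "cl2 n (ftens f g') = cl2 n (ftens f g)"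
    using f f' g g' by (simp_all add: cl2_eq_iff)
  then show ?thesis by (simp add: utens_def f'_def g'_def)
qed

lemma utens_closed [simp]:
  assumes "x \<in> carrier (Uh n)" "y \<in> carrier (Uh n)" shows "utens n x y \<in> carrier (Uh2 n)"
  using assms by (elim Uh_carrierE) (simp add: utens_class)

lemma utens_mult:
  assumes "x \<in> carrier (Uh n)" "y \<in> carrier (Uh n)" "x' \<in> carrier (Uh n)" "y' \<in> carrier (Uh n)"
  shows "utens n x y \<otimes>\<^bsub>Uh2 n\<^esub> utens n x' y' = utens n (x \<otimes>\<^bsub>Uh n\<^esub> x') (y \<otimes>\<^bsub>Uh n\<^esub> y')"
  using assms
  by (elim Uh_carrierE) (simp add: utens_class ftens_conv flip: cl2_mult Uh_class_mult)

lemma utens_add: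
  assumes "x \<in> carrier (Uh n)" "y \<in> carrier (Uh n)" "z \<in> carrier (Uh n)"
  shows "utens n (x \<oplus>\<^bsub>Uh n\<^esub> y) z = utens n x z \<oplus>\<^bsub>Uh2 n\<^esub> utens n y z"
    and "utens n z (x \<oplus>\<^bsub>Uh n\<^esub> y) = utens n z x \<oplus>\<^bsub>Uh2 n\<^esub> utens n z y"
  using assms
  by (elim Uh_carrierE, simp add: utens_class ftens_add flip: cl2_add Uh_class_add)+

lemma utens_smul:
  assumes "x \<in> carrier (Uh n)" "y \<in> carrier (Uh n)"
  shows "utens n (Uh_scalar n c \<otimes>\<^bsub>Uh n\<^esub> x) y = s2 n c \<otimes>\<^bsub>Uh2 n\<^esub> utens n x y"
    and "utens n x (Uh_scalar n c \<otimes>\<^bsub>Uh n\<^esub> y) = s2 n c \<otimes>\<^bsub>Uh2 n\<^esub> utens n x y"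
  using assms
  by (elim Uh_carrierE, simp add: utens_class ftens_smul flip: cl2_smul Uh_class_smul)+

lemma utens_one: "utens n \<one>\<^bsub>Uh n\<^esub> \<one>\<^bsub>Uh n\<^esub> = \<one>\<^bsub>Uh2 n\<^esub>"
  using utens_class[of "mon []" n "mon []"] by (simp add: Uh_class_one ftens_mon cl2_one)

lemma utens_zero:
  assumes "x \<in> carrier (Uh n)"
  shows "utens n \<zero>\<^bsub>Uh n\<^esub> x = \<zero>\<^bsub>Uh2 n\<^esub>" "utens n x \<zero>\<^bsub>Uh n\<^esub> = \<zero>\<^bsub>Uh2 n\<^esub>"
proof -
  have z: "s2 n 0 = \<zero>\<^bsub>Uh2 n\<^esub>" using cl2_zero by (simp add: s2_def smul_def)
  show "utens n \<zero>\<^bsub>Uh n\<^esub> x = \<zero>\<^bsub>Uh2 n\<^esub>" "utens n x \<zero>\<^bsub>Uh n\<^esub> = \<zero>\<^bsub>Uh2 n\<^esub>"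
    using utens_smul(1)[OF assms assms, of 0] utens_smul(2)[OF assms assms, of 0] assms
    by (simp_all add: Uh_scalar_zero z)
qed

section \<open>The comultiplication descends to \<open>U\<^sub>h\<close>\<close>

definition Delta :: "nat \<Rightarrow> (gen list \<Rightarrow> complex fps) \<Rightarrow> (gen list \<times> gen list \<Rightarrow> complex fps) set" where
  "Delta n f = cl2 n (comult_FA n f)"

lemma Delta_hom: "Delta n \<in> Ring.ring_hom (FA n) (Uh2 n)"
  unfolding Delta_def[abs_def] using ring_hom_trans[OF comult_FA_hom cl2_hom] by (simp add: o_def)

lemma Delta_closed [simp]: "f \<in> FAset n \<Longrightarrow> Delta n f \<in> carrier (Uh2 n)"
  using ring_hom_closed[OF Delta_hom] by simp

lemma Delta_mult: "f \<in> FAset n \<Longrightarrow> g \<in> FAset n \<Longrightarrow> Delta n (conv (@) f g) = Delta n f \<otimes>\<^bsub>Uh2 n\<^esub> Delta n g"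
  using ring_hom_mult[OF Delta_hom, of f n g] by simp

lemma Delta_add: "f \<in> FAset n \<Longrightarrow> g \<in> FAset n \<Longrightarrow> Delta n (\<lambda>w. f w + g w) = Delta n f \<oplus>\<^bsub>Uh2 n\<^esub> Delta n g"
  using ring_hom_add[OF Delta_hom, of f n g] by simp

lemma Delta_one: "Delta n (mon []) = \<one>\<^bsub>Uh2 n\<^esub>"
  using ring_hom_one[OF Delta_hom] by simp

lemma Delta_smul: "f \<in> FAset n \<Longrightarrow> Delta n (smul c f) = s2 n c \<otimes>\<^bsub>Uh2 n\<^esub> Delta n f"
  by (simp add: Delta_def comult_FA_smul cl2_smul comult_FA_closed)

lemma Delta_diff:
  assumes "f \<in> FAset n" "g \<in> FAset n"
  shows "Delta n (\<lambda>w. f w - g w) = Delta n f \<ominus>\<^bsub>Uh2 n\<^esub> Delta n g"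
proof -
  have "(\<lambda>w. f w - g w) \<in> FAset n"
    using FA.F.minus_closed[of f n g] assms by (simp add: FA.F_minus)
  moreover have "f = (\<lambda>w. (f w - g w) + g w)" by simp
  ultimately have "Delta n f = Delta n (\<lambda>w. f w - g w) \<oplus>\<^bsub>Uh2 n\<^esub> Delta n g"
    using Delta_add[of "\<lambda>w. f w - g w" n g] assms by simp
  then show ?thesis
    using assms \<open>(\<lambda>w. f w - g w) \<in> _\<close> by (simp add: Uh2.minus_eq Uh2.a_assoc Uh2.r_neg)
qed

lemma Delta_letter_word:
  "g \<in> gens n \<Longrightarrow> w \<in> lists (gens n) \<Longrightarrow> Delta n (mon (g # w)) = Delta n (mon [g]) \<otimes>\<^bsub>Uh2 n\<^esub> Delta n (mon w)"
  using Delta_mult[of "mon [g]" n "mon w"] by (simp add: FA.conv_mon)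

abbreviation Kc :: "nat \<Rightarrow> complex \<Rightarrow> nat \<Rightarrow> (gen list \<Rightarrow> complex fps) set" where
  "Kc n c i \<equiv> Uh_class n (hexp c i)"

lemma Delta_letter:
  assumes "i \<in> {1..n}"
  shows "Delta n (mon [Xp i]) = utens n (Xc n (Xp i)) (Kc n 1 i) \<oplus>\<^bsub>Uh2 n\<^esub> utens n \<one>\<^bsub>Uh n\<^esub> (Xc n (Xp i))"
    and "Delta n (mon [Xm i]) = utens n (Kc n (- 1) i) (Xc n (Xm i)) \<oplus>\<^bsub>Uh2 n\<^esub> utens n (Xc n (Xm i)) \<one>\<^bsub>Uh n\<^esub>"
    and "Delta n (mon [Hg i]) = utens n (Xc n (Hg i)) \<one>\<^bsub>Uh n\<^esub> \<oplus>\<^bsub>Uh2 n\<^esub> utens n \<one>\<^bsub>Uh n\<^esub> (Xc n (Hg i))"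
proof -
  have c: "comult_word n [g] = comult_gen n g" for g by simp
  have one: "\<one>\<^bsub>Uh n\<^esub> = Uh_class n (mon [])" by (simp add: Uh_class_one)
  show "Delta n (mon [Xp i]) = utens n (Xc n (Xp i)) (Kc n 1 i) \<oplus>\<^bsub>Uh2 n\<^esub> utens n \<one>\<^bsub>Uh n\<^esub> (Xc n (Xp i))"
    using assms by (simp add: Delta_def comult_FA_mon c one utens_class cl2_add del: comult_word_Cons)
  show "Delta n (mon [Xm i]) = utens n (Kc n (- 1) i) (Xc n (Xm i)) \<oplus>\<^bsub>Uh2 n\<^esub> utens n (Xc n (Xm i)) \<one>\<^bsub>Uh n\<^esub>"
    using assms
    by (simp add: Delta_def comult_FA_mon c one utens_class cl2_add Uh2.a_comm del: comult_word_Cons)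
  show "Delta n (mon [Hg i]) = utens n (Xc n (Hg i)) \<one>\<^bsub>Uh n\<^esub> \<oplus>\<^bsub>Uh2 n\<^esub> utens n \<one>\<^bsub>Uh n\<^esub> (Xc n (Hg i))"
    using assms by (simp add: Delta_def comult_FA_mon c one utens_class cl2_add del: comult_word_Cons)
qed

lemma cartan_sym: "cartan i j = cartan j i"
  by (auto simp: cartan_def)

text \<open>Stated for an arbitrary homomorphism compatible with scalars, because it serves three
  times: for the quotient map to U_h, for the comultiplication and for the specialization. In the
  last case both scalars become 1.\<close>

lemma serre_image_iff:
  assumes S: "ring S" and \<phi>: "\<phi> \<in> Ring.ring_hom (FA n) S"
    and s: "\<And>c f. f \<in> FAset n \<Longrightarrow> \<phi> (smul c f) = s c \<otimes>\<^bsub>S\<^esub> \<phi> f"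
    and g: "g \<in> gens n" "g' \<in> gens n"
  shows "\<phi> (\<lambda>w. mon [g, g, g'] w - (qh + qh_inv) * mon [g, g', g] w + mon [g', g, g] w) = \<zero>\<^bsub>S\<^esub> \<longleftrightarrow>
    \<phi> (mon [g']) \<otimes>\<^bsub>S\<^esub> (\<phi> (mon [g]) \<otimes>\<^bsub>S\<^esub> \<phi> (mon [g])) \<oplus>\<^bsub>S\<^esub> \<phi> (mon [g]) \<otimes>\<^bsub>S\<^esub> (\<phi> (mon [g]) \<otimes>\<^bsub>S\<^esub> \<phi> (mon [g'])) =
    s qh \<otimes>\<^bsub>S\<^esub> (\<phi> (mon [g]) \<otimes>\<^bsub>S\<^esub> (\<phi> (mon [g']) \<otimes>\<^bsub>S\<^esub> \<phi> (mon [g]))) \<oplus>\<^bsub>S\<^esub>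
    s qh_inv \<otimes>\<^bsub>S\<^esub> (\<phi> (mon [g]) \<otimes>\<^bsub>S\<^esub> (\<phi> (mon [g']) \<otimes>\<^bsub>S\<^esub> \<phi> (mon [g])))"
    (is "\<phi> ?r = _ \<longleftrightarrow> ?v = ?u")
proof -
  interpret S: ring S by fact
  note mult = ring_hom_mult[OF \<phi>, simplified] and add = ring_hom_add[OF \<phi>, simplified]
    and closed = ring_hom_closed[OF \<phi>, simplified]
  have m [simp]: "mon w \<in> FAset n" if "set w \<subseteq> gens n" for w
    using that by (intro FA.mon_closed) auto
  have w3: "\<phi> (mon [a, b, c]) = \<phi> (mon [a]) \<otimes>\<^bsub>S\<^esub> (\<phi> (mon [b]) \<otimes>\<^bsub>S\<^esub> \<phi> (mon [c]))"
    if "a \<in> gens n" "b \<in> gens n" "c \<in> gens n" for a b c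
    using that mult[of "mon [a]" "mon [b, c]"] mult[of "mon [b]" "mon [c]"] by (simp add: FA.conv_mon)
  define u where "u = (\<lambda>w. smul qh (mon [g, g', g]) w + smul qh_inv (mon [g, g', g]) w)"
  define v where "v = (\<lambda>w. mon [g', g, g] w + mon [g, g, g'] w :: complex fps)"
  have u: "u \<in> FAset n" "\<phi> u = ?u" using g by (simp_all add: u_def add s w3)
  have v: "v \<in> FAset n" "\<phi> v = ?v" using g by (simp_all add: v_def add w3)
  have r: "?r = v \<ominus>\<^bsub>FA n\<^esub> u" using u v
    by (simp add: FA.F_minus) (simp add: u_def v_def smul_apply fun_eq_iff algebra_simps)
  then have rc: "?r \<in> FAset n" using FA.F.minus_closed[of v n u] u v by simp
  have "v = (\<lambda>w. ?r w + u w)" by (simp add: u_def v_def smul_apply fun_eq_iff algebra_simps)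
  then have "\<phi> v = \<phi> ?r \<oplus>\<^bsub>S\<^esub> \<phi> u" using add[OF rc u(1)] by simp
  then have "\<phi> ?r = \<phi> v \<ominus>\<^bsub>S\<^esub> \<phi> u"
    using closed[OF rc] closed[OF u(1)] by (simp add: S.minus_eq S.a_assoc S.r_neg)
  then show ?thesis using u v closed[OF u(1)] closed[OF v(1)] by simp
qed

lemma Uh_class_rel: "r \<in> Uh_rels n \<Longrightarrow> Uh_class n r = \<zero>\<^bsub>Uh n\<^esub>"
  using Uh_class_eq_iff[of r n "\<lambda>w. 0"] subsetD[OF Uh_rels_closed, of r n] FA.F.zero_closed[of n]
    subsetD[OF Uh_rels_ideal, of r n] by (simp add: Uh_class_zero)

lemma Uh_serre:
  assumes X: "X \<in> {Xp, Xm}" and ij: "i \<in> {1..n}" "j \<in> {1..n}" "i = Suc j \<or> j = Suc i"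
  shows "qring.qserre (Uh n) (Uh_scalar n qh) (Uh_scalar n qh_inv) (Xc n (X j)) (Xc n (X i))"
proof -
  have "i \<noteq> j" using ij(3) by auto
  then have "serre n X i j \<in> {serre n X i j |X i j. X \<in> {Xp, Xm} \<and> i \<in> {1..n} \<and> j \<in> {1..n} \<and> i \<noteq> j}"
    using X ij(1,2) by blast
  then have "serre n X i j \<in> Uh_rels n" unfolding Uh_rels_def by (rule UnI2)
  then have "Uh_class n (serre n X i j) = \<zero>\<^bsub>Uh n\<^esub>" by (rule Uh_class_rel)
  then show ?thesis
    unfolding serre_adjacent[OF X ij] qring.qserre_def[OF Uh_qring]
    by (subst (asm) serre_image_iff[OF Uh_ring Uh_class_hom Uh_class_smul]) (use X ij in auto)
qed

lemma Uh_far: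
  assumes "X \<in> {Xp, Xm}" "i \<in> {1..n}" "j \<in> {1..n}" "i \<noteq> j" "\<not> (i = Suc j \<or> j = Suc i)"
  shows "Xc n (X i) \<otimes>\<^bsub>Uh n\<^esub> Xc n (X j) = Xc n (X j) \<otimes>\<^bsub>Uh n\<^esub> Xc n (X i)"
proof -
  have m [simp]: "mon w \<in> FAset n" if "set w \<subseteq> gens n" for w
    using that by (intro FA.mon_closed) auto
  have X: "X i \<in> gens n" "X j \<in> gens n" using assms by auto
  have "serre n X i j \<in> Uh_rels n"
    unfolding Uh_rels_def by (rule UnI2) (use assms in blast)
  then have "(\<lambda>w. mon [X i, X j] w - mon [X j, X i] w) \<in> Uh_ideal n"
    using Uh_rels_ideal serre_far[OF assms] by auto
  then have "Uh_class n (mon [X i, X j]) = Uh_class n (mon [X j, X i])"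
    using X by (simp add: Uh_class_eq_iff)
  moreover have "Uh_class n (mon [g, g']) = Xc n g \<otimes>\<^bsub>Uh n\<^esub> Xc n g'" if "g \<in> gens n" "g' \<in> gens n" for g g'
    using that Uh_class_mult[of "mon [g]" n "mon [g']"] by (simp add: FA.conv_mon)
  ultimately show ?thesis using X by simp
qed

lemma Uh_Hg:
  assumes "i \<in> {1..n}" "g \<in> gens n"
  shows "Xc n (Hg i) \<otimes>\<^bsub>Uh n\<^esub> Xc n g =
    Xc n g \<otimes>\<^bsub>Uh n\<^esub> Xc n (Hg i) \<oplus>\<^bsub>Uh n\<^esub> Uh_scalar n (of_int (weight i g)) \<otimes>\<^bsub>Uh n\<^esub> Xc n g"
proof -
  have H: "Hg i \<in> gens n" using assms by simp
  have "(\<lambda>w. conv (@) (mon [Hg i]) (mon [g]) w - (conv (@) (mon [g]) (mon [Hg i]) w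
    + smul (of_int (weight i g)) (mon [g]) w)) \<in> Uh_ideal n"
    using Hg_letter[OF assms] by (simp add: smul_apply fps_of_int diff_diff_eq)
  then show ?thesis using assms H
    by (simp add: Uh_class_eq_iff[symmetric] flip: Uh_class_mult Uh_class_smul Uh_class_add)
qed

lemma Uh_Hg_hexp:
  assumes "i \<in> {1..n}" "j \<in> {1..n}"
  shows "Xc n (Hg i) \<otimes>\<^bsub>Uh n\<^esub> Kc n c j = Kc n c j \<otimes>\<^bsub>Uh n\<^esub> Xc n (Hg i)"
  using hexp_letter[of j n "Hg i" c] assms by (simp add: weight_def Uh_scalar_one)

text \<open>With M the inverse of K, the identity K \<otimes> K - M \<otimes> M = (K - M) \<otimes>
  K + M \<otimes> (K - M) holds already in the free algebra, where the factor q - 1/q can be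
  cancelled.\<close>

lemma Delta_H_rel:
  assumes i: "i \<in> {1..n}"
  shows "Delta n (H_rel i) = utens n (Uh_class n (H_rel i)) (Kc n 1 i) \<oplus>\<^bsub>Uh2 n\<^esub>
    utens n (Kc n (- 1) i) (Uh_class n (H_rel i))"
proof -
  define Hr where "Hr = H_rel i"
  have H: "Hr \<in> FAset n" unfolding Hr_def by (rule H_rel_closed[OF i])
  have sH: "smul (qh - qh_inv) (Hr) = (\<lambda>w. Kp i w - Km i w)"
    unfolding Hr_def by (intro smul_sdiv Kp_Km_nth_0 qh_diff)
  have KK: "(\<lambda>w. Kp i w - Km i w) = (\<lambda>w. Kp i w + smul (- 1) (Km i) w)" by (simp add: smul_apply)
  have "smul (qh - qh_inv) (comult_FA n (Hr)) = comult_FA n (\<lambda>w. Kp i w - Km i w)"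
    unfolding sH[symmetric] by (rule comult_FA_smul[OF H, symmetric])
  also have "\<dots> = (\<lambda>p. ftens (Kp i) (Kp i) p + smul (- 1) (ftens (Km i) (Km i)) p)"
    unfolding KK using i by (simp add: comult_FA_add comult_FA_smul comult_hexp)
  also have "\<dots> = (\<lambda>p. ftens (\<lambda>w. Kp i w - Km i w) (Kp i) p + ftens (Km i) (\<lambda>w. Kp i w - Km i w) p)"
    unfolding ftens_diff by (simp add: smul_apply)
  also have "\<dots> = smul (qh - qh_inv) (\<lambda>p. ftens (Hr) (Kp i) p + ftens (Km i) (Hr) p)"
    unfolding sH[symmetric] ftens_smul by (simp add: smul_apply fun_eq_iff algebra_simps)
  finally have "comult_FA n (Hr) = (\<lambda>p. ftens (Hr) (Kp i) p + ftens (Km i) (Hr) p)"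
    using qh_diff(2) by (fastforce simp: smul_apply fun_eq_iff)
  then show ?thesis unfolding Hr_def[symmetric] using H i by (simp add: Delta_def cl2_add utens_class)
qed

lemma Uh_Xp_Xm:
  assumes ij: "i \<in> {1..n}" "j \<in> {1..n}"
  shows "Xc n (Xp i) \<otimes>\<^bsub>Uh n\<^esub> Xc n (Xm j) = Xc n (Xm j) \<otimes>\<^bsub>Uh n\<^esub> Xc n (Xp i) \<oplus>\<^bsub>Uh n\<^esub>
    (if i = j then Uh_class n (H_rel i) else \<zero>\<^bsub>Uh n\<^esub>)"
proof -
  have m [simp]: "mon w \<in> FAset n" if "set w \<subseteq> gens n" for w
    using that by (intro FA.mon_closed) auto
  define h where "h = (if i = j then H_rel i else (\<lambda>w. 0))"
  have h: "h \<in> FAset n" unfolding h_def using H_rel_closed[OF ij(1)] FA.F.zero_closed[of n] by (cases "i = j") simp_all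
  have e: "(if i = j then sdiv (Kp i \<ominus>\<^bsub>FA n\<^esub> Km i) (qh - qh_inv) else \<zero>\<^bsub>FA n\<^esub>) = h"
    using ij by (simp add: h_def FA.F_minus)
  have c: "(\<lambda>w. f w - g w) \<in> FAset n" if "f \<in> FAset n" "g \<in> FAset n" for f g
    using FA.F.minus_closed[of f n g] that by (simp add: FA.F_minus)
  have "mon [Xp i, Xm j] \<ominus>\<^bsub>FA n\<^esub> mon [Xm j, Xp i] \<ominus>\<^bsub>FA n\<^esub> h \<in> Uh_rels n"
    unfolding e[symmetric] Uh_rels_def by (rule UnI1, rule UnI2) (use ij in blast)
  then have "mon [Xp i, Xm j] \<ominus>\<^bsub>FA n\<^esub> mon [Xm j, Xp i] \<ominus>\<^bsub>FA n\<^esub> h \<in> Uh_ideal n"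
    using Uh_rels_ideal by blast
  then have "(\<lambda>w. mon [Xp i, Xm j] w - (mon [Xm j, Xp i] w + h w)) \<in> Uh_ideal n"
    using ij h by (simp add: FA.F_minus c diff_diff_eq)
  then have "Uh_class n (mon [Xp i, Xm j]) = Uh_class n (\<lambda>w. mon [Xm j, Xp i] w + h w)"
    using ij h by (simp add: Uh_class_eq_iff)
  moreover have "Uh_class n (mon [g, g']) = Xc n g \<otimes>\<^bsub>Uh n\<^esub> Xc n g'" if "g \<in> gens n" "g' \<in> gens n" for g g'
    using that Uh_class_mult[of "mon [g]" n "mon [g']"] by (simp add: FA.conv_mon)
  ultimately show ?thesis
    using ij h by (auto simp add: Uh_class_add h_def Uh_class_zero)
qed

lemma Delta_word2: "g \<in> gens n \<Longrightarrow> g' \<in> gens n \<Longrightarrow>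
    Delta n (mon [g, g']) = Delta n (mon [g]) \<otimes>\<^bsub>Uh2 n\<^esub> Delta n (mon [g'])"
  using Delta_letter_word[of g n "[g']"] by simp

lemma Delta_Hg:
  assumes ij: "i \<in> {1..n}" and g: "g \<in> gens n"
  shows "Delta n (mon [Hg i, g]) = Delta n (mon [g, Hg i]) \<oplus>\<^bsub>Uh2 n\<^esub> s2 n (of_int (weight i g)) \<otimes>\<^bsub>Uh2 n\<^esub> Delta n (mon [g])"
proof -
  have H [simp]: "Hg i \<in> gens n" "Xc n (Hg i) \<in> carrier (Uh n)" using ij by auto
  note rel = Uh_Hg[OF ij]
  note exps = Uh2.l_distr Uh2.r_distr utens_mult utens_add utens_smul rel
  show ?thesis
  proof (cases g)
    case (Xp j)
    then have j: "j \<in> {1..n}" using g by simp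
    have [simp]: "Xc n (Xp j) \<in> carrier (Uh n)" "Kc n 1 j \<in> carrier (Uh n)" using j by auto
    show ?thesis
      unfolding Xp using j ij
      by (simp add: Delta_word2 Delta_letter exps Uh_Hg_hexp) (simp add: Uh2.a_ac)
  next
    case (Xm j)
    then have j: "j \<in> {1..n}" using g by simp
    have [simp]: "Xc n (Xm j) \<in> carrier (Uh n)" "Kc n (- 1) j \<in> carrier (Uh n)" using j by auto
    show ?thesis
      unfolding Xm using j ij
      by (simp add: Delta_word2 Delta_letter exps Uh_Hg_hexp) (simp add: Uh2.a_ac)
  next
    case (Hg j)
    then have j: "j \<in> {1..n}" using g by simp
    have [simp]: "Xc n (Hg j) \<in> carrier (Uh n)" using j by auto
    show ?thesis
      unfolding Hg using j ij
      by (simp add: Delta_word2 Delta_letter exps) (simp add: Uh2.a_ac)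
  qed
qed

text \<open>The mixed terms agree because moving K_i past X_j^- and the inverse of K_j past X_i^+
  costs the same power of q; this is the symmetry of the Cartan matrix.\<close>

lemma Delta_Xp_Xm:
  assumes ij: "i \<in> {1..n}" "j \<in> {1..n}"
  shows "Delta n (mon [Xp i, Xm j]) = Delta n (mon [Xm j, Xp i]) \<oplus>\<^bsub>Uh2 n\<^esub>
    (if i = j then Delta n (H_rel i) else \<zero>\<^bsub>Uh2 n\<^esub>)"
proof -
  define e where "e = (fps_exp (of_int (- cartan i j)) :: complex fps)"
  define h where "h = (if i = j then Uh_class n (H_rel i) else \<zero>\<^bsub>Uh n\<^esub>)"
  let ?E = "Xc n (Xp i)" and ?F = "Xc n (Xm j)" and ?K = "Kc n 1 i" and ?L = "Kc n (- 1) j"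
  have [simp]: "?E \<in> carrier (Uh n)" "?F \<in> carrier (Uh n)" "?K \<in> carrier (Uh n)" "?L \<in> carrier (Uh n)"
    "h \<in> carrier (Uh n)" using ij H_rel_closed by (auto simp: h_def)
  have KF: "?K \<otimes>\<^bsub>Uh n\<^esub> ?F = Uh_scalar n e \<otimes>\<^bsub>Uh n\<^esub> (?F \<otimes>\<^bsub>Uh n\<^esub> ?K)"
    using hexp_letter[of i n "Xm j" 1] ij by (simp add: weight_def e_def)
  have LE: "?L \<otimes>\<^bsub>Uh n\<^esub> ?E = Uh_scalar n e \<otimes>\<^bsub>Uh n\<^esub> (?E \<otimes>\<^bsub>Uh n\<^esub> ?L)"
    using hexp_letter[of j n "Xp i" "- 1"] ij by (simp add: weight_def e_def cartan_sym[of j i])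
  have EF: "?E \<otimes>\<^bsub>Uh n\<^esub> ?F = ?F \<otimes>\<^bsub>Uh n\<^esub> ?E \<oplus>\<^bsub>Uh n\<^esub> h"
    unfolding h_def by (rule Uh_Xp_Xm[OF ij])
  have h: "(if i = j then Delta n (H_rel i) else \<zero>\<^bsub>Uh2 n\<^esub>) = utens n h ?K \<oplus>\<^bsub>Uh2 n\<^esub> utens n ?L h"
    using ij by (simp add: h_def Delta_H_rel utens_zero)
  show ?thesis
    unfolding h using ij
    by (simp add: Delta_word2 Delta_letter Uh2.l_distr Uh2.r_distr utens_mult KF LE EF utens_add utens_smul)
      (simp add: Uh2.a_ac)
qed

text \<open>The data needed by the Serre identity for sums. For X^- the summand containing the
  inverse of K is taken as A, so that the same powers of q occur for both signs and one argument
  covers both halves.\<close>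

lemma Delta_Xp_Xm_split:
  assumes X: "X \<in> {Xp, Xm}" and ij: "i \<in> {1..n}" "j \<in> {1..n}"
  obtains A B C D where "A \<in> carrier (Uh2 n)" "B \<in> carrier (Uh2 n)" "C \<in> carrier (Uh2 n)" "D \<in> carrier (Uh2 n)"
    "Delta n (mon [X i]) = A \<oplus>\<^bsub>Uh2 n\<^esub> B" "Delta n (mon [X j]) = C \<oplus>\<^bsub>Uh2 n\<^esub> D"
    "A \<otimes>\<^bsub>Uh2 n\<^esub> B = s2 n (qh * qh) \<otimes>\<^bsub>Uh2 n\<^esub> (B \<otimes>\<^bsub>Uh2 n\<^esub> A)"
    "A \<otimes>\<^bsub>Uh2 n\<^esub> D = s2 n (fps_exp (of_int (cartan i j))) \<otimes>\<^bsub>Uh2 n\<^esub> (D \<otimes>\<^bsub>Uh2 n\<^esub> A)"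
    "C \<otimes>\<^bsub>Uh2 n\<^esub> B = s2 n (fps_exp (of_int (cartan i j))) \<otimes>\<^bsub>Uh2 n\<^esub> (B \<otimes>\<^bsub>Uh2 n\<^esub> C)"
    "i = Suc j \<or> j = Suc i \<Longrightarrow> qring.qserre (Uh2 n) (s2 n qh) (s2 n qh_inv) C A"
    "i = Suc j \<or> j = Suc i \<Longrightarrow> qring.qserre (Uh2 n) (s2 n qh) (s2 n qh_inv) D B"
    "i \<noteq> j \<Longrightarrow> \<not> (i = Suc j \<or> j = Suc i) \<Longrightarrow> A \<otimes>\<^bsub>Uh2 n\<^esub> C = C \<otimes>\<^bsub>Uh2 n\<^esub> A \<and> B \<otimes>\<^bsub>Uh2 n\<^esub> D = D \<otimes>\<^bsub>Uh2 n\<^esub> B"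
proof -
  have two: "fps_exp (of_int (cartan i i)) = qh * qh"
    by (simp add: cartan_def qh_def flip: fps_exp_add_mult)
  \<comment> \<open>K for X^+ and its inverse for X^-; the product of s with the weight is then the
    Cartan entry in either case.\<close>
  define s :: complex where "s = (if X = Xp then 1 else - 1)"
  define x where "x k = Xc n (X k)" for k
  define K where "K k = Kc n s k" for k
  have [simp]: "x i \<in> carrier (Uh n)" "x j \<in> carrier (Uh n)" "K i \<in> carrier (Uh n)" "K j \<in> carrier (Uh n)"
    using X ij by (auto simp: x_def K_def)
  have Kx: "K k \<otimes>\<^bsub>Uh n\<^esub> x l = Uh_scalar n (fps_exp (of_int (cartan k l))) \<otimes>\<^bsub>Uh n\<^esub> (x l \<otimes>\<^bsub>Uh n\<^esub> K k)"
    if "k \<in> {i, j}" "l \<in> {i, j}" for k l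
  proof -
    have "k \<in> {1..n}" "X l \<in> gens n" "s * of_int (weight k (X l)) = of_int (cartan k l)"
      using X ij that by (auto simp: s_def weight_def)
    then show ?thesis using hexp_letter[of k n "X l" s] by (simp add: K_def x_def)
  qed
  have KK: "K j \<otimes>\<^bsub>Uh n\<^esub> K i = K i \<otimes>\<^bsub>Uh n\<^esub> K j" unfolding K_def by (rule hexp_hexp) (use ij in auto)
  have KK': "K j \<otimes>\<^bsub>Uh n\<^esub> (K i \<otimes>\<^bsub>Uh n\<^esub> z) = K i \<otimes>\<^bsub>Uh n\<^esub> (K j \<otimes>\<^bsub>Uh n\<^esub> z)" if "z \<in> carrier (Uh n)" for z
    using KK that by (simp flip: Uh.m_assoc)
  interpret Q: qring "Uh n" "Uh_scalar n qh" "Uh_scalar n qh_inv" by (rule Uh_qring)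
  interpret Q2: qring "Uh2 n" "s2 n qh" "s2 n qh_inv" by (rule Uh2_qring)
  have serre: "Q.qserre (x j) (x i)" if "i = Suc j \<or> j = Suc i"
    using Uh_serre[OF X ij that] by (simp add: x_def)
  have far: "x i \<otimes>\<^bsub>Uh n\<^esub> x j = x j \<otimes>\<^bsub>Uh n\<^esub> x i" if "i \<noteq> j" "\<not> (i = Suc j \<or> j = Suc i)"
    using Uh_far[OF X ij that] by (simp add: x_def)
  note T = utens_mult utens_add utens_smul
  show ?thesis
  proof (cases "X = Xp")
    case True
    have D: "Delta n (mon [X k]) = utens n (x k) (K k) \<oplus>\<^bsub>Uh2 n\<^esub> utens n \<one>\<^bsub>Uh n\<^esub> (x k)" if "k \<in> {1..n}" for k
      using Delta_letter(1)[OF that] True by (simp add: x_def K_def s_def)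
    show ?thesis
    proof (rule that[of "utens n (x i) (K i)" "utens n \<one>\<^bsub>Uh n\<^esub> (x i)" "utens n (x j) (K j)" "utens n \<one>\<^bsub>Uh n\<^esub> (x j)"])
      assume a: "i = Suc j \<or> j = Suc i"
      show "Q2.qserre (utens n (x j) (K j)) (utens n (x i) (K i))"
        using serre[OF a] by (simp add: Q2.qserre_def Q.qserre_def utens_mult KK KK' flip: utens_add(1) utens_smul(1))
      show "Q2.qserre (utens n \<one>\<^bsub>Uh n\<^esub> (x j)) (utens n \<one>\<^bsub>Uh n\<^esub> (x i))"
        using serre[OF a] by (simp add: Q2.qserre_def Q.qserre_def utens_mult flip: utens_smul(2) utens_add(2))
    qed (use D ij Kx two far cartan_sym KK in \<open>simp_all add: T\<close>)
  next
    case False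
    have D: "Delta n (mon [X k]) = utens n (K k) (x k) \<oplus>\<^bsub>Uh2 n\<^esub> utens n (x k) \<one>\<^bsub>Uh n\<^esub>" if "k \<in> {1..n}" for k
      using Delta_letter(2)[OF that] False X by (simp add: x_def K_def s_def)
    show ?thesis
    proof (rule that[of "utens n (K i) (x i)" "utens n (x i) \<one>\<^bsub>Uh n\<^esub>" "utens n (K j) (x j)" "utens n (x j) \<one>\<^bsub>Uh n\<^esub>"])
      assume a: "i = Suc j \<or> j = Suc i"
      show "Q2.qserre (utens n (K j) (x j)) (utens n (K i) (x i))"
        using serre[OF a] by (simp add: Q2.qserre_def Q.qserre_def utens_mult KK KK' flip: utens_add(2) utens_smul(2))
      show "Q2.qserre (utens n (x j) \<one>\<^bsub>Uh n\<^esub>) (utens n (x i) \<one>\<^bsub>Uh n\<^esub>)"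
        using serre[OF a] by (simp add: Q2.qserre_def Q.qserre_def utens_mult flip: utens_smul(1) utens_add(1))
    qed (use D ij Kx two far cartan_sym KK in \<open>simp_all add: T\<close>)
  qed
qed

lemma Delta_rel:
  assumes "r \<in> Uh_rels n" shows "Delta n r = \<zero>\<^bsub>Uh2 n\<^esub>"
proof -
  have m [simp]: "mon w \<in> FAset n" if "set w \<subseteq> gens n" for w
    using that by (intro FA.mon_closed) auto
  have diff: "Delta n (\<lambda>w. f w - g w) = \<zero>\<^bsub>Uh2 n\<^esub>" if "f \<in> FAset n" "g \<in> FAset n" "Delta n f = Delta n g" for f g
    using that by (simp add: Delta_diff)
  have H: "Delta n (\<lambda>w. mon [Hg i, g] w - (mon [g, Hg i] w + smul (of_int (weight i g)) (mon [g]) w)) = \<zero>\<^bsub>Uh2 n\<^esub>"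
    if "i \<in> {1..n}" "g \<in> gens n" for i g
    using that Delta_Hg[OF that] by (intro diff) (simp_all add: Delta_add Delta_smul)
  interpret Q2: qring "Uh2 n" "s2 n qh" "s2 n qh_inv" by (rule Uh2_qring)
  from assms show ?thesis
  proof (cases rule: Uh_rels_cases)
    case (HH i j)
    then show ?thesis using H[of i "Hg j"] by (simp add: weight_def smul_apply)
  next
    case (HXp i j)
    then show ?thesis using H[of i "Xp j"] by (simp add: weight_def smul_apply diff_diff_eq)
  next
    case (HXm i j)
    have "r = (\<lambda>w. mon [Hg i, Xm j] w - (mon [Xm j, Hg i] w + smul (of_int (weight i (Xm j))) (mon [Xm j]) w))"
      unfolding HXm(3) by (rule ext) (simp add: weight_def smul_apply)
    then show ?thesis using H[of i "Xm j"] HXm(1,2) by simp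
  next
    case (XX i j)
    define h where "h = (\<lambda>w. if i = j then H_rel i w else 0)"
    have h: "h \<in> FAset n" "Delta n h = (if i = j then Delta n (H_rel i) else \<zero>\<^bsub>Uh2 n\<^esub>)"
    proof -
      have "h = (if i = j then H_rel i else (\<lambda>w. 0))" by (simp add: h_def)
      then show "h \<in> FAset n" "Delta n h = (if i = j then Delta n (H_rel i) else \<zero>\<^bsub>Uh2 n\<^esub>)"
        using H_rel_closed[OF XX(1)] FA.F.zero_closed[of n]
          Ring.ring_hom_zero[OF Delta_hom FA.F_ring Uh2_ring, of n] by (auto split: if_splits)
    qed
    have "r = (\<lambda>w. mon [Xp i, Xm j] w - (mon [Xm j, Xp i] w + h w))"
      unfolding XX(3) h_def by (simp add: diff_diff_eq)
    moreover have "Delta n (mon [Xp i, Xm j]) = Delta n (\<lambda>w. mon [Xm j, Xp i] w + h w)"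
      using Delta_add[of "mon [Xm j, Xp i]" n h] XX(1,2) h(1) unfolding Delta_Xp_Xm[OF XX(1,2)] h(2) by simp
    ultimately show ?thesis
      using diff[of "mon [Xp i, Xm j]" "\<lambda>w. mon [Xm j, Xp i] w + h w"] XX(1,2) h(1) by simp
  next
    case (near X i j)
    then have X: "X i \<in> gens n" "X j \<in> gens n" by auto
    obtain A B C D where *: "A \<in> carrier (Uh2 n)" "B \<in> carrier (Uh2 n)" "C \<in> carrier (Uh2 n)" "D \<in> carrier (Uh2 n)"
      "Delta n (mon [X i]) = A \<oplus>\<^bsub>Uh2 n\<^esub> B" "Delta n (mon [X j]) = C \<oplus>\<^bsub>Uh2 n\<^esub> D"
      "A \<otimes>\<^bsub>Uh2 n\<^esub> B = s2 n (qh * qh) \<otimes>\<^bsub>Uh2 n\<^esub> (B \<otimes>\<^bsub>Uh2 n\<^esub> A)"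
      "A \<otimes>\<^bsub>Uh2 n\<^esub> D = s2 n (fps_exp (of_int (cartan i j))) \<otimes>\<^bsub>Uh2 n\<^esub> (D \<otimes>\<^bsub>Uh2 n\<^esub> A)"
      "C \<otimes>\<^bsub>Uh2 n\<^esub> B = s2 n (fps_exp (of_int (cartan i j))) \<otimes>\<^bsub>Uh2 n\<^esub> (B \<otimes>\<^bsub>Uh2 n\<^esub> C)"
      "Q2.qserre C A" "Q2.qserre D B"
      by (rule Delta_Xp_Xm_split[OF near(1-3)]) (use near(4) in blast)
    have "fps_exp (of_int (cartan i j)) = qh_inv" using near(4) by (auto simp: cartan_def qh_inv_def)
    then have "Q2.qserre (C \<oplus>\<^bsub>Uh2 n\<^esub> D) (A \<oplus>\<^bsub>Uh2 n\<^esub> B)"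
      using * by (intro Q2.qserre_add) (simp_all add: s2_mult Uh2.m_assoc)
    then show ?thesis unfolding near(5)
      by (subst serre_image_iff[OF Uh2_ring Delta_hom Delta_smul X]) (simp_all add: Q2.qserre_def *(5,6))
  next
    case (far X i j)
    then have X: "X i \<in> gens n" "X j \<in> gens n" by auto
    obtain A B C D where *: "A \<in> carrier (Uh2 n)" "B \<in> carrier (Uh2 n)" "C \<in> carrier (Uh2 n)" "D \<in> carrier (Uh2 n)"
      "Delta n (mon [X i]) = A \<oplus>\<^bsub>Uh2 n\<^esub> B" "Delta n (mon [X j]) = C \<oplus>\<^bsub>Uh2 n\<^esub> D"
      "A \<otimes>\<^bsub>Uh2 n\<^esub> D = s2 n (fps_exp (of_int (cartan i j))) \<otimes>\<^bsub>Uh2 n\<^esub> (D \<otimes>\<^bsub>Uh2 n\<^esub> A)"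
      "C \<otimes>\<^bsub>Uh2 n\<^esub> B = s2 n (fps_exp (of_int (cartan i j))) \<otimes>\<^bsub>Uh2 n\<^esub> (B \<otimes>\<^bsub>Uh2 n\<^esub> C)"
      "A \<otimes>\<^bsub>Uh2 n\<^esub> C = C \<otimes>\<^bsub>Uh2 n\<^esub> A" "B \<otimes>\<^bsub>Uh2 n\<^esub> D = D \<otimes>\<^bsub>Uh2 n\<^esub> B"
      by (rule Delta_Xp_Xm_split[OF far(1-3)]) (use far(4,5) in blast)
    have e: "s2 n (fps_exp (of_int (cartan i j))) = \<one>\<^bsub>Uh2 n\<^esub>" using far(4,5) by (auto simp: cartan_def s2_one)
    have "Delta n (mon [X i]) \<otimes>\<^bsub>Uh2 n\<^esub> Delta n (mon [X j]) = Delta n (mon [X j]) \<otimes>\<^bsub>Uh2 n\<^esub> Delta n (mon [X i])"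
      using *(1-4,7-10) by (simp add: *(5,6) e Uh2.l_distr Uh2.r_distr) (simp add: Uh2.a_ac)
    then show ?thesis unfolding far(6) using X by (intro diff) (simp_all add: Delta_word2)
  qed
qed

text \<open>The relators are killed, hence so is the ideal they generate. An element of the closure
  is handled by linearity over the power series: its approximations modulo h^m go to approximations
  of its image, and the target ideal is closed.\<close>

lemma comult_ideal:
  assumes "x \<in> Uh_ideal n" shows "comult_FA n x \<in> Uh2_ideal n"
proof (rule Uh2_ideal_closed)
  interpret D: ring_hom_ring "FA n" "Uh2 n" "Delta n"
    by (rule ring_hom_ringI2[OF FA.F_ring Uh2_ring Delta_hom])
  have "Uh_rels n \<subseteq> a_kernel (FA n) (Uh2 n) (Delta n)"
    unfolding a_kernel_def' using Delta_rel[of _ n] Uh_rels_closed[of n] by blast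
  then have Idl: "Idl\<^bsub>FA n\<^esub> (Uh_rels n) \<subseteq> a_kernel (FA n) (Uh2 n) (Delta n)"
    by (rule FA.F.genideal_minimal[OF D.kernel_is_ideal])
  have ker: "comult_FA n s \<in> Uh2_ideal n" if s: "s \<in> Idl\<^bsub>FA n\<^esub> (Uh_rels n)" for s
  proof -
    have "s \<in> FAset n" "Delta n s = \<zero>\<^bsub>Uh2 n\<^esub>" using subsetD[OF Idl s] unfolding a_kernel_def' by simp_all
    then show ?thesis using cl2_zero_iff[OF comult_FA_closed] unfolding Delta_def by blast
  qed
  show "comult_FA n x \<in> FA2set n" using assms by (intro comult_FA_closed J_carrier)
  fix m
  obtain s u where su: "s \<in> Idl\<^bsub>FA n\<^esub> (Uh_rels n)" "u \<in> FAset n" "x = (\<lambda>w. s w + fps_X ^ m * u w)"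
    using assms unfolding Uh_ideal_def FA.hclosure_iff by blast
  have s: "s \<in> FAset n"
    using ideal.Icarr[OF FA.F.genideal_ideal[OF Uh_rels_closed] su(1)] by simp
  have "x = (\<lambda>w. s w + smul (fps_X ^ m) u w)" using su(3) by (simp add: smul_apply)
  then have "comult_FA n x = (\<lambda>p. comult_FA n s p + smul (fps_X ^ m) (comult_FA n u) p)"
    using s su(2) by (simp add: comult_FA_add comult_FA_smul)
  then have "comult_FA n x = (\<lambda>p. comult_FA n s p + fps_X ^ m * comult_FA n u p)"
    by (simp add: smul_apply)
  then show "\<exists>s\<in>Uh2_ideal n. \<exists>u\<in>FA2set n. comult_FA n x = (\<lambda>w. s w + fps_X ^ m * u w)"
    using ker[OF su(1)] comult_FA_closed[OF su(2)] by blast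
qed

lemma comult_class: "f \<in> FAset n \<Longrightarrow> comult n (Uh_class n f) = Delta n f"
  unfolding comult_def Uh_class_def Delta_def cl2_def
  by (rule quot_map_coset[OF Uh_ideal_ideal Uh2_ideal_ideal])
    (simp_all add: comult_FA_closed comult_FA_add comult_ideal)

lemma comult_hom: "comult n \<in> Ring.ring_hom (Uh n) (Uh2 n)"
  unfolding comult_def Uh_def Uh2_def
  by (rule quot_map_ring_hom[OF Uh_ideal_ideal Uh2_ideal_ideal comult_FA_hom comult_ideal])

section \<open>Coproducts of the root vectors\<close>

lemma (in qring) qb_add:
  assumes "x \<in> carrier R" "y \<in> carrier R" "z \<in> carrier R"
  shows "qb (x \<oplus> y) z = qb x z \<oplus> qb y z" and "qb z (x \<oplus> y) = qb z x \<oplus> qb z y"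
  using assms by (auto intro!: emb_eqI simp: qb_def emb_simps algebra_simps)

lemma (in qring) qb_zero: "x \<in> carrier R \<Longrightarrow> qb \<zero> x = \<zero>"
  by (simp add: qb_def)

text \<open>Automorphisms of the Dynkin diagram. The identity and the reversal are the two that
  occur, so one computation of coproducts serves both families of root vectors.\<close>

definition good_perm :: "nat \<Rightarrow> (nat \<Rightarrow> nat) \<Rightarrow> bool" where
  "good_perm n \<sigma> \<longleftrightarrow> (\<forall>i\<in>{1..n}. \<sigma> i \<in> {1..n}) \<and>
     (\<forall>i\<in>{1..n}. \<forall>j\<in>{1..n}. cartan (\<sigma> i) (\<sigma> j) = cartan i j)"

lemma good_perm_id: "good_perm n (\<lambda>i. i)"
  by (simp add: good_perm_def)

lemma good_perm_rev: "good_perm n (\<lambda>i. Suc n - i)"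
proof -
  have "cartan (Suc n - i) (Suc n - j) = cartan i j" if "i \<in> {1..n}" "j \<in> {1..n}" for i j
  proof -
    have eqs: "Suc n - i = Suc n - j \<longleftrightarrow> i = j" "Suc n - i = Suc (Suc n - j) \<longleftrightarrow> j = Suc i"
      "Suc n - j = Suc (Suc n - i) \<longleftrightarrow> i = Suc j"
      using that unfolding atLeastAtMost_iff by arith+
    show ?thesis unfolding cartan_def eqs by auto
  qed
  then show ?thesis by (auto simp: good_perm_def)
qed

lemma Uh_qchain:
  assumes "good_perm n \<sigma>"
  shows "qchain (Uh n) (Uh_scalar n qh) (Uh_scalar n qh_inv) n (\<lambda>i. Xc n (Xp (\<sigma> i)))"
proof -
  interpret Q: qring "Uh n" "Uh_scalar n qh" "Uh_scalar n qh_inv" by (rule Uh_qring)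
  have ran: "\<sigma> i \<in> {1..n}" if "1 \<le> i" "i \<le> n" for i using assms that by (simp add: good_perm_def)
  have car: "cartan (\<sigma> i) (\<sigma> j) = cartan i j" if "1 \<le> i" "i \<le> n" "1 \<le> j" "j \<le> n" for i j
    using assms that by (simp add: good_perm_def)
  have adj: "cartan a b = - 1 \<longleftrightarrow> a = Suc b \<or> b = Suc a" for a b by (auto simp: cartan_def)
  have zer: "cartan a b = 0 \<longleftrightarrow> a \<noteq> b \<and> \<not> (a = Suc b \<or> b = Suc a)" for a b by (auto simp: cartan_def)
  show ?thesis
  proof
    fix i j
    show "Xc n (Xp (\<sigma> i)) \<in> carrier (Uh n)" if "1 \<le> i" "i \<le> n" using ran[OF that] by simp
    show "Xc n (Xp (\<sigma> i)) \<otimes>\<^bsub>Uh n\<^esub> Xc n (Xp (\<sigma> j)) = Xc n (Xp (\<sigma> j)) \<otimes>\<^bsub>Uh n\<^esub> Xc n (Xp (\<sigma> i))"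
      if ij: "1 \<le> i" "Suc i < j" "j \<le> n"
    proof -
      have "cartan (\<sigma> i) (\<sigma> j) = 0" using ij by (subst car) (auto simp: zer)
      then show ?thesis using ran[of i] ran[of j] ij unfolding zer by (intro Uh_far) auto
    qed
    show "Q.qserre (Xc n (Xp (\<sigma> i))) (Xc n (Xp (\<sigma> (Suc i))))"
      "Q.qserre (Xc n (Xp (\<sigma> (Suc i)))) (Xc n (Xp (\<sigma> i)))" if ij: "1 \<le> i" "i < n"
    proof -
      have "cartan (\<sigma> i) (\<sigma> (Suc i)) = - 1" using ij by (subst car) (auto simp: adj)
      then show "Q.qserre (Xc n (Xp (\<sigma> i))) (Xc n (Xp (\<sigma> (Suc i))))"
        "Q.qserre (Xc n (Xp (\<sigma> (Suc i)))) (Xc n (Xp (\<sigma> i)))"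
        using ran[of i] ran[of "Suc i"] ij unfolding adj by (auto intro!: Uh_serre)
    qed
  qed
qed

lemma utens_diff:
  assumes "x \<in> carrier (Uh n)" "y \<in> carrier (Uh n)" "z \<in> carrier (Uh n)"
  shows "utens n z (x \<ominus>\<^bsub>Uh n\<^esub> y) = utens n z x \<ominus>\<^bsub>Uh2 n\<^esub> utens n z y"
    and "utens n (x \<ominus>\<^bsub>Uh n\<^esub> y) z = utens n x z \<ominus>\<^bsub>Uh2 n\<^esub> utens n y z"
proof -
  have x: "x = (x \<ominus>\<^bsub>Uh n\<^esub> y) \<oplus>\<^bsub>Uh n\<^esub> y" using assms by (simp add: Uh.minus_eq Uh.a_assoc Uh.l_neg)
  have "utens n z x = utens n z (x \<ominus>\<^bsub>Uh n\<^esub> y) \<oplus>\<^bsub>Uh2 n\<^esub> utens n z y"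
    by (subst x, rule utens_add(2)) (use assms in auto)
  then show "utens n z (x \<ominus>\<^bsub>Uh n\<^esub> y) = utens n z x \<ominus>\<^bsub>Uh2 n\<^esub> utens n z y"
    using assms by (simp add: Uh2.minus_eq Uh2.a_assoc Uh2.r_neg)
  have "utens n x z = utens n (x \<ominus>\<^bsub>Uh n\<^esub> y) z \<oplus>\<^bsub>Uh2 n\<^esub> utens n y z"
    by (subst x, rule utens_add(1)) (use assms in auto)
  then show "utens n (x \<ominus>\<^bsub>Uh n\<^esub> y) z = utens n x z \<ominus>\<^bsub>Uh2 n\<^esub> utens n y z"
    using assms by (simp add: Uh2.minus_eq Uh2.a_assoc Uh2.r_neg)
qed

lemma comult_closed [simp]: "x \<in> carrier (Uh n) \<Longrightarrow> comult n x \<in> carrier (Uh2 n)"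
  by (rule ring_hom_closed[OF comult_hom])

lemma comult_scalar: "comult n (Uh_scalar n c) = s2 n c"
  by (simp add: Uh_scalar_def comult_class Delta_smul Delta_one)

lemma comult_qb:
  assumes "x \<in> carrier (Uh n)" "y \<in> carrier (Uh n)"
  shows "comult n (qring.qb (Uh n) (Uh_scalar n qh) x y) = qring.qb (Uh2 n) (s2 n qh) (comult n x) (comult n y)"
proof -
  interpret Q: qring "Uh n" "Uh_scalar n qh" "Uh_scalar n qh_inv" by (rule Uh_qring)
  interpret Q2: qring "Uh2 n" "s2 n qh" "s2 n qh_inv" by (rule Uh2_qring)
  interpret C: ring_hom_ring "Uh n" "Uh2 n" "comult n" by (rule ring_hom_ringI2[OF Uh_ring Uh2_ring comult_hom])
  show ?thesis using assms by (simp add: Q.qb_def Q2.qb_def Uh.minus_eq Uh2.minus_eq comult_scalar)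
qed

locale coideal_chain =
  fixes n :: nat and \<sigma> :: "nat \<Rightarrow> nat"
  assumes good: "good_perm n \<sigma>"
begin

abbreviation e :: "nat \<Rightarrow> (gen list \<Rightarrow> complex fps) set" where "e k \<equiv> Xc n (Xp (\<sigma> k))"
abbreviation K :: "nat \<Rightarrow> (gen list \<Rightarrow> complex fps) set" where "K k \<equiv> Kc n 1 (\<sigma> k)"

sublocale qchain "Uh n" "Uh_scalar n qh" "Uh_scalar n qh_inv" n "\<lambda>i. Xc n (Xp (\<sigma> i))"
  by (rule Uh_qchain[OF good])

lemma \<sigma>_range: "1 \<le> k \<Longrightarrow> k \<le> n \<Longrightarrow> \<sigma> k \<in> {1..n}"
  using good by (simp add: good_perm_def)

lemma K_closed [simp]: "1 \<le> k \<Longrightarrow> k \<le> n \<Longrightarrow> K k \<in> carrier (Uh n)"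
  using \<sigma>_range by simp

lemma K_e:
  assumes "1 \<le> k" "k \<le> n" "1 \<le> l" "l \<le> n"
  shows "K k \<otimes>\<^bsub>Uh n\<^esub> e l = Uh_scalar n (fps_exp (of_int (cartan k l))) \<otimes>\<^bsub>Uh n\<^esub> (e l \<otimes>\<^bsub>Uh n\<^esub> K k)"
  using hexp_letter[of "\<sigma> k" n "Xp (\<sigma> l)" 1] \<sigma>_range assms good by (simp add: weight_def good_perm_def)

lemma K_Suc_e: "1 \<le> k \<Longrightarrow> k < n \<Longrightarrow> K (Suc k) \<otimes>\<^bsub>Uh n\<^esub> e k = Uh_scalar n qh_inv \<otimes>\<^bsub>Uh n\<^esub> (e k \<otimes>\<^bsub>Uh n\<^esub> K (Suc k))"
  by (subst K_e) (auto simp: cartan_def qh_inv_def)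

lemma K_far_e: "1 \<le> k \<Longrightarrow> Suc k < m \<Longrightarrow> m \<le> n \<Longrightarrow> K m \<otimes>\<^bsub>Uh n\<^esub> e k = e k \<otimes>\<^bsub>Uh n\<^esub> K m"
  by (subst K_e) (auto simp: cartan_def Uh_scalar_one)

text \<open>The weight condition met by expressions in e_1, ..., e_k and the K's in which e_k occurs
  exactly once. It is all that the next bracketing, with e_(k+1), has to know about the second
  tensor factors.\<close>

definition Y :: "nat \<Rightarrow> (gen list \<Rightarrow> complex fps) set set" where
  "Y k = {y \<in> carrier (Uh n).
     (k < n \<longrightarrow> K (Suc k) \<otimes>\<^bsub>Uh n\<^esub> y = Uh_scalar n qh_inv \<otimes>\<^bsub>Uh n\<^esub> (y \<otimes>\<^bsub>Uh n\<^esub> K (Suc k))) \<and>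
     (\<forall>m. Suc k < m \<and> m \<le> n \<longrightarrow> K m \<otimes>\<^bsub>Uh n\<^esub> y = y \<otimes>\<^bsub>Uh n\<^esub> K m)}"

text \<open>The required power of q comes from e_(k+1) alone, so y only has to commute with the
  later K's. This covers elements of \<open>Y k\<close> as well as the factor \<kappa> of the
  leading tensor.\<close>

lemma qb_Y:
  assumes y: "y \<in> carrier (Uh n)" and k: "k < n"
    and comm: "\<And>m. Suc k < m \<Longrightarrow> m \<le> n \<Longrightarrow> K m \<otimes>\<^bsub>Uh n\<^esub> y = y \<otimes>\<^bsub>Uh n\<^esub> K m"
  shows "qb y (e (Suc k)) \<in> Y (Suc k)"
proof -
  have e: "e (Suc k) \<in> carrier (Uh n)" using k by simp
  have "K (Suc (Suc k)) \<otimes>\<^bsub>Uh n\<^esub> qb y (e (Suc k)) =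
      Uh_scalar n qh_inv \<otimes>\<^bsub>Uh n\<^esub> (qb y (e (Suc k)) \<otimes>\<^bsub>Uh n\<^esub> K (Suc (Suc k)))" if "Suc k < n"
    using qcommute_qb[OF y e, of "K (Suc (Suc k))" "\<one>\<^bsub>Uh n\<^esub>" "Uh_scalar n qh_inv"] that comm y
      K_Suc_e[of "Suc k"] Uh_scalar_central by simp
  moreover have "K m \<otimes>\<^bsub>Uh n\<^esub> qb y (e (Suc k)) = qb y (e (Suc k)) \<otimes>\<^bsub>Uh n\<^esub> K m" if "Suc (Suc k) < m" "m \<le> n" for m
    using commute_qb[OF y e, of "K m"] that comm K_far_e[of "Suc k" m] by simp
  ultimately show ?thesis using y e by (simp add: Y_def)
qed

text \<open>The bound on the index of A is strict: A_k itself occurs only in the leading term of its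
  coproduct.\<close>

definition lower_tensors :: "nat \<Rightarrow> (gen list \<times> gen list \<Rightarrow> complex fps) set set" where
  "lower_tensors k = {utens n a y | a y. a \<in> insert \<one>\<^bsub>Uh n\<^esub> (A ` {1..<k}) \<and> y \<in> Y k}"

text \<open>Bracketing a \<otimes> y with e \<otimes> K gives ae \<otimes> (yK - qKy) because a and
  e commute, and this vanishes by the weight of y. Otherwise first factors ae_(k+1) would appear,
  which the spanning sets of tensors do not allow. Bracketing with 1 \<otimes> e changes only the
  second factor.\<close>

lemma lower_tensors_step:
  assumes "z \<in> lspan (Uh2 n) {\<one>\<^bsub>Uh2 n\<^esub>} (lower_tensors k)" and k: "k < n"
  defines "Q2 \<equiv> qring.qb (Uh2 n) (s2 n qh)"
  shows "z \<in> carrier (Uh2 n) \<and> Q2 z (utens n (e (Suc k)) (K (Suc k))) = \<zero>\<^bsub>Uh2 n\<^esub> \<and>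
    Q2 z (utens n \<one>\<^bsub>Uh n\<^esub> (e (Suc k))) \<in> lspan (Uh2 n) {\<one>\<^bsub>Uh2 n\<^esub>} (lower_tensors (Suc k))"
proof -
  interpret Q2: qring "Uh2 n" "s2 n qh" "s2 n qh_inv" by (rule Uh2_qring)
  have e [simp]: "e (Suc k) \<in> carrier (Uh n)" "K (Suc k) \<in> carrier (Uh n)" using k by simp_all
  show ?thesis using assms(1)
  proof (induction rule: lspan.induct)
    case lspan_zero
    then show ?case by (simp add: Q2_def Q2.qb_zero lspan.lspan_zero)
  next
    case (lspan_step z c g)
    then obtain a y where g: "g = utens n a y" "a \<in> insert \<one>\<^bsub>Uh n\<^esub> (A ` {1..<k})" "y \<in> Y k"
      unfolding lower_tensors_def by blast
    have a [simp]: "a \<in> carrier (Uh n)" using g(2) k by auto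
    have y [simp]: "y \<in> carrier (Uh n)" using g(3) by (simp add: Y_def)
    have ea: "e (Suc k) \<otimes>\<^bsub>Uh n\<^esub> a = a \<otimes>\<^bsub>Uh n\<^esub> e (Suc k)"
      using g(2) k A_far[of _ "Suc k"] by auto
    have Ky: "K (Suc k) \<otimes>\<^bsub>Uh n\<^esub> y = Uh_scalar n qh_inv \<otimes>\<^bsub>Uh n\<^esub> (y \<otimes>\<^bsub>Uh n\<^esub> K (Suc k))"
      using g(3) k by (simp add: Y_def)
    have "s2 n qh \<otimes>\<^bsub>Uh2 n\<^esub> (s2 n qh_inv \<otimes>\<^bsub>Uh2 n\<^esub> u) = u" if "u \<in> carrier (Uh2 n)" for u
      using that by (simp add: s2_one qh_mult flip: Uh2.m_assoc s2_mult)
    then have 1: "Q2 g (utens n (e (Suc k)) (K (Suc k))) = \<zero>\<^bsub>Uh2 n\<^esub>"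
      by (simp add: Q2_def Q2.qb_def g(1) utens_mult ea Ky utens_smul)
    have "Q2 g (utens n \<one>\<^bsub>Uh n\<^esub> (e (Suc k))) = utens n a (qb y (e (Suc k)))"
      by (simp add: Q2_def Q2.qb_def g(1) utens_mult qb_def utens_diff utens_smul)
    moreover have "qb y (e (Suc k)) \<in> Y (Suc k)" using g(3) k by (intro qb_Y) (auto simp: Y_def)
    moreover have "a \<in> insert \<one>\<^bsub>Uh n\<^esub> (A ` {1..<Suc k})" using g(2) by auto
    ultimately have 2: "Q2 g (utens n \<one>\<^bsub>Uh n\<^esub> (e (Suc k))) \<in> lower_tensors (Suc k)"
      unfolding lower_tensors_def by blast
    have g' [simp]: "g \<in> carrier (Uh2 n)" by (simp add: g(1))
    have c: "c \<otimes>\<^bsub>Uh2 n\<^esub> g = g" using lspan_step(2) by simp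
    have "Q2 z (utens n \<one>\<^bsub>Uh n\<^esub> (e (Suc k))) \<oplus>\<^bsub>Uh2 n\<^esub> \<one>\<^bsub>Uh2 n\<^esub> \<otimes>\<^bsub>Uh2 n\<^esub> Q2 g (utens n \<one>\<^bsub>Uh n\<^esub> (e (Suc k)))
      \<in> lspan (Uh2 n) {\<one>\<^bsub>Uh2 n\<^esub>} (lower_tensors (Suc k))"
      using lspan_step.IH 2 by (intro lspan.lspan_step) auto
    then show ?case
      using lspan_step.IH 1 unfolding c by (simp add: Q2_def Q2.qb_add)
  qed
qed

text \<open>The factor \<kappa> is K_1 ... K_k (indices permuted by \<sigma>), of which only
  commutation with the K's is recorded. Bracketing the leading term with e \<otimes> K reproduces a
  leading term, since the bracket acts on the first factor alone; bracketing it with 1 \<otimes> e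
  yields one new lower tensor.\<close>

lemma comult_A:
  assumes "1 \<le> k" "k \<le> n"
  shows "\<exists>\<kappa>\<in>carrier (Uh n). \<exists>z\<in>lspan (Uh2 n) {\<one>\<^bsub>Uh2 n\<^esub>} (lower_tensors k).
    (\<forall>m\<in>{1..n}. K m \<otimes>\<^bsub>Uh n\<^esub> \<kappa> = \<kappa> \<otimes>\<^bsub>Uh n\<^esub> K m) \<and> comult n (A k) = utens n (A k) \<kappa> \<oplus>\<^bsub>Uh2 n\<^esub> z"
  using assms
proof (induction k rule: dec_induct)
  case base
  have e1: "e 1 \<in> Y 1" using base K_Suc_e[of 1] K_far_e[of 1] by (auto simp: Y_def)
  have KK: "K m \<otimes>\<^bsub>Uh n\<^esub> K 1 = K 1 \<otimes>\<^bsub>Uh n\<^esub> K m" if "m \<in> {1..n}" for m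
    using that base by (intro hexp_hexp \<sigma>_range) auto
  have "comult n (A 1) = utens n (A 1) (K 1) \<oplus>\<^bsub>Uh2 n\<^esub> utens n \<one>\<^bsub>Uh n\<^esub> (e 1)"
    using Delta_letter(1)[OF \<sigma>_range[of 1]] \<sigma>_range[of 1] base by (simp add: nest_1 comult_class)
  moreover have "\<zero>\<^bsub>Uh2 n\<^esub> \<oplus>\<^bsub>Uh2 n\<^esub> \<one>\<^bsub>Uh2 n\<^esub> \<otimes>\<^bsub>Uh2 n\<^esub> utens n \<one>\<^bsub>Uh n\<^esub> (e 1) \<in> lspan (Uh2 n) {\<one>\<^bsub>Uh2 n\<^esub>} (lower_tensors 1)"
    using e1 by (intro lspan.intros) (auto simp: lower_tensors_def)
  then have "utens n \<one>\<^bsub>Uh n\<^esub> (e 1) \<in> lspan (Uh2 n) {\<one>\<^bsub>Uh2 n\<^esub>} (lower_tensors 1)"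
    using base by simp
  ultimately show ?case using KK base K_closed[of 1] by blast
next
  case (step k)
  interpret Q2: qring "Uh2 n" "s2 n qh" "s2 n qh_inv" by (rule Uh2_qring)
  have k: "k < n" "1 \<le> k" using step by auto
  obtain \<kappa> z where \<kappa>: "\<kappa> \<in> carrier (Uh n)" "\<forall>m\<in>{1..n}. K m \<otimes>\<^bsub>Uh n\<^esub> \<kappa> = \<kappa> \<otimes>\<^bsub>Uh n\<^esub> K m"
    and z: "z \<in> lspan (Uh2 n) {\<one>\<^bsub>Uh2 n\<^esub>} (lower_tensors k)"
    and Ak: "comult n (A k) = utens n (A k) \<kappa> \<oplus>\<^bsub>Uh2 n\<^esub> z"
    using step by auto
  note z' = lower_tensors_step[OF z k(1)]
  let ?e = "e (Suc k)" and ?K = "K (Suc k)" and ?A = "A k"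
  have [simp]: "?e \<in> carrier (Uh n)" "?K \<in> carrier (Uh n)" "?A \<in> carrier (Uh n)" "z \<in> carrier (Uh2 n)" "\<kappa> \<in> carrier (Uh n)"
    using k z' \<kappa> by simp_all
  have K\<kappa>: "?K \<otimes>\<^bsub>Uh n\<^esub> \<kappa> = \<kappa> \<otimes>\<^bsub>Uh n\<^esub> ?K" using \<kappa>(2) k by auto
  have De: "comult n ?e = utens n ?e ?K \<oplus>\<^bsub>Uh2 n\<^esub> utens n \<one>\<^bsub>Uh n\<^esub> ?e"
    using Delta_letter(1)[OF \<sigma>_range[of "Suc k"]] \<sigma>_range[of "Suc k"] k by (simp add: comult_class)
  have 1: "Q2.qb (utens n ?A \<kappa>) (utens n ?e ?K) = utens n (A (Suc k)) (\<kappa> \<otimes>\<^bsub>Uh n\<^esub> ?K)"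
    using k by (simp add: nest_Suc Q2.qb_def qb_def utens_mult K\<kappa> utens_diff utens_smul)
  have 2: "Q2.qb (utens n ?A \<kappa>) (utens n \<one>\<^bsub>Uh n\<^esub> ?e) = utens n ?A (qb \<kappa> ?e)"
    by (simp add: Q2.qb_def qb_def utens_mult utens_diff utens_smul)
  have "qb \<kappa> ?e \<in> Y (Suc k)" using \<kappa> k by (intro qb_Y) auto
  moreover have "?A \<in> insert \<one>\<^bsub>Uh n\<^esub> (A ` {1..<Suc k})" using k by auto
  ultimately have low: "utens n ?A (qb \<kappa> ?e) \<in> lower_tensors (Suc k)"
    unfolding lower_tensors_def by blast
  \<comment> \<open>The new lower part: the old one bracketed with 1 \<otimes> e, plus the
    contribution of the old leading term.\<close>
  define z2 where "z2 = Q2.qb z (utens n \<one>\<^bsub>Uh n\<^esub> ?e) \<oplus>\<^bsub>Uh2 n\<^esub> \<one>\<^bsub>Uh2 n\<^esub> \<otimes>\<^bsub>Uh2 n\<^esub> utens n ?A (qb \<kappa> ?e)"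
  have z2: "z2 \<in> lspan (Uh2 n) {\<one>\<^bsub>Uh2 n\<^esub>} (lower_tensors (Suc k))"
    unfolding z2_def using z' low by (intro lspan.lspan_step) auto
  have "comult n (A (Suc k)) = Q2.qb (utens n ?A \<kappa> \<oplus>\<^bsub>Uh2 n\<^esub> z) (utens n ?e ?K \<oplus>\<^bsub>Uh2 n\<^esub> utens n \<one>\<^bsub>Uh n\<^esub> ?e)"
    using k by (simp add: nest_Suc comult_qb Ak De)
  also have "\<dots> = utens n (A (Suc k)) (\<kappa> \<otimes>\<^bsub>Uh n\<^esub> ?K) \<oplus>\<^bsub>Uh2 n\<^esub> z2"
    using z' k by (simp add: Q2.qb_add 1 2 z2_def) (simp add: Uh2.a_ac)
  finally have "comult n (A (Suc k)) = utens n (A (Suc k)) (\<kappa> \<otimes>\<^bsub>Uh n\<^esub> ?K) \<oplus>\<^bsub>Uh2 n\<^esub> z2" .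
  moreover have "K m \<otimes>\<^bsub>Uh n\<^esub> (\<kappa> \<otimes>\<^bsub>Uh n\<^esub> ?K) = \<kappa> \<otimes>\<^bsub>Uh n\<^esub> ?K \<otimes>\<^bsub>Uh n\<^esub> K m" if m: "m \<in> {1..n}" for m
  proof -
    have Km: "K m \<in> carrier (Uh n)" using m by simp
    have "K m \<otimes>\<^bsub>Uh n\<^esub> (\<kappa> \<otimes>\<^bsub>Uh n\<^esub> ?K) = \<kappa> \<otimes>\<^bsub>Uh n\<^esub> (K m \<otimes>\<^bsub>Uh n\<^esub> ?K)"
      using \<kappa>(2) m Km by (simp flip: Uh.m_assoc)
    also have "K m \<otimes>\<^bsub>Uh n\<^esub> ?K = ?K \<otimes>\<^bsub>Uh n\<^esub> K m"
      using m k by (intro hexp_hexp \<sigma>_range) auto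
    finally show ?thesis using Km by (simp add: Uh.m_assoc)
  qed
  ultimately show ?case using z2 by (intro bexI[of _ "\<kappa> \<otimes>\<^bsub>Uh n\<^esub> ?K"] bexI[of _ z2]) auto
qed

end

lemma comult_Kpart: "set is \<subseteq> {1..n} \<Longrightarrow> comult_FA n (Kpart is) = ftens (Kpart is) (Kpart is)"
proof (induction "is")
  case Nil
  then show ?case using comult_FA_mon[of "[]" n] by (simp add: Kpart_def ftens_mon)
next
  case (Cons i "is")
  then show ?case
    using Kpart_closed[of "is" n] comult_FA_mult[of "Kp i" n "Kpart is"] comult_hexp[of i n 1]
    by (simp add: Kpart_def ftens_conv)
qed

lemma comult_Kprod: "comult_FA n (Kprod n) = ftens (Kprod n) (Kprod n)"
  unfolding Kprod_Kpart by (rule comult_Kpart) auto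

text \<open>From K \<otimes> K - 1 \<otimes> 1 = (K - 1) \<otimes> K + 1 \<otimes> (K - 1), with q -
  1 cancelled in the free algebra.\<close>

lemma comult_Lgen:
  "comult_FA n (Lgen n) = (\<lambda>p. ftens (Lgen n) (Kprod n) p + ftens (mon []) (Lgen n) p)"
proof -
  have K1: "(\<lambda>w. Kprod n w - mon [] w) = (\<lambda>w. Kprod n w + smul (- 1) (mon []) w)" by (simp add: smul_apply)
  have "smul (qh - 1) (comult_FA n (Lgen n)) = comult_FA n (\<lambda>w. Kprod n w - mon [] w)"
    unfolding Lgen_mult[symmetric] by (rule comult_FA_smul[OF Lgen_closed, symmetric])
  also have "\<dots> = (\<lambda>p. ftens (Kprod n) (Kprod n) p + smul (- 1) (mon ([], [])) p)"
    unfolding K1 using comult_FA_mon[of "[]" n] by (simp add: comult_FA_add comult_FA_smul comult_Kprod)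
  also have "\<dots> = (\<lambda>p. ftens (\<lambda>w. Kprod n w - mon [] w) (Kprod n) p + ftens (mon []) (\<lambda>w. Kprod n w - mon [] w) p)"
    unfolding ftens_diff ftens_mon by (simp add: smul_apply)
  also have "\<dots> = smul (qh - 1) (\<lambda>p. ftens (Lgen n) (Kprod n) p + ftens (mon []) (Lgen n) p)"
    unfolding Lgen_mult[symmetric] ftens_smul by (simp add: smul_apply fun_eq_iff algebra_simps)
  finally show ?thesis using qh_diff(4) by (fastforce simp: smul_apply fun_eq_iff)
qed

section \<open>The coideal property\<close>

lemma tensor_sub_utens:
  assumes "x \<in> M" "M \<subseteq> carrier (Uh n)" "y \<in> carrier (Uh n)"
  shows "utens n x y \<in> tensor_sub n M (carrier (Uh n))"
proof -
  obtain f where f: "f \<in> FAset n" "x = Uh_class n f" using assms Uh_carrierE by blast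
  obtain g where g: "g \<in> FAset n" "y = Uh_class n g" using assms Uh_carrierE by blast
  have "utens n x y = Uh2_ideal n +>\<^bsub>FA2 n\<^esub> ftens f g" using f g by (simp add: utens_class cl2_def)
  then show ?thesis
    unfolding tensor_sub_def using f g assms FA_simps(1) by (intro generate.incl) blast
qed

lemma (in ring) add_generate_props:
  assumes "G \<subseteq> carrier R"
  defines "T \<equiv> generate (add_monoid R) G"
  shows "T \<subseteq> carrier R" "\<zero> \<in> T"
    "\<And>x y. x \<in> T \<Longrightarrow> y \<in> T \<Longrightarrow> x \<oplus> y \<in> T" "\<And>x. x \<in> T \<Longrightarrow> \<ominus> x \<in> T"
proof -
  have T: "subgroup T (add_monoid R)"
    unfolding T_def using assms by (intro group.generate_is_subgroup a_group) auto
  show "T \<subseteq> carrier R" "\<zero> \<in> T" "\<And>x y. x \<in> T \<Longrightarrow> y \<in> T \<Longrightarrow> x \<oplus> y \<in> T"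
    using subgroup.subset[OF T] subgroup.one_closed[OF T] subgroup.m_closed[OF T] by auto
  show "\<ominus> x \<in> T" if "x \<in> T" for x
    using subgroup.m_inv_closed[OF T that] by (simp only: a_inv_def)
qed

lemma (in ring) add_generate_induct [consumes 2, case_names zero incl minus add]:
  assumes G: "G \<subseteq> carrier R" and x: "x \<in> generate (add_monoid R) G"
    and zero: "P \<zero>" and incl: "\<And>g. g \<in> G \<Longrightarrow> P g" and minus: "\<And>g. g \<in> G \<Longrightarrow> P (\<ominus> g)"
    and add: "\<And>x y. x \<in> carrier R \<Longrightarrow> y \<in> carrier R \<Longrightarrow> P x \<Longrightarrow> P y \<Longrightarrow> P (x \<oplus> y)"
  shows "P x"
  using x
proof (induction rule: generate.induct)
  case (inv h)
  then show ?case using minus by (simp only: a_inv_def)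
next
  case (eng x y)
  then show ?case using add add_generate_props(1)[OF G] by (simp add: subset_iff)
qed (use zero incl in auto)

lemma (in ring) add_generate_mult:
  assumes G: "G \<subseteq> carrier R"
    and closed: "\<And>g h. g \<in> G \<Longrightarrow> h \<in> G \<Longrightarrow> g \<otimes> h \<in> generate (add_monoid R) G"
    and s: "s \<in> generate (add_monoid R) G" and t: "t \<in> generate (add_monoid R) G"
  shows "s \<otimes> t \<in> generate (add_monoid R) G"
proof -
  note T = add_generate_props[OF G]
  have l: "g \<otimes> t \<in> generate (add_monoid R) G" if g: "g \<in> G" for g
    using G t
  proof (induction rule: add_generate_induct)
    case (minus h)
    then show ?case using T(4)[OF closed[OF g minus]] g G by (simp add: r_minus subset_iff)
  next
    case (add x y)
    then show ?case using T(3) g G by (simp add: r_distr subset_iff)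
  qed (use g G T(2) closed in \<open>auto simp: subset_iff\<close>)
  have tc: "t \<in> carrier R" using T(1) t by blast
  show ?thesis using G s
  proof (induction rule: add_generate_induct)
    case (minus h)
    then show ?case using T(4)[OF l[OF minus]] tc G by (simp add: l_minus subset_iff)
  next
    case (add x y)
    then show ?case using T(3) tc by (simp add: l_distr)
  qed (use tc l T(2) in auto)
qed

text \<open>Since the coproduct is multiplicative, this reduces the coideal property to the
  generators.\<close>

lemma tensor_sub_subring:
  assumes M: "subring M (Uh n)"
  shows "subring (tensor_sub n M (carrier (Uh n))) (Uh2 n)"
proof -
  define G where "G = {Uh2_ideal n +>\<^bsub>FA2 n\<^esub> ftens f g | f g.
        f \<in> carrier (FA n) \<and> g \<in> carrier (FA n) \<and> Uh_class n f \<in> M \<and> Uh_class n g \<in> carrier (Uh n)}"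
  have T: "tensor_sub n M (carrier (Uh n)) = generate (add_monoid (Uh2 n)) G"
    by (simp add: tensor_sub_def G_def)
  note Mc = subringE(1)[OF M]
  have G: "\<exists>x\<in>M. \<exists>y\<in>carrier (Uh n). g = utens n x y" if g: "g \<in> G" for g
  proof -
    obtain f f' where f: "f \<in> FAset n" "f' \<in> FAset n" "Uh_class n f \<in> M" "g = cl2 n (ftens f f')"
      using g unfolding cl2_def FA_simps G_def by blast
    then have "g = utens n (Uh_class n f) (Uh_class n f')" by (simp add: utens_class)
    then show ?thesis using f Uh_class_closed by blast
  qed
  have Gc: "G \<subseteq> carrier (Uh2 n)"
    using G Mc utens_closed by fastforce
  note gen = tensor_sub_utens[OF _ Mc, unfolded T]
  have closed: "g \<otimes>\<^bsub>Uh2 n\<^esub> h \<in> generate (add_monoid (Uh2 n)) G" if gh: "g \<in> G" "h \<in> G" for g h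
  proof -
    obtain x y where g: "x \<in> M" "y \<in> carrier (Uh n)" "g = utens n x y" using G gh(1) by blast
    obtain x' y' where h: "x' \<in> M" "y' \<in> carrier (Uh n)" "h = utens n x' y'" using G gh(2) by blast
    have "g \<otimes>\<^bsub>Uh2 n\<^esub> h = utens n (x \<otimes>\<^bsub>Uh n\<^esub> x') (y \<otimes>\<^bsub>Uh n\<^esub> y')"
      unfolding g h using g h Mc by (intro utens_mult) auto
    then show ?thesis using gen[OF subringE(6)[OF M g(1) h(1)], of "y \<otimes>\<^bsub>Uh n\<^esub> y'"] g h by simp
  qed
  note T' = Uh2.add_generate_props[OF Gc]
  have "\<one>\<^bsub>Uh2 n\<^esub> \<in> generate (add_monoid (Uh2 n)) G"
    using gen[OF subringE(3)[OF M], of "\<one>\<^bsub>Uh n\<^esub>"] by (simp add: utens_one)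
  then show ?thesis
    unfolding T using T' Uh2.add_generate_mult[OF Gc closed] by (intro Uh2.subringI) auto
qed

section \<open>The Lie algebra \<open>sl(n+1)\<close>\<close>

abbreviation MC :: "nat \<Rightarrow> complex mat set" where "MC n \<equiv> carrier_mat (Suc n) (Suc n)"

lemma munit_carrier [simp]: "munit n i j \<in> MC n"
  by (simp add: munit_def)

lemma munit_dim [simp]: "dim_row (munit n i j) = Suc n" "dim_col (munit n i j) = Suc n"
  by (simp_all add: munit_def)

lemma munit_index [simp]:
  "a < Suc n \<Longrightarrow> b < Suc n \<Longrightarrow> munit n i j $$ (a, b) = (if a = i \<and> b = j then 1 else 0)"
  by (simp add: munit_def)

lemma mat_mult_index:
  assumes "A \<in> MC n" "B \<in> MC n" "a \<le> n" "b \<le> n"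
  shows "(A * B) $$ (a, b) = (\<Sum>c<Suc n. A $$ (a, c) * B $$ (c, b))"
  using assms by (simp add: scalar_prod_def atLeast0LessThan)

lemma munit_mult:
  assumes "i \<le> n" "j \<le> n" "k \<le> n" "l \<le> n"
  shows "munit n i j * munit n k l = (if j = k then munit n i l else 0\<^sub>m (n+1) (n+1))"
proof (rule eq_matI)
  fix a b assume "a < dim_row (if j = k then munit n i l else 0\<^sub>m (n+1) (n+1))"
    "b < dim_col (if j = k then munit n i l else 0\<^sub>m (n+1) (n+1))"
  then have ab: "a \<le> n" "b \<le> n" by (auto split: if_splits)
  have "(munit n i j * munit n k l) $$ (a, b) = (\<Sum>c<Suc n. munit n i j $$ (a, c) * munit n k l $$ (c, b))"
    using ab by (intro mat_mult_index) auto
  also have "\<dots> = (\<Sum>c<Suc n. if c = j then (if a = i \<and> j = k \<and> b = l then 1 else 0) else 0)"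
    using ab by (intro sum.cong) auto
  also have "\<dots> = (if j = k then munit n i l else 0\<^sub>m (n+1) (n+1)) $$ (a, b)"
    using ab assms by (auto simp: sum.delta)
  finally show "(munit n i j * munit n k l) $$ (a, b) = (if j = k then munit n i l else 0\<^sub>m (n+1) (n+1)) $$ (a, b)" .
qed auto

lemma lie_munit:
  assumes "i \<le> n" "j \<le> n" "k \<le> n" "l \<le> n"
  shows "lie (munit n i j) (munit n k l) =
    (if j = k then munit n i l else 0\<^sub>m (n+1) (n+1)) - (if l = i then munit n k j else 0\<^sub>m (n+1) (n+1))"
  using assms by (simp add: lie_def munit_mult)

lemma lie_closed [simp]: "x \<in> MC n \<Longrightarrow> y \<in> MC n \<Longrightarrow> lie x y \<in> MC n"
  by (auto simp: lie_def)

lemma lie_add: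
  assumes "x \<in> MC n" "y \<in> MC n" "z \<in> MC n"
  shows "lie (x + y) z = lie x z + lie y z" "lie z (x + y) = lie z x + lie z y"
  using assms
  by (auto simp: lie_def add_mult_distrib_mat[of _ "n+1" "n+1" _ _ "n+1"]
      mult_add_distrib_mat[of _ "n+1" "n+1" _ "n+1"] intro!: eq_matI)

lemma lie_smult:
  assumes "x \<in> MC n" "z \<in> MC n"
  shows "lie (c \<cdot>\<^sub>m x) z = c \<cdot>\<^sub>m lie x z" "lie z (c \<cdot>\<^sub>m x) = c \<cdot>\<^sub>m lie z x"
  using assms
  by (auto simp: lie_def mult_smult_assoc_mat[of _ "n+1" "n+1" _ "n+1"]
      mult_smult_distrib[of _ "n+1" "n+1" _ "n+1"] algebra_simps intro!: eq_matI)

lemma lie_zero: "x \<in> MC n \<Longrightarrow> lie (0\<^sub>m (n+1) (n+1)) x = 0\<^sub>m (n+1) (n+1)"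
  "x \<in> MC n \<Longrightarrow> lie x (0\<^sub>m (n+1) (n+1)) = 0\<^sub>m (n+1) (n+1)"
  by (auto simp: lie_def)

lemma sl_carrier: "x \<in> sl n \<Longrightarrow> x \<in> MC n" by (simp add: sl_def)

lemma sl_add:
  assumes "x \<in> sl n" "y \<in> sl n" shows "x + y \<in> sl n"
proof -
  have "(\<Sum>i<n+1. (x + y) $$ (i, i)) = (\<Sum>i<n+1. x $$ (i, i) + y $$ (i, i))"
    using assms by (intro sum.cong) (auto simp: sl_def)
  then show ?thesis using assms by (simp add: sl_def sum.distrib del: sum.lessThan_Suc)
qed

lemma sl_smult:
  assumes "x \<in> sl n" shows "c \<cdot>\<^sub>m x \<in> sl n"
proof -
  have "(\<Sum>i<n+1. (c \<cdot>\<^sub>m x) $$ (i, i)) = (\<Sum>i<n+1. c * x $$ (i, i))"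
    using assms by (intro sum.cong) (auto simp: sl_def)
  then show ?thesis using assms by (simp add: sl_def sum_distrib_left[symmetric] del: sum.lessThan_Suc)
qed

lemma sl_zero: "0\<^sub>m (n+1) (n+1) \<in> sl n" by (simp add: sl_def)

lemma sl_munit: "i \<noteq> j \<Longrightarrow> munit n i j \<in> sl n"
  by (auto simp: sl_def intro!: sum.neutral)

lemma sl_diag: "i \<le> n \<Longrightarrow> j \<le> n \<Longrightarrow> munit n i i - munit n j j \<in> sl n"
  by (auto simp: sl_def sum_subtractf)

lemma trace_mult_commute:
  assumes "x \<in> MC n" "y \<in> MC n"
  shows "(\<Sum>i<n+1. (x * y) $$ (i, i)) = (\<Sum>i<n+1. (y * x) $$ (i, i))"
proof -
  have "(\<Sum>i<n+1. (x * y) $$ (i, i)) = (\<Sum>i<n+1. \<Sum>c<Suc n. x $$ (i, c) * y $$ (c, i))"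
    using assms by (intro sum.cong refl mat_mult_index) auto
  also have "\<dots> = (\<Sum>c<Suc n. \<Sum>i<n+1. y $$ (c, i) * x $$ (i, c))"
    by (subst sum.swap) (simp add: mult.commute)
  also have "\<dots> = (\<Sum>i<n+1. (y * x) $$ (i, i))"
    using assms mat_mult_index[of y n x] by (intro sum.cong) auto
  finally show ?thesis .
qed

lemma sl_lie: 
  assumes "x \<in> MC n" "y \<in> MC n" shows "lie x y \<in> sl n"
proof -
  have "(\<Sum>i<n+1. lie x y $$ (i, i)) = (\<Sum>i<n+1. (x * y) $$ (i, i) - (y * x) $$ (i, i))"
    using assms by (intro sum.cong) (auto simp: lie_def)
  then show ?thesis
    using trace_mult_commute[OF assms] lie_closed[OF assms] by (simp add: sl_def sum_subtractf del: sum.lessThan_Suc)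
qed

lemma lie_munit_cases:
  assumes "i \<le> n" "j \<le> n" "k \<le> n" "l \<le> n"
  shows "j = k \<Longrightarrow> l \<noteq> i \<Longrightarrow> lie (munit n i j) (munit n k l) = munit n i l"
    and "j \<noteq> k \<Longrightarrow> l = i \<Longrightarrow> lie (munit n i j) (munit n k l) = - 1 \<cdot>\<^sub>m munit n k j"
    and "j \<noteq> k \<Longrightarrow> l \<noteq> i \<Longrightarrow> lie (munit n i j) (munit n k l) = 0\<^sub>m (n+1) (n+1)"
    and "j = k \<Longrightarrow> l = i \<Longrightarrow> lie (munit n i j) (munit n k l) = munit n i i - munit n j j"
  using assms by (auto simp: lie_munit intro!: eq_matI)

lemma smult_one [simp]: "(1 :: complex) \<cdot>\<^sub>m A = A"
  by (auto intro!: eq_matI)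

lemma smult_smult: "a \<cdot>\<^sub>m (b \<cdot>\<^sub>m A) = (a * b :: complex) \<cdot>\<^sub>m A"
  by (auto simp: mult.assoc intro!: eq_matI)

section \<open>The subalgebra \<open>\<hh>\<close>\<close>

lemma nest_lie_e: "1 \<le> k \<Longrightarrow> k \<le> n \<Longrightarrow> nest lie (che n) k = munit n 0 k"
proof (induction k rule: dec_induct)
  case (step k)
  then show ?case by (simp add: nest_Suc che_def lie_munit_cases(1))
qed (simp add: nest_1 che_def)

text \<open>Each bracket extends the root at its left end, and E_(n-k,n) bracketed with
  E_(n-k-1,n-k) is -E_(n-k-1,n); hence the alternating sign.\<close>

lemma nest_lie_e_rev:
  "1 \<le> k \<Longrightarrow> k \<le> n \<Longrightarrow> nest lie (\<lambda>i. che n (Suc n - i)) k = (- 1) ^ (k - 1) \<cdot>\<^sub>m munit n (n - k) n"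
proof (induction k rule: dec_induct)
  case base
  then show ?case by (auto simp: nest_1 che_def)
next
  case (step k)
  have "lie (munit n (n - k) n) (munit n (n - Suc k) (n - k)) = - 1 \<cdot>\<^sub>m munit n (n - Suc k) n"
    using step by (intro lie_munit_cases(2)) auto
  moreover have "k = Suc (k - 1)" using step by simp
  then have "(- 1 :: complex) ^ k = (- 1) ^ (k - 1) * (- 1)" by (metis power_Suc2)
  ultimately show ?case
    using step by (auto simp: nest_Suc che_def lie_smult[where n = n] smult_smult)
qed

lemma rev_upt_map: "k \<in> {1..n} \<Longrightarrow> rev [k..<n+1] = map (\<lambda>i. Suc n - i) [1..<(Suc n - k) + 1]"
  by (rule nth_equalityI) (auto simp: rev_nth simp del: upt_Suc)

lemma nested_rev:
  assumes "k \<in> {1..n}" shows "nested br x (rev [k..<n+1]) = nest br (\<lambda>i. x (Suc n - i)) (Suc n - k)"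
proof -
  have "nested br x (rev [k..<n+1]) = nested br x (map (\<lambda>i. Suc n - i) [1..<(Suc n - k) + 1])"
    using rev_upt_map[OF assms] by (rule arg_cong)
  also have "\<dots> = nested br (\<lambda>i. x (Suc n - i)) [1..<(Suc n - k) + 1]"
    by (rule nested_map) (use assms in auto)
  finally show ?thesis by (simp only: nest_def)
qed

text \<open>A telescoping sum, taken from an arbitrary lower end for the induction.\<close>

lemma chh_sum:
  assumes "1 \<le> m" "m \<le> n + 1"
  shows "foldr (+) (map (chh n) [m..<n+1]) (0\<^sub>m (n+1) (n+1)) = munit n (m - 1) (m - 1) - munit n n n"
  using assms(2,1)
proof (induction m rule: inc_induct)
  case base
  then show ?case by (auto intro!: eq_matI)
next
  case (step m)
  then have "[m..<n+1] = m # [Suc m..<n+1]" by (simp add: upt_conv_Cons)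
  then show ?case using step by (auto simp: chh_def intro!: eq_matI)
qed

text \<open>The signs are those of the nested brackets, so these are exactly the specialized
  generators. The last family stops at k = n - 1 because k = n would repeat E_(0,n) up to
  sign.\<close>

definition h_basis :: "nat \<Rightarrow> complex mat set" where
  "h_basis n = {munit n 0 0 - munit n n n} \<union> {munit n 0 k | k. k \<in> {1..n}} \<union>
     {(- 1) ^ (k - 1) \<cdot>\<^sub>m munit n (n - k) n | k. k \<in> {1..<n}}"

lemma rev_range: "{1..<n} = (\<lambda>k. Suc n - k) ` {2..n}"
proof (intro equalityI subsetI)
  fix x assume "x \<in> {1..<n}"
  then show "x \<in> (\<lambda>k. Suc n - k) ` {2..n}" by (intro image_eqI[of _ _ "Suc n - x"]) auto
qed auto

lemma coiso_h_basis:
  assumes "n \<ge> 1" shows "coiso_h n = mat_span n (h_basis n)"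
proof -
  have 1: "{nested lie (che n) [1..<k+1] | k. k \<in> {1..n}} = {munit n 0 k | k. k \<in> {1..n}}"
  proof -
    have "{nested lie (che n) [1..<k+1] | k. k \<in> {1..n}} = (\<lambda>k. nest lie (che n) k) ` {1..n}"
      by (auto simp only: nest_def)
    also have "\<dots> = (\<lambda>k. munit n 0 k) ` {1..n}"
      by (rule image_cong[OF refl], rule nest_lie_e) auto
    finally show ?thesis by blast
  qed
  have "{nested lie (che n) (rev [k..<n+1]) | k. k \<in> {2..n}} =
      (\<lambda>k. nest lie (\<lambda>i. che n (Suc n - i)) (Suc n - k)) ` {2..n}"
  proof -
    have "{nested lie (che n) (rev [k..<n+1]) | k. k \<in> {2..n}} = (\<lambda>k. nested lie (che n) (rev [k..<n+1])) ` {2..n}"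
      by blast
    also have "\<dots> = (\<lambda>k. nest lie (\<lambda>i. che n (Suc n - i)) (Suc n - k)) ` {2..n}"
      by (rule image_cong[OF refl], rule nested_rev) auto
    finally show ?thesis .
  qed
  also have "\<dots> = (\<lambda>k. nest lie (\<lambda>i. che n (Suc n - i)) k) ` {1..<n}"
  proof -
    show ?thesis unfolding rev_range image_image ..
  qed
  also have "\<dots> = {(- 1) ^ (k - 1) \<cdot>\<^sub>m munit n (n - k) n | k. k \<in> {1..<n}}"
  proof -
    have "(\<lambda>k. nest lie (\<lambda>i. che n (Suc n - i)) k) ` {1..<n} = (\<lambda>k. (- 1) ^ (k - 1) \<cdot>\<^sub>m munit n (n - k) n) ` {1..<n}"
      by (rule image_cong[OF refl], rule nest_lie_e_rev) auto
    then show ?thesis by blast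
  qed
  finally have 2: "{nested lie (che n) (rev [k..<n+1]) | k. k \<in> {2..n}} =
      {(- 1) ^ (k - 1) \<cdot>\<^sub>m munit n (n - k) n | k. k \<in> {1..<n}}" .
  show ?thesis
    unfolding coiso_h_def h_basis_def 1 2 using chh_sum[of 1 n] assms by simp
qed

lemma h_basis_cases:
  assumes "x \<in> h_basis n"
  obtains (H) "x = munit n 0 0 - munit n n n" | (E) k where "k \<in> {1..n}" "x = munit n 0 k"
  | (F) k where "k \<in> {1..<n}" "x = (- 1) ^ (k - 1) \<cdot>\<^sub>m munit n (n - k) n"
  using assms unfolding h_basis_def by blast

lemma h_basis_sl: "n \<ge> 1 \<Longrightarrow> h_basis n \<subseteq> sl n"
  by (auto simp: h_basis_def intro!: sl_diag sl_munit sl_smult)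

lemma mat_span_induct [consumes 1, case_names zero step]:
  assumes "x \<in> mat_span n S" "P (0\<^sub>m (n+1) (n+1))"
    "\<And>x c s. x \<in> mat_span n S \<Longrightarrow> P x \<Longrightarrow> s \<in> S \<Longrightarrow> P (x + c \<cdot>\<^sub>m s)"
  shows "P x"
  using assms(1) unfolding mat_span_def
  by (induction rule: lin_span.induct) (use assms(2,3) in \<open>auto simp: mat_span_def\<close>)

lemma mat_span_zero: "0\<^sub>m (n+1) (n+1) \<in> mat_span n S"
  by (simp add: mat_span_def lin_span.intros)

lemma mat_span_step: "x \<in> mat_span n S \<Longrightarrow> s \<in> S \<Longrightarrow> x + c \<cdot>\<^sub>m s \<in> mat_span n S"
  unfolding mat_span_def by (rule lin_span.intros)

lemma mat_span_sl:
  assumes "S \<subseteq> sl n" "x \<in> mat_span n S" shows "x \<in> sl n"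
  using assms(2) by (induction rule: mat_span_induct) (use assms(1) sl_zero sl_add sl_smult in blast)+

lemma mat_span_add:
  assumes S: "S \<subseteq> sl n" and "x \<in> mat_span n S" "y \<in> mat_span n S"
  shows "x + y \<in> mat_span n S"
  using assms(3)
proof (induction rule: mat_span_induct)
  case zero
  then show ?case using assms(2) mat_span_sl[OF S] sl_carrier by auto
next
  case (step y c s)
  have "x \<in> MC n" "y \<in> MC n" "s \<in> MC n" using step assms mat_span_sl[OF S] sl_carrier by auto
  then have "x + (y + c \<cdot>\<^sub>m s) = (x + y) + c \<cdot>\<^sub>m s" by (auto intro!: eq_matI)
  then show ?case using mat_span_step[OF step.IH step.hyps(2)] by simp
qed

lemma mat_span_smult:
  assumes S: "S \<subseteq> sl n" and "x \<in> mat_span n S"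
  shows "a \<cdot>\<^sub>m x \<in> mat_span n S"
  using assms(2)
proof (induction rule: mat_span_induct)
  case zero
  have "a \<cdot>\<^sub>m 0\<^sub>m (n+1) (n+1) = 0\<^sub>m (n+1) (n+1)" by (auto intro!: eq_matI)
  then show ?case using mat_span_zero by simp
next
  case (step y c s)
  have "y \<in> MC n" "s \<in> MC n" using step assms mat_span_sl[OF S] sl_carrier by auto
  then have "a \<cdot>\<^sub>m (y + c \<cdot>\<^sub>m s) = a \<cdot>\<^sub>m y + (a * c) \<cdot>\<^sub>m s" by (auto simp: algebra_simps intro!: eq_matI)
  then show ?case using mat_span_step[OF step.IH step.hyps(2)] by simp
qed

lemma mat_span_incl:
  assumes "S \<subseteq> sl n" "s \<in> S" shows "s \<in> mat_span n S"
proof -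
  have "s \<in> MC n" using assms sl_carrier by auto
  then have "s = 0\<^sub>m (n+1) (n+1) + 1 \<cdot>\<^sub>m s" by (auto intro!: eq_matI)
  then show ?thesis using mat_span_step[OF mat_span_zero assms(2)] by metis
qed

context
  fixes n :: nat
  assumes n: "n \<ge> 1"
begin

lemma h_munit: "1 \<le> k \<Longrightarrow> k \<le> n \<Longrightarrow> munit n 0 k \<in> mat_span n (h_basis n)"
  by (rule mat_span_incl[OF h_basis_sl[OF n]]) (auto simp: h_basis_def)

lemma h_munit': "k < n \<Longrightarrow> munit n k n \<in> mat_span n (h_basis n)"
proof (cases "k = 0")
  case True
  then show ?thesis using h_munit[of n] n by simp
next
  case False
  assume k: "k < n"
  define l where "l = n - k"
  have l: "l \<in> {1..<n}" "n - l = k" using k False by (auto simp: l_def)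
  have "(- 1) ^ (l - 1) \<cdot>\<^sub>m munit n (n - l) n \<in> h_basis n" using l(1) by (auto simp: h_basis_def)
  \<comment> \<open>Multiplying by the same sign again undoes it; the witness l = n - k is the
    position of E_(k,n) in the basis.\<close>
  then have "(- 1) ^ (l - 1) \<cdot>\<^sub>m ((- 1) ^ (l - 1) \<cdot>\<^sub>m munit n (n - l) n) \<in> mat_span n (h_basis n)"
    by (rule mat_span_smult[OF h_basis_sl[OF n] mat_span_incl[OF h_basis_sl[OF n]]])
  moreover have "(- 1) ^ (l - 1) * (- 1) ^ (l - 1) = (1 :: complex)"
    by (simp flip: power_mult_distrib)
  ultimately show ?thesis by (simp add: smult_smult l(2))
qed

text \<open>Up to signs of the basis, the elements E_(0,k) and E_(k,n) span a Heisenberg algebra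
  with centre E_(0,n), and the diagonal element acts on it as a grading. Scalars are pulled out
  first, so that only brackets of matrix units and the diagonal element remain.\<close>

lemma h_lie_basis:
  assumes x: "x \<in> h_basis n" and y: "y \<in> h_basis n"
  shows "lie x y \<in> mat_span n (h_basis n)"
proof -
  note sm = mat_span_smult[OF h_basis_sl[OF n]]
  have z: "0\<^sub>m (Suc n) (Suc n) \<in> mat_span n (h_basis n)" using mat_span_zero[of n] by simp
  have HE: "lie (munit n 0 0 - munit n n n) (munit n 0 k) \<in> mat_span n (h_basis n) \<and>
    lie (munit n 0 k) (munit n 0 0 - munit n n n) \<in> mat_span n (h_basis n)" if "1 \<le> k" "k \<le> n" for k
  proof -
    have "lie (munit n 0 0 - munit n n n) (munit n 0 k) = (if k = n then 2 else 1) \<cdot>\<^sub>m munit n 0 k"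
      "lie (munit n 0 k) (munit n 0 0 - munit n n n) = (if k = n then - 2 else - 1) \<cdot>\<^sub>m munit n 0 k"
      using that n
      by (auto simp: lie_def minus_mult_distrib_mat[of _ "n+1" "n+1" _ _ "n+1"]
        mult_minus_distrib_mat[of _ "n+1" "n+1" _ "n+1"] munit_mult intro!: eq_matI)
    then show ?thesis using sm[OF h_munit[OF that]] by simp
  qed
  have HF: "lie (munit n 0 0 - munit n n n) (munit n k n) \<in> mat_span n (h_basis n) \<and>
    lie (munit n k n) (munit n 0 0 - munit n n n) \<in> mat_span n (h_basis n)" if "1 \<le> k" "k < n" for k
  proof -
    have "lie (munit n 0 0 - munit n n n) (munit n k n) = 1 \<cdot>\<^sub>m munit n k n"
      "lie (munit n k n) (munit n 0 0 - munit n n n) = - 1 \<cdot>\<^sub>m munit n k n"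
      using that n
      by (auto simp: lie_def minus_mult_distrib_mat[of _ "n+1" "n+1" _ _ "n+1"]
        mult_minus_distrib_mat[of _ "n+1" "n+1" _ "n+1"] munit_mult intro!: eq_matI)
    then show ?thesis using sm[OF h_munit'[OF that(2)]] h_munit'[OF that(2)] by simp
  qed
  have EE: "lie (munit n 0 k) (munit n 0 l) \<in> mat_span n (h_basis n)" if "k \<in> {1..n}" "l \<in> {1..n}" for k l
    using that z by (subst lie_munit_cases(3)) auto
  have FF: "lie (munit n k n) (munit n l n) \<in> mat_span n (h_basis n)" if "k < n" "l < n" for k l
    using that z by (subst lie_munit_cases(3)) auto
  have EF: "lie (munit n 0 k) (munit n l n) \<in> mat_span n (h_basis n) \<and>
    lie (munit n l n) (munit n 0 k) \<in> mat_span n (h_basis n)" if "k \<in> {1..n}" "l \<in> {1..<n}" for k l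
  proof (cases "k = l")
    case True
    then show ?thesis
      using that n h_munit[of n] sm[OF h_munit[of n], of "- 1"]
        lie_munit_cases(1)[of 0 n k l n] lie_munit_cases(2)[of l n n 0 k] by auto
  next
    case False
    then show ?thesis
      using that n z lie_munit_cases(3)[of 0 n k l n] lie_munit_cases(3)[of l n n 0 k] by auto
  qed
  define G where "G = {munit n 0 0 - munit n n n} \<union> (\<lambda>k. munit n 0 k) ` {1..n} \<union> (\<lambda>k. munit n k n) ` {1..<n}"
  have GG: "lie u v \<in> mat_span n (h_basis n)" if "u \<in> G" "v \<in> G" for u v
  proof -
    have HH: "lie (munit n 0 0 - munit n n n) (munit n 0 0 - munit n n n) = 0\<^sub>m (Suc n) (Suc n)"
      by (auto simp: lie_def intro!: eq_matI)
    from that show ?thesis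
      unfolding G_def by (elim UnE imageE singletonE) (use HE HF EE FF EF HH z in simp_all)
  qed
  have G: "\<exists>c. \<exists>g\<in>G. u = c \<cdot>\<^sub>m g" if "u \<in> h_basis n" for u
    using that
  proof (cases rule: h_basis_cases)
    case H
    then show ?thesis by (intro exI[of _ 1] bexI[of _ u]) (auto simp: G_def)
  next
    case (E k)
    then show ?thesis by (intro exI[of _ 1] bexI[of _ u]) (auto simp: G_def)
  next
    case (F k)
    have "n - k \<in> {1..<n}" using F(1) by auto
    then have "munit n (n - k) n \<in> G" by (auto simp: G_def)
    then show ?thesis using F(2) by blast
  qed
  obtain c g where c: "g \<in> G" "x = c \<cdot>\<^sub>m g" using G[OF x] by blast
  obtain d h where d: "h \<in> G" "y = d \<cdot>\<^sub>m h" using G[OF y] by blast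
  have car: "G \<subseteq> MC n" by (auto simp: G_def)
  have "lie x y = c \<cdot>\<^sub>m (d \<cdot>\<^sub>m lie g h)"
    using c d car by (simp add: lie_smult[where n = n] smult_smult mult.commute subset_iff)
  then show ?thesis using GG[OF c(1) d(1)] sm by simp
qed

lemma h_lie:
  assumes x: "x \<in> mat_span n (h_basis n)" and y: "y \<in> mat_span n (h_basis n)"
  shows "lie x y \<in> mat_span n (h_basis n)"
proof -
  note B = h_basis_sl[OF n]
  have c: "u \<in> MC n" if "u \<in> mat_span n (h_basis n)" for u using that mat_span_sl[OF B] sl_carrier by auto
  have b: "s \<in> MC n" if "s \<in> h_basis n" for s using that B sl_carrier by auto
  have 1: "lie s y \<in> mat_span n (h_basis n)" if s: "s \<in> h_basis n" for s
    using y
  proof (induction rule: mat_span_induct)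
    case zero
    then show ?case using b[OF s] mat_span_zero lie_zero by simp
  next
    case (step y c t)
    then have "lie s (y + c \<cdot>\<^sub>m t) = lie s y + c \<cdot>\<^sub>m lie s t"
      using b[OF s] b[OF step.hyps(2)] c[OF step(1)] by (simp add: lie_add[where n = n] lie_smult[where n = n])
    then show ?case using step h_lie_basis[OF s] by (simp add: mat_span_add[OF B] mat_span_smult[OF B])
  qed
  show ?thesis using x
  proof (induction rule: mat_span_induct)
    case zero
    then show ?case using c[OF y] mat_span_zero lie_zero by simp
  next
    case (step x c s)
    then have "lie (x + c \<cdot>\<^sub>m s) y = lie x y + c \<cdot>\<^sub>m lie s y"
      using b[OF step.hyps(2)] c[OF step(1)] c[OF y] by (simp add: lie_add[where n = n] lie_smult[where n = n])
    then show ?case using step 1 by (simp add: mat_span_add[OF B] mat_span_smult[OF B])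
  qed
qed

section \<open>The cobracket of the basis and coisotropy\<close>

abbreviation hwedge :: "tensor set" where
  "hwedge \<equiv> tensor_span {wedge n a b | a b. a \<in> mat_span n (h_basis n) \<and> b \<in> sl n}"

lemma tensor_span_zero: "(\<lambda>p. 0) \<in> tensor_span S"
  by (simp add: tensor_span_def lin_span.intros)

lemma tensor_span_step: "s \<in> tensor_span S \<Longrightarrow> t \<in> S \<Longrightarrow> (\<lambda>p. s p + c * t p) \<in> tensor_span S"
  using lin_span.intros(2)[of s "\<lambda>p. 0" "\<lambda>s t p. s p + t p" smul S t c]
  by (simp add: tensor_span_def smul_def)

lemma tensor_span_induct [consumes 1, case_names zero step]:
  assumes "s \<in> tensor_span S" "P (\<lambda>p. 0)"
    "\<And>s c t. s \<in> tensor_span S \<Longrightarrow> P s \<Longrightarrow> t \<in> S \<Longrightarrow> P (\<lambda>p. s p + c * t p)"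
  shows "P s"
  using assms(1) unfolding tensor_span_def
proof (induction rule: lin_span.induct)
  case (2 s t c)
  then show ?case using assms(3)[of s t c] by (simp add: tensor_span_def smul_def)
qed (rule assms(2))

lemma tensor_span_add:
  assumes "t \<in> tensor_span S" "s \<in> tensor_span S" shows "(\<lambda>p. s p + t p) \<in> tensor_span S"
  using assms(1)
proof (induction rule: tensor_span_induct)
  case zero
  then show ?case using assms(2) by simp
next
  case (step t c u)
  then show ?case using tensor_span_step[of "\<lambda>p. s p + t p" S u c] by (simp add: add.assoc)
qed

lemma tensor_span_smul:
  assumes "t \<in> tensor_span S" shows "(\<lambda>p. a * t p) \<in> tensor_span S"
  using assms
proof (induction rule: tensor_span_induct)
  case zero
  then show ?case using tensor_span_zero[of S] by simp
next
  case (step t c u)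
  then show ?case using tensor_span_step[of "\<lambda>p. a * t p" S u "a * c"] by (simp add: algebra_simps)
qed

lemma tensor_span_sum:
  assumes "finite I" "\<And>i. i \<in> I \<Longrightarrow> f i \<in> tensor_span S"
  shows "(\<lambda>p. \<Sum>i\<in>I. f i p) \<in> tensor_span S"
  using assms by (induction I) (simp_all add: tensor_span_zero tensor_span_add)

lemma wedge_h: "a \<in> mat_span n (h_basis n) \<Longrightarrow> b \<in> sl n \<Longrightarrow> wedge n a b \<in> hwedge"
  using tensor_span_step[OF tensor_span_zero, of "wedge n a b" "{wedge n a b | a b. a \<in> mat_span n (h_basis n) \<and> b \<in> sl n}" 1]
  by auto

lemma wedge_swap: "wedge n b a = (\<lambda>p. - 1 * wedge n a b p)"
  by (auto simp: wedge_def)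

lemma wedge_h': "a \<in> mat_span n (h_basis n) \<Longrightarrow> b \<in> sl n \<Longrightarrow> wedge n b a \<in> hwedge"
  unfolding wedge_swap[of b a] by (intro tensor_span_smul wedge_h)

lemma wedge_zero: "wedge n (0\<^sub>m (n+1) (n+1)) b \<in> hwedge" "wedge n b (0\<^sub>m (n+1) (n+1)) \<in> hwedge"
proof -
  have "wedge n (0\<^sub>m (n+1) (n+1)) b = (\<lambda>p. 0)" "wedge n b (0\<^sub>m (n+1) (n+1)) = (\<lambda>p. 0)"
    by (auto simp: wedge_def tens_def fun_eq_iff)
  then show "wedge n (0\<^sub>m (n+1) (n+1)) b \<in> hwedge" "wedge n b (0\<^sub>m (n+1) (n+1)) \<in> hwedge"
    by (simp_all add: tensor_span_zero)
qed

lemma tens_lin: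
  assumes "x \<in> MC n" "y \<in> MC n" "z \<in> MC n"
  shows "wedge n (x + c \<cdot>\<^sub>m y) z = (\<lambda>p. wedge n x z p + c * wedge n y z p)"
    "wedge n z (x + c \<cdot>\<^sub>m y) = (\<lambda>p. wedge n z x p + c * wedge n z y p)"
  using assms by (auto simp: wedge_def tens_def fun_eq_iff algebra_simps)

lemma wedge_smult:
  assumes "y \<in> MC n" "z \<in> MC n"
  shows "wedge n (c \<cdot>\<^sub>m y) z = (\<lambda>p. c * wedge n y z p)" "wedge n z (c \<cdot>\<^sub>m y) = (\<lambda>p. c * wedge n z y p)"
  using assms by (auto simp: wedge_def tens_def fun_eq_iff algebra_simps)

lemma cobracket_lin:
  assumes "x \<in> MC n" "y \<in> MC n"
  shows "cobracket n (x + c \<cdot>\<^sub>m y) = (\<lambda>p. cobracket n x p + c * cobracket n y p)"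
proof -
  have "lie (x + c \<cdot>\<^sub>m y) z = lie x z + c \<cdot>\<^sub>m lie y z" if "z \<in> MC n" for z
    using assms that by (simp add: lie_add[where n = n] lie_smult[where n = n])
  then have "wedge n (lie (x + c \<cdot>\<^sub>m y) (munit n i j)) (munit n j i) p + wedge n (munit n i j) (lie (x + c \<cdot>\<^sub>m y) (munit n j i)) p
     = (wedge n (lie x (munit n i j)) (munit n j i) p + wedge n (munit n i j) (lie x (munit n j i)) p) +
      c * (wedge n (lie y (munit n i j)) (munit n j i) p + wedge n (munit n i j) (lie y (munit n j i)) p)" for i j p
    using assms tens_lin[of "lie x (munit n i j)" "lie y (munit n i j)" "munit n j i" c]
      tens_lin[of "lie x (munit n j i)" "lie y (munit n j i)" "munit n i j" c]
    by (simp add: algebra_simps)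
  then show ?thesis
    by (simp add: cobracket_def fun_eq_iff sum_distrib_left sum.distrib[symmetric] algebra_simps case_prod_unfold)
qed

text \<open>The summands for the individual positive roots lie in the span one by one, so no
  cancellation between different roots has to be followed.\<close>

lemma cobracket_termwise:
  assumes "\<And>i j. i < j \<Longrightarrow> j \<le> n \<Longrightarrow>
    (\<lambda>p. wedge n (lie x (munit n i j)) (munit n j i) p + wedge n (munit n i j) (lie x (munit n j i)) p) \<in> hwedge"
  shows "cobracket n x \<in> hwedge"
proof -
  have fin: "finite {(i, j). i < j \<and> j < n + 1}"
    by (rule finite_subset[of _ "{..n} \<times> {..n}"]) auto
  have "(\<lambda>p. \<Sum>q\<in>{(i, j). i < j \<and> j < n+1}. 1 / killing n (munit n (fst q) (snd q)) (munit n (snd q) (fst q)) *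
       (wedge n (lie x (munit n (fst q) (snd q))) (munit n (snd q) (fst q)) p +
        wedge n (munit n (fst q) (snd q)) (lie x (munit n (snd q) (fst q))) p)) \<in> hwedge"
    by (rule tensor_span_sum[OF fin], rule tensor_span_smul) (use assms in auto)
  then show ?thesis by (simp add: cobracket_def case_prod_unfold)
qed

text \<open>In each nonzero wedge one entry lies in row 0 right of the diagonal, hence in
  \<open>\<hh>\<close>: either the bracket with E_(0,k) moves a matrix unit there, or the entry left
  alone is E_(i,j) with i = 0.\<close>

lemma cobracket_E:
  assumes k: "k \<in> {1..n}" shows "cobracket n (munit n 0 k) \<in> hwedge"
proof (rule cobracket_termwise, rule tensor_span_add)
  fix i j assume ij: "i < j" "j \<le> n"
  have mid: "munit n j i \<in> sl n" "munit n i j \<in> sl n" using ij by (auto intro: sl_munit)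
  show "wedge n (lie (munit n 0 k) (munit n i j)) (munit n j i) \<in> hwedge"
  proof (cases "k = i")
    case True
    then have "lie (munit n 0 k) (munit n i j) = munit n 0 j" using ij k by (intro lie_munit_cases) auto
    then show ?thesis using wedge_h[OF h_munit[of j] mid(1)] ij by simp
  next
    case False
    then have "lie (munit n 0 k) (munit n i j) = 0\<^sub>m (n+1) (n+1)" using ij k by (intro lie_munit_cases) auto
    then show ?thesis using wedge_zero by simp
  qed
  consider "k = j" "i \<noteq> 0" | "k \<noteq> j" "i = 0" | "k \<noteq> j" "i \<noteq> 0" | "k = j" "i = 0" by blast
  then show "wedge n (munit n i j) (lie (munit n 0 k) (munit n j i)) \<in> hwedge"
  proof cases
    case 1
    then have "lie (munit n 0 k) (munit n j i) = munit n 0 i" using ij k by (intro lie_munit_cases) auto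
    then show ?thesis using wedge_h'[OF h_munit[of i] mid(2)] ij 1 by simp
  next
    case 2
    then have "lie (munit n 0 k) (munit n j i) = - 1 \<cdot>\<^sub>m munit n j k" using ij k by (intro lie_munit_cases) auto
    then show ?thesis using wedge_h[OF h_munit[of j] sl_smult[OF sl_munit[of j k]], of "- 1"] ij 2 by simp
  next
    case 3
    then have "lie (munit n 0 k) (munit n j i) = 0\<^sub>m (n+1) (n+1)" using ij k by (intro lie_munit_cases) auto
    then show ?thesis using wedge_zero by simp
  next
    case 4
    then have "lie (munit n 0 k) (munit n j i) = munit n 0 0 - munit n k k" using ij k by (intro lie_munit_cases) auto
    then show ?thesis using wedge_h[OF h_munit[of j] sl_diag[of 0 n k]] ij k 4 by simp
  qed
qed

text \<open>The mirror image, with the last column in the role of row 0.\<close>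

lemma cobracket_F:
  assumes k: "k < n" shows "cobracket n (munit n k n) \<in> hwedge"
proof (rule cobracket_termwise, rule tensor_span_add)
  fix i j assume ij: "i < j" "j \<le> n"
  have mid: "munit n j i \<in> sl n" "munit n i j \<in> sl n" using ij by (auto intro: sl_munit)
  show "wedge n (lie (munit n k n) (munit n i j)) (munit n j i) \<in> hwedge"
  proof (cases "j = k")
    case True
    then have "lie (munit n k n) (munit n i j) = - 1 \<cdot>\<^sub>m munit n i n" using ij k by (intro lie_munit_cases) auto
    then show ?thesis
      using wedge_h[OF mat_span_smult[OF h_basis_sl[OF n] h_munit'[of i]] mid(1), of "- 1"] ij by simp
  next
    case False
    then have "lie (munit n k n) (munit n i j) = 0\<^sub>m (n+1) (n+1)" using ij k by (intro lie_munit_cases) auto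
    then show ?thesis using wedge_zero by simp
  qed
  consider "n = j" "i \<noteq> k" | "n \<noteq> j" "i = k" | "n \<noteq> j" "i \<noteq> k" | "n = j" "i = k" by blast
  then show "wedge n (munit n i j) (lie (munit n k n) (munit n j i)) \<in> hwedge"
  proof cases
    case 1
    then have "lie (munit n k n) (munit n j i) = munit n k i" using ij k by (intro lie_munit_cases) auto
    then show ?thesis using wedge_h[OF h_munit'[of i] sl_munit[of k i]] ij 1 by simp
  next
    case 2
    then have "lie (munit n k n) (munit n j i) = - 1 \<cdot>\<^sub>m munit n j n" using ij k by (intro lie_munit_cases) auto
    then show ?thesis
      using wedge_h'[OF mat_span_smult[OF h_basis_sl[OF n] h_munit'[of j]] mid(2), of "- 1"] ij 2 by simp
  next
    case 3
    then have "lie (munit n k n) (munit n j i) = 0\<^sub>m (n+1) (n+1)" using ij k by (intro lie_munit_cases) auto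
    then show ?thesis using wedge_zero by simp
  next
    case 4
    then have "lie (munit n k n) (munit n j i) = munit n k k - munit n n n" using ij k by (intro lie_munit_cases) auto
    then show ?thesis using wedge_h[OF h_munit'[of i] sl_diag[of k n n]] ij k 4 by simp
  qed
qed

lemma lie_diag_munit:
  assumes "i \<le> n" "j \<le> n" "a \<le> n" "b \<le> n"
  shows "lie (munit n a a - munit n b b) (munit n i j) =
    (of_bool (a = i) - of_bool (a = j) - of_bool (b = i) + of_bool (b = j)) \<cdot>\<^sub>m munit n i j"
  using assms
  by (auto simp: lie_def minus_mult_distrib_mat[of _ "n+1" "n+1" _ _ "n+1"]
        mult_minus_distrib_mat[of _ "n+1" "n+1" _ "n+1"] munit_mult intro!: eq_matI)

text \<open>Opposite root vectors have opposite weights, so the two wedges for each root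
  cancel.\<close>

lemma cobracket_H: "cobracket n (munit n 0 0 - munit n n n) \<in> hwedge"
proof (rule cobracket_termwise)
  fix i j assume ij: "i < j" "j \<le> n"
  define c :: complex where "c = of_bool (0 = i) - of_bool (0 = j) - of_bool (n = i) + of_bool (n = j)"
  have "lie (munit n 0 0 - munit n n n) (munit n i j) = c \<cdot>\<^sub>m munit n i j"
    using lie_diag_munit[of i j 0 n] ij by (simp add: c_def)
  moreover have "lie (munit n 0 0 - munit n n n) (munit n j i) = - c \<cdot>\<^sub>m munit n j i"
    using lie_diag_munit[of j i 0 n] ij by (simp add: c_def)
  ultimately have "(\<lambda>p. wedge n (lie (munit n 0 0 - munit n n n) (munit n i j)) (munit n j i) p +
      wedge n (munit n i j) (lie (munit n 0 0 - munit n n n) (munit n j i)) p) = (\<lambda>p. 0)"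
    by (simp only: wedge_smult[OF munit_carrier munit_carrier]) simp
  then show "(\<lambda>p. wedge n (lie (munit n 0 0 - munit n n n) (munit n i j)) (munit n j i) p +
      wedge n (munit n i j) (lie (munit n 0 0 - munit n n n) (munit n j i)) p) \<in> hwedge"
    by (simp only: tensor_span_zero)
qed

lemma cobracket_zero: "cobracket n (0\<^sub>m (n+1) (n+1)) = (\<lambda>p. 0)"
proof -
  \<comment> \<open>Written in this way, linearity expresses the cobracket of 0 as its difference
    with itself.\<close>
  have z: "0\<^sub>m (n+1) (n+1) = (0\<^sub>m (n+1) (n+1) + (- 1) \<cdot>\<^sub>m 0\<^sub>m (n+1) (n+1) :: complex mat)"
    by (auto intro!: eq_matI)
  show ?thesis
    by (subst z, subst cobracket_lin) auto
qed

lemma coisotropic_h: "coisotropic_subalgebra n (coiso_h n)"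
proof -
  note B = h_basis_sl[OF n]
  have b: "s \<in> MC n" if "s \<in> h_basis n" for s using that B sl_carrier by auto
  have basis: "cobracket n s \<in> hwedge" if "s \<in> h_basis n" for s
    using that
  proof (cases rule: h_basis_cases)
    case H then show ?thesis using cobracket_H by simp
  next
    case (E k) then show ?thesis using cobracket_E by simp
  next
    case (F k)
    have "(- 1) ^ (k - 1) \<cdot>\<^sub>m munit n (n - k) n = 0\<^sub>m (n+1) (n+1) + (- 1) ^ (k - 1) \<cdot>\<^sub>m munit n (n - k) n"
      by (auto intro!: eq_matI)
    then have "cobracket n s = (\<lambda>p. 0 + (- 1) ^ (k - 1) * cobracket n (munit n (n - k) n) p)"
      unfolding F(2) using cobracket_lin[of "0\<^sub>m (n+1) (n+1)" "munit n (n - k) n" "(- 1) ^ (k - 1)"] cobracket_zero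
      by simp
    then show ?thesis using F(1) cobracket_F[of "n - k"] by (simp add: tensor_span_smul)
  qed
  have "cobracket n x \<in> hwedge" if "x \<in> mat_span n (h_basis n)" for x
    using that
  proof (induction rule: mat_span_induct)
    case zero then show ?case using cobracket_zero tensor_span_zero by simp
  next
    case (step x c s)
    have "x \<in> MC n" using step mat_span_sl[OF B] sl_carrier by auto
    then show ?case
      using step basis b by (simp add: cobracket_lin tensor_span_add tensor_span_smul)
  qed
  moreover have "lie_subalgebra n (mat_span n (h_basis n))"
    unfolding lie_subalgebra_def
    by (intro conjI ballI allI subsetI mat_span_zero mat_span_add[OF B] mat_span_smult[OF B] h_lie mat_span_sl[OF B])
  ultimately show ?thesis
    unfolding coisotropic_subalgebra_def coiso_h_basis[OF n] by simp
qed

end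

section \<open>The generators of \<open>Bh\<close> and the left coideal property\<close>

lemma nested_qbr_class:
  assumes "is \<noteq> []" "set is \<subseteq> {1..n}"
  shows "nested (qbr n) (\<lambda>i. mon [Xp i]) is \<in> hcomplete (lists (gens n)) \<and>
    Uh_class n (nested (qbr n) (\<lambda>i. mon [Xp i]) is) =
      nested (qring.qb (Uh n) (Uh_scalar n qh)) (\<lambda>i. Xc n (Xp i)) is"
  using assms
proof (induction "is" rule: rev_nonempty_induct)
  case (single i)
  then show ?case by (simp add: nested_single)
next
  case (snoc i js)
  interpret Q: qring "Uh n" "Uh_scalar n qh" "Uh_scalar n qh_inv" by (rule Uh_qring)
  define f where "f = nested (qbr n) (\<lambda>i. mon [Xp i]) js"
  have f: "f \<in> hcomplete (lists (gens n))"
    "Uh_class n f = nested (qring.qb (Uh n) (Uh_scalar n qh)) (\<lambda>i. Xc n (Xp i)) js"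
    using snoc by (auto simp: f_def)
  have i: "mon [Xp i] \<in> hcomplete (lists (gens n))" using snoc by simp
  have "qbr n f (mon [Xp i]) = (\<lambda>w. conv (@) f (mon [Xp i]) w - smul qh (conv (@) (mon [Xp i]) f) w)"
    using f(1) i by (simp add: qbr_def FA.F_minus)
  moreover have "(\<lambda>w. conv (@) f (mon [Xp i]) w - smul qh (conv (@) (mon [Xp i]) f) w) \<in> hcomplete (lists (gens n))"
    using FA.F.minus_closed[of "conv (@) f (mon [Xp i])" n "smul qh (conv (@) (mon [Xp i]) f)"] f(1) i
    by (simp add: FA.F_minus)
  ultimately have "qbr n f (mon [Xp i]) \<in> hcomplete (lists (gens n)) \<and>
      Uh_class n (qbr n f (mon [Xp i])) = Q.qb (Uh_class n f) (Xc n (Xp i))"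
    using f(1) i by (simp add: Uh_class_diff Uh_class_mult Uh_class_smul Q.qb_def)
  then show ?case using snoc.hyps by (simp add: nested_snoc f_def[symmetric] f(2)[symmetric])
qed

abbreviation Uchain :: "nat \<Rightarrow> (nat \<Rightarrow> nat) \<Rightarrow> nat \<Rightarrow> (gen list \<Rightarrow> complex fps) set" where
  "Uchain n \<sigma> \<equiv> nest (qring.qb (Uh n) (Uh_scalar n qh)) (\<lambda>i. Xc n (Xp (\<sigma> i)))"

definition Bgens :: "nat \<Rightarrow> (gen list \<Rightarrow> complex fps) set set" where
  "Bgens n = {Uh_class n (Kprod n), Uh_class n (Lgen n)} \<union> Uchain n (\<lambda>i. i) ` {1..n} \<union>
     Uchain n (\<lambda>i. Suc n - i) ` {1..<n}"

lemma Uchain_closed: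
  assumes "good_perm n \<sigma>" "1 \<le> k" "k \<le> n" shows "Uchain n \<sigma> k \<in> carrier (Uh n)"
proof -
  interpret coideal_chain n \<sigma> by unfold_locales fact
  show ?thesis using assms by simp
qed

lemma Bgens_closed: "Bgens n \<subseteq> carrier (Uh n)"
  using Uchain_closed[OF good_perm_id] Uchain_closed[OF good_perm_rev] by (auto simp: Bgens_def)

lemma Bh_Bgens: "Bh n = generate_ring (Uh n) (range (Uh_scalar n) \<union> Bgens n)"
proof -
  have 1: "Uh_class n ` {nested (qbr n) (\<lambda>i. mon [Xp i]) [1..<k+1] | k. k \<in> {1..n}} = Uchain n (\<lambda>i. i) ` {1..n}"
  proof -
    have "Uh_class n ` {nested (qbr n) (\<lambda>i. mon [Xp i]) [1..<k+1] | k. k \<in> {1..n}} =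
        (\<lambda>k. Uh_class n (nested (qbr n) (\<lambda>i. mon [Xp i]) [1..<k+1])) ` {1..n}" by blast
    also have "\<dots> = Uchain n (\<lambda>i. i) ` {1..n}"
      unfolding nest_def
      by (rule image_cong[OF refl], rule conjunct2[OF nested_qbr_class]) auto
    finally show ?thesis .
  qed
  have "Uh_class n ` {nested (qbr n) (\<lambda>i. mon [Xp i]) (rev [k..<n+1]) | k. k \<in> {2..n}} =
      (\<lambda>k. Uh_class n (nested (qbr n) (\<lambda>i. mon [Xp i]) (rev [k..<n+1]))) ` {2..n}" by blast
  also have "\<dots> = (\<lambda>k. nested (qring.qb (Uh n) (Uh_scalar n qh)) (\<lambda>i. Xc n (Xp i)) (rev [k..<n+1])) ` {2..n}"
    by (rule image_cong[OF refl], rule conjunct2[OF nested_qbr_class]) auto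
  also have "\<dots> = (\<lambda>k. Uchain n (\<lambda>i. Suc n - i) (Suc n - k)) ` {2..n}"
    by (rule image_cong[OF refl], rule nested_rev) auto
  also have "\<dots> = Uchain n (\<lambda>i. Suc n - i) ` {1..<n}"
    unfolding rev_range image_image ..
  finally have 2: "Uh_class n ` {nested (qbr n) (\<lambda>i. mon [Xp i]) (rev [k..<n+1]) | k. k \<in> {2..n}} =
      Uchain n (\<lambda>i. Suc n - i) ` {1..<n}" .
  show ?thesis
    unfolding Bh_def Bgens_def image_Un 1 2 Lgen_eq by (simp add: Un_assoc)
qed

lemma Bh_subring: "subring (Bh n) (Uh n)"
  unfolding Bh_Bgens using Bgens_closed by (intro Uh.generate_ring_is_subring) auto

lemma Bh_incl: "b \<in> range (Uh_scalar n) \<union> Bgens n \<Longrightarrow> b \<in> Bh n"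
  unfolding Bh_Bgens by (rule generate_ring.incl)

text \<open>Every first factor in the coproduct of A_k is 1 or some A_j with j \<le> k, so all that
  is asked of M is to contain these.\<close>

lemma (in coideal_chain) comult_A_tensor_sub:
  assumes M: "subring M (Uh n)" and A: "\<And>j. 1 \<le> j \<Longrightarrow> j \<le> k \<Longrightarrow> A j \<in> M" and k: "1 \<le> k" "k \<le> n"
  shows "comult n (A k) \<in> tensor_sub n M (carrier (Uh n))"
proof -
  note T = tensor_sub_subring[OF M]
  note Mc = subringE(1)[OF M]
  obtain \<kappa> z where \<kappa>: "\<kappa> \<in> carrier (Uh n)" and z: "z \<in> lspan (Uh2 n) {\<one>\<^bsub>Uh2 n\<^esub>} (lower_tensors k)"
    and eq: "comult n (A k) = utens n (A k) \<kappa> \<oplus>\<^bsub>Uh2 n\<^esub> z"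
    using comult_A[OF k] by blast
  have low: "g \<in> tensor_sub n M (carrier (Uh n))" if g: "g \<in> lower_tensors k" for g
  proof -
    obtain a y where "g = utens n a y" "a \<in> insert \<one>\<^bsub>Uh n\<^esub> (A ` {1..<k})" "y \<in> Y k"
      using g unfolding lower_tensors_def by blast
    moreover from this have "a \<in> M" using A subringE(3)[OF M] by auto
    ultimately show ?thesis using tensor_sub_utens[OF _ Mc] by (simp add: Y_def)
  qed
  have "z \<in> tensor_sub n M (carrier (Uh n))"
    using z
  proof (induction rule: lspan.induct)
    case lspan_zero
    then show ?case by (rule subringE(2)[OF T])
  next
    case (lspan_step z c g)
    have g: "g \<in> tensor_sub n M (carrier (Uh n))" by (rule low) fact
    then have "g \<in> carrier (Uh2 n)" using subringE(1)[OF T] by blast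
    then have "c \<otimes>\<^bsub>Uh2 n\<^esub> g = g" using \<open>c \<in> {\<one>\<^bsub>Uh2 n\<^esub>}\<close> by simp
    then show ?case using subringE(7)[OF T lspan_step.IH g] by simp
  qed
  then show ?thesis
    unfolding eq by (rule subringE(7)[OF T tensor_sub_utens[OF A[OF k(1) order_refl] Mc \<kappa>]])
qed

text \<open>K is group-like, L is skew-primitive, scalars pass to the first factor, and both chains
  of root vectors are instances of the same computation for the identity and for the
  reversal.\<close>

lemma left_coideal_Bh: "left_coideal n (Bh n)"
proof -
  note T = tensor_sub_subring[OF Bh_subring[of n]]
  note Bc = subringE(1)[OF Bh_subring[of n]]
  let ?T = "tensor_sub n (Bh n) (carrier (Uh n))"
  interpret C: ring_hom_ring "Uh n" "Uh2 n" "comult n" by (rule ring_hom_ringI2[OF Uh_ring Uh2_ring comult_hom])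
  have oneB: "\<one>\<^bsub>Uh n\<^esub> \<in> Bh n" by (rule subringE(3)[OF Bh_subring])
  have chain: "comult n (Uchain n \<sigma> k) \<in> ?T"
    if \<sigma>: "good_perm n \<sigma>" and k: "1 \<le> k" "k \<le> n" and B: "\<And>j. 1 \<le> j \<Longrightarrow> j \<le> k \<Longrightarrow> Uchain n \<sigma> j \<in> Bh n" for \<sigma> k
  proof -
    interpret coideal_chain n \<sigma> by unfold_locales fact
    show ?thesis by (rule comult_A_tensor_sub[OF Bh_subring B k])
  qed
  have gen: "comult n b \<in> ?T" if b: "b \<in> range (Uh_scalar n) \<union> Bgens n" for b
  proof -
    consider c where "b = Uh_scalar n c" | "b = Uh_class n (Kprod n)" | "b = Uh_class n (Lgen n)" |
      k where "k \<in> {1..n}" "b = Uchain n (\<lambda>i. i) k" | k where "k \<in> {1..<n}" "b = Uchain n (\<lambda>i. Suc n - i) k"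
      using b unfolding Bgens_def by blast
    then show ?thesis
    proof cases
      case (1 c)
      have "comult n b = utens n (Uh_scalar n c \<otimes>\<^bsub>Uh n\<^esub> \<one>\<^bsub>Uh n\<^esub>) \<one>\<^bsub>Uh n\<^esub>"
        unfolding 1 comult_scalar by (subst utens_smul) (simp_all add: utens_one)
      then show ?thesis using tensor_sub_utens[OF Bh_incl[of "Uh_scalar n c"] Bc] by simp
    next
      case 2
      have "comult n b = utens n b b"
        unfolding 2 by (simp add: comult_class Delta_def comult_Kprod utens_class)
      then show ?thesis using tensor_sub_utens[of b "Bh n" n b] Bc Bh_incl[of b n] 2 by (simp add: Bgens_def)
    next
      case 3
      have "comult n b = utens n b (Uh_class n (Kprod n)) \<oplus>\<^bsub>Uh2 n\<^esub> utens n \<one>\<^bsub>Uh n\<^esub> b"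
        unfolding 3 by (simp add: comult_class Delta_def comult_Lgen cl2_add utens_class Uh_class_one[symmetric])
      moreover have "utens n b (Uh_class n (Kprod n)) \<in> ?T"
        using 3 by (intro tensor_sub_utens Bc Bh_incl) (simp_all add: Bgens_def)
      moreover have "utens n \<one>\<^bsub>Uh n\<^esub> b \<in> ?T"
        using 3 by (intro tensor_sub_utens Bc oneB) simp
      ultimately show ?thesis using subringE(7)[OF T] by simp
    next
      case (4 k)
      show ?thesis unfolding 4
        by (rule chain[OF good_perm_id]) (use 4 in \<open>auto intro!: Bh_incl simp: Bgens_def\<close>)
    next
      case (5 k)
      show ?thesis unfolding 5
        by (rule chain[OF good_perm_rev]) (use 5 in \<open>auto intro!: Bh_incl simp: Bgens_def\<close>)
    qed
  qed
  note Bc' = Bc[unfolded Bh_Bgens]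
  have "comult n b \<in> ?T" if "b \<in> generate_ring (Uh n) (range (Uh_scalar n) \<union> Bgens n)" for b
    using that
  proof (induction rule: generate_ring.induct)
    case one
    then show ?case using subringE(3)[OF T] by simp
  next
    case (incl h)
    then show ?case by (rule gen)
  next
    case (a_inv h)
    then show ?case using subringE(5)[OF T] Bc' by (simp add: subset_iff)
  next
    case (eng_add x y)
    then show ?case using subringE(7)[OF T] Bc' by (simp add: subset_iff)
  next
    case (eng_mult x y)
    then show ?case using subringE(6)[OF T] Bc' by (simp add: subset_iff)
  qed
  then show ?thesis by (auto simp: left_coideal_def Bh_Bgens[symmetric])
qed

section \<open>The enveloping algebra and the specialization\<close>

abbreviation supp :: "('w \<Rightarrow> 'r::zero) \<Rightarrow> 'w set" where "supp f \<equiv> {w. f w \<noteq> 0}"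

definition lin :: "('w \<Rightarrow> 'r) \<Rightarrow> ('w \<Rightarrow> 'r::comm_ring_1) \<Rightarrow> 'r" where
  "lin F f = (\<Sum>w\<in>supp f. f w * F w)"

lemma lin_superset: "finite S \<Longrightarrow> supp f \<subseteq> S \<Longrightarrow> lin F f = (\<Sum>w\<in>S. f w * F w)"
  unfolding lin_def by (rule sum.mono_neutral_left) auto

lemma lin_add:
  assumes "finite (supp f)" "finite (supp g)"
  shows "lin F (\<lambda>w. f w + g w) = lin F f + lin F g"
proof -
  have fin: "finite (supp f \<union> supp g)" using assms by simp
  have "lin F (\<lambda>w. f w + g w) = (\<Sum>w\<in>supp f \<union> supp g. (f w + g w) * F w)"
    by (rule lin_superset[OF fin]) auto
  moreover have "lin F f = (\<Sum>w\<in>supp f \<union> supp g. f w * F w)"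
    by (rule lin_superset[OF fin]) auto
  moreover have "lin F g = (\<Sum>w\<in>supp f \<union> supp g. g w * F w)"
    by (rule lin_superset[OF fin]) auto
  ultimately show ?thesis by (simp add: sum.distrib distrib_right)
qed

lemma lin_smul:
  assumes "finite (supp f)" shows "lin F (smul c f) = c * lin F f"
proof -
  have "lin F (smul c f) = (\<Sum>w\<in>supp f. smul c f w * F w)"
    by (rule lin_superset[OF assms]) (auto simp: smul_apply)
  then show ?thesis by (simp add: lin_def smul_apply sum_distrib_left mult.assoc)
qed

lemma lin_mon: "lin F (mon w) = F w"
  using lin_superset[of "{w}" "mon w" F] by (auto simp: mon_apply)

lemma (in words) finite_supp_conv:
  assumes "finite (supp f)" "finite (supp g)" shows "finite (supp (conv op f g))"
proof (rule finite_subset)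
  show "supp (conv op f g) \<subseteq> (\<lambda>(u, v). op u v) ` (supp f \<times> supp g)"
    by (auto elim!: conv_nonzero)
qed (use assms in simp)

lemma (in words) lin_conv:
  assumes "finite (supp f)" "finite (supp g)"
  shows "lin F (conv op f g) = (\<Sum>p\<in>supp f \<times> supp g. f (fst p) * g (snd p) * F (op (fst p) (snd p)))"
proof -
  let ?P = "supp f \<times> supp g" and ?op = "\<lambda>p. op (fst p) (snd p)"
  let ?T = "?op ` ?P"
  have fin: "finite ?P" using assms by simp
  have sT: "supp (conv op f g) \<subseteq> ?T"
  proof
    fix w assume "w \<in> supp (conv op f g)"
    then obtain u v where "op u v = w" "f u \<noteq> 0" "g v \<noteq> 0" by (auto elim: conv_nonzero)
    then show "w \<in> ?T" by (intro image_eqI[of _ _ "(u, v)"]) auto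
  qed
  have "lin F (conv op f g) = (\<Sum>w\<in>?T. conv op f g w * F w)"
    by (rule lin_superset[OF _ sT]) (use fin in simp)
  also have "\<dots> = (\<Sum>w\<in>?T. \<Sum>p | p \<in> ?P \<and> ?op p = w. f (fst p) * g (snd p) * F (?op p))"
  proof (rule sum.cong[OF refl])
    fix w
    have "conv op f g w = (\<Sum>p | p \<in> ?P \<and> ?op p = w. f (fst p) * g (snd p))"
      unfolding conv_alt using finite_splits by (intro sum.mono_neutral_right) auto
    then show "conv op f g w * F w = (\<Sum>p | p \<in> ?P \<and> ?op p = w. f (fst p) * g (snd p) * F (?op p))"
      by (auto simp: sum_distrib_right intro!: sum.cong)
  qed
  also have "\<dots> = (\<Sum>p\<in>?P. f (fst p) * g (snd p) * F (?op p))"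
    by (rule sum.group) (use fin in auto)
  finally show ?thesis .
qed

definition TAset :: "nat \<Rightarrow> (complex mat list \<Rightarrow> complex) set" where
  "TAset n = {f. finite (supp f) \<and> supp f \<subseteq> lists (sl n)}"

lemma TA_simps [simp]:
  "carrier (TA n) = TAset n" "mult (TA n) = conv (@)"
  "one (TA n) = mon []" "zero (TA n) = (\<lambda>w. 0)" "add (TA n) = (\<lambda>f g w. f w + g w)"
  by (simp_all add: free_alg_def TAset_def)

interpretation MW: words "(@)" "[] :: complex mat list" by (rule words_append)

lemma TA_mon [simp]: "set w \<subseteq> sl n \<Longrightarrow> mon w \<in> TAset n"
  by (auto simp: mon_apply TAset_def)

lemma TA_add: "f \<in> TAset n \<Longrightarrow> g \<in> TAset n \<Longrightarrow> (\<lambda>w. f w + g w) \<in> TAset n"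
proof -
  assume f: "f \<in> TAset n" "g \<in> TAset n"
  have "supp (\<lambda>w. f w + g w) \<subseteq> supp f \<union> supp g" by auto
  then show ?thesis using f finite_subset unfolding TAset_def by fastforce
qed

lemma TA_smul [simp]: "f \<in> TAset n \<Longrightarrow> smul c f \<in> TAset n"
proof -
  assume f: "f \<in> TAset n"
  have "supp (smul c f) \<subseteq> supp f" by (auto simp: smul_apply)
  then show ?thesis using f finite_subset unfolding TAset_def by fastforce
qed

lemma TA_conv: "f \<in> TAset n \<Longrightarrow> g \<in> TAset n \<Longrightarrow> conv (@) f g \<in> TAset n"
  using MW.finite_supp_conv[of f g] unfolding TAset_def by (fastforce elim!: MW.conv_nonzero)

lemma TA_ring: "ring (TA n)"
  unfolding free_alg_def TAset_def[symmetric]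
  by (rule MW.word_ring_ring) (simp_all add: TA_add TA_conv)

interpretation TA: ring "TA n" for n by (rule TA_ring)

lemma TA_minus:
  assumes "f \<in> TAset n" "g \<in> TAset n" shows "f \<ominus>\<^bsub>TA n\<^esub> g = (\<lambda>w. f w - g w)"
  using assms word_ring_uminus[of "TAset n" "(@)" "[]" g] TA_smul[OF assms(2), of "- 1"] TA_ring[of n]
  by (simp add: TA.minus_eq) (simp add: free_alg_def smul_apply flip: TAset_def)

definition UE_rels :: "nat \<Rightarrow> (complex mat list \<Rightarrow> complex) set" where
  "UE_rels n = {(\<lambda>w. mon [x + y] w - mon [x] w - mon [y] w) | x y. x \<in> sl n \<and> y \<in> sl n} \<union>
      {(\<lambda>w. mon [c \<cdot>\<^sub>m x] w - c * mon [x] w) | c x. x \<in> sl n} \<union>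
      {(\<lambda>w. mon [x, y] w - mon [y, x] w - mon [lie x y] w) | x y. x \<in> sl n \<and> y \<in> sl n}"

lemma sl_lie': "x \<in> sl n \<Longrightarrow> y \<in> sl n \<Longrightarrow> lie x y \<in> sl n"
  by (rule sl_lie) (use sl_carrier in auto)

lemma UE_rels_closed: "UE_rels n \<subseteq> carrier (TA n)"
proof -
  have d: "(\<lambda>w. f w - g w) \<in> TAset n" if "f \<in> TAset n" "g \<in> TAset n" for f g
    using TA.minus_closed[of f n g] that TA_minus[of f n g] by simp
  have s: "(\<lambda>w. c * f w) \<in> TAset n" if "f \<in> TAset n" for c f
    using TA_smul[OF that, of c] by (simp add: smul_def)
  show ?thesis
    unfolding UE_rels_def TA_simps
    by (intro Un_least subsetI; elim CollectE exE conjE; hypsubst; intro d s TA_mon)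
      (auto intro: sl_add sl_smult sl_lie')
qed

lemma UE_ideal_rels: "UE_ideal n = Idl\<^bsub>TA n\<^esub> (UE_rels n)"
proof -
  have d: "(\<lambda>w. f w - g w) \<in> TAset n" if "f \<in> TAset n" "g \<in> TAset n" for f g
    using TA.minus_closed[of f n g] that TA_minus[of f n g] by simp
  have m3: "f \<ominus>\<^bsub>TA n\<^esub> g \<ominus>\<^bsub>TA n\<^esub> h = (\<lambda>w. f w - g w - h w)" if "f \<in> TAset n" "g \<in> TAset n" "h \<in> TAset n" for f g h
    using TA_minus[OF that(1,2)] TA_minus[OF d[OF that(1,2)] that(3)] by simp
  have 1: "mon [x + y] \<ominus>\<^bsub>TA n\<^esub> mon [x] \<ominus>\<^bsub>TA n\<^esub> mon [y] = (\<lambda>w. mon [x + y] w - mon [x] w - mon [y] w)"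
    if "x \<in> sl n" "y \<in> sl n" for x y
    by (intro m3 TA_mon) (use that sl_add in auto)
  have 2: "mon [x, y] \<ominus>\<^bsub>TA n\<^esub> mon [y, x] \<ominus>\<^bsub>TA n\<^esub> mon [lie x y] = (\<lambda>w. mon [x, y] w - mon [y, x] w - mon [lie x y] w)"
    if "x \<in> sl n" "y \<in> sl n" for x y
    by (intro m3 TA_mon) (use that sl_lie' in auto)
  have 3: "mon [c \<cdot>\<^sub>m x] \<ominus>\<^bsub>TA n\<^esub> smul c (mon [x]) = (\<lambda>w. mon [c \<cdot>\<^sub>m x] w - c * mon [x] w)" if "x \<in> sl n" for c x
    using TA_minus[of "mon [c \<cdot>\<^sub>m x]" n "smul c (mon [x])"] that sl_smult TA_smul[OF TA_mon, of "[x]" n c] TA_mon[of "[c \<cdot>\<^sub>m x]" n]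
    by (simp add: smul_apply)
  show ?thesis
    unfolding UE_ideal_def UE_rels_def
    by (simp only: 1 2 3 cong: rev_conj_cong)
qed

lemma UE_ideal_ideal: "ideal (UE_ideal n) (TA n)"
  unfolding UE_ideal_rels by (rule TA.genideal_ideal[OF UE_rels_closed])

lemma UE_ring: "ring (UE n)"
  unfolding UE_def by (rule ideal.quotient_is_ring[OF UE_ideal_ideal])

interpretation UE: ring "UE n" for n by (rule UE_ring)

definition ucl :: "nat \<Rightarrow> (complex mat list \<Rightarrow> complex) \<Rightarrow> (complex mat list \<Rightarrow> complex) set" where
  "ucl n f = UE_ideal n +>\<^bsub>TA n\<^esub> f"

lemma ucl_hom: "ucl n \<in> Ring.ring_hom (TA n) (UE n)"
  unfolding ucl_def UE_def by (rule coset_ring_hom[OF UE_ideal_ideal])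

lemma ucl_closed [simp]: "f \<in> TAset n \<Longrightarrow> ucl n f \<in> carrier (UE n)"
  using ring_hom_closed[OF ucl_hom, of f n] by simp

lemma ucl_mult: "f \<in> TAset n \<Longrightarrow> g \<in> TAset n \<Longrightarrow> ucl n (conv (@) f g) = ucl n f \<otimes>\<^bsub>UE n\<^esub> ucl n g"
  using ring_hom_mult[OF ucl_hom, of f n g] by simp

lemma ucl_add: "f \<in> TAset n \<Longrightarrow> g \<in> TAset n \<Longrightarrow> ucl n (\<lambda>w. f w + g w) = ucl n f \<oplus>\<^bsub>UE n\<^esub> ucl n g"
  using ring_hom_add[OF ucl_hom, of f n g] by simp

lemma ucl_one: "ucl n (mon []) = \<one>\<^bsub>UE n\<^esub>"
  using ring_hom_one[OF ucl_hom, of n] by simp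

lemma ucl_zero: "ucl n (\<lambda>w. 0) = \<zero>\<^bsub>UE n\<^esub>"
  using ring_hom_zero[OF ucl_hom TA_ring UE_ring, of n] by simp

lemma ucl_eq_iff: "f \<in> TAset n \<Longrightarrow> g \<in> TAset n \<Longrightarrow> ucl n f = ucl n g \<longleftrightarrow> (\<lambda>w. f w - g w) \<in> UE_ideal n"
  using coset_eq_iff[OF UE_ideal_ideal, of f n g] TA_minus[of f n g] by (simp add: ucl_def)

definition uscal :: "nat \<Rightarrow> complex \<Rightarrow> (complex mat list \<Rightarrow> complex) set" where
  "uscal n c = ucl n (smul c (mon []))"

definition \<iota> :: "nat \<Rightarrow> complex mat \<Rightarrow> (complex mat list \<Rightarrow> complex) set" where
  "\<iota> n x = ucl n (mon [x])"

lemma uscal_closed [simp]: "uscal n c \<in> carrier (UE n)"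
  unfolding uscal_def by (intro ucl_closed TA_smul TA_mon) auto

lemma \<iota>_closed [simp]: "x \<in> sl n \<Longrightarrow> \<iota> n x \<in> carrier (UE n)"
  unfolding \<iota>_def by (intro ucl_closed TA_mon) auto

lemma ucl_smul:
  assumes "f \<in> TAset n" shows "ucl n (smul c f) = uscal n c \<otimes>\<^bsub>UE n\<^esub> ucl n f"
proof -
  have "smul c f = conv (@) (smul c (mon [])) f" by (simp add: MW.conv_smul_left)
  then show ?thesis
    using ucl_mult[OF TA_smul[OF TA_mon], of "[]" n f c] assms by (simp add: uscal_def)
qed

lemma uscal_one: "uscal n 1 = \<one>\<^bsub>UE n\<^esub>"
  by (simp add: uscal_def smul_def ucl_one)

lemma UE_rel_zero: "r \<in> UE_rels n \<Longrightarrow> r \<in> UE_ideal n"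
  unfolding UE_ideal_rels using TA.genideal_self[OF UE_rels_closed] by blast

lemma \<iota>_add:
  assumes "x \<in> sl n" "y \<in> sl n" shows "\<iota> n (x + y) = \<iota> n x \<oplus>\<^bsub>UE n\<^esub> \<iota> n y"
proof -
  have m: "mon [x] \<in> TAset n" "mon [y] \<in> TAset n" "mon [x + y] \<in> TAset n"
    using assms sl_add by (auto intro!: TA_mon)
  have "(\<lambda>w. mon [x + y] w - mon [x] w - mon [y] w) \<in> UE_ideal n"
    using assms by (intro UE_rel_zero) (auto simp: UE_rels_def)
  then have "ucl n (mon [x + y]) = ucl n (\<lambda>w. mon [x] w + mon [y] w)"
    using ucl_eq_iff[OF m(3) TA_add[OF m(1,2)]] by (simp add: diff_diff_eq)
  then show ?thesis using m by (simp add: ucl_add \<iota>_def)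
qed

lemma \<iota>_smult:
  assumes "x \<in> sl n" shows "\<iota> n (c \<cdot>\<^sub>m x) = uscal n c \<otimes>\<^bsub>UE n\<^esub> \<iota> n x"
proof -
  have m: "mon [x] \<in> TAset n" "mon [c \<cdot>\<^sub>m x] \<in> TAset n"
    using assms sl_smult by (auto intro!: TA_mon)
  have "(\<lambda>w. mon [c \<cdot>\<^sub>m x] w - c * mon [x] w) \<in> UE_ideal n"
    using assms by (intro UE_rel_zero) (auto simp: UE_rels_def)
  then have "ucl n (mon [c \<cdot>\<^sub>m x]) = ucl n (smul c (mon [x]))"
    using ucl_eq_iff[OF m(2) TA_smul[OF m(1)], of c] by (simp add: smul_apply)
  then show ?thesis unfolding \<iota>_def using ucl_smul[OF m(1)] by simp
qed

lemma \<iota>_lie: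
  assumes "x \<in> sl n" "y \<in> sl n"
  shows "\<iota> n x \<otimes>\<^bsub>UE n\<^esub> \<iota> n y = \<iota> n y \<otimes>\<^bsub>UE n\<^esub> \<iota> n x \<oplus>\<^bsub>UE n\<^esub> \<iota> n (lie x y)"
proof -
  have m: "mon [x] \<in> TAset n" "mon [y] \<in> TAset n" "mon [x, y] \<in> TAset n" "mon [y, x] \<in> TAset n" "mon [lie x y] \<in> TAset n"
    using assms sl_lie' by (auto intro!: TA_mon)
  have "(\<lambda>w. mon [x, y] w - mon [y, x] w - mon [lie x y] w) \<in> UE_ideal n"
    unfolding UE_rels_def by (rule UE_rel_zero[unfolded UE_rels_def], rule UnI2) (use assms in blast)
  then have "ucl n (mon [x, y]) = ucl n (\<lambda>w. mon [y, x] w + mon [lie x y] w)"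
    using ucl_eq_iff[OF m(3) TA_add[OF m(4,5)]] by (simp add: diff_diff_eq)
  moreover have "ucl n (mon [x, y]) = \<iota> n x \<otimes>\<^bsub>UE n\<^esub> \<iota> n y" "ucl n (mon [y, x]) = \<iota> n y \<otimes>\<^bsub>UE n\<^esub> \<iota> n x"
    using m(1,2) by (simp_all add: \<iota>_def MW.conv_mon flip: ucl_mult)
  ultimately show ?thesis using m by (simp add: ucl_add) (simp add: \<iota>_def)
qed

section \<open>The specialization on the free algebra\<close>

abbreviation cf0 :: "('w \<Rightarrow> complex fps) \<Rightarrow> 'w \<Rightarrow> complex" where "cf0 f \<equiv> \<lambda>w. fps_nth (f w) 0"

lemma cf0_finite: "f \<in> FAset n \<Longrightarrow> finite (supp (cf0 f))"
  by (rule FA.hcompleteD)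

lemma spec_FA_lin:
  assumes "finite (supp (cf0 f))"
  shows "spec_FA n f v = lin (\<lambda>w. of_bool (map (spec_gen n) w = v)) (cf0 f)"
proof -
  have "spec_FA n f v = (\<Sum>w\<in>supp (cf0 f) \<inter> {w. map (spec_gen n) w = v}. cf0 f w)"
    unfolding spec_FA_def by (rule sum.cong) auto
  also have "\<dots> = (\<Sum>w\<in>supp (cf0 f). cf0 f w * of_bool (map (spec_gen n) w = v))"
    using assms by (auto simp: sum.inter_restrict intro!: sum.cong)
  finally show ?thesis by (simp add: lin_def)
qed

lemma che_sl: "i \<in> {1..n} \<Longrightarrow> che n i \<in> sl n" "i \<in> {1..n} \<Longrightarrow> chf n i \<in> sl n" "i \<in> {1..n} \<Longrightarrow> chh n i \<in> sl n"
  by (auto simp: che_def chf_def chh_def intro!: sl_munit sl_diag)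

lemma spec_gen_sl: "g \<in> gens n \<Longrightarrow> spec_gen n g \<in> sl n"
  by (cases g) (auto simp: che_sl)

lemma spec_FA_closed [simp]:
  assumes f: "f \<in> FAset n" shows "spec_FA n f \<in> TAset n"
proof -
  have sub: "supp (spec_FA n f) \<subseteq> map (spec_gen n) ` supp (cf0 f)"
  proof
    fix v assume "v \<in> supp (spec_FA n f)"
    then obtain w where "w \<in> {w. fps_nth (f w) 0 \<noteq> 0 \<and> map (spec_gen n) w = v}"
      unfolding spec_FA_def by (auto elim!: sum.not_neutral_contains_not_neutral)
    then show "v \<in> map (spec_gen n) ` supp (cf0 f)" by auto
  qed
  have "set (map (spec_gen n) w) \<subseteq> sl n" if "w \<in> supp (cf0 f)" for w
  proof -
    have "f w \<noteq> 0" using that by auto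
    then have "w \<in> lists (gens n)" using FA.hcompleteD(2)[OF f] by blast
    then show ?thesis using spec_gen_sl by auto
  qed
  then have "map (spec_gen n) ` supp (cf0 f) \<subseteq> lists (sl n)" unfolding lists_eq_set by blast
  then show ?thesis using sub finite_surj[OF cf0_finite[OF f] sub] by (auto simp: TAset_def)
qed

lemma spec_FA_add: "f \<in> FAset n \<Longrightarrow> g \<in> FAset n \<Longrightarrow> spec_FA n (\<lambda>w. f w + g w) = (\<lambda>v. spec_FA n f v + spec_FA n g v)"
  using cf0_finite[of f n] cf0_finite[of g n] cf0_finite[of "\<lambda>w. f w + g w" n]
  by (simp add: fun_eq_iff spec_FA_lin lin_add)

lemma spec_FA_smul: "f \<in> FAset n \<Longrightarrow> spec_FA n (smul c f) = smul (fps_nth c 0) (spec_FA n f)"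
  using cf0_finite[of f n] cf0_finite[of "smul c f" n] lin_smul[of "cf0 f" _ "fps_nth c 0"]
  by (simp add: fun_eq_iff spec_FA_lin smul_def)

lemma spec_FA_mon: "spec_FA n (mon w) = mon (map (spec_gen n) w)"
proof -
  have c: "cf0 (mon w :: gen list \<Rightarrow> complex fps) = mon w" by (auto simp: mon_apply)
  have fin: "finite (supp (cf0 (mon w :: gen list \<Rightarrow> complex fps)))" by (simp add: mon_apply)
  have "spec_FA n (mon w) v = mon (map (spec_gen n) w) v" for v
    unfolding spec_FA_lin[OF fin] c lin_mon by (auto simp: mon_apply)
  then show ?thesis by (rule ext)
qed

lemma spec_FA_mult:
  assumes f: "f \<in> FAset n" and g: "g \<in> FAset n"
  shows "spec_FA n (conv (@) f g) = conv (@) (spec_FA n f) (spec_FA n g)"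
proof
  fix v
  let ?f = "cf0 f" and ?g = "cf0 g" and ?m = "map (spec_gen n)"
  note fin = cf0_finite[OF f] cf0_finite[OF g]
  have c: "cf0 (conv (@) f g) = conv (@) ?f ?g"
    by (simp add: fun_eq_iff FA.conv_alt fps_sum_nth)
  have "spec_FA n (conv (@) f g) v =
      (\<Sum>p\<in>supp ?f \<times> supp ?g. ?f (fst p) * ?g (snd p) * of_bool (?m (fst p @ snd p) = v))"
    unfolding spec_FA_lin[OF cf0_finite[OF FA.conv_closed[OF f g]]] c by (rule FA.lin_conv[OF fin])
  also have "\<dots> = (\<Sum>p\<in>supp ?f \<times> supp ?g. \<Sum>q | fst q @ snd q = v.
      ?f (fst p) * of_bool (?m (fst p) = fst q) * (?g (snd p) * of_bool (?m (snd p) = snd q)))"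
  proof (rule sum.cong[OF refl])
    fix p
    have "of_bool (?m (fst p @ snd p) = v) = (\<Sum>q | fst q @ snd q = v. if q = (?m (fst p), ?m (snd p)) then 1 else 0 :: complex)"
      by (subst sum.delta[OF MW.finite_splits]) auto
    then show "?f (fst p) * ?g (snd p) * of_bool (?m (fst p @ snd p) = v) = (\<Sum>q | fst q @ snd q = v.
      ?f (fst p) * of_bool (?m (fst p) = fst q) * (?g (snd p) * of_bool (?m (snd p) = snd q)))"
      by (simp only: sum_distrib_left) (auto intro!: sum.cong)
  qed
  also have "\<dots> = (\<Sum>q | fst q @ snd q = v. \<Sum>p\<in>supp ?f \<times> supp ?g.
      ?f (fst p) * of_bool (?m (fst p) = fst q) * (?g (snd p) * of_bool (?m (snd p) = snd q)))"
    by (rule sum.swap)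
  also have "\<dots> = (\<Sum>q | fst q @ snd q = v. spec_FA n f (fst q) * spec_FA n g (snd q))"
    unfolding spec_FA_lin[OF fin(1)] spec_FA_lin[OF fin(2)] lin_def sum_product sum.cartesian_product
    by (simp only: case_prod_unfold)
  also have "\<dots> = conv (@) (spec_FA n f) (spec_FA n g) v" by (simp add: MW.conv_alt)
  finally show "spec_FA n (conv (@) f g) v = conv (@) (spec_FA n f) (spec_FA n g) v" .
qed

lemma spec_FA_hom: "spec_FA n \<in> Ring.ring_hom (FA n) (TA n)"
  using spec_FA_closed spec_FA_mon[of n "[]"] by (intro ring_hom_memI) (simp_all add: spec_FA_mult spec_FA_add)

definition sp :: "nat \<Rightarrow> (gen list \<Rightarrow> complex fps) \<Rightarrow> (complex mat list \<Rightarrow> complex) set" where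
  "sp n f = ucl n (spec_FA n f)"

lemma sp_hom: "sp n \<in> Ring.ring_hom (FA n) (UE n)"
  using ring_hom_trans[OF spec_FA_hom ucl_hom, of n] by (simp add: sp_def[abs_def] comp_def)

lemma sp_letter: "sp n (mon [g]) = \<iota> n (spec_gen n g)"
  by (simp add: sp_def spec_FA_mon \<iota>_def)

lemma sp_smul: "f \<in> FAset n \<Longrightarrow> sp n (smul c f) = uscal n (fps_nth c 0) \<otimes>\<^bsub>UE n\<^esub> sp n f"
  by (simp add: sp_def spec_FA_smul ucl_smul)

text \<open>The specialization sees constant terms only, so quotients such as L may be replaced by
  their values at h = 0.\<close>

lemma sp_cong: "cf0 f = cf0 g \<Longrightarrow> sp n f = sp n g"
  by (simp add: sp_def spec_FA_def fun_eq_iff)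

text \<open>To first order K - 1/K is 2hH and q - 1/q is 2h. Since the divisor has no constant term,
  the coefficient of h in divisor times quotient isolates the constant term of the quotient.\<close>

lemma H_rel_cf0:
  shows "cf0 (H_rel i) = cf0 (mon [Hg i])"
proof
  fix w
  have low: "fps_nth (hexp c i w) 1 = (if w = [Hg i] then c else 0)" for c
  proof (cases w)
    case (Cons a u)
    then show ?thesis by (cases u) (auto simp: hexp_def fps_X_power_iff)
  qed (simp add: hexp_def)
  have "smul (qh - qh_inv) (H_rel i) = (\<lambda>w. Kp i w - Km i w)"
    by (rule smul_sdiv[OF Kp_Km_nth_0 qh_diff(1,2)])
  then have "fps_nth ((qh - qh_inv) * H_rel i w) 1 = fps_nth (Kp i w - Km i w) 1"
    by (simp add: smul_apply fun_eq_iff)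
  then show "fps_nth (H_rel i w) 0 = fps_nth (mon [Hg i] w) 0"
    unfolding fps_mult_nth_1 qh_diff by (simp add: low[simplified] qh_nth mon_apply split: if_splits)
qed

text \<open>The same comparison of coefficients of h, now from the expansion of K to second order
  and q - 1 = h + O(h^2).\<close>

lemma Lgen_cf0: "cf0 (Lgen n) = cf0 (\<lambda>w. \<Sum>i\<leftarrow>[1..<n+1]. mon [Hg i] w)"
proof
  fix w
  have "set [1..<n+1] \<subseteq> {1..n}" by auto
  then obtain u where K: "Kprod n = (\<lambda>w. mon [] w + fps_X * (\<Sum>i\<leftarrow>[1..<n+1]. mon [Hg i] w) + fps_X * fps_X * u w)"
    using Kpart_low[of "[1..<n+1]" n] unfolding Kprod_Kpart by blast
  have "(qh - 1) * Lgen n w = fps_X * (\<Sum>i\<leftarrow>[1..<n+1]. mon [Hg i] w) + fps_X * (fps_X * u w)"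
    using fun_cong[OF Lgen_mult, of n w] unfolding K by (simp add: smul_apply mult.assoc)
  then have "fps_nth ((qh - 1) * Lgen n w) 1 =
      fps_nth (fps_X * (\<Sum>i\<leftarrow>[1..<n+1]. mon [Hg i] w) + fps_X * (fps_X * u w)) 1" by simp
  then show "fps_nth (Lgen n w) 0 = fps_nth (\<Sum>i\<leftarrow>[1..<n+1]. mon [Hg i] w) 0"
    unfolding fps_mult_nth_1 qh_diff by (simp add: qh_nth fps_mult_nth_1 del: upt_Suc)
qed

section \<open>The defining relations at h = 0\<close>

lemma lie_chh_chh:
  assumes "i \<in> {1..n}" "j \<in> {1..n}" shows "lie (chh n i) (chh n j) = 0\<^sub>m (n+1) (n+1)"
proof -
  have e: "chh n j = munit n (j - 1) (j - 1) + (- 1) \<cdot>\<^sub>m munit n j j"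
    by (auto simp: chh_def intro!: eq_matI)
  have c: "chh n i \<in> MC n" by (auto simp: chh_def)
  have "lie (chh n i) (chh n j) = lie (chh n i) (munit n (j - 1) (j - 1)) + (- 1) \<cdot>\<^sub>m lie (chh n i) (munit n j j)"
    using lie_add(2)[of "munit n (j - 1) (j - 1)" n "(- 1) \<cdot>\<^sub>m munit n j j" "chh n i"]
      lie_smult(2)[of "munit n j j" n "chh n i" "- 1"] c unfolding e by simp
  also have "lie (chh n i) (munit n (j - 1) (j - 1)) = 0 \<cdot>\<^sub>m munit n (j - 1) (j - 1)"
    using assms unfolding chh_def by (subst lie_diag_munit) auto
  also have "lie (chh n i) (munit n j j) = 0 \<cdot>\<^sub>m munit n j j"
    using assms unfolding chh_def by (subst lie_diag_munit) auto
  also have "0 \<cdot>\<^sub>m munit n (j - 1) (j - 1) + (- 1) \<cdot>\<^sub>m (0 \<cdot>\<^sub>m munit n j j) = 0\<^sub>m (n+1) (n+1)"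
    by (auto intro!: eq_matI)
  finally show ?thesis .
qed

lemma lie_chh_gen:
  assumes i: "i \<in> {1..n}" and g: "g \<in> gens n"
  shows "lie (chh n i) (spec_gen n g) = of_int (weight i g) \<cdot>\<^sub>m spec_gen n g"
proof -
  obtain a where a: "i = Suc a" using i by (cases i) auto
  show ?thesis
  proof (cases g)
    case (Xp j)
    then obtain b where b: "j = Suc b" using g by (cases j) auto
    have "lie (chh n i) (che n j) = (of_bool (a = b) - of_bool (a = Suc b) - of_bool (Suc a = b) + of_bool (Suc a = Suc b)) \<cdot>\<^sub>m che n j"
      unfolding chh_def che_def a b using lie_diag_munit[of n b "Suc b" a "Suc a"] i g Xp a b by simp
    moreover have "(of_bool (a = b) - of_bool (a = Suc b) - of_bool (Suc a = b) + of_bool (Suc a = Suc b) :: complex) = of_int (cartan i j)"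
      by (auto simp: a b cartan_def)
    ultimately show ?thesis using Xp by (simp add: weight_def)
  next
    case (Xm j)
    then obtain b where b: "j = Suc b" using g by (cases j) auto
    have "lie (chh n i) (chf n j) = (of_bool (a = Suc b) - of_bool (a = b) - of_bool (Suc a = Suc b) + of_bool (Suc a = b)) \<cdot>\<^sub>m chf n j"
      unfolding chh_def chf_def a b using lie_diag_munit[of n "Suc b" b a "Suc a"] i g Xm a b by simp
    moreover have "(of_bool (a = Suc b) - of_bool (a = b) - of_bool (Suc a = Suc b) + of_bool (Suc a = b) :: complex) = of_int (- cartan i j)"
      by (auto simp: a b cartan_def)
    ultimately show ?thesis using Xm by (simp add: weight_def)
  next
    case (Hg j)
    then show ?thesis
      using i g lie_chh_chh[of i n j] by (auto simp: weight_def chh_def intro!: eq_matI)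
  qed
qed

lemma lie_che_chf:
  assumes "i \<in> {1..n}" "j \<in> {1..n}"
  shows "lie (che n i) (chf n j) = (if i = j then chh n i else 0\<^sub>m (n+1) (n+1))"
  using assms by (auto simp: che_def chf_def chh_def lie_munit intro!: eq_matI)

lemma lie_far:
  assumes "X = Xp \<or> X = Xm" "i \<in> {1..n}" "j \<in> {1..n}" "i \<noteq> j" "\<not> (i = Suc j \<or> j = Suc i)"
  shows "lie (spec_gen n (X i)) (spec_gen n (X j)) = 0\<^sub>m (n+1) (n+1)"
  using assms by (auto simp: che_def chf_def lie_munit intro!: eq_matI)

lemma lie_near:
  assumes "X = Xp \<or> X = Xm" "i \<in> {1..n}" "j \<in> {1..n}" "i = Suc j \<or> j = Suc i"
  shows "lie (spec_gen n (X i)) (lie (spec_gen n (X i)) (spec_gen n (X j))) = 0\<^sub>m (n+1) (n+1)"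
proof -
  obtain a b c d where *: "spec_gen n (X i) = munit n a b" "spec_gen n (X j) = munit n c d"
    "a \<le> n" "b \<le> n" "c \<le> n" "d \<le> n" "a \<noteq> b" "c \<noteq> d" "b = c \<and> a \<noteq> d \<or> b \<noteq> c \<and> a = d"
    using assms by (auto simp: che_def chf_def)
  consider "b = c" "d \<noteq> a" | "b \<noteq> c" "d = a" using *(9) by blast
  then show ?thesis
  proof cases
    case 1
    then have "lie (munit n a b) (munit n c d) = munit n a d" using * by (intro lie_munit_cases) auto
    moreover have "lie (munit n a b) (munit n a d) = 0\<^sub>m (n+1) (n+1)" using * 1 by (intro lie_munit_cases) auto
    ultimately show ?thesis unfolding * by simp
  next
    case 2
    then have "lie (munit n a b) (munit n c d) = - 1 \<cdot>\<^sub>m munit n c b" using * by (intro lie_munit_cases) auto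
    moreover have "lie (munit n a b) (munit n c b) = 0\<^sub>m (n+1) (n+1)" using * 2 by (intro lie_munit_cases) auto
    ultimately show ?thesis unfolding * by (simp add: lie_smult[where n = n])
  qed
qed

lemma uscal_zero: "uscal n 0 = \<zero>\<^bsub>UE n\<^esub>"
  by (simp add: uscal_def smul_def ucl_zero)

lemma \<iota>_zero: "\<iota> n (0\<^sub>m (n+1) (n+1)) = \<zero>\<^bsub>UE n\<^esub>"
proof -
  have "0 \<cdot>\<^sub>m 0\<^sub>m (n+1) (n+1) = (0\<^sub>m (n+1) (n+1) :: complex mat)" by (auto intro!: eq_matI)
  then show ?thesis using \<iota>_smult[OF sl_zero, of n 0] sl_zero[of n] by (simp add: uscal_zero)
qed

lemma sp_closed [simp]: "f \<in> FAset n \<Longrightarrow> sp n f \<in> carrier (UE n)"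
  by (simp add: sp_def)

lemma sp_add: "f \<in> FAset n \<Longrightarrow> g \<in> FAset n \<Longrightarrow> sp n (\<lambda>w. f w + g w) = sp n f \<oplus>\<^bsub>UE n\<^esub> sp n g"
  using ring_hom_add[OF sp_hom, of f n g] by simp

lemma sp_mult: "f \<in> FAset n \<Longrightarrow> g \<in> FAset n \<Longrightarrow> sp n (conv (@) f g) = sp n f \<otimes>\<^bsub>UE n\<^esub> sp n g"
  using ring_hom_mult[OF sp_hom, of f n g] by simp

lemma sp_zero: "sp n (\<lambda>w. 0) = \<zero>\<^bsub>UE n\<^esub>"
  using Ring.ring_hom_zero[OF sp_hom FA.F_ring UE_ring, of n] by simp

lemma sp_rel:
  assumes "r \<in> Uh_rels n" shows "sp n r = \<zero>\<^bsub>UE n\<^esub>"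
proof -
  have m [simp]: "mon w \<in> FAset n" if "set w \<subseteq> gens n" for w
    using that by (intro FA.mon_closed) auto
  have diff: "sp n (\<lambda>w. f w - h w) = \<zero>\<^bsub>UE n\<^esub>" if fh: "f \<in> FAset n" "h \<in> FAset n" "sp n f = sp n h" for f h
  proof -
    have "(\<lambda>w. f w - h w) \<in> FAset n"
      using FA.F.minus_closed[of f n h] fh by (simp add: FA.F_minus)
    moreover from this have "sp n f = sp n (\<lambda>w. f w - h w) \<oplus>\<^bsub>UE n\<^esub> sp n h"
      using sp_add[of "\<lambda>w. f w - h w" n h] fh(2) by simp
    ultimately have "sp n h = sp n (\<lambda>w. f w - h w) \<oplus>\<^bsub>UE n\<^esub> sp n h" using fh(3) by simp
    then show ?thesis
      using \<open>(\<lambda>w. f w - h w) \<in> FAset n\<close> fh(2) by simp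
  qed
  have w2: "sp n (mon [a, b]) = sp n (mon [b, a]) \<oplus>\<^bsub>UE n\<^esub> \<iota> n (lie (spec_gen n a) (spec_gen n b))"
    if "a \<in> gens n" "b \<in> gens n" for a b
    using that sp_mult[of "mon [a]" n "mon [b]"] sp_mult[of "mon [b]" n "mon [a]"]
      \<iota>_lie[OF spec_gen_sl[OF that(1)] spec_gen_sl[OF that(2)]]
    by (simp add: FA.conv_mon sp_letter)
  have H: "sp n (\<lambda>w. mon [Hg i, g] w - (mon [g, Hg i] w + smul (of_int (weight i g)) (mon [g]) w)) = \<zero>\<^bsub>UE n\<^esub>"
    if "i \<in> {1..n}" "g \<in> gens n" for i g
    using that w2[of "Hg i" g] lie_chh_gen[OF that]
    by (intro diff) (simp_all add: sp_add sp_smul sp_letter \<iota>_smult[OF spec_gen_sl])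
  from assms show ?thesis
  proof (cases rule: Uh_rels_cases)
    case (HH i j)
    then show ?thesis using H[of i "Hg j"] by (simp add: weight_def smul_apply)
  next
    case (HXp i j)
    then show ?thesis using H[of i "Xp j"] by (simp add: weight_def smul_apply diff_diff_eq)
  next
    case (HXm i j)
    have "r = (\<lambda>w. mon [Hg i, Xm j] w - (mon [Xm j, Hg i] w + smul (of_int (weight i (Xm j))) (mon [Xm j]) w))"
      unfolding HXm(3) by (rule ext) (simp add: weight_def smul_apply)
    then show ?thesis using H[of i "Xm j"] HXm(1,2) by simp
  next
    case (XX i j)
    define h where "h = (if i = j then H_rel i else (\<lambda>w. 0))"
    have h: "h \<in> FAset n" using H_rel_closed[OF XX(1)] FA.F.zero_closed[of n] by (auto simp: h_def)
    have "sp n h = \<iota> n (lie (che n i) (chf n j))"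
      unfolding h_def lie_che_chf[OF XX(1,2)]
      using sp_letter[of n "Hg i"] sp_cong[OF H_rel_cf0[of i], of n] \<iota>_zero[of n]
      by (cases "i = j") (simp_all add: sp_zero)
    moreover have "r = (\<lambda>w. mon [Xp i, Xm j] w - (mon [Xm j, Xp i] w + h w))"
      unfolding XX(3) h_def by (simp add: diff_diff_eq fun_eq_iff)
    ultimately show ?thesis
      using diff[of "mon [Xp i, Xm j]" "\<lambda>w. mon [Xm j, Xp i] w + h w"] XX(1,2) h w2[of "Xp i" "Xm j"]
      by (simp add: sp_add)
  next
    case (near X i j)
    then have X: "X i \<in> gens n" "X j \<in> gens n" by auto
    let ?x = "spec_gen n (X i)" and ?y = "spec_gen n (X j)"
    let ?z = "lie ?x ?y"
    have sl: "?x \<in> sl n" "?y \<in> sl n" "?z \<in> sl n" using X by (auto intro: spec_gen_sl sl_lie')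
    define x y z where "x = \<iota> n ?x" and "y = \<iota> n ?y" and "z = \<iota> n ?z"
    have c [simp]: "x \<in> carrier (UE n)" "y \<in> carrier (UE n)" "z \<in> carrier (UE n)" using sl by (auto simp: x_def y_def z_def)
    have xy: "x \<otimes>\<^bsub>UE n\<^esub> y = y \<otimes>\<^bsub>UE n\<^esub> x \<oplus>\<^bsub>UE n\<^esub> z" using \<iota>_lie[OF sl(1,2)] by (simp add: x_def y_def z_def)
    \<comment> \<open>The classical Serre relation: the double bracket of x with y vanishes.\<close>
    have "lie ?x ?z = 0\<^sub>m (n+1) (n+1)" using near by (intro lie_near) auto
    then have xz: "x \<otimes>\<^bsub>UE n\<^esub> z = z \<otimes>\<^bsub>UE n\<^esub> x" using \<iota>_lie[OF sl(1,3)] \<iota>_zero[of n] c by (simp add: x_def z_def)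
    have xyx: "x \<otimes>\<^bsub>UE n\<^esub> (y \<otimes>\<^bsub>UE n\<^esub> x) = y \<otimes>\<^bsub>UE n\<^esub> (x \<otimes>\<^bsub>UE n\<^esub> x) \<oplus>\<^bsub>UE n\<^esub> z \<otimes>\<^bsub>UE n\<^esub> x"
      by (simp add: xy UE.l_distr flip: UE.m_assoc)
    \<comment> \<open>With xy = yx + z and xz = zx this is yxx + xxy = 2xyx, the quantum Serre
      relation at q = 1.\<close>
    have "y \<otimes>\<^bsub>UE n\<^esub> (x \<otimes>\<^bsub>UE n\<^esub> x) \<oplus>\<^bsub>UE n\<^esub> x \<otimes>\<^bsub>UE n\<^esub> (x \<otimes>\<^bsub>UE n\<^esub> y) =
        x \<otimes>\<^bsub>UE n\<^esub> (y \<otimes>\<^bsub>UE n\<^esub> x) \<oplus>\<^bsub>UE n\<^esub> x \<otimes>\<^bsub>UE n\<^esub> (y \<otimes>\<^bsub>UE n\<^esub> x)"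
      unfolding xy UE.r_distr[OF UE.m_closed[OF c(2,1)] c(3,1)] xz xyx by (simp add: UE.a_ac)
    moreover have "uscal n (fps_nth qh 0) = \<one>\<^bsub>UE n\<^esub>" "uscal n (fps_nth qh_inv 0) = \<one>\<^bsub>UE n\<^esub>"
      by (simp_all add: qh_nth uscal_one)
    ultimately show ?thesis unfolding near(5)
      by (subst serre_image_iff[OF UE_ring sp_hom sp_smul X]) (simp_all add: sp_letter x_def[symmetric] y_def[symmetric])
  next
    case (far X i j)
    then have X: "X i \<in> gens n" "X j \<in> gens n" by auto
    have "lie (spec_gen n (X i)) (spec_gen n (X j)) = 0\<^sub>m (n+1) (n+1)" using far by (intro lie_far) auto
    then show ?thesis unfolding far(6) using X w2[OF X] \<iota>_zero[of n] by (intro diff) simp_all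
  qed
qed

text \<open>For the closure, an approximation modulo h is enough, because the specialization kills
  multiples of h.\<close>

lemma spec_ideal:
  assumes "x \<in> Uh_ideal n" shows "sp n x = \<zero>\<^bsub>UE n\<^esub>"
proof -
  interpret D: ring_hom_ring "FA n" "UE n" "sp n"
    by (rule ring_hom_ringI2[OF FA.F_ring UE_ring sp_hom])
  have "Uh_rels n \<subseteq> a_kernel (FA n) (UE n) (sp n)"
    unfolding a_kernel_def' using sp_rel[of _ n] Uh_rels_closed[of n] by blast
  then have Idl: "Idl\<^bsub>FA n\<^esub> (Uh_rels n) \<subseteq> a_kernel (FA n) (UE n) (sp n)"
    by (rule FA.F.genideal_minimal[OF D.kernel_is_ideal])
  obtain s u where su: "s \<in> Idl\<^bsub>FA n\<^esub> (Uh_rels n)" "u \<in> FAset n" "x = (\<lambda>w. s w + fps_X ^ 1 * u w)"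
    using assms unfolding Uh_ideal_def FA.hclosure_iff by blast
  have "sp n x = sp n s" unfolding su(3) by (rule sp_cong) simp
  also have "\<dots> = \<zero>\<^bsub>UE n\<^esub>" using subsetD[OF Idl su(1)] unfolding a_kernel_def' by simp
  finally show ?thesis .
qed

lemma spec_FA_ideal: "x \<in> Uh_ideal n \<Longrightarrow> spec_FA n x \<in> UE_ideal n"
  using spec_ideal[of x n] ucl_eq_iff[of "spec_FA n x" n "\<lambda>w. 0"] J_carrier[of x n] TA.zero_closed[of n]
  by (simp add: sp_def ucl_zero)

lemma spec_class: "f \<in> FAset n \<Longrightarrow> spec n (Uh_class n f) = sp n f"
  unfolding spec_def Uh_class_def sp_def ucl_def
  by (rule quot_map_coset[OF Uh_ideal_ideal UE_ideal_ideal]) (simp_all add: spec_FA_add spec_FA_ideal)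

lemma spec_hom: "spec n \<in> Ring.ring_hom (Uh n) (UE n)"
  unfolding spec_def Uh_def UE_def
  by (rule quot_map_ring_hom[OF Uh_ideal_ideal UE_ideal_ideal spec_FA_hom spec_FA_ideal])

lemma spec_scalar: "spec n (Uh_scalar n c) = uscal n (fps_nth c 0)"
  using sp_smul[of "mon []" n c] ring_hom_one[OF sp_hom, of n] by (simp add: Uh_scalar_def spec_class)

lemma sp_Hg_sum:
  assumes "set is \<subseteq> {1..n}"
  shows "(\<lambda>w. \<Sum>i\<leftarrow>is. mon [Hg i] w) \<in> FAset n \<and> foldr (+) (map (chh n) is) (0\<^sub>m (n+1) (n+1)) \<in> sl n \<and>
    sp n (\<lambda>w. \<Sum>i\<leftarrow>is. mon [Hg i] w) = \<iota> n (foldr (+) (map (chh n) is) (0\<^sub>m (n+1) (n+1)))"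
  using assms
proof (induction "is")
  case Nil
  then show ?case using FA.F.zero_closed[of n] sl_zero[of n] \<iota>_zero[of n] by (simp add: sp_zero)
next
  case (Cons i "is")
  then have s: "(\<lambda>w. \<Sum>i\<leftarrow>is. mon [Hg i] w) \<in> FAset n" by simp
  show ?case
    using Cons sp_add[OF letter_closed s, of "Hg i"] sp_letter[of n "Hg i"] che_sl(3)[of i n]
    by (simp add: sl_add \<iota>_add)
qed

lemma spec_Lgen:
  assumes "n \<ge> 1" shows "spec n (Uh_class n (Lgen n)) = \<iota> n (munit n 0 0 - munit n n n)"
proof -
  have "set [1..<n+1] \<subseteq> {1..n}" by auto
  then show ?thesis
    using sp_cong[OF Lgen_cf0, of n] sp_Hg_sum[of "[1..<n+1]" n] chh_sum[of 1 n] assms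
    by (simp add: spec_class del: upt_Suc)
qed

text \<open>At h = 0 the scalar q becomes 1, and each q-bracket turns into a commutator in the
  enveloping algebra.\<close>

lemma spec_chain:
  assumes \<sigma>: "good_perm n \<sigma>" and k: "1 \<le> k" "k \<le> n"
  shows "nest lie (\<lambda>i. che n (\<sigma> i)) k \<in> sl n \<and> spec n (Uchain n \<sigma> k) = \<iota> n (nest lie (\<lambda>i. che n (\<sigma> i)) k)"
  using k
proof (induction k rule: dec_induct)
  case base
  then have "\<sigma> 1 \<in> {1..n}" using \<sigma> by (auto simp: good_perm_def)
  then show ?case by (simp add: nest_1 spec_class sp_letter che_sl)
next
  case (step k)
  then have k: "\<sigma> (Suc k) \<in> {1..n}" using \<sigma> by (auto simp: good_perm_def)
  interpret coideal_chain n \<sigma> by unfold_locales fact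
  interpret C: ring_hom_ring "Uh n" "UE n" "spec n" by (rule ring_hom_ringI2[OF Uh_ring UE_ring spec_hom])
  define x where "x = nest lie (\<lambda>i. che n (\<sigma> i)) k"
  have x: "x \<in> sl n" "spec n (A k) = \<iota> n x" using step by (auto simp: x_def)
  have Ac: "A k \<in> carrier (Uh n)" "e (Suc k) \<in> carrier (Uh n)" using step k by simp_all
  have q: "spec n (Uh_scalar n qh) = \<one>\<^bsub>UE n\<^esub>" by (simp add: spec_scalar qh_nth uscal_one)
  have e: "spec n (e (Suc k)) = \<iota> n (che n (\<sigma> (Suc k)))" using k by (simp add: spec_class sp_letter)
  have "spec n (qb (A k) (e (Suc k))) = \<iota> n x \<otimes>\<^bsub>UE n\<^esub> \<iota> n (che n (\<sigma> (Suc k))) \<ominus>\<^bsub>UE n\<^esub> \<iota> n (che n (\<sigma> (Suc k))) \<otimes>\<^bsub>UE n\<^esub> \<iota> n x"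
    using Ac x(1) che_sl(1)[OF k] by (simp add: qb_def Uh.minus_eq UE.minus_eq q e x(2))
  also have "\<dots> = \<iota> n (lie x (che n (\<sigma> (Suc k))))"
    using x(1) che_sl(1)[OF k] \<iota>_lie[OF x(1) che_sl(1)[OF k]] sl_lie'[OF x(1) che_sl(1)[OF k]]
    by (simp add: UE.minus_eq UE.a_ac UE.r_neg)
  finally show ?case
    using step x(1) che_sl(1)[OF k] by (simp add: nest_Suc x_def[symmetric] sl_lie')
qed

section \<open>Linear independence of ordered monomials\<close>

text \<open>\<open>unsh f w\<close> is the sum of \<open>f a b\<close> over all ways of splitting \<open>w\<close> into two complementary
  subwords \<open>a\<close> and \<open>b\<close>: the pairing with the coproduct of the enveloping algebra.\<close>

fun unsh :: "('a list \<Rightarrow> 'a list \<Rightarrow> complex) \<Rightarrow> 'a list \<Rightarrow> complex" where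
  "unsh f [] = f [] []"
| "unsh f (x # w) = unsh (\<lambda>a b. f (x # a) b) w + unsh (\<lambda>a b. f a (x # b)) w"

lemma unsh_append: "unsh f (u @ w) = unsh (\<lambda>a b. unsh (\<lambda>c d. f (a @ c) (b @ d)) w) u"
  by (induction u arbitrary: f) simp_all

lemma unsh_add: "unsh (\<lambda>a b. f a b + g a b) w = unsh f w + unsh g w"
  by (induction w arbitrary: f g) simp_all

lemma unsh_scale: "unsh (\<lambda>a b. c * f a b) w = c * unsh f w"
  by (induction w arbitrary: f) (simp_all add: algebra_simps)

lemma unsh_swap: "unsh (\<lambda>a b. unsh (f a b) w) u = unsh (\<lambda>c d. unsh (\<lambda>a b. f a b c d) u) w"
  by (induction u arbitrary: f) (simp_all add: unsh_add)

lemma unsh_map: "unsh f (map x w) = unsh (\<lambda>a b. f (map x a) (map x b)) w"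
  by (induction w arbitrary: f) simp_all

text \<open>Formulated for any set closed under addition, since it is applied both to {0} and to the
  natural numbers.\<close>

lemma unsh_closed:
  assumes "\<And>y z. y \<in> Z \<Longrightarrow> z \<in> Z \<Longrightarrow> y + z \<in> Z" "\<And>a b. mset a + mset b = mset w \<Longrightarrow> f a b \<in> Z"
  shows "unsh f w \<in> Z"
  using assms(2)
proof (induction w arbitrary: f)
  case (Cons x w)
  show ?case unfolding unsh.simps by (intro assms(1) Cons.IH Cons.prems) (use Cons.prems in auto)
qed simp

lemma unsh_zero: "(\<And>a b. mset a + mset b = mset w \<Longrightarrow> f a b = 0) \<Longrightarrow> unsh f w = 0"
  using unsh_closed[of "{0}" w f] by simp

lemma unsh_cong: "(\<And>a b. mset a + mset b = mset w \<Longrightarrow> f a b = g a b) \<Longrightarrow> unsh f w = unsh g w"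
  using unsh_zero[of w "\<lambda>a b. f a b + (- 1) * g a b"] unfolding unsh_add unsh_scale by simp

lemma unsh_nil:
  assumes "\<And>a b. mset a + mset b = mset w \<Longrightarrow> a \<noteq> [] \<Longrightarrow> f a b = 0"
  shows "unsh f w = f [] w"
  using assms
proof (induction w arbitrary: f)
  case (Cons x w)
  have "unsh (\<lambda>a b. f (x # a) b) w = 0" by (rule unsh_zero, rule Cons.prems) auto
  moreover have "unsh (\<lambda>a b. f a (x # b)) w = f [] (x # w)"
    by (rule Cons.IH, rule Cons.prems) auto
  ultimately show ?case by simp
qed simp

lemma mset_split_set: "mset a + mset b = mset w \<Longrightarrow> set a \<subseteq> set w \<and> set b \<subseteq> set w"
  by (metis Un_upper1 Un_upper2 set_mset_mset set_mset_union)

lemma mset_split_length: "mset a + mset b = mset w \<Longrightarrow> length a + length b = length w"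
  by (metis size_mset size_union)

text \<open>A relation among the words c, c', c'' may be checked in place. Splitting u @ c @ v
  splits the three parts independently, and the splitting of the middle part can be moved
  innermost.\<close>

lemma unsh_context:
  assumes F: "\<And>a1 b1 a2 b2. set a1 \<subseteq> S \<Longrightarrow> set b1 \<subseteq> S \<Longrightarrow> set a2 \<subseteq> S \<Longrightarrow> set b2 \<subseteq> S \<Longrightarrow>
      unsh (\<lambda>p q. F (a1 @ p @ a2) (b1 @ q @ b2)) c =
      k * unsh (\<lambda>p q. F (a1 @ p @ a2) (b1 @ q @ b2)) c' + l * unsh (\<lambda>p q. F (a1 @ p @ a2) (b1 @ q @ b2)) c''"
    and uv: "set u \<subseteq> S" "set v \<subseteq> S"
  shows "unsh F (u @ c @ v) = k * unsh F (u @ c' @ v) + l * unsh F (u @ c'' @ v)"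
proof -
  have e: "unsh F (u @ c @ v) = unsh (\<lambda>a1 b1. unsh (\<lambda>a2 b2. unsh (\<lambda>p q. F (a1 @ p @ a2) (b1 @ q @ b2)) c) v) u" for c
    by (simp add: unsh_append unsh_swap[of _ v c])
  show ?thesis
    unfolding e unsh_scale[symmetric] unsh_add[symmetric]
    by (intro unsh_cong, unfold unsh_scale, rule F) (use uv mset_split_set in blast)+
qed

text \<open>Functions on words that factor through the enveloping algebra: they respect its three
  families of relations inside every word, and \<open>ufun_ideal\<close> draws the conclusion for
  the whole ideal.\<close>

definition ufun :: "nat \<Rightarrow> (complex mat list \<Rightarrow> complex) \<Rightarrow> bool" where
  "ufun n T \<longleftrightarrow> (\<forall>a b. set a \<subseteq> sl n \<longrightarrow> set b \<subseteq> sl n \<longrightarrow>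
     (\<forall>x\<in>sl n. \<forall>y\<in>sl n. T (a @ [x + y] @ b) = T (a @ [x] @ b) + T (a @ [y] @ b) \<and>
        T (a @ [x, y] @ b) = T (a @ [y, x] @ b) + T (a @ [lie x y] @ b)) \<and>
     (\<forall>c. \<forall>x\<in>sl n. T (a @ [c \<cdot>\<^sub>m x] @ b) = c * T (a @ [x] @ b)))"

lemma ufunD:
  assumes "ufun n T" "set a \<subseteq> sl n" "set b \<subseteq> sl n" "x \<in> sl n"
  shows "y \<in> sl n \<Longrightarrow> T (a @ [x + y] @ b) = T (a @ [x] @ b) + T (a @ [y] @ b)"
    and "y \<in> sl n \<Longrightarrow> T (a @ [x, y] @ b) = T (a @ [y, x] @ b) + T (a @ [lie x y] @ b)"
    and "T (a @ [c \<cdot>\<^sub>m x] @ b) = c * T (a @ [x] @ b)"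
  using assms unfolding ufun_def by blast+

text \<open>The convolution product of functionals on the enveloping algebra, whose coproduct makes
  the elements of the Lie algebra primitive. Additivity and homogeneity concern a single letter and
  pass to either factor at once.\<close>

lemma ufun_unsh:
  assumes T: "ufun n T" and T': "ufun n T'"
  shows "ufun n (unsh (\<lambda>a b. T a * T' b))"
proof -
  note D = ufunD(1,3)[OF T, simplified] ufunD(1,3)[OF T', simplified]
  let ?F = "\<lambda>a b. T a * T' b"
  have 1: "unsh ?F (u @ [x + y] @ v) = 1 * unsh ?F (u @ [x] @ v) + 1 * unsh ?F (u @ [y] @ v)"
    if "set u \<subseteq> sl n" "set v \<subseteq> sl n" "x \<in> sl n" "y \<in> sl n" for u v x y
    by (rule unsh_context[of "sl n"]) (use that in \<open>simp_all add: D algebra_simps\<close>)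
  have 2: "unsh ?F (u @ [x, y] @ v) = 1 * unsh ?F (u @ [y, x] @ v) + 1 * unsh ?F (u @ [lie x y] @ v)"
    if uv: "set u \<subseteq> sl n" "set v \<subseteq> sl n" "x \<in> sl n" "y \<in> sl n" for u v x y
  proof (rule unsh_context[of "sl n"])
    fix a1 b1 a2 b2 :: "complex mat list"
    assume s: "set a1 \<subseteq> sl n" "set b1 \<subseteq> sl n" "set a2 \<subseteq> sl n" "set b2 \<subseteq> sl n"
    show "unsh (\<lambda>p q. T (a1 @ p @ a2) * T' (b1 @ q @ b2)) [x, y] =
      1 * unsh (\<lambda>p q. T (a1 @ p @ a2) * T' (b1 @ q @ b2)) [y, x] +
      1 * unsh (\<lambda>p q. T (a1 @ p @ a2) * T' (b1 @ q @ b2)) [lie x y]"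
      \<comment> \<open>Of the four splittings of [x, y], the two that separate x from y are the
        same for [y, x]; the other two differ by the bracket in one factor.\<close>
      using ufunD(2)[OF T s(1,3) uv(3,4)] ufunD(2)[OF T' s(2,4) uv(3,4)] by (simp add: algebra_simps)
  qed (use uv in auto)
  have 3: "unsh ?F (u @ [c \<cdot>\<^sub>m x] @ v) = c * unsh ?F (u @ [x] @ v) + 0 * unsh ?F (u @ [x] @ v)"
    if "set u \<subseteq> sl n" "set v \<subseteq> sl n" "x \<in> sl n" for u v x c
    by (rule unsh_context[of "sl n"]) (use that in \<open>simp_all add: D algebra_simps\<close>)
  show ?thesis
    using 1 2 3 unfolding ufun_def mult_1 mult_zero_left add_0_right by blast
qed

text \<open>The elements killed by T in every context of letters form a two-sided ideal, since
  multiplication by a word only enlarges the context. This ideal contains the relators.\<close>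

lemma ufun_ideal:
  assumes T: "ufun n T" and f: "f \<in> UE_ideal n"
  shows "lin T f = 0"
proof -
  define N where "N = {f \<in> TAset n. \<forall>a b. set a \<subseteq> sl n \<longrightarrow> set b \<subseteq> sl n \<longrightarrow> lin (\<lambda>v. T (a @ v @ b)) f = 0}"
  have fin: "finite (supp f)" if "f \<in> TAset n" for f using that by (simp add: TAset_def)
  have sup: "set w \<subseteq> sl n" if "f \<in> TAset n" "w \<in> supp f" for f w using that by (auto simp: TAset_def)
  have l: "conv (@) g f \<in> N" and r: "conv (@) f g \<in> N" if g: "g \<in> TAset n" and f: "f \<in> N" for f g
  proof -
    have fT: "f \<in> TAset n" and ker: "\<And>a b. set a \<subseteq> sl n \<Longrightarrow> set b \<subseteq> sl n \<Longrightarrow> lin (\<lambda>v. T (a @ v @ b)) f = 0"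
      using f by (simp_all add: N_def)
    have "lin (\<lambda>v. T (a @ v @ b)) (conv (@) g f) = 0" if ab: "set a \<subseteq> sl n" "set b \<subseteq> sl n" for a b
    proof -
      have "lin (\<lambda>v. T (a @ v @ b)) (conv (@) g f) =
          (\<Sum>u\<in>supp g. g u * lin (\<lambda>v. T ((a @ u) @ v @ b)) f)"
        unfolding MW.lin_conv[OF fin[OF g] fin[OF fT]]
        by (simp add: lin_def sum_distrib_left sum.cartesian_product case_prod_unfold mult.assoc)
      also have "\<dots> = 0"
      proof (intro sum.neutral ballI)
        fix u assume "u \<in> supp g"
        then have "lin (\<lambda>v. T ((a @ u) @ v @ b)) f = 0" by (intro ker) (use ab sup[OF g] in auto)
        then show "g u * lin (\<lambda>v. T ((a @ u) @ v @ b)) f = 0" by simp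
      qed
      finally show ?thesis .
    qed
    then show "conv (@) g f \<in> N" using TA_conv[OF g fT] by (simp add: N_def)
    have "lin (\<lambda>v. T (a @ v @ b)) (conv (@) f g) = 0" if ab: "set a \<subseteq> sl n" "set b \<subseteq> sl n" for a b
    proof -
      have "lin (\<lambda>v. T (a @ v @ b)) (conv (@) f g) =
          (\<Sum>u\<in>supp f. \<Sum>v\<in>supp g. g v * (f u * T (a @ u @ v @ b)))"
        unfolding MW.lin_conv[OF fin[OF fT] fin[OF g]]
        by (simp add: sum.cartesian_product case_prod_unfold mult_ac)
      also have "\<dots> = (\<Sum>v\<in>supp g. g v * lin (\<lambda>u. T (a @ u @ v @ b)) f)"
        by (subst sum.swap) (simp add: lin_def sum_distrib_left)
      also have "\<dots> = 0"
      proof (intro sum.neutral ballI)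
        fix v assume "v \<in> supp g"
        then have "lin (\<lambda>u. T (a @ u @ v @ b)) f = 0" by (intro ker) (use ab sup[OF g] in auto)
        then show "g v * lin (\<lambda>u. T (a @ u @ v @ b)) f = 0" by simp
      qed
      finally show ?thesis .
    qed
    then show "conv (@) f g \<in> N" using TA_conv[OF fT g] by (simp add: N_def)
  qed
  have add: "(\<lambda>w. f w + g w) \<in> N" if "f \<in> N" "g \<in> N" for f g
    using that fin by (simp add: N_def TA_add lin_add)
  have sm: "smul c f \<in> N" if "f \<in> N" for c f using that fin by (simp add: N_def lin_smul)
  have zero: "(\<lambda>w. 0) \<in> N" using TA.zero_closed[of n] by (simp add: N_def lin_def)
  have I: "ideal N (TA n)"
  proof (rule idealI[OF TA_ring])
    show "subgroup N (add_monoid (TA n))"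
    proof (rule TA.add.subgroupI)
      show "N \<subseteq> carrier (TA n)" by (auto simp: N_def)
      show "N \<noteq> {}" using zero by blast
      show "\<ominus>\<^bsub>TA n\<^esub> f \<in> N" if f: "f \<in> N" for f
      proof -
        have "f \<in> TAset n" using f by (simp add: N_def)
        then have "\<ominus>\<^bsub>TA n\<^esub> f = smul (- 1) f"
          using word_ring_uminus[of "TAset n" "(@)" "[]" f] TA_ring[of n]
          by (simp add: free_alg_def flip: TAset_def)
        then show ?thesis using sm[OF f] by simp
      qed
    qed (simp add: add)
  qed (use l r in auto)
  have m: "mon w \<in> TAset n" if "set w \<subseteq> sl n" for w using that by (rule TA_mon)
  have d: "(\<lambda>w. f w - g w) \<in> TAset n \<and> lin F (\<lambda>w. f w - g w) = lin F f - lin F g"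
    if fg: "f \<in> TAset n" "g \<in> TAset n" for f g F
  proof -
    have e: "(\<lambda>w. f w - g w) = (\<lambda>w. f w + smul (- 1) g w)" by (simp add: smul_apply)
    show ?thesis unfolding e using fg fin[OF fg(1)] fin[OF TA_smul[OF fg(2), of "- 1"]] fin[OF fg(2)]
      by (simp only: TA_add TA_smul lin_add lin_smul) simp
  qed
  have "UE_rels n \<subseteq> N"
  proof
    fix r assume "r \<in> UE_rels n"
    then consider (1) x y where "x \<in> sl n" "y \<in> sl n" "r = (\<lambda>w. mon [x + y] w - mon [x] w - mon [y] w)"
      | (2) c x where "x \<in> sl n" "r = (\<lambda>w. mon [c \<cdot>\<^sub>m x] w - smul c (mon [x]) w)"
      | (3) x y where "x \<in> sl n" "y \<in> sl n" "r = (\<lambda>w. mon [x, y] w - mon [y, x] w - mon [lie x y] w)"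
      unfolding UE_rels_def smul_apply by blast
    then show "r \<in> N"
    proof cases
      case 1
      note dd = d[OF m[of "[x + y]"] m[of "[x]"]]
      show ?thesis
        using 1 dd d[OF conjunct1[OF dd] m[of "[y]"]] sl_add[of x n y] ufunD(1)[OF T _ _ 1(1,2)] by (simp add: N_def lin_mon)
    next
      case 2
      note dd = d[OF m[of "[c \<cdot>\<^sub>m x]"] TA_smul[OF m[of "[x]"], of c]]
      have "finite (supp (mon [x] :: complex mat list \<Rightarrow> complex))" by (simp add: mon_apply)
      then show ?thesis
        using 2 dd sl_smult[of x n c] ufunD(3)[OF T _ _ 2(1)] by (simp add: N_def lin_mon lin_smul)
    next
      case 3
      note dd = d[OF m[of "[x, y]"] m[of "[y, x]"]]
      show ?thesis
        using 3 dd d[OF conjunct1[OF dd] m[of "[lie x y]"]] sl_lie'[of x n y] ufunD(2)[OF T _ _ 3(1,2)] by (simp add: N_def lin_mon)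
    qed
  qed
  then have "UE_ideal n \<subseteq> N" unfolding UE_ideal_rels by (rule TA.genideal_minimal[OF I])
  then have "f \<in> N" using f by blast
  then have "\<forall>a b. set a \<subseteq> sl n \<longrightarrow> set b \<subseteq> sl n \<longrightarrow> lin (\<lambda>v. T (a @ v @ b)) f = 0" by (simp add: N_def)
  from this[rule_format, of "[]" "[]"] show ?thesis by simp
qed

text \<open>The convolution product of a list of functionals; its value on w is a sum over all
  distributions of the letters of w among the factors, with the counit as empty product.\<close>

fun tpow :: "('a list \<Rightarrow> complex) list \<Rightarrow> 'a list \<Rightarrow> complex" where
  "tpow [] w = of_bool (w = [])"
| "tpow (T # Ts) w = unsh (\<lambda>a b. T a * tpow Ts b) w"

lemma ufun_tpow: "(\<And>T. T \<in> set Ts \<Longrightarrow> ufun n T) \<Longrightarrow> ufun n (tpow Ts)"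
proof (induction Ts)
  case Nil
  then show ?case by (simp add: ufun_def)
next
  case (Cons T Ts)
  have "tpow (T # Ts) = unsh (\<lambda>a b. T a * tpow Ts b)" by (rule ext) simp
  then show ?case using ufun_unsh[of n T "tpow Ts"] Cons by simp
qed

text \<open>Functionals that vanish at 1 need at least one letter each.\<close>

lemma tpow_short:
  assumes "\<And>T. T \<in> set Ts \<Longrightarrow> T [] = 0" "length w < length Ts"
  shows "tpow Ts w = 0"
  using assms
proof (induction Ts arbitrary: w)
  case (Cons T Ts)
  show ?case unfolding tpow.simps
  proof (rule unsh_zero)
    fix a b assume "mset a + mset b = mset w"
    then show "T a * tpow Ts b = 0"
      using mset_split_length[of a b w] Cons by (cases a) auto
  qed
qed simp

locale dual_family =
  fixes x :: "nat \<Rightarrow> 'a" and T :: "nat \<Rightarrow> 'a list \<Rightarrow> complex" and N :: nat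
  assumes T_Nil: "T i [] = 0"
    and T_x: "i < N \<Longrightarrow> j < N \<Longrightarrow> T i [x j] = of_bool (i = j)"
begin

text \<open>When there are as many letters as factors, each factor receives exactly one. The value
  is the permanent of a matrix of zeros and ones: it counts the ways to match w with ks and is zero
  unless the multisets agree.\<close>

lemma tpow_perm:
  assumes "set ks \<subseteq> {..<N}" "set w \<subseteq> {..<N}" "length w = length ks"
  shows "tpow (map T ks) (map x w) \<in> \<nat> \<and> (mset w \<noteq> mset ks \<longrightarrow> tpow (map T ks) (map x w) = 0)"
  using assms
proof (induction ks arbitrary: w)
  case (Cons k ks)
  let ?f = "\<lambda>a b. T k (map x a) * tpow (map T ks) (map x b)"
  have f: "?f a b \<in> \<nat> \<and> (mset w \<noteq> mset (k # ks) \<longrightarrow> ?f a b = 0)" if ab: "mset a + mset b = mset w" for a b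
  proof -
    have len: "length a + length b = Suc (length ks)" and s: "set a \<subseteq> {..<N}" "set b \<subseteq> {..<N}"
      using mset_split_length[OF ab] mset_split_set[OF ab] Cons.prems by auto
    consider "a = []" | j where "a = [j]" | "length a \<ge> 2"
      by (cases a; cases "tl a") auto
    then show ?thesis
    proof cases
      case 1 then show ?thesis by (simp add: T_Nil)
    next
      case (2 j)
      have jk: "k < N" "j < N" using Cons.prems(1) s 2 by auto
      have "tpow (map T ks) (map x b) \<in> \<nat> \<and> (mset b \<noteq> mset ks \<longrightarrow> tpow (map T ks) (map x b) = 0)"
        using Cons.prems s len 2 by (intro Cons.IH) auto
      moreover have "mset w = add_mset j (mset b)" using ab 2 by simp
      ultimately show ?thesis using T_x[OF jk] 2 by auto
    next
      case 3
      then have "tpow (map T ks) (map x b) = 0" using len by (intro tpow_short) (auto simp: T_Nil)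
      then show ?thesis by simp
    qed
  qed
  have "unsh ?f w \<in> \<nat>" by (rule unsh_closed) (use f in \<open>auto intro: Nats_add\<close>)
  moreover have "mset w \<noteq> mset (k # ks) \<Longrightarrow> unsh ?f w = 0" by (rule unsh_zero) (use f in auto)
  ultimately show ?case by (simp add: unsh_map)
qed simp

text \<open>The identity matching contributes 1, and the remaining contributions are natural
  numbers, so nothing can cancel it.\<close>

lemma tpow_diag:
  assumes "set ks \<subseteq> {..<N}" shows "\<exists>p::nat. p > 0 \<and> tpow (map T ks) (map x ks) = of_nat p"
  using assms
proof (induction ks)
  case (Cons k ks)
  then obtain p where p: "p > 0" "tpow (map T ks) (map x ks) = of_nat p" by auto
  let ?f = "\<lambda>a b. T k (map x a) * tpow (map T ks) (map x b)"
  \<comment> \<open>If the first letter goes to the first factor, any further letter there would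
    leave too few for the rest.\<close>
  have "unsh (\<lambda>a b. ?f (k # a) b) ks = ?f [k] ks"
  proof (rule unsh_nil)
    fix a b assume ab: "mset a + mset b = mset ks" "a \<noteq> []"
    then have "length b < length ks" using mset_split_length[OF ab(1)] by (cases a) auto
    then have "tpow (map T ks) (map x b) = 0" by (intro tpow_short) (auto simp: T_Nil)
    then show "?f (k # a) b = 0" by simp
  qed
  also have "\<dots> = of_nat p" using T_x[of k k] Cons.prems p by simp
  finally have 1: "unsh (\<lambda>a b. ?f (k # a) b) ks = of_nat p" .
  have "?f a (k # b) \<in> \<nat>" if ab: "mset a + mset b = mset ks" for a b
  proof -
    have len: "length a + length b = length ks" and s: "set a \<subseteq> {..<N}" "set b \<subseteq> {..<N}"
      using mset_split_length[OF ab] mset_split_set[OF ab] Cons.prems by auto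
    consider "a = []" | j where "a = [j]" | "length a \<ge> 2"
      by (cases a; cases "tl a") auto
    then show ?thesis
    proof cases
      case 1 then show ?thesis by (simp add: T_Nil)
    next
      case (2 j)
      have "T k [x j] \<in> \<nat>" using T_x[of k j] Cons.prems s 2 by simp
      moreover have "tpow (map T ks) (map x (k # b)) \<in> \<nat>"
        using Cons.prems s len 2 by (intro conjunct1[OF tpow_perm]) auto
      ultimately show ?thesis using 2 by (simp add: Nats_mult)
    next
      case 3
      then have "tpow (map T ks) (map x (k # b)) = 0" using len by (intro tpow_short) (auto simp: T_Nil)
      then show ?thesis by simp
    qed
  qed
  then have "unsh (\<lambda>a b. ?f a (k # b)) ks \<in> \<nat>" by (intro unsh_closed Nats_add) auto
  then obtain r where "unsh (\<lambda>a b. ?f a (k # b)) ks = of_nat r" by (auto elim: Nats_cases)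
  then have "tpow (map T (k # ks)) (map x (k # ks)) = of_nat (p + r)"
    using 1 unsh_map[of "\<lambda>a b. T k a * tpow (map T ks) b" x "k # ks"] by simp
  then show ?case using p by blast
qed auto

end

text \<open>A longest word v with nonzero coefficient is detected by the product of the functionals
  dual to its letters. Shorter words are killed for lack of letters, and other words of the same
  length because two sorted words with equal multisets coincide.\<close>

lemma sorted_words_independent:
  assumes D: "dual_family x T N" and T: "\<And>i. i < N \<Longrightarrow> ufun n (T i)" and x: "\<And>i. i < N \<Longrightarrow> x i \<in> sl n"
    and A: "finite A" "A \<subseteq> {w. sorted w \<and> set w \<subseteq> {..<N}}"
    and zero: "(\<Oplus>\<^bsub>UE n\<^esub>w\<in>A. uscal n (c w) \<otimes>\<^bsub>UE n\<^esub> ucl n (mon (map x w))) = \<zero>\<^bsub>UE n\<^esub>"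
    and w: "w \<in> A"
  shows "c w = 0"
proof (rule ccontr)
  interpret dual_family x T N by fact
  assume "c w \<noteq> 0"
  define A' where "A' = {w \<in> A. c w \<noteq> 0}"
  have A': "finite A'" "A' \<noteq> {}" using A w \<open>c w \<noteq> 0\<close> by (auto simp: A'_def)
  \<comment> \<open>The maximum is taken over words with nonzero coefficient only; A may contain
    longer ones with coefficient zero.\<close>
  define m where "m = Max (length ` A')"
  have "m \<in> length ` A'" unfolding m_def using A' by (intro Max_in) auto
  then obtain v where v: "v \<in> A'" "length v = m" by auto
  have le: "length u \<le> m" if "u \<in> A'" for u unfolding m_def using A' that by (intro Max_ge) auto
  let ?G = "tpow (map T v)"
  have sv: "set v \<subseteq> {..<N}" "sorted v" using v A by (auto simp: A'_def)
  have sA: "set u \<subseteq> {..<N}" "sorted u" if "u \<in> A" for u using that A by auto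
  have G: "ufun n ?G" using T sv by (intro ufun_tpow) auto
  \<comment> \<open>The relation is lifted to the tensor algebra, where functionals on words can be
    evaluated; its class vanishes, so the lift lies in the ideal.\<close>
  define F where "F = (\<lambda>B v. \<Sum>w\<in>B. c w * mon (map x w) v :: complex)"
  have F: "F B \<in> TAset n \<and> lin ?G (F B) = (\<Sum>w\<in>B. c w * ?G (map x w)) \<and>
     ucl n (F B) = (\<Oplus>\<^bsub>UE n\<^esub>w\<in>B. uscal n (c w) \<otimes>\<^bsub>UE n\<^esub> ucl n (mon (map x w)))" if "B \<subseteq> A" for B
    using finite_subset[OF that A(1)] that
  proof (induction B rule: finite_induct)
    case empty
    then show ?case using TA.zero_closed[of n] by (simp add: F_def lin_def ucl_zero)
  next
    case (insert u B)
    have m: "mon (map x w) \<in> TAset n" if "w \<in> A" for w using sA[OF that] x by (intro TA_mon) auto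
    have mu: "mon (map x u) \<in> TAset n" using insert by (intro m) auto
    have e: "F (insert u B) = (\<lambda>v. smul (c u) (mon (map x u)) v + F B v)"
      using insert by (simp add: F_def smul_apply)
    have fin: "finite (supp f)" if "f \<in> TAset n" for f using that by (simp add: TAset_def)
    have "(\<lambda>w. uscal n (c w) \<otimes>\<^bsub>UE n\<^esub> ucl n (mon (map x w))) \<in> insert u B \<rightarrow> carrier (UE n)"
      using insert.prems m by auto
    then show ?case
      using insert mu fin[OF mu] fin[OF TA_smul[OF mu]] fin[of "F B"] unfolding e
      by (simp add: TA_add lin_add lin_smul lin_mon ucl_add ucl_smul Pi_def)
  qed
  have "F A \<in> UE_ideal n"
    using ucl_eq_iff[of "F A" n "\<lambda>w. 0"] F[OF order_refl] zero TA.zero_closed[of n] by (simp add: ucl_zero)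
  then have "lin ?G (F A) = 0" by (rule ufun_ideal[OF G])
  then have "(\<Sum>w\<in>A. c w * ?G (map x w)) = 0" using F[OF order_refl] by simp
  moreover have "c u * ?G (map x u) = 0" if u: "u \<in> A" "u \<noteq> v" for u
  proof (cases "u \<in> A'")
    case True
    consider "length u < m" | "length u = m" using le[OF True] by linarith
    then show ?thesis
    proof cases
      case 1
      then have "?G (map x u) = 0" using v by (intro tpow_short) (auto simp: T_Nil)
      then show ?thesis by simp
    next
      case 2
      have "mset u \<noteq> mset v"
        using u(2) properties_for_sort[of u v] sorted_sort_id[OF sv(2)] sA(2)[OF u(1)] by auto
      then show ?thesis using tpow_perm[OF sv(1) sA(1)[OF u(1)]] 2 v by simp
    qed
  qed (use u in \<open>simp add: A'_def\<close>)
  then have "(\<Sum>w\<in>A - {v}. c w * ?G (map x w)) = 0" by (intro sum.neutral) blast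
  then have "(\<Sum>w\<in>A. c w * ?G (map x w)) = c v * ?G (map x v)"
    using sum.remove[of A v "\<lambda>w. c w * ?G (map x w)"] v A by (simp add: A'_def)
  moreover obtain p :: nat where "p > 0" "?G (map x v) = of_nat p" using tpow_diag[OF sv(1)] by blast
  ultimately show False using v by (simp add: A'_def)
qed

section \<open>The ordered root vectors at \<open>h = 0\<close>\<close>

definition mprod :: "nat \<Rightarrow> complex mat list \<Rightarrow> complex mat" where
  "mprod n w = foldr (*) w (1\<^sub>m (Suc n))"

lemma mprod_simps [simp]: "mprod n [] = 1\<^sub>m (Suc n)" "mprod n (x # w) = x * mprod n w"
  by (simp_all add: mprod_def)

lemma mprod_closed [simp]: "set w \<subseteq> sl n \<Longrightarrow> mprod n w \<in> MC n"
proof (induction w)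
  case (Cons x w)
  then have "x \<in> MC n" "mprod n w \<in> MC n" using sl_carrier by auto
  then show ?case by auto
qed simp

lemma mprod_append:
  assumes "set u \<subseteq> sl n" "set w \<subseteq> sl n" shows "mprod n (u @ w) = mprod n u * mprod n w"
  using assms(1)
proof (induction u)
  case Nil
  then show ?case using mprod_closed[OF assms(2)] by simp
next
  case (Cons x u)
  then have "x \<in> MC n" "mprod n u \<in> MC n" "mprod n w \<in> MC n" using assms sl_carrier by auto
  then show ?case using Cons by (simp add: assoc_mult_mat[of _ "Suc n" "Suc n" _ "Suc n" _ "Suc n"])
qed

text \<open>Matrix coefficients of the natural representation: words act by the product of their
  letters, and the relation for a bracket is xy = yx + [x, y] for matrices.\<close>

lemma ufun_mprod:
  assumes add: "\<And>A B. A \<in> MC n \<Longrightarrow> B \<in> MC n \<Longrightarrow> \<phi> (A + B) = \<phi> A + \<phi> B"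
    and scale: "\<And>c A. A \<in> MC n \<Longrightarrow> \<phi> (c \<cdot>\<^sub>m A) = c * \<phi> A"
  shows "ufun n (\<lambda>w. \<phi> (mprod n w))"
  unfolding ufun_def
proof (intro allI impI ballI conjI)
  fix a b x assume ab: "set a \<subseteq> sl n" "set b \<subseteq> sl n" and x: "x \<in> sl n"
  define A B where "A = mprod n a" and "B = mprod n b"
  have c [simp]: "A \<in> MC n" "B \<in> MC n" "x \<in> MC n" using ab x sl_carrier by (auto simp: A_def B_def)
  have one: "mprod n (a @ [z] @ b) = A * (z * B)" if "z \<in> sl n" for z
    using mprod_append[of a n "z # b"] ab that by (simp add: A_def B_def)
  have two: "mprod n (a @ [z, u] @ b) = A * ((z * u) * B)" if "z \<in> sl n" "u \<in> sl n" for z u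
  proof -
    have "z \<in> MC n" "u \<in> MC n" using that sl_carrier by auto
    then show ?thesis
      using mprod_append[of a n "z # u # b"] ab that
      by (simp add: assoc_mult_mat[of z "Suc n" "Suc n" u "Suc n" B "Suc n"] flip: A_def B_def)
  qed
  have lin: "\<phi> (A * ((z + u) * B)) = \<phi> (A * (z * B)) + \<phi> (A * (u * B))" if "z \<in> MC n" "u \<in> MC n" for z u
  proof -
    note zB = mult_carrier_mat[OF that(1) c(2)] mult_carrier_mat[OF that(2) c(2)]
    note AzB = mult_carrier_mat[OF c(1) zB(1)] mult_carrier_mat[OF c(1) zB(2)]
    show ?thesis
      using that zB AzB by (simp add: add_mult_distrib_mat[of z "Suc n" "Suc n" u B "Suc n"]
          mult_add_distrib_mat[of A "Suc n" "Suc n" "z * B" "Suc n" "u * B"] add)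
  qed
  show "\<phi> (mprod n (a @ [k \<cdot>\<^sub>m x] @ b)) = k * \<phi> (mprod n (a @ [x] @ b))" for k
  proof -
    have xB: "x * B \<in> MC n" by (rule mult_carrier_mat[OF c(3,2)])
    have "A * (k \<cdot>\<^sub>m x * B) = k \<cdot>\<^sub>m (A * (x * B))"
      using mult_smult_assoc_mat[OF c(3,2), of k] mult_smult_distrib[OF c(1) xB, of k] by simp
    then show ?thesis using one[OF x] one[OF sl_smult[OF x]] scale[OF mult_carrier_mat[OF c(1) xB]] by simp
  qed
  fix y assume y: "y \<in> sl n"
  have yc: "y \<in> MC n" using y sl_carrier by auto
  show "\<phi> (mprod n (a @ [x + y] @ b)) = \<phi> (mprod n (a @ [x] @ b)) + \<phi> (mprod n (a @ [y] @ b))"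
    unfolding one[OF x] one[OF y] one[OF sl_add[OF x y]] by (rule lin[OF c(3) yc])
  have "x * y = y * x + lie x y"
    using carrier_matD[OF c(3)] yc by (auto simp: lie_def intro!: eq_matI)
  then show "\<phi> (mprod n (a @ [x, y] @ b)) = \<phi> (mprod n (a @ [y, x] @ b)) + \<phi> (mprod n (a @ [lie x y] @ b))"
    unfolding two[OF x y] two[OF y x] one[OF sl_lie'[OF x y]]
    using lin[OF mult_carrier_mat[OF yc c(3)] lie_closed[OF c(3) yc]] by simp
qed

text \<open>The specialized root vectors in the order of \<open>root_vector\<close>. The sign (-1)^i
  is the one of the reversed nested bracket of length k = i + 1.\<close>

definition hv :: "nat \<Rightarrow> nat \<Rightarrow> complex mat" where
  "hv n i = (if i < n - 1 then (- 1) ^ i \<cdot>\<^sub>m munit n (n - 1 - i) n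
     else if i < 2 * n - 1 then munit n 0 (i + 2 - n) else munit n 0 0 - munit n n n)"

text \<open>Off-diagonal entries vanish at the identity matrix. For the diagonal element a
  difference of two diagonal entries is used to the same effect, and 1/2 normalises its value there
  to 1.\<close>

definition hdual :: "nat \<Rightarrow> nat \<Rightarrow> complex mat \<Rightarrow> complex" where
  "hdual n i A = (if i < n - 1 then (- 1) ^ i * A $$ (n - 1 - i, n)
     else if i < 2 * n - 1 then A $$ (0, i + 2 - n) else (A $$ (0, 0) - A $$ (n, n)) / 2)"

lemma hv_sl: "n \<ge> 1 \<Longrightarrow> i < 2 * n \<Longrightarrow> hv n i \<in> sl n"
  by (auto simp: hv_def intro!: sl_smult sl_munit sl_diag)

lemma hdual_hv:
  assumes "n \<ge> 1" "i < 2 * n" "j < 2 * n" shows "hdual n i (hv n j) = of_bool (i = j)"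
proof -
  have sgn: "(- 1 :: complex) ^ k * (- 1) ^ k = 1" for k by (simp flip: power_mult_distrib)
  consider "i < n - 1" | "\<not> i < n - 1" "i < 2 * n - 1" | "i = 2 * n - 1" using assms by linarith
  then show ?thesis
  proof cases
    case 1
    consider "j < n - 1" | "\<not> j < n - 1" "j < 2 * n - 1" | "j = 2 * n - 1" using assms by linarith
    then show ?thesis
    proof cases
      case j1: 1
      then have "n - 1 - i = n - 1 - j \<longleftrightarrow> i = j" using 1 by arith
      then show ?thesis using 1 j1 sgn[of i] by (auto simp: hdual_def hv_def)
    qed (use 1 in \<open>auto simp: hdual_def hv_def\<close>)
  next
    case 2
    consider "j < n - 1" | "\<not> j < n - 1" "j < 2 * n - 1" | "j = 2 * n - 1" using assms by linarith
    then show ?thesis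
    proof cases
      case j2: 2
      then have "i + 2 - n = j + 2 - n \<longleftrightarrow> i = j" using 2 assms by arith
      then show ?thesis using 2 j2 by (auto simp: hdual_def hv_def)
    qed (use 2 in \<open>auto simp: hdual_def hv_def\<close>)
  next
    case 3
    consider "j < n - 1" | "\<not> j < n - 1" "j < 2 * n - 1" | "j = 2 * n - 1" using assms by linarith
    then show ?thesis by cases (use 3 assms in \<open>auto simp: hdual_def hv_def\<close>)
  qed
qed

lemma hdual_ufun: "n \<ge> 1 \<Longrightarrow> i < 2 * n \<Longrightarrow> ufun n (\<lambda>w. hdual n i (mprod n w))"
  by (rule ufun_mprod) (auto simp: hdual_def algebra_simps add_divide_distrib diff_divide_distrib)

lemma hdual_family:
  assumes "n \<ge> 1"
  shows "dual_family (hv n) (\<lambda>i w. if i < 2 * n then hdual n i (mprod n w) else 0) (2 * n)"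
proof
  show "(if i < 2 * n then hdual n i (mprod n []) else 0) = 0" for i
    using assms by (auto simp: hdual_def)
  show "(if i < 2 * n then hdual n i (mprod n [hv n j]) else 0) = of_bool (i = j)" if "i < 2 * n" "j < 2 * n" for i j
    using hdual_hv[OF assms that] sl_carrier[OF hv_sl[OF assms that(2)]] that by simp
qed

section \<open>The subalgebra \<open>B\<^sub>h\<close>\<close>

lemma Uh_qchain_scalars:
  assumes "n \<ge> 1"
  shows "qchain_scalars (Uh n) (Uh_scalar n qh) (Uh_scalar n qh_inv) n (\<lambda>i. Xc n (Xp i))
    (range (Uh_scalar n)) (Uh_class n (Lgen n))"
proof (intro qchain_scalars.intro qchain_scalars_axioms.intro Uh_qchain[OF good_perm_id] Uh_scalars)
    fix i assume "1 \<le> i" "i \<le> n"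
    then have "Xp i \<in> gens n" by simp
    from Lgen_letter[OF this] obtain c d where cd: "c = 1 + (qh - 1) * d"
      "Uh_class n (Lgen n) \<otimes>\<^bsub>Uh n\<^esub> Xc n (Xp i) =
      Uh_scalar n c \<otimes>\<^bsub>Uh n\<^esub> (Xc n (Xp i) \<otimes>\<^bsub>Uh n\<^esub> Uh_class n (Lgen n)) \<oplus>\<^bsub>Uh n\<^esub> Uh_scalar n d \<otimes>\<^bsub>Uh n\<^esub> Xc n (Xp i)"
      by blast
    have "Uh_scalar n c = \<one>\<^bsub>Uh n\<^esub> \<oplus>\<^bsub>Uh n\<^esub> (Uh_scalar n qh \<ominus>\<^bsub>Uh n\<^esub> \<one>\<^bsub>Uh n\<^esub>) \<otimes>\<^bsub>Uh n\<^esub> Uh_scalar n d"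
      by (simp add: cd(1) Uh_scalar_add Uh_scalar_mult Uh_scalar_minus Uh_scalar_one)
    then show "\<exists>c\<in>range (Uh_scalar n). \<exists>d\<in>range (Uh_scalar n).
      c = \<one>\<^bsub>Uh n\<^esub> \<oplus>\<^bsub>Uh n\<^esub> (Uh_scalar n qh \<ominus>\<^bsub>Uh n\<^esub> \<one>\<^bsub>Uh n\<^esub>) \<otimes>\<^bsub>Uh n\<^esub> d \<and>
      Uh_class n (Lgen n) \<otimes>\<^bsub>Uh n\<^esub> Xc n (Xp i) =
      c \<otimes>\<^bsub>Uh n\<^esub> (Xc n (Xp i) \<otimes>\<^bsub>Uh n\<^esub> Uh_class n (Lgen n)) \<oplus>\<^bsub>Uh n\<^esub> d \<otimes>\<^bsub>Uh n\<^esub> Xc n (Xp i)"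
      using cd(2) by blast
qed (use assms in auto)

text \<open>K = 1 + (q - 1)L, so K lies in the ring generated by the scalars and L and does not have
  to be straightened separately.\<close>

lemma Kprod_class: "Uh_class n (Kprod n) = \<one>\<^bsub>Uh n\<^esub> \<oplus>\<^bsub>Uh n\<^esub> Uh_scalar n (qh - 1) \<otimes>\<^bsub>Uh n\<^esub> Uh_class n (Lgen n)"
proof -
  have "Kprod n = (\<lambda>w. mon [] w + smul (qh - 1) (Lgen n) w)"
    unfolding Lgen_mult by simp
  then have "Uh_class n (Kprod n) = Uh_class n (\<lambda>w. mon [] w + smul (qh - 1) (Lgen n) w)" by (rule arg_cong)
  then show ?thesis by (simp add: Uh_class_add Uh_class_smul Uh_class_one)
qed

context
  fixes n :: nat
  assumes n: "n \<ge> 1"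
begin

interpretation qchain_scalars "Uh n" "Uh_scalar n qh" "Uh_scalar n qh_inv" n "\<lambda>i. Xc n (Xp i)"
    "range (Uh_scalar n)" "Uh_class n (Lgen n)"
  by (rule Uh_qchain_scalars[OF n])

interpretation S: ring_hom_ring "Uh n" "UE n" "spec n"
  by (rule ring_hom_ringI2[OF Uh_ring UE_ring spec_hom])

lemma root_vector_spec:
  assumes "i < 2 * n" shows "root_vector i \<in> Bh n \<and> spec n (root_vector i) = \<iota> n (hv n i)"
  using assms
proof (cases rule: root_vector_cases)
  case (1 k)
  then have k: "1 \<le> k" "k \<le> n" "i = k - 1" "i < n - 1" by auto
  have r: "root_vector i = Uchain n (\<lambda>i. Suc n - i) k" using 1 root_vector_B[of k] by simp
  have "nest lie (\<lambda>i. che n (Suc n - i)) k = hv n i"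
    using nest_lie_e_rev[OF k(1,2)] k by (simp add: hv_def)
  then show ?thesis
    using spec_chain[OF good_perm_rev k(1,2)] Bh_incl[of "Uchain n (\<lambda>i. Suc n - i) k" n] 1 unfolding r
    by (simp add: Bgens_def)
next
  case (2 k)
  then have k: "1 \<le> k" "k \<le> n" "i = k + n - 2" "\<not> i < n - 1" "i < 2 * n - 1" by auto
  have r: "root_vector i = Uchain n (\<lambda>i. i) k" using 2 root_vector_A[of k] by simp
  have e: "i + 2 - n = k" using k(1,3) n by arith
  have "hv n i = munit n 0 k" unfolding hv_def e using k(4,5) by simp
  then have "nest lie (che n) k = hv n i" using nest_lie_e[OF k(1,2)] by simp
  then show ?thesis
    using spec_chain[OF good_perm_id k(1,2)] Bh_incl[of "Uchain n (\<lambda>i. i) k" n] k(1,2) unfolding r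
    by (simp add: Bgens_def)
next
  case 3
  then have r: "root_vector i = Uh_class n (Lgen n)" and h: "hv n i = munit n 0 0 - munit n n n"
  proof -
    have "\<not> i < n - 1" "\<not> i < 2 * n - 1" using 3 n by linarith+
    then show "root_vector i = Uh_class n (Lgen n)" "hv n i = munit n 0 0 - munit n n n"
      using root_vector_L 3 by (simp_all add: hv_def)
  qed
  have "Uh_class n (Lgen n) \<in> Bh n" by (rule Bh_incl) (simp add: Bgens_def)
  then show ?thesis unfolding r h using spec_Lgen[OF n] by simp
qed

lemma Bh_root_vector: "Bh n = generate_ring (Uh n) (range (Uh_scalar n) \<union> root_vector ` {..<2 * n})"
proof
  have c: "range (Uh_scalar n) \<union> root_vector ` {..<2 * n} \<subseteq> carrier (Uh n)" using root_vector_closed by auto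
  note T = Uh.generate_ring_is_subring[OF c]
  have rv: "root_vector i \<in> generate_ring (Uh n) (range (Uh_scalar n) \<union> root_vector ` {..<2 * n})" if "i < 2 * n" for i
    using that by (intro generate_ring.incl) auto
  have sc: "Uh_scalar n d \<in> generate_ring (Uh n) (range (Uh_scalar n) \<union> root_vector ` {..<2 * n})" for d
    by (intro generate_ring.incl) auto
  have L: "Uh_class n (Lgen n) \<in> generate_ring (Uh n) (range (Uh_scalar n) \<union> root_vector ` {..<2 * n})"
    using rv[of "2 * n - 1"] root_vector_L n by simp
  have "Bgens n \<subseteq> generate_ring (Uh n) (range (Uh_scalar n) \<union> root_vector ` {..<2 * n})"
  proof
    fix b assume "b \<in> Bgens n"
    then consider "b = Uh_class n (Kprod n)" | "b = Uh_class n (Lgen n)" |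
      k where "k \<in> {1..n}" "b = A k" | k where "k \<in> {1..<n}" "b = B k"
      unfolding Bgens_def by auto
    then show "b \<in> generate_ring (Uh n) (range (Uh_scalar n) \<union> root_vector ` {..<2 * n})"
    proof cases
      case 1
      show ?thesis unfolding 1 Kprod_class
        by (intro subringE(7)[OF T] subringE(3)[OF T] subringE(6)[OF T] L sc)
    next
      case 2
      then show ?thesis using L by simp
    next
      case (3 k)
      then show ?thesis using rv[of "k + n - 2"] root_vector_A[of k] by auto
    next
      case (4 k)
      then show ?thesis using rv[of "k - 1"] root_vector_B[of k] by auto
    qed
  qed
  then show "Bh n \<subseteq> generate_ring (Uh n) (range (Uh_scalar n) \<union> root_vector ` {..<2 * n})"
    unfolding Bh_Bgens using sc Bgens_closed by (intro Uh.generate_ring_min_subring1[OF _ T]) auto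
  show "generate_ring (Uh n) (range (Uh_scalar n) \<union> root_vector ` {..<2 * n}) \<subseteq> Bh n"
    using root_vector_spec Bh_incl[of _ n] by (intro Uh.generate_ring_min_subring1[OF c Bh_subring]) auto
qed

lemma hv_word_closed: "set w \<subseteq> {..<2 * n} \<Longrightarrow> mon (map (hv n) w) \<in> TAset n"
  by (intro TA_mon) (use hv_sl[OF n] in \<open>auto simp: subset_iff\<close>)

lemma gword_Bh:
  assumes "set w \<subseteq> {..<2 * n}"
  shows "gword root_vector w \<in> Bh n \<and> spec n (gword root_vector w) = ucl n (mon (map (hv n) w))"
  using assms
proof (induction w)
  case Nil
  then show ?case using subringE(3)[OF Bh_subring] by (simp add: ucl_one)
next
  case (Cons i w)
  then have i: "i < 2 * n" and IH: "gword root_vector w \<in> Bh n" "spec n (gword root_vector w) = ucl n (mon (map (hv n) w))"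
    by auto
  note r = root_vector_spec[OF i]
  have m: "mon [hv n i] \<in> TAset n" "mon (map (hv n) w) \<in> TAset n"
    using hv_word_closed[of "[i]"] hv_word_closed[of w] i Cons.prems by simp_all
  have "ucl n (mon (map (hv n) (i # w))) = \<iota> n (hv n i) \<otimes>\<^bsub>UE n\<^esub> ucl n (mon (map (hv n) w))"
    using ucl_mult[OF m] by (simp add: MW.conv_mon \<iota>_def)
  then show ?case
    using r IH subringE(6)[OF Bh_subring _ IH(1), of "root_vector i"] subringE(1)[OF Bh_subring[of n]]
    by (simp add: subset_iff)
qed

lemma gword_carrier: "set w \<subseteq> {..<2 * n} \<Longrightarrow> gword root_vector w \<in> carrier (Uh n)"
  using gword_Bh subringE(1)[OF Bh_subring[of n]] by blast

text \<open>Repeated words are collected, so that the coefficients form one function on a finite set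
  of sorted words. No uniqueness over the power series is asserted.\<close>

lemma Bh_normal_form:
  assumes "b \<in> Bh n"
  shows "\<exists>W c. finite W \<and> W \<subseteq> {w. sorted w \<and> set w \<subseteq> {..<2 * n}} \<and> (\<forall>w. w \<notin> W \<longrightarrow> c w = 0) \<and>
    b = (\<Oplus>\<^bsub>Uh n\<^esub>w\<in>W. Uh_scalar n (c w) \<otimes>\<^bsub>Uh n\<^esub> gword root_vector w)"
proof -
  have "b \<in> lspan (Uh n) (range (Uh_scalar n)) (gword root_vector ` sorted_words (2 * n))"
    using assms root_vector_straighten unfolding Bh_root_vector by blast
  then show ?thesis
  proof (induction rule: lspan.induct)
    case lspan_zero
    show ?case by (intro exI[of _ "{}"] exI[of _ "\<lambda>w. 0"]) simp
  next
    case (lspan_step b s g)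
    obtain W c where W: "finite W" "W \<subseteq> {w. sorted w \<and> set w \<subseteq> {..<2 * n}}" "\<forall>w. w \<notin> W \<longrightarrow> c w = 0"
      "b = (\<Oplus>\<^bsub>Uh n\<^esub>w\<in>W. Uh_scalar n (c w) \<otimes>\<^bsub>Uh n\<^esub> gword root_vector w)"
      using lspan_step.IH by blast
    obtain d v where dv: "s = Uh_scalar n d" "g = gword root_vector v" "sorted v" "set v \<subseteq> {..<2 * n}"
      using lspan_step.hyps unfolding sorted_words_def by blast
    let ?g = "gword root_vector" and ?W = "insert v W"
    have gc: "?g w \<in> carrier (Uh n)" if "w \<in> ?W" for w
      using that W(2) dv(4) by (intro gword_carrier) blast
    \<comment> \<open>The index set is enlarged by v, whose coefficient is 0 if v was
      absent.\<close>
    have b: "b = (\<Oplus>\<^bsub>Uh n\<^esub>w\<in>?W. Uh_scalar n (c w) \<otimes>\<^bsub>Uh n\<^esub> ?g w)"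
    proof (cases "v \<in> W")
      case True then show ?thesis using W(4) by (simp add: insert_absorb)
    next
      case False
      then show ?thesis using W gc by (simp add: Pi_def Uh_scalar_zero)
    qed
    have "s \<otimes>\<^bsub>Uh n\<^esub> g = (\<Oplus>\<^bsub>Uh n\<^esub>w\<in>?W. if v = w then Uh_scalar n d \<otimes>\<^bsub>Uh n\<^esub> ?g w else \<zero>\<^bsub>Uh n\<^esub>)"
      unfolding dv using Uh.add.finprod_singleton[of v ?W "\<lambda>w. Uh_scalar n d \<otimes>\<^bsub>Uh n\<^esub> ?g w" n] W(1) gc
      by (simp add: finsum_def)
    then have "b \<oplus>\<^bsub>Uh n\<^esub> s \<otimes>\<^bsub>Uh n\<^esub> g = (\<Oplus>\<^bsub>Uh n\<^esub>w\<in>?W. Uh_scalar n (c w) \<otimes>\<^bsub>Uh n\<^esub> ?g w \<oplus>\<^bsub>Uh n\<^esub>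
        (if v = w then Uh_scalar n d \<otimes>\<^bsub>Uh n\<^esub> ?g w else \<zero>\<^bsub>Uh n\<^esub>))"
      unfolding b using gc by (subst Uh.finsum_addf) auto
    also have "\<dots> = (\<Oplus>\<^bsub>Uh n\<^esub>w\<in>?W. Uh_scalar n (if v = w then c w + d else c w) \<otimes>\<^bsub>Uh n\<^esub> ?g w)"
      using gc by (intro Uh.finsum_cong') (auto simp: Uh_scalar_add Uh.l_distr)
    finally show ?case
      using W dv(3,4) by (intro exI[of _ ?W] exI[of _ "\<lambda>w. if v = w then c w + d else c w"]) auto
  qed
qed

lemma finsum_Bh:
  assumes "finite W" "W \<subseteq> {w. sorted w \<and> set w \<subseteq> {..<2 * n}}"
  shows "(\<Oplus>\<^bsub>Uh n\<^esub>w\<in>W. Uh_scalar n (c w) \<otimes>\<^bsub>Uh n\<^esub> gword root_vector w) \<in> Bh n"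
  using assms
proof (induction W rule: finite_induct)
  case empty
  then show ?case using subringE(2)[OF Bh_subring] by simp
next
  case (insert w W)
  have t: "Uh_scalar n (c u) \<otimes>\<^bsub>Uh n\<^esub> gword root_vector u \<in> Bh n" if "u \<in> insert w W" for u
  proof -
    have "gword root_vector u \<in> Bh n" using that insert.prems gword_Bh by blast
    then show ?thesis by (rule subringE(6)[OF Bh_subring Bh_incl, rotated]) simp
  qed
  then have "(\<lambda>u. Uh_scalar n (c u) \<otimes>\<^bsub>Uh n\<^esub> gword root_vector u) \<in> insert w W \<rightarrow> carrier (Uh n)"
    using subringE(1)[OF Bh_subring[of n]] by blast
  then show ?case
    using insert t[of w] subringE(7)[OF Bh_subring] by (simp add: Pi_def)
qed

text \<open>Independence at h = 0 shows that all constant terms of the coefficients of any normal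
  form of b vanish. Dividing the coefficients, and not b itself, by h produces an element of
  \<open>Bh n\<close> whose h-multiple is b.\<close>

lemma spec_kernel_Bh:
  "{b \<in> Bh n. spec n b = \<zero>\<^bsub>UE n\<^esub>} = (\<lambda>b. Uh_scalar n fps_X \<otimes>\<^bsub>Uh n\<^esub> b) ` Bh n"
proof (intro equalityI subsetI)
  fix b assume "b \<in> (\<lambda>b. Uh_scalar n fps_X \<otimes>\<^bsub>Uh n\<^esub> b) ` Bh n"
  then obtain b' where b': "b' \<in> Bh n" "b = Uh_scalar n fps_X \<otimes>\<^bsub>Uh n\<^esub> b'" by blast
  have "b' \<in> carrier (Uh n)" using b' subringE(1)[OF Bh_subring[of n]] by blast
  moreover have "b \<in> Bh n" unfolding b'(2) by (rule subringE(6)[OF Bh_subring Bh_incl b'(1)]) simp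
  ultimately show "b \<in> {b \<in> Bh n. spec n b = \<zero>\<^bsub>UE n\<^esub>}" using b'(2) by (simp add: spec_scalar uscal_zero)
next
  fix b assume "b \<in> {b \<in> Bh n. spec n b = \<zero>\<^bsub>UE n\<^esub>}"
  then have b: "b \<in> Bh n" "spec n b = \<zero>\<^bsub>UE n\<^esub>" by auto
  obtain W c where Wc: "finite W \<and> W \<subseteq> {w. sorted w \<and> set w \<subseteq> {..<2 * n}} \<and> (\<forall>w. w \<notin> W \<longrightarrow> c w = 0) \<and>
      b = (\<Oplus>\<^bsub>Uh n\<^esub>w\<in>W. Uh_scalar n (c w) \<otimes>\<^bsub>Uh n\<^esub> gword root_vector w)"
    using Bh_normal_form[OF b(1)] by (elim exE) (rule that)
  then have W: "finite W" "W \<subseteq> {w. sorted w \<and> set w \<subseteq> {..<2 * n}}"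
    and bW: "b = (\<Oplus>\<^bsub>Uh n\<^esub>w\<in>W. Uh_scalar n (c w) \<otimes>\<^bsub>Uh n\<^esub> gword root_vector w)"
    by - (elim conjE, assumption)+
  have gc: "gword root_vector w \<in> carrier (Uh n)" if "w \<in> W" for w
    using that W(2) by (intro gword_carrier) blast
  have m: "ucl n (mon (map (hv n) w)) \<in> carrier (UE n)" if "w \<in> W" for w
    using that W(2) by (intro ucl_closed hv_word_closed) blast
  have "spec n b = (\<Oplus>\<^bsub>UE n\<^esub>w\<in>W. (spec n \<circ> (\<lambda>w. Uh_scalar n (c w) \<otimes>\<^bsub>Uh n\<^esub> gword root_vector w)) w)"
    unfolding bW by (rule S.hom_finsum) (use gc in auto)
  also have "\<dots> = (\<Oplus>\<^bsub>UE n\<^esub>w\<in>W. uscal n (fps_nth (c w) 0) \<otimes>\<^bsub>UE n\<^esub> ucl n (mon (map (hv n) w)))"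
  proof (rule UE.finsum_cong'[OF refl])
    show "(\<lambda>w. uscal n (fps_nth (c w) 0) \<otimes>\<^bsub>UE n\<^esub> ucl n (mon (map (hv n) w))) \<in> W \<rightarrow> carrier (UE n)"
      using m by simp
    fix w assume w: "w \<in> W"
    then have "spec n (gword root_vector w) = ucl n (mon (map (hv n) w))" using W(2) gword_Bh by blast
    then show "(spec n \<circ> (\<lambda>w. Uh_scalar n (c w) \<otimes>\<^bsub>Uh n\<^esub> gword root_vector w)) w =
        uscal n (fps_nth (c w) 0) \<otimes>\<^bsub>UE n\<^esub> ucl n (mon (map (hv n) w))"
      using gc[OF w] by (simp add: spec_scalar)
  qed
  finally have z: "(\<Oplus>\<^bsub>UE n\<^esub>w\<in>W. uscal n (fps_nth (c w) 0) \<otimes>\<^bsub>UE n\<^esub> ucl n (mon (map (hv n) w))) = \<zero>\<^bsub>UE n\<^esub>"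
    using b(2) by simp
  have c0: "fps_nth (c w) 0 = 0" if "w \<in> W" for w
    by (rule sorted_words_independent[OF hdual_family[OF n] _ _ W z that])
      (use hdual_ufun[OF n] hv_sl[OF n] in auto)
  \<comment> \<open>The coefficients divided by h; the shift is exact because their constant terms
    vanish.\<close>
  define c' where "c' w = fps_shift 1 (c w)" for w
  have "c w = fps_X * c' w" if "w \<in> W" for w
    using fps_shift_times_fps_X'[of "c w"] c0[OF that] by (auto simp: c'_def fps_eq_iff)
  then have "b = (\<Oplus>\<^bsub>Uh n\<^esub>w\<in>W. Uh_scalar n fps_X \<otimes>\<^bsub>Uh n\<^esub> (Uh_scalar n (c' w) \<otimes>\<^bsub>Uh n\<^esub> gword root_vector w))"
    unfolding bW using gc by (intro Uh.finsum_cong') (auto simp: Uh_scalar_mult Uh.m_assoc)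
  also have "\<dots> = Uh_scalar n fps_X \<otimes>\<^bsub>Uh n\<^esub> (\<Oplus>\<^bsub>Uh n\<^esub>w\<in>W. Uh_scalar n (c' w) \<otimes>\<^bsub>Uh n\<^esub> gword root_vector w)"
    using W(1) gc by (subst Uh.finsum_rdistr) auto
  finally show "b \<in> (\<lambda>b. Uh_scalar n fps_X \<otimes>\<^bsub>Uh n\<^esub> b) ` Bh n" using finsum_Bh[OF W] by blast
qed

lemma UE_sub_eq: "UE_sub n M = generate_ring (UE n) (range (uscal n) \<union> \<iota> n ` M)"
proof -
  have "(\<lambda>f. UE_ideal n +>\<^bsub>TA n\<^esub> f) ` (range (\<lambda>c. smul c (mon [])) \<union> (\<lambda>x. mon [x]) ` M) = range (uscal n) \<union> \<iota> n ` M"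
    unfolding image_Un image_image uscal_def \<iota>_def ucl_def ..
  then show ?thesis by (simp only: UE_sub_def)
qed

lemma hv_basis: "i < 2 * n \<Longrightarrow> hv n i \<in> h_basis n"
proof -
  assume i: "i < 2 * n"
  consider "i < n - 1" | "\<not> i < n - 1" "i < 2 * n - 1" | "i = 2 * n - 1" using i by linarith
  then show ?thesis
  proof cases
    case 1
    then have "hv n i = (- 1) ^ (Suc i - 1) \<cdot>\<^sub>m munit n (n - Suc i) n" "Suc i \<in> {1..<n}" by (auto simp: hv_def)
    then show ?thesis unfolding h_basis_def by blast
  next
    case 2
    then have "hv n i = munit n 0 (i + 2 - n)" "i + 2 - n \<in> {1..n}" by (auto simp: hv_def)
    then show ?thesis unfolding h_basis_def by blast
  next
    case 3
    then have "hv n i = munit n 0 0 - munit n n n" using n by (auto simp: hv_def)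
    then show ?thesis unfolding h_basis_def by blast
  qed
qed

lemma h_basis_hv: "s \<in> h_basis n \<Longrightarrow> \<exists>i<2 * n. s = hv n i"
proof -
  assume "s \<in> h_basis n"
  then show ?thesis
  proof (cases rule: h_basis_cases)
    case H
    then show ?thesis using n by (intro exI[of _ "2 * n - 1"]) (auto simp: hv_def)
  next
    case (E k)
    then have "k + n - 2 + 2 - n = k" "\<not> k + n - 2 < n - 1" "k + n - 2 < 2 * n - 1" by auto
    then show ?thesis using E(2) by (intro exI[of _ "k + n - 2"]) (simp only: hv_def if_True if_False, simp)
  next
    case (F k)
    then have "n - 1 - (k - 1) = n - k" "k - 1 < n - 1" by auto
    then show ?thesis using F(2) by (intro exI[of _ "k - 1"]) (simp only: hv_def if_True, simp)
  qed
qed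

text \<open>The generators go to the scalars and to the basis \<open>hv\<close> of
  \<open>\<hh>\<close>. Conversely, complex scalars lift to constant power series, and elements of
  \<open>\<hh>\<close> are linear combinations of images of root vectors.\<close>

lemma spec_image_Bh: "spec n ` Bh n = UE_sub n (coiso_h n)"
proof
  let ?h = "mat_span n (h_basis n)"
  note B = h_basis_sl[OF n]
  have hc: "range (uscal n) \<union> \<iota> n ` ?h \<subseteq> carrier (UE n)" using mat_span_sl[OF B] by auto
  note T = UE.generate_ring_is_subring[OF hc]
  have gen: "spec n b \<in> UE_sub n (coiso_h n)" if "b \<in> range (Uh_scalar n) \<union> root_vector ` {..<2 * n}" for b
  proof -
    have "spec n b \<in> range (uscal n) \<union> \<iota> n ` ?h"
      using that spec_scalar[of n] root_vector_spec mat_span_incl[OF B hv_basis] by auto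
    then show ?thesis unfolding UE_sub_eq coiso_h_basis[OF n] by (rule generate_ring.incl)
  qed
  have T': "subring (UE_sub n (coiso_h n)) (UE n)" unfolding UE_sub_eq coiso_h_basis[OF n] by (rule T)
  have c: "generate_ring (Uh n) (range (Uh_scalar n) \<union> root_vector ` {..<2 * n}) \<subseteq> carrier (Uh n)"
    using subringE(1)[OF Bh_subring[of n]] unfolding Bh_root_vector .
  have "spec n b \<in> UE_sub n (coiso_h n)"
    if "b \<in> generate_ring (Uh n) (range (Uh_scalar n) \<union> root_vector ` {..<2 * n})" for b
    using that
  proof (induction rule: generate_ring.induct)
    case one
    then show ?case using subringE(3)[OF T'] by simp
  next
    case (incl b)
    then show ?case by (rule gen)
  next
    case (a_inv b)
    then show ?case using subringE(5)[OF T'] c by (simp add: subset_iff)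
  next
    case (eng_add x y)
    then show ?case using subringE(7)[OF T'] c by (simp add: subset_iff)
  next
    case (eng_mult x y)
    then show ?case using subringE(6)[OF T'] c by (simp add: subset_iff)
  qed
  then show "spec n ` Bh n \<subseteq> UE_sub n (coiso_h n)" unfolding Bh_root_vector by blast
  note I = S.img_is_subring[OF Bh_subring]
  have us: "uscal n k \<in> spec n ` Bh n" for k
    using spec_scalar[of n "fps_const k"] Bh_incl[of "Uh_scalar n (fps_const k)" n] by (intro image_eqI) auto
  have "\<iota> n x \<in> spec n ` Bh n" if "x \<in> ?h" for x
    using that
  proof (induction rule: mat_span_induct)
    case zero
    then show ?case using subringE(2)[OF I] \<iota>_zero[of n] by simp
  next
    case (step x k s)
    obtain i where i: "i < 2 * n" "s = hv n i" using h_basis_hv[OF step.hyps(2)] by blast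
    have s: "s \<in> sl n" "x \<in> sl n" using B step.hyps mat_span_sl[OF B] by auto
    have "\<iota> n s \<in> spec n ` Bh n" using root_vector_spec[OF i(1)] i(2) by (metis imageI)
    then have "\<iota> n x \<oplus>\<^bsub>UE n\<^esub> uscal n k \<otimes>\<^bsub>UE n\<^esub> \<iota> n s \<in> spec n ` Bh n"
      by (intro subringE(7)[OF I] subringE(6)[OF I] us step.IH)
    then show ?case using s by (simp add: \<iota>_add \<iota>_smult sl_smult)
  qed
  then show "UE_sub n (coiso_h n) \<subseteq> spec n ` Bh n"
    unfolding UE_sub_eq coiso_h_basis[OF n] using us by (intro UE.generate_ring_min_subring1[OF hc I]) auto
qed

end

theorem theorem3p3:
  fixes n :: nat
  assumes "n \<ge> 1"
  shows "quantization n (coiso_h n) (Bh n)"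
  unfolding quantization_def Uh_subalgebra_def
  using coisotropic_h[OF assms] Bh_subring Bh_incl[of _ n] left_coideal_Bh spec_kernel_Bh[OF assms] spec_image_Bh[OF assms]
  by auto

end
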